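(* Let $\lambda\ge0$. Let $\mathcal{X}$ be a spike prior such that for some fixed $\alpha<1/8$, with probability $1-o(1)$ over $x\sim\mathcal{X}_n$, all entries satisfy $|x_i|\le n^{-1/2+\alpha}$. Let $\mathcal{P}$ be a probability distribution on $\mathbb{R}$ with mean $0$ and variance $1$, and $\mathcal{P}_d$ a probability distribution on $\mathbb{R}$. Assume: (i) $\mathcal{P}$ has a non-vanishing $C^3$ density function $p(w)>0$; (ii) letting $f(w)=-p'(w)/p(w)$, there exist $C>0$ and an even integer $m\ge2$ such that $|f^{(\ell)}(w)|\le C+w^m$ for all $w\in\mathbb{R}$ and all $0\le\ell\le2$; (iii) with $m$ as in (ii), $\mathbb{E}_{w\sim\mathcal{P}}|w|^k<\infty$ for all $1\le k\le5m$. Let $\hat Y=\sqrt n\,Y$ where $Y$ is drawn from $\mathrm{Wig}(\lambda,\mathcal{P},\mathcal{P}_d,\mathcal{X})$ with spike $x$. Let $f(\hat Y)$ denote the entrywise application of $f$ to $\hat Y$, except that the diagonal entries of $f(\hat Y)$ are defined to be zero. Let $\lambda_{\max}(\cdot)$ denote the maximum eigenvalue. Then: (a) If $\lambda\le1/\sqrt{F_{\mathcal{P}}}$, then $\frac1{\sqrt n}\lambda_{\max}(f(\hat Y))\to2\sqrt{F_{\mathcal{P}}}$ in probability as $n\to\infty$. (b) If $\lambda>1/\sqrt{F_{\mathcal{P}}}$, then $\frac1{\sqrt n}\lambda_{\max}(f(\hat Y))\to\lambda F_{\mathcal{P}}+\frac1\lambda>2\sqrt{F_{\mathcal{P}}}$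 in probability as $n\to\infty$, and furthermore the top (unit-norm) eigenvector $v$ of $f(\hat Y)$ satisfies $$\langle v,x\rangle^2\ge\frac{(\lambda-1/\sqrt{F_{\mathcal{P}}})^2}{\lambda^2}-o(1)$$ with probability $1-o(1)$.
   Context: A spike prior is a family $\mathcal{X}=\{\mathcal{X}_n\}$, where $\mathcal{X}_n$ is a probability distribution on $\mathbb{R}^n$ such that for $x\sim\mathcal{X}_n$, $\|x\|\to1$ in probability as $n\to\infty$. General spiked Wigner model: $\mathrm{Wig}(\lambda,\mathcal{P},\mathcal{P}_d,\mathcal{X})$ is the distribution (for each $n$) of the $n\times n$ matrix $Y=\lambda xx^\top+\frac1{\sqrt n}W$, where the spike $x\sim\mathcal{X}_n$ and, independently, $W$ is symmetric with entries independent up to symmetry, off-diagonal entries distributed as $\mathcal{P}$ and diagonal entries distributed as $\mathcal{P}_d$. Fisher information: $F_{\mathcal{P}}=\mathbb{E}_{w\sim\mathcal{P}}\left[\left(\frac{p'(w)}{p(w)}\right)^2\right]=\int_{-\infty}^\infty\frac{p'(w)^2}{p(w)}\,dw$. *)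

theory Defs
  imports "HOL-Probability.Probability" "Jordan_Normal_Form.Spectral_Radius"
begin

text \<open>
  The dimension \<open>n\<close> tends to infinity, so vectors in \<open>\<real>\<^sup>n\<close> are points of the product space
  \<open>PiM {..<n} (\<lambda>_. borel)\<close> (functions on \<open>{..<n}\<close>, indices starting at 0), and
  \<open>n \<times> n\<close> matrices are matrices of \<open>Jordan_Normal_Form\<close>.
\<close>

text \<open>
  Convergence in probability to a constant. The random variables may live on different probability
  spaces. Measurability is required explicitly because \<open>measure\<close> is 0 on non-measurable sets.
\<close>

definition tendsto_in_prob ::
  "(nat \<Rightarrow> 'a measure) \<Rightarrow> (nat \<Rightarrow> 'a \<Rightarrow> real) \<Rightarrow> real \<Rightarrow> bool" where
  "tendsto_in_prob M Z c \<longleftrightarrow>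
     (\<forall>n. Z n \<in> borel_measurable (M n)) \<and>
     (\<forall>\<epsilon>>0. (\<lambda>n. measure (M n) {\<omega> \<in> space (M n). \<epsilon> < \<bar>Z n \<omega> - c\<bar>}) \<longlonglongrightarrow> 0)"

definition spike_prior :: "(nat \<Rightarrow> (nat \<Rightarrow> real) measure) \<Rightarrow> bool" where
  "spike_prior X \<longleftrightarrow>
     (\<forall>n. prob_space (X n) \<and> sets (X n) = sets (PiM {..<n} (\<lambda>_. borel :: real measure))) \<and>
     tendsto_in_prob X (\<lambda>n x. L2_set x {..<n}) 1"

definition Ck :: "nat \<Rightarrow> (real \<Rightarrow> real) \<Rightarrow> bool" where
  "Ck k g \<longleftrightarrow>
     (\<forall>j<k. \<forall>w. (deriv ^^ j) g field_differentiable (at w)) \<and>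
     continuous_on UNIV ((deriv ^^ k) g)"

definition score :: "(real \<Rightarrow> real) \<Rightarrow> real \<Rightarrow> real" where
  "score p w = - deriv p w / p w"

definition fisher_info :: "real measure \<Rightarrow> (real \<Rightarrow> real) \<Rightarrow> real" where
  "fisher_info P p = (\<integral>w. (deriv p w / p w)\<^sup>2 \<partial>P)"

text \<open>
  The entries of \<open>W\<close> on and above the diagonal, i.e. those at \<open>(i, j)\<close> with \<open>i \<le> j\<close>, are independent.
\<close>

definition wigner_noise :: "real measure \<Rightarrow> real measure \<Rightarrow> nat \<Rightarrow> (nat \<times> nat \<Rightarrow> real) measure" where
  "wigner_noise P Pd n =
     PiM {(i, j). i \<le> j \<and> j < n} (\<lambda>(i, j). if i = j then Pd else P)"

definition noise_matrix :: "nat \<Rightarrow> (nat \<times> nat \<Rightarrow> real) \<Rightarrow> real mat" where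
  "noise_matrix n w = mat n n (\<lambda>(i, j). w (min i j, max i j))"

text \<open>
  The spiked Wigner model \<open>Wig(\<lambda>, P, P\<^sub>d, X)\<close> is the law of \<open>spiked_matrix lam n\<close> (with \<open>lam = \<lambda>\<close>) under
  \<open>wig_space P Pd X n\<close>. We keep the underlying space because the joint law of the matrix and its
  spike (the first component) is needed.
\<close>

definition wig_space ::
  "real measure \<Rightarrow> real measure \<Rightarrow> (nat \<Rightarrow> (nat \<Rightarrow> real) measure) \<Rightarrow> nat \<Rightarrow>
   ((nat \<Rightarrow> real) \<times> (nat \<times> nat \<Rightarrow> real)) measure" where
  "wig_space P Pd X n = X n \<Otimes>\<^sub>M wigner_noise P Pd n"

definition spiked_matrix ::
  "real \<Rightarrow> nat \<Rightarrow> (nat \<Rightarrow> real) \<times> (nat \<times> nat \<Rightarrow> real) \<Rightarrow> real mat" where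
  "spiked_matrix lam n = (\<lambda>(x, w).
     lam \<cdot>\<^sub>m mat n n (\<lambda>(i, j). x i * x j) + (1 / sqrt (real n)) \<cdot>\<^sub>m noise_matrix n w)"

definition entrywise_offdiag :: "(real \<Rightarrow> real) \<Rightarrow> real mat \<Rightarrow> real mat" where
  "entrywise_offdiag f A =
     mat (dim_row A) (dim_col A) (\<lambda>(i, j). if i = j then 0 else f (A $$ (i, j)))"

definition transformed_matrix ::
  "(real \<Rightarrow> real) \<Rightarrow> real \<Rightarrow> nat \<Rightarrow> (nat \<Rightarrow> real) \<times> (nat \<times> nat \<Rightarrow> real) \<Rightarrow> real mat" where
  "transformed_matrix f lam n \<omega> =
     entrywise_offdiag f (sqrt (real n) \<cdot>\<^sub>m spiked_matrix lam n \<omega>)"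

definition lambda_max :: "real mat \<Rightarrow> real" where
  "lambda_max A = Max (spectrum A)"

definition top_unit_eigenvector :: "real mat \<Rightarrow> real Matrix.vec \<Rightarrow> bool" where
  "top_unit_eigenvector A v \<longleftrightarrow>
     eigenvector A v (lambda_max A) \<and> L2_set (\<lambda>i. vec_index v i) {..<dim_vec v} = 1"

end

theory Submission
  imports Defs "HOL-Real_Asymp.Real_Asymp"
begin

text \<open>
  Write \<open>F\<close> for the Fisher information, \<open>f\<close> for the score, \<open>\<theta> = \<lambda> \<surd>F\<close>, and \<open>Z\<close> for the Wigner matrix with off-diagonal
  entries \<open>f(W\<^sub>i\<^sub>j) / \<surd>(n F)\<close>. Integration by parts gives \<open>E f = 0\<close> and \<open>E f' = E f\<^sup>2 = F\<close>, so a Taylor expansion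
  at \<open>W\<^sub>i\<^sub>j\<close> shows that the transformed matrix divided by \<open>\<surd>(n F)\<close> is \<open>Z + \<theta> x x\<^sup>T\<close> up to an error whose operator
  norm tends to 0 because \<open>\<alpha> < 1/8\<close>.

  Let \<open>s\<^sub>j(i)\<close> be the sum of \<open>Z\<^bsub>p\<^sub>0p\<^sub>1\<^esub> \<cdots> Z\<^bsub>p\<^sub>j\<^sub>-\<^sub>1p\<^sub>j\<^esub> x\<^bsub>p\<^sub>j\<^esub>\<close> over the self-avoiding paths of length \<open>j\<close> from \<open>i\<close>, so that \<open>s\<^sub>0 = x\<close>. Second
  moments show that the \<open>s\<^sub>j\<close> are nearly orthonormal and that \<open>Z s\<^sub>j\<close> is nearly \<open>s\<^bsub>j+1\<^esub> + s\<^bsub>j-1\<^esub>\<close>. The test vectors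
  \<open>\<Sum>\<^sub>j s\<^sub>j\<close> and \<open>\<Sum>\<^sub>j \<theta>\<^bsup>-j\<^esup> s\<^sub>j\<close> give the lower bounds \<open>2\<close> and \<open>\<theta> + 1/\<theta>\<close>. For the upper bound, \<open>Z \<le> 2 + o(1)\<close> by
  the trace method after truncation. If \<open>0 < m < 1\<close> and \<open>\<theta> m < 1\<close>, then \<open>B = m + 1/m - Z\<close> is positive and maps
  \<open>y = \<Sum>\<^sub>j m\<^bsup>j+1\<^esup> s\<^sub>j\<close> nearly to \<open>x\<close>, so Cauchy-Schwarz for the form of \<open>B\<close> yields
  \<open>\<theta> \<langle>w,x\<rangle>\<^sup>2 \<le> \<theta> \<langle>y,By\<rangle> \<langle>w,Bw\<rangle> \<approx> \<theta> m \<langle>w,Bw\<rangle>\<close>, that is \<open>Z + \<theta> x x\<^sup>T \<le> m + 1/m\<close>. For a top eigenvector \<open>v\<close>,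
  \<open>\<theta> + 1/\<theta> \<approx> \<langle>v,Zv\<rangle> + \<theta> \<langle>v,x\<rangle>\<^sup>2 \<le> 2 + o(1) + \<theta> \<langle>v,x\<rangle>\<^sup>2\<close> bounds the overlap from below.
\<close>

section \<open>Quadratic forms and the largest eigenvalue\<close>

text \<open>The hypotheses provide five moments of \<open>f(W)\<close> and no information on the
  resolvent of the noise in the direction of \<open>x\<close>. Along a self-avoiding path every
  noise entry occurs once, so products over different edge sets are orthogonal, and for each
  tolerance a fixed number of steps is enough. Ideally \<open>s j\<close> is U_j(Z/2) x for the
  Chebyshev polynomials U_j of the second kind. The generating function sum m^(j+1) U_j(z/2) = 1/(m
  + 1/m - z) then explains \<open>y\<close>: it is a truncated resolvent applied to
  \<open>x\<close>. Walks of growing length enter only in the bound on \<open>Z\<close> itself,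
  where truncating the entries is paid for by the fifth moment.

  The value 1/8 arises twice in the linearization. The fluctuation of f' contributes n^(-1/4 + 2
  \<alpha>) when the norm of its matrix is bounded crudely by n^(3/4), and the second-order Taylor
  remainder contributes n^(-1/2 + 4 \<alpha>). Both vanish for the same \<alpha>, so the crude norm
  bound costs nothing.\<close>

definition ip :: "nat \<Rightarrow> (nat \<Rightarrow> real) \<Rightarrow> (nat \<Rightarrow> real) \<Rightarrow> real" where
  "ip n u v = (\<Sum>i<n. u i * v i)"

definition mv :: "nat \<Rightarrow> (nat \<Rightarrow> nat \<Rightarrow> real) \<Rightarrow> (nat \<Rightarrow> real) \<Rightarrow> nat \<Rightarrow> real" where
  "mv n A v = (\<lambda>i. \<Sum>j<n. A i j * v j)"

definition qf :: "nat \<Rightarrow> (nat \<Rightarrow> nat \<Rightarrow> real) \<Rightarrow> (nat \<Rightarrow> real) \<Rightarrow> real" where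
  "qf n A v = ip n v (mv n A v)"

lemma ip_commute: "ip n u v = ip n v u"
  by (simp add: ip_def mult.commute)

lemma ip_add_left: "ip n (\<lambda>i. u i + v i) w = ip n u w + ip n v w"
  and ip_diff_left: "ip n (\<lambda>i. u i - v i) w = ip n u w - ip n v w"
  and ip_scale_left: "ip n (\<lambda>i. c * u i) w = c * ip n u w"
  by (simp_all add: ip_def sum.distrib sum_subtractf sum_distrib_left algebra_simps)

lemma ip_sum_left: "ip n (\<lambda>i. \<Sum>k\<in>S. f k i) w = (\<Sum>k\<in>S. ip n (f k) w)"
  by (simp add: ip_def sum_distrib_right) (rule sum.swap)

lemma ip_add_right: "ip n w (\<lambda>i. u i + v i) = ip n w u + ip n w v"
  and ip_diff_right: "ip n w (\<lambda>i. u i - v i) = ip n w u - ip n w v"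
  and ip_scale_right: "ip n w (\<lambda>i. c * u i) = c * ip n w u"
  and ip_sum_right: "ip n w (\<lambda>i. \<Sum>k\<in>S. f k i) = (\<Sum>k\<in>S. ip n w (f k))"
  by (simp_all add: ip_commute[of n w] ip_add_left ip_diff_left ip_scale_left ip_sum_left)

lemmas ip_linear = ip_add_left ip_diff_left ip_scale_left ip_sum_left
  ip_add_right ip_diff_right ip_scale_right ip_sum_right

lemma ip_cong: "(\<And>i. i < n \<Longrightarrow> u i = u' i) \<Longrightarrow> (\<And>i. i < n \<Longrightarrow> v i = v' i) \<Longrightarrow> ip n u v = ip n u' v'"
  by (simp add: ip_def)

lemma ip_self_nonneg: "0 \<le> ip n v v"
  by (simp add: ip_def sum_nonneg)

lemma ip_self_eq_0: "ip n v v = 0 \<longleftrightarrow> (\<forall>i<n. v i = 0)"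
  by (auto simp: ip_def sum_nonneg_eq_0_iff)

lemma ip_self_sum_squares: "ip n v v = (\<Sum>i<n. (v i)\<^sup>2)"
  by (simp add: ip_def power2_eq_square)

lemma ip_Cauchy_Schwarz: "(ip n u v)\<^sup>2 \<le> ip n u u * ip n v v"
  unfolding ip_def using Cauchy_Schwarz_ineq_sum[of u v "{..<n}"] by (simp add: power2_eq_square)

lemma mv_add: "mv n A (\<lambda>i. u i + v i) = (\<lambda>i. mv n A u i + mv n A v i)"
  and mv_diff: "mv n A (\<lambda>i. u i - v i) = (\<lambda>i. mv n A u i - mv n A v i)"
  and mv_scale: "mv n A (\<lambda>i. c * u i) = (\<lambda>i. c * mv n A u i)"
  by (simp_all add: mv_def sum.distrib sum_subtractf sum_distrib_left algebra_simps)

lemma mv_sum: "mv n A (\<lambda>i. \<Sum>k\<in>S. f k i) = (\<lambda>i. \<Sum>k\<in>S. mv n A (f k) i)"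
  by (simp add: mv_def sum_distrib_left fun_eq_iff) (intro allI sum.swap)

lemma mv_cong: "(\<And>i. i < n \<Longrightarrow> u i = u' i) \<Longrightarrow> mv n A u = mv n A u'"
  by (simp add: mv_def)

lemma ip_mv_symmetric:
  assumes "\<And>i j. i < n \<Longrightarrow> j < n \<Longrightarrow> A i j = A j i"
  shows "ip n u (mv n A v) = ip n (mv n A u) v"
proof -
  have "ip n u (mv n A v) = (\<Sum>i<n. \<Sum>j<n. A i j * u i * v j)"
    by (simp add: ip_def mv_def sum_distrib_left algebra_simps)
  also have "\<dots> = (\<Sum>j<n. \<Sum>i<n. A i j * u i * v j)"
    by (rule sum.swap)
  also have "\<dots> = (\<Sum>j<n. \<Sum>i<n. A j i * u i * v j)"
    using assms by (intro sum.cong refl) auto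
  also have "\<dots> = ip n (mv n A u) v"
    by (simp add: ip_def mv_def sum_distrib_right sum_distrib_left algebra_simps)
  finally show ?thesis .
qed

lemma qf_eq_double_sum: "qf n A v = (\<Sum>i<n. \<Sum>j<n. A i j * v i * v j)"
  by (simp add: qf_def ip_def mv_def sum_distrib_left algebra_simps)

text \<open>The dimension varies, so R^n is modelled inside the functions on \<open>nat\<close> with
  the product topology. Pinning the coordinates from \<open>n\<close> on to 0 makes the sphere a
  closed subset of a compact cube.\<close>

lemma compact_unit_sphere: "compact {v::nat \<Rightarrow> real. (\<forall>i\<ge>n. v i = 0) \<and> ip n v v = 1}"
proof -
  let ?B = "PiE UNIV (\<lambda>i::nat. {-1..1::real})"
  have cB: "compact ?B"
    using compactin_PiE[of "\<lambda>i::nat. euclidean :: real topology" UNIV "\<lambda>i. {-1..1::real}"]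
    by (simp add: euclidean_product_topology)
  have ipc: "continuous_on UNIV (\<lambda>v::nat \<Rightarrow> real. ip n v v)"
    unfolding ip_def by (intro continuous_intros) simp_all
  have c1: "closed {v::nat \<Rightarrow> real. ip n v v = 1}"
    by (rule closed_Collect_eq[OF ipc]) simp
  have c2: "closed {v::nat \<Rightarrow> real. \<forall>i. n \<le> i \<longrightarrow> v i = 0}"
    by (intro closed_Collect_all closed_Collect_imp closed_Collect_eq open_Collect_const)
       (simp_all add: continuous_on_product_coordinates)
  have "{v::nat \<Rightarrow> real. (\<forall>i\<ge>n. v i = 0) \<and> ip n v v = 1} \<subseteq> ?B"
  proof (clarsimp simp: PiE_def Pi_def)
    fix v :: "nat \<Rightarrow> real" and i
    assume z: "\<forall>i\<ge>n. v i = 0" and o: "ip n v v = 1"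
    have "(v i)\<^sup>2 \<le> 1"
    proof (cases "i < n")
      case True
      then have "(v i)\<^sup>2 \<le> ip n v v" unfolding ip_self_sum_squares
        by (intro member_le_sum) auto
      then show ?thesis using o by simp
    qed (use z in simp)
    then have "\<bar>v i\<bar> \<le> 1" using abs_square_le_1 by blast
    then show "- 1 \<le> v i \<and> v i \<le> 1" by auto
  qed
  moreover have "compact (?B \<inter> ({v. ip n v v = 1} \<inter> {v. \<forall>i. n \<le> i \<longrightarrow> v i = 0}))"
    by (rule compact_Int_closed[OF cB closed_Int[OF c1 c2]])
  moreover have "{v::nat \<Rightarrow> real. (\<forall>i\<ge>n. v i = 0) \<and> ip n v v = 1} =
      {v. ip n v v = 1} \<inter> {v. \<forall>i. n \<le> i \<longrightarrow> v i = 0}"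
    by (simp add: Collect_conj_eq inf_commute)
  ultimately show ?thesis by (simp only: inf_absorb2)
qed

lemma continuous_on_qf: "continuous_on UNIV (qf n A)"
  unfolding qf_eq_double_sum by (intro continuous_intros) simp_all

lemma continuous_on_qf': "continuous_on S (qf n A)"
  using continuous_on_qf continuous_on_subset by blast

text \<open>Compactness gives a maximiser \<open>v\<close> of the Rayleigh quotient. The first
  variation in the direction of the defect \<open>k v - A v\<close> must vanish, which forces the
  defect to be zero.\<close>

lemma rayleigh_maximizer:
  assumes n: "0 < n" and sym: "\<And>i j. i < n \<Longrightarrow> j < n \<Longrightarrow> A i j = A j i"
  shows "\<exists>v k. ip n v v = 1 \<and> (\<forall>i<n. mv n A v i = k * v i) \<and> (\<forall>u. qf n A u \<le> k * ip n u u)"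
proof -
  let ?S = "{v::nat \<Rightarrow> real. (\<forall>i\<ge>n. v i = 0) \<and> ip n v v = 1}"
  have "(\<lambda>i. if i = 0 then 1 else 0) \<in> ?S"
  proof -
    have "ip n (\<lambda>i. if i = 0 then 1 else 0) (\<lambda>i. if i = 0 then 1 else 0)
        = (\<Sum>i<n. if i = 0 then 1 else 0)"
      unfolding ip_def by (rule sum.cong) auto
    also have "\<dots> = 1" using n by simp
    finally show ?thesis using n by simp
  qed
  then have "?S \<noteq> {}" by (metis empty_iff)
  then have "\<exists>v\<in>?S. \<forall>u\<in>?S. qf n A u \<le> qf n A v"
    by (rule continuous_attains_sup[OF compact_unit_sphere _ continuous_on_qf'])
  then obtain v where v: "v \<in> ?S" and vmax: "\<forall>u\<in>?S. qf n A u \<le> qf n A v" ..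
  define k where "k = qf n A v"
  have bound: "qf n A u \<le> k * ip n u u" for u
  proof (cases "ip n u u = 0")
    case True
    then have "\<forall>i<n. u i = 0" by (simp add: ip_self_eq_0)
    then have "qf n A u = 0" by (simp add: qf_def ip_def)
    then show ?thesis using True by simp
  next
    case False
    then have pos: "0 < ip n u u" using ip_self_nonneg[of n u] by linarith
    define c where "c = 1 / sqrt (ip n u u)"
    have c2: "c * c * ip n u u = 1"
      using pos by (simp add: c_def)
    define w where "w = (\<lambda>i. if i < n then c * u i else 0)"
    have "ip n w w = ip n (\<lambda>i. c * u i) (\<lambda>i. c * u i)"
      by (rule ip_cong) (auto simp: w_def)
    also have "\<dots> = 1" using c2 by (simp add: ip_linear)
    finally have "w \<in> ?S" by (auto simp: w_def)
    then have "qf n A w \<le> k" unfolding k_def by (rule bspec[OF vmax])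
    moreover have "qf n A w = qf n A (\<lambda>i. c * u i)"
      by (simp add: qf_eq_double_sum w_def)
    moreover have "\<dots> = c * c * qf n A u"
      by (simp add: qf_def ip_linear mv_scale)
    ultimately have "c * c * qf n A u \<le> k * (c * c * ip n u u)" using c2 by simp
    then have "(c * c) * qf n A u \<le> (c * c) * (k * ip n u u)" by (simp add: algebra_simps)
    moreover have "0 < c * c" using pos by (simp add: c_def)
    ultimately show ?thesis by (simp only: mult_le_cancel_left_pos)
  qed
  have v1: "ip n v v = 1" using v by simp
  define r where "r = (\<lambda>i. k * v i - mv n A v i)"
  define a where "a = ip n r r"
  define b where "b = k * a - qf n A r"
  \<comment> \<open>Expand the nonnegative form \<open>k |u|^2 - <u, A u>\<close> at
    \<open>v + t r\<close>: the constant term is 0 because \<open>v\<close> attains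
    \<open>k\<close>, and the linear coefficient is \<open>2 a\<close>.\<close>
  have quad: "2 * t * a + t * t * b \<ge> 0" for t
  proof -
    have "0 \<le> k * ip n (\<lambda>i. v i + t * r i) (\<lambda>i. v i + t * r i) - qf n A (\<lambda>i. v i + t * r i)"
      using bound[of "\<lambda>i. v i + t * r i"] by simp
    also have "\<dots> = (k * ip n v v - qf n A v) + 2 * t * (k * ip n r v - ip n r (mv n A v)) + t * t * b"
    proof -
      have "ip n v (mv n A r) = ip n r (mv n A v)"
        using ip_mv_symmetric[of n A v r, OF sym] by (simp add: ip_commute)
      then show ?thesis
        by (simp add: qf_def ip_linear mv_add mv_scale b_def a_def ip_commute[of n v r])
           (simp add: algebra_simps)
    qed
    also have "k * ip n r v - ip n r (mv n A v) = ip n r (\<lambda>i. k * v i - mv n A v i)"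
      by (simp add: ip_linear)
    also have "\<dots> = a" by (simp add: a_def r_def)
    finally show ?thesis using v1 by (simp add: k_def a_def)
  qed
  have "a = 0"
  proof (rule ccontr)
    assume "a \<noteq> 0"
    then have a: "0 < a" using ip_self_nonneg[of n r] by (simp add: a_def)
    \<comment> \<open>The step \<open>- t\<close> is so short that the linear term outweighs the
      quadratic one unless \<open>a = 0\<close>.\<close>
    define t where "t = a / (\<bar>b\<bar> + 1)"
    have t: "0 < t" using a by (simp add: t_def)
    have "0 \<le> t * (t * b - 2 * a)" using quad[of "- t"] by (simp add: algebra_simps)
    then have "2 * a \<le> t * b" using t by (simp add: zero_le_mult_iff)
    also have "t * b \<le> t * (\<bar>b\<bar> + 1)" using t by (intro mult_left_mono) auto
    also have "\<dots> = a" by (simp add: t_def)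
    finally show False using a by simp
  qed
  then have "\<forall>i<n. r i = 0" by (simp add: a_def ip_self_eq_0)
  then have "\<forall>i<n. mv n A v i = k * v i" by (simp add: r_def)
  then show ?thesis using v1 bound by auto
qed

lemma eigenvector_mat_iff:
  "eigenvector (mat n n (\<lambda>(i, j). A i j)) v k \<longleftrightarrow>
     v \<in> carrier_vec n \<and> v \<noteq> 0\<^sub>v n \<and> (\<forall>i<n. mv n A (vec_index v) i = k * vec_index v i)"
proof -
  have "mat n n (\<lambda>(i, j). A i j) *\<^sub>v v = k \<cdot>\<^sub>v v \<longleftrightarrow> (\<forall>i<n. mv n A (vec_index v) i = k * vec_index v i)"
    if "v \<in> carrier_vec n"
    using that by (auto simp: vec_eq_iff mv_def scalar_prod_def lessThan_atLeast0)
  then show ?thesis by (auto simp: eigenvector_def)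
qed

text \<open>The Rayleigh maximum is an eigenvalue and dominates every eigenvalue, and the spectrum
  is finite, so the \<open>Max\<close> in \<open>lambda_max\<close> is this maximum.\<close>

lemma lambda_max_symmetric:
  assumes n: "0 < n" and sym: "\<And>i j. i < n \<Longrightarrow> j < n \<Longrightarrow> A i j = A j i"
  shows qf_le_lambda_max: "qf n A u \<le> lambda_max (mat n n (\<lambda>(i, j). A i j)) * ip n u u"
    and lambda_max_attained: "\<exists>v. ip n v v = 1 \<and>
      (\<forall>i<n. mv n A v i = lambda_max (mat n n (\<lambda>(i, j). A i j)) * v i)"
proof -
  let ?M = "mat n n (\<lambda>(i, j). A i j)"
  obtain v k where v: "ip n v v = 1" "\<forall>i<n. mv n A v i = k * v i"
    and k: "\<forall>u. qf n A u \<le> k * ip n u u"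
    using rayleigh_maximizer[where A = A, OF n sym] by blast
  have "eigenvector ?M (Matrix.vec n v) k"
  proof -
    have "Matrix.vec n v \<noteq> 0\<^sub>v n"
      using v(1) ip_self_eq_0[of n v] by (auto simp: vec_eq_iff)
    moreover have "mv n A (vec_index (Matrix.vec n v)) = mv n A v"
      by (rule mv_cong) simp
    ultimately show ?thesis using v(2) by (simp add: eigenvector_mat_iff)
  qed
  then have k_in: "k \<in> spectrum ?M" by (auto simp: spectrum_def eigenvalue_def)
  have k_max: "l \<le> k" if "l \<in> spectrum ?M" for l
  proof -
    from that obtain u where u: "u \<in> carrier_vec n" "u \<noteq> 0\<^sub>v n"
      "\<And>i. i < n \<Longrightarrow> mv n A (vec_index u) i = l * vec_index u i"
      by (auto simp: spectrum_def eigenvalue_def eigenvector_mat_iff)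
    let ?u = "vec_index u"
    have "ip n ?u ?u \<noteq> 0" using u(1,2) by (auto simp: ip_self_eq_0 vec_eq_iff)
    then have pos: "0 < ip n ?u ?u" using ip_self_nonneg[of n ?u] by linarith
    have "l * ip n ?u ?u = qf n A ?u"
      using u(3) by (simp add: qf_def ip_def sum_distrib_left algebra_simps)
    also have "\<dots> \<le> k * ip n ?u ?u" using k ..
    finally show ?thesis using pos by simp
  qed
  have "finite (spectrum ?M)" by (rule card_finite_spectrum[of _ n]) simp
  then have "lambda_max ?M = k"
    unfolding lambda_max_def using k_in k_max by (intro Max_eqI) auto
  then show "qf n A u \<le> lambda_max ?M * ip n u u"
    and "\<exists>v. ip n v v = 1 \<and> (\<forall>i<n. mv n A v i = lambda_max ?M * v i)"
    using k v by auto
qed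

section \<open>Measurability of the top of the spectrum\<close>

lemma compact_ball_fun: "compact {v::nat \<Rightarrow> real. (\<forall>i\<ge>n. v i = 0) \<and> (\<forall>i. \<bar>v i\<bar> \<le> r)}"
proof -
  let ?B = "PiE UNIV (\<lambda>i::nat. {-r..r})"
  have cB: "compact ?B"
    using compactin_PiE[of "\<lambda>i::nat. euclidean :: real topology" UNIV "\<lambda>i. {-r..r}"]
    by (simp add: euclidean_product_topology)
  have c2: "closed {v::nat \<Rightarrow> real. \<forall>i. n \<le> i \<longrightarrow> v i = 0}"
    by (intro closed_Collect_all closed_Collect_imp closed_Collect_eq open_Collect_const)
       (simp_all add: continuous_on_product_coordinates)
  have "{v::nat \<Rightarrow> real. (\<forall>i\<ge>n. v i = 0) \<and> (\<forall>i. \<bar>v i\<bar> \<le> r)} =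
      ?B \<inter> {v. \<forall>i. n \<le> i \<longrightarrow> v i = 0}"
  proof -
    have "y \<in> {-r..r} \<longleftrightarrow> \<bar>y\<bar> \<le> r" for y by auto
    then show ?thesis by (auto simp: PiE_def Pi_def)
  qed
  then show ?thesis using compact_Int_closed[OF cB c2] by simp
qed

text \<open>A countable dense family of vectors: it turns quantifiers over all vectors into
  countable ones, which preserve measurability.\<close>

definition rat_vec :: "rat list \<Rightarrow> nat \<Rightarrow> real" where
  "rat_vec l i = (if i < length l then real_of_rat (l ! i) else 0)"

lemma rat_vec_approx: "\<exists>l. \<forall>i<n. (\<lambda>k. rat_vec (l k) i) \<longlonglongrightarrow> v i"
proof -
  have "\<exists>q. \<bar>real_of_rat q - v i\<bar> < inverse (real (Suc k))" for i k
  proof -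
    obtain q where "v i < real_of_rat q" "real_of_rat q < v i + inverse (real (Suc k))"
      using of_rat_dense[of "v i" "v i + inverse (real (Suc k))"] by auto
    then have "\<bar>real_of_rat q - v i\<bar> < inverse (real (Suc k))" by linarith
    then show ?thesis ..
  qed
  then obtain q where q: "\<And>i k. \<bar>real_of_rat (q i k) - v i\<bar> < inverse (real (Suc k))"
    by metis
  have "(\<lambda>k. rat_vec (map (\<lambda>i. q i k) [0..<n]) i) \<longlonglongrightarrow> v i" if "i < n" for i
  proof -
    have "(\<lambda>k. real_of_rat (q i k) - v i) \<longlonglongrightarrow> 0"
      by (rule tendsto_rabs_zero_cancel, rule tendsto_sandwich[OF _ _ tendsto_const LIMSEQ_inverse_real_of_nat])
         (use q less_imp_le in \<open>auto intro!: always_eventually\<close>)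
    then have "(\<lambda>k. real_of_rat (q i k)) \<longlonglongrightarrow> v i" by (rule LIM_zero_cancel)
    then show ?thesis using that by (simp add: rat_vec_def)
  qed
  then show ?thesis by (intro exI[of _ "\<lambda>k. map (\<lambda>i. q i k) [0..<n]"]) auto
qed

lemma tendsto_ip:
  assumes "\<And>i. i < n \<Longrightarrow> (\<lambda>k. u k i) \<longlonglongrightarrow> u' i" "\<And>i. i < n \<Longrightarrow> (\<lambda>k. v k i) \<longlonglongrightarrow> v' i"
  shows "(\<lambda>k. ip n (u k) (v k)) \<longlonglongrightarrow> ip n u' v'"
  unfolding ip_def using assms by (intro tendsto_intros) auto

lemma tendsto_mv:
  assumes "\<And>i. i < n \<Longrightarrow> (\<lambda>k. v k i) \<longlonglongrightarrow> v' i"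
  shows "(\<lambda>k. mv n A (v k) i) \<longlonglongrightarrow> mv n A v' i"
  unfolding mv_def using assms by (intro tendsto_intros) auto

lemma lambda_max_le_iff:
  assumes n: "0 < n" and sym: "\<And>i j. i < n \<Longrightarrow> j < n \<Longrightarrow> A i j = A j i"
  shows "lambda_max (mat n n (\<lambda>(i, j). A i j)) \<le> c \<longleftrightarrow> (\<forall>u. qf n A u \<le> c * ip n u u)"
proof
  assume "lambda_max (mat n n (\<lambda>(i, j). A i j)) \<le> c"
  then show "\<forall>u. qf n A u \<le> c * ip n u u"
    using qf_le_lambda_max[where A = A, OF n sym] ip_self_nonneg mult_right_mono order_trans by meson
next
  assume *: "\<forall>u. qf n A u \<le> c * ip n u u"
  obtain v where v: "ip n v v = 1" "\<forall>i<n. mv n A v i = lambda_max (mat n n (\<lambda>(i, j). A i j)) * v i"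
    using lambda_max_attained[where A = A, OF n sym] by blast
  have "qf n A v = ip n v (\<lambda>i. lambda_max (mat n n (\<lambda>(i, j). A i j)) * v i)"
    unfolding qf_def using v(2) by (intro ip_cong) auto
  with v(1) * show "lambda_max (mat n n (\<lambda>(i, j). A i j)) \<le> c"
    by (metis ip_scale_right mult.right_neutral)
qed

text \<open>\<open>lambda_max <= c\<close> says that the form \<open>c |u|^2 - <u, A u>\<close> is
  nonnegative, and by continuity this can be tested on the countable family
  \<open>rat_vec\<close>.\<close>

lemma borel_measurable_lambda_max:
  fixes A :: "'a \<Rightarrow> nat \<Rightarrow> nat \<Rightarrow> real"
  assumes sym: "\<And>\<omega> i j. i < n \<Longrightarrow> j < n \<Longrightarrow> A \<omega> i j = A \<omega> j i"
    and meas: "\<And>i j. i < n \<Longrightarrow> j < n \<Longrightarrow> (\<lambda>\<omega>. A \<omega> i j) \<in> borel_measurable M"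
  shows "(\<lambda>\<omega>. lambda_max (mat n n (\<lambda>(i, j). A \<omega> i j))) \<in> borel_measurable M"
proof (cases "n = 0")
  case True
  \<comment> \<open>All 0 by 0 matrices coincide, so \<open>lambda_max\<close> is constant here,
    whatever its value.\<close>
  then have "mat n n (\<lambda>(i, j). A \<omega> i j) = mat 0 0 (\<lambda>_. 0)" for \<omega>
    by (intro eq_matI) auto
  then show ?thesis by simp
next
  case False
  then have n: "0 < n" by simp
  have qf_meas: "(\<lambda>\<omega>. qf n (A \<omega>) u) \<in> borel_measurable M" for u
    unfolding qf_eq_double_sum using meas by (intro borel_measurable_sum borel_measurable_times) auto
  show ?thesis
  proof (rule borel_measurableI_le)
    fix c
    have "lambda_max (mat n n (\<lambda>(i, j). A \<omega> i j)) \<le> c \<longleftrightarrow>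
        (\<forall>l. qf n (A \<omega>) (rat_vec l) \<le> c * ip n (rat_vec l) (rat_vec l))" for \<omega>
    proof -
      have "qf n (A \<omega>) u \<le> c * ip n u u"
        if *: "\<forall>l. qf n (A \<omega>) (rat_vec l) \<le> c * ip n (rat_vec l) (rat_vec l)" for u
      proof -
      obtain l where "\<forall>i<n. (\<lambda>k. rat_vec (l k) i) \<longlonglongrightarrow> u i"
        using rat_vec_approx[of n u] ..
      then have l: "(\<lambda>k. rat_vec (l k) i) \<longlonglongrightarrow> u i" if "i < n" for i using that by blast
      have "(\<lambda>k. qf n (A \<omega>) (rat_vec (l k))) \<longlonglongrightarrow> qf n (A \<omega>) u"
        unfolding qf_def using l by (intro tendsto_ip tendsto_mv)
      moreover have "(\<lambda>k. c * ip n (rat_vec (l k)) (rat_vec (l k))) \<longlonglongrightarrow> c * ip n u u"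
        using l by (intro tendsto_intros tendsto_ip)
      ultimately show ?thesis
        by (rule LIMSEQ_le) (use * in auto)
      qed
      then show ?thesis
        using lambda_max_le_iff[where A = "A \<omega>" and c = c, OF n sym] by blast
    qed
    then have "{\<omega> \<in> space M. lambda_max (mat n n (\<lambda>(i, j). A \<omega> i j)) \<le> c} =
        {\<omega> \<in> space M. \<forall>l. qf n (A \<omega>) (rat_vec l) \<le> c * ip n (rat_vec l) (rat_vec l)}"
      by blast
    also have "\<dots> \<in> sets M"
      using qf_meas by (intro sets.sets_Collect_countable_All borel_measurable_le) auto
    finally show "{\<omega> \<in> space M. lambda_max (mat n n (\<lambda>(i, j). A \<omega> i j)) \<le> c} \<in> sets M" .
  qed
qed

text \<open>An uncountable existential over exact eigenvectors becomes countable: approximate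
  solutions with tolerance 1/(N + 1) are sought among the \<open>rat_vec\<close>, and compactness
  recovers an exact one in the limit. The closed condition \<open><= c\<close> is what survives the
  limit.\<close>

lemma exists_approximate_eigenvector_iff:
  "(\<exists>v. ip n v v = 1 \<and> (\<forall>i<n. mv n A v i = k * v i) \<and> (ip n v x)\<^sup>2 \<le> c) \<longleftrightarrow>
   (\<forall>N. \<exists>l. \<bar>ip n (rat_vec l) (rat_vec l) - 1\<bar> \<le> 1 / real (Suc N) \<and>
     (\<Sum>i<n. (mv n A (rat_vec l) i - k * rat_vec l i)\<^sup>2) \<le> 1 / real (Suc N) \<and>
     (ip n (rat_vec l) x)\<^sup>2 \<le> c + 1 / real (Suc N))"
  (is "?L \<longleftrightarrow> (\<forall>N. \<exists>l. ?P l N)")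
proof
  assume ?L
  then obtain v where v: "ip n v v = 1" "\<forall>i<n. mv n A v i = k * v i" "(ip n v x)\<^sup>2 \<le> c" by blast
  obtain l where "\<forall>i<n. (\<lambda>k. rat_vec (l k) i) \<longlonglongrightarrow> v i"
    using rat_vec_approx[of n v] ..
  then have l: "(\<lambda>k. rat_vec (l k) i) \<longlonglongrightarrow> v i" if "i < n" for i using that by blast
  have t1: "(\<lambda>j. \<bar>ip n (rat_vec (l j)) (rat_vec (l j)) - 1\<bar>) \<longlonglongrightarrow> \<bar>ip n v v - 1\<bar>"
    using l by (intro tendsto_intros tendsto_ip)
  have t2: "(\<lambda>j. \<Sum>i<n. (mv n A (rat_vec (l j)) i - k * rat_vec (l j) i)\<^sup>2)
      \<longlonglongrightarrow> (\<Sum>i<n. (mv n A v i - k * v i)\<^sup>2)"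
    using l by (intro tendsto_intros tendsto_mv) auto
  have t3: "(\<lambda>j. (ip n (rat_vec (l j)) x)\<^sup>2) \<longlonglongrightarrow> (ip n v x)\<^sup>2"
    using l by (intro tendsto_intros tendsto_ip)
  show "\<forall>N. \<exists>l. ?P l N"
  proof
    fix N
    let ?e = "1 / real (Suc N)"
    have "\<forall>\<^sub>F j in sequentially. \<bar>ip n (rat_vec (l j)) (rat_vec (l j)) - 1\<bar> < ?e"
      by (rule order_tendstoD(2)[OF t1]) (simp add: v)
    moreover have "\<forall>\<^sub>F j in sequentially. (\<Sum>i<n. (mv n A (rat_vec (l j)) i - k * rat_vec (l j) i)\<^sup>2) < ?e"
      by (rule order_tendstoD(2)[OF t2]) (simp add: v)
    moreover have "\<forall>\<^sub>F j in sequentially. (ip n (rat_vec (l j)) x)\<^sup>2 < c + ?e"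
      by (rule order_tendstoD(2)[OF t3]) (use v(3) in \<open>auto intro: le_less_trans\<close>)
    ultimately have "\<forall>\<^sub>F j in sequentially. ?P (l j) N"
      by eventually_elim (simp only: less_imp_le simp_thms)
    then have "\<exists>j. ?P (l j) N" by (rule eventually_happens'[OF sequentially_bot])
    then show "\<exists>l. ?P l N" by (elim exE) (rule exI)
  qed
next
  assume "\<forall>N. \<exists>l. ?P l N"
  then have "\<exists>l. \<forall>N. ?P (l N) N" by (rule choice)
  then obtain l where l': "\<forall>N. ?P (l N) N" ..
  have l: "?P (l N) N" for N using l' by (rule spec)
  define w where "w N i = (if i < n then rat_vec (l N) i else 0)" for N i
  \<comment> \<open>A tolerance of at most 1 bounds the squared norms by 2, so the cube of radius 2
    contains all candidates.\<close>
  let ?B = "{v::nat \<Rightarrow> real. (\<forall>i\<ge>n. v i = 0) \<and> (\<forall>i. \<bar>v i\<bar> \<le> 2)}"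
  have "w N \<in> ?B" for N
  proof -
    have "1 / real (Suc N) \<le> 1" by simp
    then have "ip n (rat_vec (l N)) (rat_vec (l N)) \<le> 4" using l[of N] by linarith
    then have "(rat_vec (l N) i)\<^sup>2 \<le> 2\<^sup>2" if "i < n" for i
      using member_le_sum[of i "{..<n}" "\<lambda>i. (rat_vec (l N) i)\<^sup>2"] that
      by (simp add: ip_self_sum_squares)
    then have "\<bar>rat_vec (l N) i\<bar> \<le> 2" if "i < n" for i
      using that abs_le_square_iff[of "rat_vec (l N) i" 2] by simp
    then show ?thesis by (auto simp: w_def)
  qed
  then obtain v r where r: "strict_mono r" and lim: "(w \<circ> r) \<longlonglongrightarrow> v"
    using compact_imp_seq_compact[OF compact_ball_fun[of n 2]] by (metis (no_types, lifting) seq_compactE)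
  have w: "(\<lambda>j. rat_vec (l (r j)) i) \<longlonglongrightarrow> v i" if "i < n" for i
  proof -
    have "(\<lambda>j. (w \<circ> r) j i) \<longlonglongrightarrow> v i"
      using continuous_on_tendsto_compose[OF continuous_on_product_coordinates[of i] lim] by simp
    then show ?thesis using that by (simp add: w_def)
  qed
  have e: "(\<lambda>j. 1 / real (Suc (r j))) \<longlonglongrightarrow> 0"
    using LIMSEQ_subseq_LIMSEQ[OF LIMSEQ_inverse_real_of_nat r] by (simp add: o_def inverse_eq_divide)
  have t1: "(\<lambda>j. \<bar>ip n (rat_vec (l (r j))) (rat_vec (l (r j))) - 1\<bar>) \<longlonglongrightarrow> \<bar>ip n v v - 1\<bar>"
    using w by (intro tendsto_intros tendsto_ip)
  have t2: "(\<lambda>j. \<Sum>i<n. (mv n A (rat_vec (l (r j))) i - k * rat_vec (l (r j)) i)\<^sup>2)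
      \<longlonglongrightarrow> (\<Sum>i<n. (mv n A v i - k * v i)\<^sup>2)"
    using w by (intro tendsto_intros tendsto_mv) auto
  have t3: "(\<lambda>j. (ip n (rat_vec (l (r j))) x)\<^sup>2) \<longlonglongrightarrow> (ip n v x)\<^sup>2"
    using w by (intro tendsto_intros tendsto_ip)
  have t4: "(\<lambda>j. c + 1 / real (Suc (r j))) \<longlonglongrightarrow> c + 0" by (intro tendsto_intros e)
  have "\<bar>ip n v v - 1\<bar> \<le> 0" by (rule LIMSEQ_le[OF t1 e]) (use l in blast)
  moreover have "(\<Sum>i<n. (mv n A v i - k * v i)\<^sup>2) \<le> 0" by (rule LIMSEQ_le[OF t2 e]) (use l in blast)
  then have "(\<Sum>i<n. (mv n A v i - k * v i)\<^sup>2) = 0" by (intro antisym sum_nonneg) auto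
  then have "\<forall>i<n. mv n A v i = k * v i" by (simp add: sum_nonneg_eq_0_iff)
  moreover have "(ip n v x)\<^sup>2 \<le> c + 0" by (rule LIMSEQ_le[OF t3 t4]) (use l in blast)
  ultimately show ?L by auto
qed

lemma top_unit_eigenvector_mat_iff:
  assumes n: "0 < n"
  shows "top_unit_eigenvector (mat n n (\<lambda>(i, j). A i j)) v \<longleftrightarrow>
    v \<in> carrier_vec n \<and> ip n (vec_index v) (vec_index v) = 1 \<and>
    (\<forall>i<n. mv n A (vec_index v) i = lambda_max (mat n n (\<lambda>(i, j). A i j)) * vec_index v i)"
proof -
  have "L2_set (vec_index v) {..<n} = 1 \<longleftrightarrow> ip n (vec_index v) (vec_index v) = 1"
    by (simp add: L2_set_def ip_self_sum_squares)
  moreover have "v \<noteq> 0\<^sub>v n" if "ip n (vec_index v) (vec_index v) = 1"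
    using that by (auto simp: ip_def)
  ultimately show ?thesis
    unfolding top_unit_eigenvector_def eigenvector_mat_iff by auto
qed

text \<open>The quantifier over \<open>v\<close> covers every choice from a possibly degenerate top
  eigenspace. In the complement the strict inequality \<open>< c\<close> is split over rationals
  \<open>q < c\<close>, since the countable description of eigenvectors is available for non-strict
  bounds.\<close>

lemma measurable_top_eigenvector_event:
  fixes A :: "'a \<Rightarrow> nat \<Rightarrow> nat \<Rightarrow> real"
  assumes sym: "\<And>\<omega> i j. i < n \<Longrightarrow> j < n \<Longrightarrow> A \<omega> i j = A \<omega> j i"
    and meas: "\<And>i j. i < n \<Longrightarrow> j < n \<Longrightarrow> (\<lambda>\<omega>. A \<omega> i j) \<in> borel_measurable M"
    and measx: "\<And>i. i < n \<Longrightarrow> (\<lambda>\<omega>. x \<omega> i) \<in> borel_measurable M"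
    and n: "0 < n"
  shows "{\<omega> \<in> space M. \<forall>v. top_unit_eigenvector (mat n n (\<lambda>(i, j). A \<omega> i j)) v \<longrightarrow>
      c \<le> (scalar_prod v (Matrix.vec n (x \<omega>)))\<^sup>2} \<in> sets M" (is "{\<omega> \<in> space M. ?E \<omega>} \<in> _")
proof -
  define k where "k \<omega> = lambda_max (mat n n (\<lambda>(i, j). A \<omega> i j))" for \<omega>
  have k: "k \<in> borel_measurable M"
    unfolding k_def using sym meas by (rule borel_measurable_lambda_max)
  let ?R = "\<lambda>\<omega> q N l. \<bar>ip n (rat_vec l) (rat_vec l) - 1\<bar> \<le> 1 / real (Suc N) \<and>
     (\<Sum>i<n. (mv n (A \<omega>) (rat_vec l) i - k \<omega> * rat_vec l i)\<^sup>2) \<le> 1 / real (Suc N) \<and>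
     (ip n (rat_vec l) (x \<omega>))\<^sup>2 \<le> real_of_rat q + 1 / real (Suc N)"
  have "\<not> ?E \<omega> \<longleftrightarrow> (\<exists>q. real_of_rat q < c \<and> (\<forall>N. \<exists>l. ?R \<omega> q N l))" for \<omega>
  proof -
    have sp: "scalar_prod v (Matrix.vec n (x \<omega>)) = ip n (vec_index v) (x \<omega>)" for v
      by (simp add: scalar_prod_def ip_def lessThan_atLeast0)
    have "\<not> ?E \<omega> \<longleftrightarrow> (\<exists>v\<in>carrier_vec n. ip n (vec_index v) (vec_index v) = 1 \<and>
        (\<forall>i<n. mv n (A \<omega>) (vec_index v) i = k \<omega> * vec_index v i) \<and> (ip n (vec_index v) (x \<omega>))\<^sup>2 < c)"
      by (auto simp: top_unit_eigenvector_mat_iff[OF n] sp k_def not_le)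
    also have "\<dots> \<longleftrightarrow> (\<exists>v. ip n v v = 1 \<and> (\<forall>i<n. mv n (A \<omega>) v i = k \<omega> * v i) \<and> (ip n v (x \<omega>))\<^sup>2 < c)"
    proof
      assume "\<exists>v. ip n v v = 1 \<and> (\<forall>i<n. mv n (A \<omega>) v i = k \<omega> * v i) \<and> (ip n v (x \<omega>))\<^sup>2 < c"
      then obtain v where v: "ip n v v = 1" "\<forall>i<n. mv n (A \<omega>) v i = k \<omega> * v i" "(ip n v (x \<omega>))\<^sup>2 < c"
        by blast
      let ?v = "Matrix.vec n v"
      have 1: "ip n (vec_index ?v) u = ip n v u" "ip n u (vec_index ?v) = ip n u v" for u
        by (simp_all add: ip_def)
      have 2: "mv n (A \<omega>) (vec_index ?v) = mv n (A \<omega>) v" by (rule mv_cong) simp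
      show "\<exists>v\<in>carrier_vec n. ip n (vec_index v) (vec_index v) = 1 \<and>
        (\<forall>i<n. mv n (A \<omega>) (vec_index v) i = k \<omega> * vec_index v i) \<and> (ip n (vec_index v) (x \<omega>))\<^sup>2 < c"
        by (rule bexI[of _ ?v]) (use v in \<open>simp_all add: 1 2\<close>)
    qed blast
    also have "\<dots> \<longleftrightarrow> (\<exists>q. real_of_rat q < c \<and> (\<exists>v. ip n v v = 1 \<and>
        (\<forall>i<n. mv n (A \<omega>) v i = k \<omega> * v i) \<and> (ip n v (x \<omega>))\<^sup>2 \<le> real_of_rat q))"
    proof -
      have "a < c \<longleftrightarrow> (\<exists>q. real_of_rat q < c \<and> a \<le> real_of_rat q)" for a :: real
        by (metis of_rat_dense order_le_less_trans less_imp_le)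
      then show ?thesis by metis
    qed
    finally show ?thesis unfolding exists_approximate_eigenvector_iff .
  qed
  then have "{\<omega> \<in> space M. ?E \<omega>} = {\<omega> \<in> space M. \<not> (\<exists>q. real_of_rat q < c \<and> (\<forall>N. \<exists>l. ?R \<omega> q N l))}"
    by blast
  also have "\<dots> \<in> sets M"
  proof -
    have [measurable]: "k \<in> borel_measurable M" by fact
    have 1: "(\<lambda>\<omega>. \<Sum>i<n. (mv n (A \<omega>) (rat_vec l) i - k \<omega> * rat_vec l i)\<^sup>2) \<in> borel_measurable M" for l
      unfolding mv_def using meas k by (intro borel_measurable_sum borel_measurable_power
          borel_measurable_diff borel_measurable_times) auto
    have 2: "(\<lambda>\<omega>. (ip n (rat_vec l) (x \<omega>))\<^sup>2) \<in> borel_measurable M" for l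
      unfolding ip_def using measx by (intro borel_measurable_sum borel_measurable_power
          borel_measurable_times) auto
    show ?thesis
      by (intro sets.sets_Collect_neg sets.sets_Collect_countable_Ex sets.sets_Collect_countable_All sets.sets_Collect_conj
          sets.sets_Collect_const borel_measurable_le 1 2 borel_measurable_const)
  qed
  finally show ?thesis .
qed

section \<open>Second moments of sums over edge sets\<close>

lemma product_expectation:
  fixes g :: "'e \<Rightarrow> 'b \<Rightarrow> real"
  assumes D: "\<And>e. prob_space (D e)" and I: "finite I" "E \<subseteq> I"
    and g: "\<And>e. e \<in> E \<Longrightarrow> integrable (D e) (g e)"
  shows integrable_product: "integrable (PiM I D) (\<lambda>\<omega>. \<Prod>e\<in>E. g e (\<omega> e))"
    and integral_product: "(\<integral>\<omega>. (\<Prod>e\<in>E. g e (\<omega> e)) \<partial>PiM I D) = (\<Prod>e\<in>E. \<integral>y. g e y \<partial>D e)"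
proof -
  interpret product_sigma_finite D
    using D by (simp add: product_sigma_finite_def prob_space_imp_sigma_finite)
  \<comment> \<open>Factors outside \<open>E\<close> are padded with 1, so that the product runs
    over the full index set of the product measure.\<close>
  define h where "h e = (if e \<in> E then g e else (\<lambda>_. 1))" for e
  have one: "integrable (D e) (\<lambda>_. 1::real)" "(\<integral>y. 1 \<partial>D e) = (1::real)" for e
    using D[of e] by (simp_all add: prob_space.prob_space finite_measure.integrable_const prob_space.finite_measure)
  have h: "integrable (D e) (h e)" for e
    using g one(1) by (simp add: h_def)
  have eq: "(\<Prod>e\<in>E. g e (\<omega> e)) = (\<Prod>e\<in>I. h e (\<omega> e))" for \<omega>
    using I by (intro prod.mono_neutral_cong_left) (auto simp: h_def)
  have eq2: "(\<Prod>e\<in>E. \<integral>y. g e y \<partial>D e) = (\<Prod>e\<in>I. \<integral>y. h e y \<partial>D e)"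
    using I one(2) by (intro prod.mono_neutral_cong_left) (auto simp: h_def)
  show "integrable (PiM I D) (\<lambda>\<omega>. \<Prod>e\<in>E. g e (\<omega> e))"
    unfolding eq using I(1) h by (intro product_integrable_prod) auto
  show "(\<integral>\<omega>. (\<Prod>e\<in>E. g e (\<omega> e)) \<partial>PiM I D) = (\<Prod>e\<in>E. \<integral>y. g e y \<partial>D e)"
    unfolding eq eq2 using I(1) h by (intro product_integral_prod) auto
qed

lemma integrable_mult_of_squares:
  fixes f g :: "'a \<Rightarrow> real"
  assumes [measurable]: "f \<in> borel_measurable M" "g \<in> borel_measurable M"
    and f: "integrable M (\<lambda>x. (f x)\<^sup>2)" and g: "integrable M (\<lambda>x. (g x)\<^sup>2)"
  shows "integrable M (\<lambda>x. f x * g x)"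
proof (rule Bochner_Integration.integrable_bound[OF Bochner_Integration.integrable_add[OF f g]])
  have "\<bar>a * b\<bar> \<le> a\<^sup>2 + b\<^sup>2" for a b :: real
  proof -
    have "0 \<le> (\<bar>a\<bar> - \<bar>b\<bar>)\<^sup>2" by simp
    then have "2 * \<bar>a * b\<bar> \<le> a\<^sup>2 + b\<^sup>2" by (simp add: power2_diff abs_mult)
    then show ?thesis by linarith
  qed
  then show "AE x in M. norm (f x * g x) \<le> norm ((f x)\<^sup>2 + (g x)\<^sup>2)"
    by (simp add: abs_of_nonneg)
qed simp

text \<open>Products over different edge sets are orthogonal, since every factor is centred.\<close>

lemma second_moment_edge_sum:
  fixes \<phi> :: "'q \<Rightarrow> 'e \<Rightarrow> 'b \<Rightarrow> real" and a :: "'q \<Rightarrow> real"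
  assumes D: "\<And>e. prob_space (D e)" and I: "finite I" and S: "finite S"
    and E: "\<And>q. q \<in> S \<Longrightarrow> E q \<subseteq> I"
    and meas: "\<And>q e. q \<in> S \<Longrightarrow> e \<in> E q \<Longrightarrow> \<phi> q e \<in> borel_measurable (D e)"
    and sq: "\<And>q e. q \<in> S \<Longrightarrow> e \<in> E q \<Longrightarrow> integrable (D e) (\<lambda>y. (\<phi> q e y)\<^sup>2)"
    and mean: "\<And>q e. q \<in> S \<Longrightarrow> e \<in> E q \<Longrightarrow> (\<integral>y. \<phi> q e y \<partial>D e) = 0"
    and B: "\<And>q. q \<in> S \<Longrightarrow> (\<Prod>e\<in>E q. \<integral>y. (\<phi> q e y)\<^sup>2 \<partial>D e) \<le> B" "0 \<le> B"
    and K: "\<And>q. q \<in> S \<Longrightarrow> card {q' \<in> S. E q' = E q} \<le> K"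
  shows integrable_edge_sum_square:
      "integrable (PiM I D) (\<lambda>\<omega>. (\<Sum>q\<in>S. a q * (\<Prod>e\<in>E q. \<phi> q e (\<omega> e)))\<^sup>2)"
    and integral_edge_sum_square_le:
      "(\<integral>\<omega>. (\<Sum>q\<in>S. a q * (\<Prod>e\<in>E q. \<phi> q e (\<omega> e)))\<^sup>2 \<partial>PiM I D) \<le> real K * B * (\<Sum>q\<in>S. (a q)\<^sup>2)"
proof -
  define F where "F q \<omega> = (\<Prod>e\<in>E q. \<phi> q e (\<omega> e))" for q \<omega>
  have finE: "finite (E q)" if "q \<in> S" for q using E[OF that] I finite_subset by blast
  have int1: "integrable (D e) (\<phi> q e)" if "q \<in> S" "e \<in> E q" for q e
    using finite_measure.square_integrable_imp_integrable[OF prob_space.finite_measure[OF D]] meas sq that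
    by blast
  define h where "h q q' e y = (if e \<in> E q then \<phi> q e y else 1) * (if e \<in> E q' then \<phi> q' e y else 1)"
    for q q' e y
  have FF: "F q \<omega> * F q' \<omega> = (\<Prod>e\<in>E q \<union> E q'. h q q' e (\<omega> e))" if "q \<in> S" "q' \<in> S" for q q' \<omega>
  proof -
    have "F q \<omega> = (\<Prod>e\<in>E q \<union> E q'. if e \<in> E q then \<phi> q e (\<omega> e) else 1)"
      unfolding F_def using finE that by (intro prod.mono_neutral_cong_left) auto
    moreover have "F q' \<omega> = (\<Prod>e\<in>E q \<union> E q'. if e \<in> E q' then \<phi> q' e (\<omega> e) else 1)"
      unfolding F_def using finE that by (intro prod.mono_neutral_cong_left) auto
    ultimately show ?thesis by (simp add: h_def prod.distrib)
  qed
  have inth: "integrable (D e) (h q q' e)" if "q \<in> S" "q' \<in> S" "e \<in> E q \<union> E q'" for q q' e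
  proof -
    have "integrable (D e) (\<lambda>y. \<phi> q e y * \<phi> q' e y)" if "e \<in> E q" "e \<in> E q'"
      using that \<open>q \<in> S\<close> \<open>q' \<in> S\<close> meas sq by (intro integrable_mult_of_squares) auto
    then show ?thesis
      using that int1 unfolding h_def by (cases "e \<in> E q"; cases "e \<in> E q'") auto
  qed
  have intFF: "integrable (PiM I D) (\<lambda>\<omega>. F q \<omega> * F q' \<omega>)" if "q \<in> S" "q' \<in> S" for q q'
    unfolding FF[OF that] using that E inth by (intro integrable_product D I) auto
  define G where "G q q' = (\<integral>\<omega>. F q \<omega> * F q' \<omega> \<partial>PiM I D)" for q q'
  have G0: "G q q' = 0" if "q \<in> S" "q' \<in> S" "E q \<noteq> E q'" for q q'
  proof -
    have "G q q' = (\<Prod>e\<in>E q \<union> E q'. \<integral>y. h q q' e y \<partial>D e)"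
      unfolding G_def FF[OF that(1,2)] using that E inth by (intro integral_product D I) auto
    moreover
    have "\<exists>e. e \<in> E q \<union> E q' \<and> \<not> (e \<in> E q \<and> e \<in> E q')" using that(3) by blast
    then obtain e where e: "e \<in> E q \<union> E q'" "\<not> (e \<in> E q \<and> e \<in> E q')" by blast
    have "(\<integral>y. h q q' e y \<partial>D e) = 0"
      using e mean that(1,2) unfolding h_def by (cases "e \<in> E q"; cases "e \<in> E q'") auto
    ultimately show ?thesis
      using e(1) finE that(1,2) by (auto intro!: prod_zero)
  qed
  have Gdiag: "G q q \<le> B" if "q \<in> S" for q
  proof -
    have "G q q = (\<integral>\<omega>. (\<Prod>e\<in>E q. (\<phi> q e (\<omega> e))\<^sup>2) \<partial>PiM I D)"
      unfolding G_def F_def power2_eq_square prod.distrib ..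
    also have "\<dots> = (\<Prod>e\<in>E q. \<integral>y. (\<phi> q e y)\<^sup>2 \<partial>D e)"
      using that E sq by (intro integral_product D I) auto
    finally show ?thesis using B(1)[OF that] by simp
  qed
  \<comment> \<open>Different labels may share an edge set and still carry different factors, so
    these cross moments are only bounded, by the arithmetic-geometric mean inequality.\<close>
  have GB: "\<bar>G q q'\<bar> \<le> B" if "q \<in> S" "q' \<in> S" for q q'
  proof -
    have "\<bar>G q q'\<bar> \<le> (\<integral>\<omega>. \<bar>F q \<omega> * F q' \<omega>\<bar> \<partial>PiM I D)"
      unfolding G_def using integral_norm_bound[of "PiM I D" "\<lambda>\<omega>. F q \<omega> * F q' \<omega>"] by simp
    also have "\<dots> \<le> (\<integral>\<omega>. (F q \<omega> * F q \<omega> + F q' \<omega> * F q' \<omega>) / 2 \<partial>PiM I D)"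
    proof (rule integral_mono)
      show "integrable (PiM I D) (\<lambda>\<omega>. \<bar>F q \<omega> * F q' \<omega>\<bar>)" using intFF[OF that] by simp
      show "integrable (PiM I D) (\<lambda>\<omega>. (F q \<omega> * F q \<omega> + F q' \<omega> * F q' \<omega>) / 2)"
        using intFF that by (intro integrable_divide Bochner_Integration.integrable_add) auto
      fix \<omega>
      have "0 \<le> (\<bar>F q \<omega>\<bar> - \<bar>F q' \<omega>\<bar>)\<^sup>2" by simp
      then show "\<bar>F q \<omega> * F q' \<omega>\<bar> \<le> (F q \<omega> * F q \<omega> + F q' \<omega> * F q' \<omega>) / 2"
        by (simp add: power2_diff abs_mult) (simp add: power2_eq_square)
    qed
    also have "\<dots> = (G q q + G q' q') / 2"
      unfolding G_def using intFF that by simp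
    also have "\<dots> \<le> B" using Gdiag[OF that(1)] Gdiag[OF that(2)] by simp
    finally show ?thesis .
  qed
  have exp: "(\<Sum>q\<in>S. a q * F q \<omega>)\<^sup>2 = (\<Sum>q\<in>S. \<Sum>q'\<in>S. a q * a q' * (F q \<omega> * F q' \<omega>))" for \<omega>
    by (simp add: power2_eq_square sum_product algebra_simps)
  show "integrable (PiM I D) (\<lambda>\<omega>. (\<Sum>q\<in>S. a q * (\<Prod>e\<in>E q. \<phi> q e (\<omega> e)))\<^sup>2)"
    unfolding F_def[symmetric] exp using intFF
    by (intro Bochner_Integration.integrable_sum integrable_mult_right) auto
  have "(\<integral>\<omega>. (\<Sum>q\<in>S. a q * F q \<omega>)\<^sup>2 \<partial>PiM I D) = (\<Sum>q\<in>S. \<Sum>q'\<in>S. a q * a q' * G q q')"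
    unfolding exp G_def using intFF
    by (subst Bochner_Integration.integral_sum, force)+ (auto intro!: sum.cong)
  \<comment> \<open>Only pairs with equal edge sets survive. Splitting \<open>a q * a q'\<close>
    symmetrically lets each \<open>q\<close> be charged for its at most \<open>K\<close>
    partners.\<close>
  also have "\<dots> \<le> (\<Sum>q\<in>S. \<Sum>q'\<in>S. of_bool (E q' = E q) * (B * ((a q)\<^sup>2 / 2) + B * ((a q')\<^sup>2 / 2)))"
  proof (intro sum_mono)
    fix q q' assume q: "q \<in> S" "q' \<in> S"
    show "a q * a q' * G q q' \<le> of_bool (E q' = E q) * (B * ((a q)\<^sup>2 / 2) + B * ((a q')\<^sup>2 / 2))"
    proof (cases "E q' = E q")
      case True
      have "a q * a q' * G q q' \<le> \<bar>a q * a q'\<bar> * \<bar>G q q'\<bar>"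
        by (metis abs_ge_self abs_mult)
      also have "\<dots> \<le> \<bar>a q * a q'\<bar> * B" using GB[OF q] by (intro mult_left_mono) auto
      also have "\<dots> \<le> ((a q)\<^sup>2 / 2 + (a q')\<^sup>2 / 2) * B"
      proof (rule mult_right_mono[OF _ B(2)])
        have "0 \<le> (\<bar>a q\<bar> - \<bar>a q'\<bar>)\<^sup>2" by simp
        then show "\<bar>a q * a q'\<bar> \<le> (a q)\<^sup>2 / 2 + (a q')\<^sup>2 / 2"
          by (simp add: power2_diff abs_mult)
      qed
      finally show ?thesis using True by (simp add: algebra_simps)
    qed (use G0 q in auto)
  qed
  also have "\<dots> = (\<Sum>q\<in>S. \<Sum>q'\<in>S. of_bool (E q' = E q) * (B * ((a q)\<^sup>2 / 2))) +
      (\<Sum>q\<in>S. \<Sum>q'\<in>S. of_bool (E q' = E q) * (B * ((a q')\<^sup>2 / 2)))"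
    by (simp only: distrib_left sum.distrib)
  also have "(\<Sum>q\<in>S. \<Sum>q'\<in>S. of_bool (E q' = E q) * (B * ((a q')\<^sup>2 / 2))) =
      (\<Sum>q\<in>S. \<Sum>q'\<in>S. of_bool (E q' = E q) * (B * ((a q)\<^sup>2 / 2)))"
    by (subst sum.swap) (intro sum.cong refl, auto simp: of_bool_def)
  also have "(\<Sum>q\<in>S. \<Sum>q'\<in>S. of_bool (E q' = E q) * (B * ((a q)\<^sup>2 / 2))) +
      (\<Sum>q\<in>S. \<Sum>q'\<in>S. of_bool (E q' = E q) * (B * ((a q)\<^sup>2 / 2))) =
      (\<Sum>q\<in>S. real (card {q' \<in> S. E q' = E q}) * (B * (a q)\<^sup>2))"
  proof -
    have "(\<Sum>q'\<in>S. of_bool (E q' = E q) * c) + (\<Sum>q'\<in>S. of_bool (E q' = E q) * c)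
        = real (card {q' \<in> S. E q' = E q}) * (2 * c)" for q and c :: real
    proof -
      have "(\<Sum>q'\<in>S. of_bool (E q' = E q) * c) = (\<Sum>q'\<in>{q' \<in> S. E q' = E q}. c)"
        using S by (intro sum.mono_neutral_cong_right) auto
      then show ?thesis by simp
    qed
    then have "(\<Sum>q'\<in>S. of_bool (E q' = E q) * (B * ((a q)\<^sup>2 / 2)))
        + (\<Sum>q'\<in>S. of_bool (E q' = E q) * (B * ((a q)\<^sup>2 / 2)))
        = real (card {q' \<in> S. E q' = E q}) * (B * (a q)\<^sup>2)" for q
      by (simp only:)
    then show ?thesis by (simp only: sum.distrib[symmetric])
  qed
  also have "\<dots> \<le> (\<Sum>q\<in>S. real K * (B * (a q)\<^sup>2))"
    using K B(2) by (intro sum_mono mult_right_mono) auto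
  also have "\<dots> = real K * B * (\<Sum>q\<in>S. (a q)\<^sup>2)"
    by (simp add: sum_distrib_left algebra_simps)
  finally show "(\<integral>\<omega>. (\<Sum>q\<in>S. a q * (\<Prod>e\<in>E q. \<phi> q e (\<omega> e)))\<^sup>2 \<partial>PiM I D)
      \<le> real K * B * (\<Sum>q\<in>S. (a q)\<^sup>2)"
    unfolding F_def .
qed

section \<open>Self-avoiding vectors\<close>

text \<open>Sorted, because \<open>wigner_noise\<close> indexes the entries on and above the
  diagonal.\<close>

definition edge :: "nat \<Rightarrow> nat \<Rightarrow> nat \<times> nat" where
  "edge i j = (min i j, max i j)"

definition edge_mat :: "(real \<Rightarrow> real) \<Rightarrow> (nat \<times> nat \<Rightarrow> real) \<Rightarrow> nat \<Rightarrow> nat \<Rightarrow> real" where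
  "edge_mat g w i j = (if i = j then 0 else g (w (edge i j)))"

definition offdiag_edges :: "nat \<Rightarrow> (nat \<times> nat) set" where
  "offdiag_edges n = {(i, j). i < j \<and> j < n}"

definition lists_below :: "nat \<Rightarrow> nat \<Rightarrow> nat list set" where
  "lists_below n m = {p. set p \<subseteq> {..<n} \<and> length p = m}"

definition saw_paths :: "nat \<Rightarrow> nat \<Rightarrow> nat list set" where
  "saw_paths n m = {p. set p \<subseteq> {..<n} \<and> length p = m \<and> distinct p}"

fun path_edges :: "nat list \<Rightarrow> (nat \<times> nat) set" where
  "path_edges (a # b # p) = insert (edge a b) (path_edges (b # p))"
| "path_edges _ = {}"

fun walk_weight :: "(nat \<Rightarrow> nat \<Rightarrow> real) \<Rightarrow> nat list \<Rightarrow> real" where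
  "walk_weight Z (a # b # p) = Z a b * walk_weight Z (b # p)"
| "walk_weight Z _ = 1"

definition verts :: "(nat \<times> nat) set \<Rightarrow> nat set" where
  "verts E = fst ` E \<union> snd ` E"

definition saw :: "nat \<Rightarrow> (nat \<Rightarrow> nat \<Rightarrow> real) \<Rightarrow> (nat \<Rightarrow> real) \<Rightarrow> nat \<Rightarrow> nat \<Rightarrow> real" where
  "saw n Z x j i = (\<Sum>p\<in>{p \<in> saw_paths n (Suc j). hd p = i}. walk_weight Z p * x (last p))"

section \<open>Combinatorics of self-avoiding paths\<close>

lemma edge_commute: "edge i j = edge j i"
  by (simp add: edge_def min.commute max.commute)

lemma edge_eq_iff: "edge a b = edge c d \<longleftrightarrow> (a = c \<and> b = d) \<or> (a = d \<and> b = c)"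
  by (auto simp: edge_def min_def max_def)

lemma edge_mat_commute: "edge_mat g w i j = edge_mat g w j i"
  by (simp add: edge_mat_def edge_commute)

lemma edge_in_offdiag: "i \<noteq> j \<Longrightarrow> i < n \<Longrightarrow> j < n \<Longrightarrow> edge i j \<in> offdiag_edges n"
  by (auto simp: edge_def offdiag_edges_def min_def max_def)

lemma verts_insert_edge: "verts (insert (edge a b) E) = insert a (insert b (verts E))"
  by (auto simp: verts_def edge_def min_def max_def)

lemma verts_path_edges: "2 \<le> length p \<Longrightarrow> verts (path_edges p) = set p"
proof (induction p rule: path_edges.induct)
  case (1 a b p)
  show ?case
  proof (cases p)
    case Nil
    then show ?thesis by (simp add: verts_insert_edge) (auto simp: verts_def)
  next
    case (Cons c q)
    then show ?thesis using 1 by (auto simp: verts_insert_edge)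
  qed
qed auto

lemma path_edges_subset: "verts (path_edges p) \<subseteq> set p"
  by (induction p rule: path_edges.induct) (auto simp: verts_insert_edge, auto simp: verts_def)

lemma finite_path_edges [simp]: "finite (path_edges p)"
  by (induction p rule: path_edges.induct) auto

lemma edge_in_path_edgesD: "edge a b \<in> path_edges p \<Longrightarrow> a \<in> set p \<and> b \<in> set p"
proof -
  assume "edge a b \<in> path_edges p"
  then have "verts (path_edges p) = verts (insert (edge a b) (path_edges p))"
    by (simp add: insert_absorb)
  then show ?thesis using path_edges_subset[of p] by (auto simp: verts_insert_edge)
qed

lemma card_path_edges: "distinct p \<Longrightarrow> card (path_edges p) = length p - 1"
proof (induction p rule: path_edges.induct)
  case (1 a b p)
  have "edge a b \<notin> path_edges (b # p)"
    using 1(2) edge_in_path_edgesD[of a b "b # p"] by auto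
  then show ?case using 1 by simp
qed auto

lemma path_edges_offdiag:
  "distinct p \<Longrightarrow> set p \<subseteq> {..<n} \<Longrightarrow> path_edges p \<subseteq> offdiag_edges n"
  by (induction p rule: path_edges.induct) (auto intro: edge_in_offdiag)

lemma walk_weight_edge_mat:
  "distinct p \<Longrightarrow> walk_weight (edge_mat g w) p = (\<Prod>e\<in>path_edges p. g (w e))"
proof (induction p rule: path_edges.induct)
  case (1 a b p)
  have "edge a b \<notin> path_edges (b # p)"
    using 1(2) edge_in_path_edgesD[of a b "b # p"] by auto
  then show ?case using 1 by (simp add: edge_mat_def)
qed auto

text \<open>In a self-avoiding path the first vertex lies on the first edge only, whose other end
  has position 1. A chord from position 2 or later is therefore a new, independent edge.\<close>

lemma closing_edge_not_in_path:
  assumes "distinct p" "2 \<le> r" "r < length p"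
  shows "edge (p ! r) (hd p) \<notin> path_edges p"
proof
  assume *: "edge (p ! r) (hd p) \<in> path_edges p"
  obtain a b q where p: "p = a # b # q"
    using assms(2,3) by (metis One_nat_def Suc_1 Suc_le_length_iff le_trans less_imp_le)
  have r: "p ! r \<noteq> a" "p ! r \<noteq> b"
    using assms nth_eq_iff_index_eq[of p r 0] nth_eq_iff_index_eq[of p r 1] by (auto simp: p)
  have "edge (p ! r) a \<noteq> edge a b" using r by (auto simp: edge_eq_iff)
  then have "edge (p ! r) a \<in> path_edges (b # q)" using * by (simp add: p)
  then have "a \<in> set (b # q)" using edge_in_path_edgesD by blast
  then show False using assms(1) by (simp add: p)
qed

lemma finite_offdiag_edges [simp]: "finite (offdiag_edges n)"
  by (rule finite_subset[of _ "{..<n} \<times> {..<n}"]) (auto simp: offdiag_edges_def)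

lemma finite_lists_below [simp]: "finite (lists_below n m)"
  unfolding lists_below_def by (rule finite_lists_length_eq) simp

lemma saw_paths_subset: "saw_paths n m \<subseteq> lists_below n m"
  by (auto simp: saw_paths_def lists_below_def)

lemma finite_saw_paths [simp]: "finite (saw_paths n m)"
  using saw_paths_subset finite_lists_below by (rule finite_subset)

lemma sum_lists_below_Suc:
  "(\<Sum>p\<in>lists_below n (Suc m). F p) = (\<Sum>a<n. \<Sum>p\<in>lists_below n m. F (a # p))"
proof -
  have "lists_below n (Suc m) = (\<lambda>(a, p). a # p) ` ({..<n} \<times> lists_below n m)"
    by (auto simp: lists_below_def length_Suc_conv image_iff)
  moreover have "inj_on (\<lambda>(a, p). a # p) ({..<n} \<times> lists_below n m)"
    by (auto simp: inj_on_def)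
  ultimately have "(\<Sum>p\<in>lists_below n (Suc m). F p) = (\<Sum>(a, p)\<in>{..<n} \<times> lists_below n m. F (a # p))"
    by (simp add: sum.reindex case_prod_unfold)
  then show ?thesis by (simp add: sum.cartesian_product)
qed

lemma sum_lists_below_last:
  fixes f :: "nat \<Rightarrow> real"
  shows "(\<Sum>p\<in>lists_below n (Suc j). f (last p)) = real n ^ j * (\<Sum>i<n. f i)"
proof (induction j)
  case 0
  have "lists_below n 0 = {[]}" by (auto simp: lists_below_def)
  then show ?case by (simp add: sum_lists_below_Suc)
next
  case (Suc j)
  have "(\<Sum>p\<in>lists_below n (Suc j). f (last (a # p))) = (\<Sum>p\<in>lists_below n (Suc j). f (last p))" for a
    by (intro sum.cong) (auto simp: lists_below_def)
  then show ?case using Suc by (subst sum_lists_below_Suc) simp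
qed

text \<open>Dropping distinctness enlarges a nonnegative sum; the \<open>j\<close> vertices before
  the last are then free.\<close>

lemma sum_saw_paths_last_le:
  fixes f :: "nat \<Rightarrow> real"
  assumes "\<And>i. 0 \<le> f i"
  shows "(\<Sum>p\<in>saw_paths n (Suc j). f (last p)) \<le> real n ^ j * (\<Sum>i<n. f i)"
  unfolding sum_lists_below_last[symmetric]
  using saw_paths_subset assms by (intro sum_mono2) auto

lemma sum_saw_paths_hd_last_le:
  fixes f :: "nat \<Rightarrow> real"
  assumes "\<And>i. 0 \<le> f i" "\<And>i. 0 \<le> g i"
  shows "(\<Sum>p\<in>saw_paths n (Suc (Suc j)). f (hd p) * g (last p)) \<le> real n ^ j * ((\<Sum>i<n. f i) * (\<Sum>i<n. g i))"
proof -
  have "(\<Sum>p\<in>saw_paths n (Suc (Suc j)). f (hd p) * g (last p)) \<le>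
      (\<Sum>p\<in>lists_below n (Suc (Suc j)). f (hd p) * g (last p))"
    using saw_paths_subset assms by (intro sum_mono2) auto
  also have "\<dots> = (\<Sum>a<n. f a * (\<Sum>p\<in>lists_below n (Suc j). g (last p)))"
  proof -
    have "(\<Sum>p\<in>lists_below n (Suc (Suc j)). f (hd p) * g (last p)) =
        (\<Sum>a<n. \<Sum>p\<in>lists_below n (Suc j). f (hd (a # p)) * g (last (a # p)))"
      by (rule sum_lists_below_Suc)
    also have "\<dots> = (\<Sum>a<n. \<Sum>p\<in>lists_below n (Suc j). f a * g (last p))"
      by (intro sum.cong refl) (auto simp: lists_below_def)
    finally show ?thesis by (simp add: sum_distrib_left)
  qed
  also have "\<dots> = real n ^ j * ((\<Sum>i<n. f i) * (\<Sum>i<n. g i))"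
    unfolding sum_lists_below_last sum_distrib_right[symmetric] by (simp add: mult_ac)
  finally show ?thesis .
qed

text \<open>The edge set fixes the vertex set, so at most \<open>m ^ m\<close> lists are possible.
  The count is crude but free of \<open>n\<close>, which is all that the second moment bound asks
  for.\<close>

lemma card_same_edges_le:
  assumes S: "S \<subseteq> saw_paths n m" and V: "\<And>p. p \<in> S \<Longrightarrow> verts (E p) = set p" and p: "p \<in> S"
  shows "card {q \<in> S. E q = E p} \<le> m ^ m"
proof -
  have "{q \<in> S. E q = E p} \<subseteq> {q. set q \<subseteq> set p \<and> length q = m}"
  proof (safe, goal_cases)
    case (1 q v)
    then show ?case using V[of q] V[of p] p by auto
  qed (use S in \<open>auto simp: saw_paths_def\<close>)
  then have "card {q \<in> S. E q = E p} \<le> card {q. set q \<subseteq> set p \<and> length q = m}"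
    by (intro card_mono finite_lists_length_eq) auto
  also have "\<dots> = card (set p) ^ m" by (rule card_lists_length_eq) simp
  also have "card (set p) = m" using p S by (auto simp: saw_paths_def distinct_card)
  finally show ?thesis .
qed

lemma mv_saw:
  assumes "i < n"
  shows "mv n Z (saw n Z x j) i = (\<Sum>p\<in>saw_paths n (Suc j). Z i (hd p) * (walk_weight Z p * x (last p)))"
proof -
  have hd: "hd ` saw_paths n (Suc j) \<subseteq> {..<n}"
  proof safe
    fix p assume "p \<in> saw_paths n (Suc j)"
    then have "p \<noteq> []" "set p \<subseteq> {..<n}" by (auto simp: saw_paths_def)
    then show "hd p < n" using hd_in_set[of p] by (meson lessThan_iff subsetD)
  qed
  have "mv n Z (saw n Z x j) i =
      (\<Sum>k<n. \<Sum>p\<in>{p \<in> saw_paths n (Suc j). hd p = k}. Z i (hd p) * (walk_weight Z p * x (last p)))"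
    unfolding mv_def saw_def sum_distrib_left by (intro sum.cong refl) auto
  also have "\<dots> = (\<Sum>p\<in>saw_paths n (Suc j). Z i (hd p) * (walk_weight Z p * x (last p)))"
    by (rule sum.group) (use hd in auto)
  finally show ?thesis .
qed

text \<open>Prefixing \<open>i\<close> to the paths that avoid it gives exactly the paths of the
  next length starting at \<open>i\<close>. This part of \<open>Z s_j\<close> is
  \<open>s_(j+1)\<close>.\<close>

lemma sum_avoiding_paths:
  assumes "i < n"
  shows "(\<Sum>p\<in>{p \<in> saw_paths n (Suc j). i \<notin> set p}. Z i (hd p) * (walk_weight Z p * x (last p)))
    = saw n Z x (Suc j) i"
  unfolding saw_def
proof (rule sum.reindex_bij_witness[where i = tl and j = "\<lambda>p. i # p"])
  fix q assume "q \<in> {p \<in> saw_paths n (Suc (Suc j)). hd p = i}"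
  then obtain q' where q: "q = i # q'" "q' \<in> {p \<in> saw_paths n (Suc j). i \<notin> set p}"
    by (cases q) (auto simp: saw_paths_def)
  then show "i # tl q = q" "tl q \<in> {p \<in> saw_paths n (Suc j). i \<notin> set p}" by simp_all
next
  fix p assume p: "p \<in> {p \<in> saw_paths n (Suc j). i \<notin> set p}"
  then show "tl (i # p) = p" "i # p \<in> {p \<in> saw_paths n (Suc (Suc j)). hd p = i}"
    using assms by (auto simp: saw_paths_def)
  obtain a p' where "p = a # p'" using p by (cases p) (auto simp: saw_paths_def)
  then show "walk_weight Z (i # p) * x (last (i # p)) = Z i (hd p) * (walk_weight Z p * x (last p))"
    by simp
qed

text \<open>Multiplying by \<open>Z\<close> attaches a vertex \<open>i\<close> in front of a path.
  If \<open>i\<close> already occurs there, its position decides its role: position 0 is killed by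
  the zero diagonal, position 1 backtracks to a shorter path, and later positions close a
  loop.\<close>

lemma sum_split_by_position:
  fixes F :: "nat list \<Rightarrow> real"
  shows "(\<Sum>p\<in>saw_paths n m. F p) = (\<Sum>p\<in>{p \<in> saw_paths n m. i \<notin> set p}. F p) +
    (\<Sum>r<m. \<Sum>p\<in>{p \<in> saw_paths n m. p ! r = i}. F p)"
proof -
  have "{p \<in> saw_paths n m. i \<in> set p} = (\<Union>r<m. {p \<in> saw_paths n m. p ! r = i})"
    by (auto simp: saw_paths_def in_set_conv_nth)
  moreover have "(\<Sum>p\<in>(\<Union>r<m. {p \<in> saw_paths n m. p ! r = i}). F p) =
      (\<Sum>r<m. \<Sum>p\<in>{p \<in> saw_paths n m. p ! r = i}. F p)"
  proof (rule sum.UNION_disjoint)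
    show "\<forall>r\<in>{..<m}. finite {p \<in> saw_paths n m. p ! r = i}" by simp
  qed (auto simp: saw_paths_def nth_eq_iff_index_eq)
  moreover have "(\<Sum>p\<in>saw_paths n m. F p) =
      (\<Sum>p\<in>{p \<in> saw_paths n m. i \<notin> set p}. F p) + (\<Sum>p\<in>{p \<in> saw_paths n m. i \<in> set p}. F p)"
    by (subst sum.union_disjoint[symmetric]) (auto intro: sum.cong)
  ultimately show ?thesis by simp
qed

text \<open>The first vertex can be any of the \<open>n - (j + 1)\<close> vertices off the tail.
  Against the variance 1/n of the backtracked edge this makes the coefficient of the shorter path
  almost 1.\<close>

lemma sum_backtrack_mean:
  fixes F :: "nat list \<Rightarrow> real"
  shows "(\<Sum>p\<in>{p \<in> saw_paths n (Suc (Suc j)). p ! 1 = i}. F (tl p)) =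
    (real n - real (Suc j)) * (\<Sum>q\<in>{q \<in> saw_paths n (Suc j). hd q = i}. F q)"
proof -
  let ?Q = "{q \<in> saw_paths n (Suc j). hd q = i}"
  have "(\<Sum>p\<in>{p \<in> saw_paths n (Suc (Suc j)). p ! 1 = i}. F (tl p)) =
      (\<Sum>(q, a)\<in>(SIGMA q:?Q. {..<n} - set q). F q)"
  proof (rule sum.reindex_bij_witness[where i = "\<lambda>(q, a). a # q" and j = "\<lambda>p. (tl p, hd p)"])
    fix p assume p: "p \<in> {p \<in> saw_paths n (Suc (Suc j)). p ! 1 = i}"
    then obtain a b q where "p = a # b # q" by (auto simp: saw_paths_def length_Suc_conv)
    then show "(case (tl p, hd p) of (q, a) \<Rightarrow> a # q) = p" "(tl p, hd p) \<in> (SIGMA q:?Q. {..<n} - set q)"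
      "(case (tl p, hd p) of (q, a) \<Rightarrow> F q) = F (tl p)"
      using p by (auto simp: saw_paths_def)
  next
    fix qa assume *: "qa \<in> (SIGMA q:?Q. {..<n} - set q)"
    then obtain q a where qa: "qa = (q, a)" "q \<in> ?Q" "a \<in> {..<n} - set q" by auto
    moreover obtain b q' where "q = b # q'" using qa(2) by (cases q) (auto simp: saw_paths_def)
    ultimately show "(tl (case qa of (q, a) \<Rightarrow> a # q), hd (case qa of (q, a) \<Rightarrow> a # q)) = qa"
      "(case qa of (q, a) \<Rightarrow> a # q) \<in> {p \<in> saw_paths n (Suc (Suc j)). p ! 1 = i}"
      by (auto simp: saw_paths_def)
  qed
  also have "\<dots> = (\<Sum>q\<in>?Q. \<Sum>a\<in>{..<n} - set q. F q)"
    by (subst sum.Sigma) auto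
  also have "\<dots> = (\<Sum>q\<in>?Q. (real n - real (Suc j)) * F q)"
  proof (rule sum.cong)
    fix q assume "q \<in> ?Q"
    then have q: "set q \<subseteq> {..<n}" "card (set q) = Suc j" by (auto simp: saw_paths_def distinct_card)
    then have "Suc j \<le> n" using card_mono[of "{..<n}" "set q"] by simp
    moreover have "card ({..<n} - set q) = n - Suc j" using q by (simp add: card_Diff_subset)
    ultimately show "(\<Sum>a\<in>{..<n} - set q. F q) = (real n - real (Suc j)) * F q"
      by (simp add: of_nat_diff)
  qed simp
  also have "\<dots> = (real n - real (Suc j)) * (\<Sum>q\<in>?Q. F q)" by (simp add: sum_distrib_left)
  finally show ?thesis .
qed

section \<open>Second moments of path sums\<close>

locale centred_noise =
  fixes P Pd :: "real measure" and n :: nat and g :: "real \<Rightarrow> real" and \<kappa> :: real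
  assumes P: "prob_space P" and Pd: "prob_space Pd" and n: "0 < n"
    and g_meas: "g \<in> borel_measurable P"
    and g4: "integrable P (\<lambda>y. g y ^ 4)"
    and g_mean: "(\<integral>y. g y \<partial>P) = 0"
    and g_var: "(\<integral>y. (g y)\<^sup>2 \<partial>P) = 1 / real n"
    and g_fourth: "(\<integral>y. g y ^ 4 \<partial>P) \<le> \<kappa> / (real n)\<^sup>2"
begin

abbreviation "noise \<equiv> wigner_noise P Pd n"

lemma noise_law_prob_space: "prob_space ((\<lambda>(i, j). if i = j then Pd else P) e)"
  using P Pd by (cases e) auto

lemma noise_prob_space: "prob_space noise"
  unfolding wigner_noise_def by (rule prob_space_PiM) (rule noise_law_prob_space)

lemma noise_law_offdiag:
  "e \<in> offdiag_edges n \<Longrightarrow> (\<lambda>(i, j). if i = j then Pd else P) e = P"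
  by (auto simp: offdiag_edges_def)

lemma offdiag_subset_noise_index: "offdiag_edges n \<subseteq> {(i, j). i \<le> j \<and> j < n}"
  by (auto simp: offdiag_edges_def)

lemma finite_noise_index: "finite {(i, j). i \<le> j \<and> j < n}"
  by (rule finite_subset[of _ "{..<n} \<times> {..<n}"]) auto

lemma kappa_nonneg: "0 \<le> \<kappa>"
proof -
  have "0 \<le> (\<integral>y. g y ^ 4 \<partial>P)" by simp
  with g_fourth have "0 \<le> \<kappa> / (real n)\<^sup>2" by linarith
  then show ?thesis using n by (simp add: zero_le_divide_iff)
qed

lemma g2: "integrable P (\<lambda>y. (g y)\<^sup>2)"
proof -
  have "integrable P (\<lambda>y. ((g y)\<^sup>2)\<^sup>2)" using g4 by simp
  then show ?thesis
    using finite_measure.square_integrable_imp_integrable[OF prob_space.finite_measure[OF P]] g_meas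
    by (metis borel_measurable_power)
qed

text \<open>A backtracked edge enters squared. Removing its mean 1/n leaves a centred factor whose
  variance is of order 1/n^2, smaller by 1/n than that of a plain edge.\<close>

lemma centred_square:
  defines "b \<equiv> \<lambda>y. (g y)\<^sup>2 - 1 / real n"
  shows centred_square_integrable: "integrable P (\<lambda>y. (b y)\<^sup>2)"
    and centred_square_mean: "(\<integral>y. b y \<partial>P) = 0"
    and centred_square_var: "(\<integral>y. (b y)\<^sup>2 \<partial>P) \<le> \<kappa> / (real n)\<^sup>2"
proof -
  interpret prob_space P by (rule P)
  have e: "(b y)\<^sup>2 = g y ^ 4 - 2 / real n * (g y)\<^sup>2 + 1 / (real n)\<^sup>2" for y
    by (simp add: b_def power2_diff power_divide)
  show "integrable P (\<lambda>y. (b y)\<^sup>2)" unfolding e using g2 g4 by auto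
  show "(\<integral>y. b y \<partial>P) = 0" unfolding b_def using g2 g_var by (simp add: prob_space)
  have "(\<integral>y. (b y)\<^sup>2 \<partial>P) = (\<integral>y. g y ^ 4 \<partial>P) - 2 / real n * (1 / real n) + 1 / (real n)\<^sup>2"
    unfolding e using g2 g4 by (simp add: prob_space g_var)
  also have "\<dots> \<le> (\<integral>y. g y ^ 4 \<partial>P)" using n by (simp add: power2_eq_square field_simps)
  finally show "(\<integral>y. (b y)\<^sup>2 \<partial>P) \<le> \<kappa> / (real n)\<^sup>2" using g_fourth by linarith
qed

lemma path_sum_second_moment:
  fixes \<phi> :: "nat list \<Rightarrow> nat \<times> nat \<Rightarrow> real \<Rightarrow> real" and a :: "nat list \<Rightarrow> real"
  assumes S: "S \<subseteq> saw_paths n m"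
    and E: "\<And>p. p \<in> S \<Longrightarrow> E p \<subseteq> offdiag_edges n" "\<And>p. p \<in> S \<Longrightarrow> verts (E p) = set p"
    and meas: "\<And>p e. p \<in> S \<Longrightarrow> e \<in> E p \<Longrightarrow> \<phi> p e \<in> borel_measurable P"
    and sq: "\<And>p e. p \<in> S \<Longrightarrow> e \<in> E p \<Longrightarrow> integrable P (\<lambda>y. (\<phi> p e y)\<^sup>2)"
    and mean: "\<And>p e. p \<in> S \<Longrightarrow> e \<in> E p \<Longrightarrow> (\<integral>y. \<phi> p e y \<partial>P) = 0"
    and B: "\<And>p. p \<in> S \<Longrightarrow> (\<Prod>e\<in>E p. \<integral>y. (\<phi> p e y)\<^sup>2 \<partial>P) \<le> B" "0 \<le> B"
  shows path_sum_integrable: "integrable noise (\<lambda>w. (\<Sum>p\<in>S. a p * (\<Prod>e\<in>E p. \<phi> p e (w e)))\<^sup>2)" (is ?A)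
    and path_sum_integral_le: "(\<integral>w. (\<Sum>p\<in>S. a p * (\<Prod>e\<in>E p. \<phi> p e (w e)))\<^sup>2 \<partial>noise)
      \<le> real (m ^ m) * B * (\<Sum>p\<in>S. (a p)\<^sup>2)" (is ?B)
proof -
  let ?D = "\<lambda>(i, j). if i = j then Pd else P"
  have DP: "?D e = P" if "p \<in> S" "e \<in> E p" for p e
    using E(1)[OF that(1)] that(2) noise_law_offdiag by blast
  have fS: "finite S" using S finite_saw_paths finite_subset by blast
  have "(\<Prod>e\<in>E p. \<integral>y. (\<phi> p e y)\<^sup>2 \<partial>?D e) = (\<Prod>e\<in>E p. \<integral>y. (\<phi> p e y)\<^sup>2 \<partial>P)" if "p \<in> S" for p
    by (intro prod.cong refl, simp only: DP[OF that])
  then have B': "\<And>p. p \<in> S \<Longrightarrow> (\<Prod>e\<in>E p. \<integral>y. (\<phi> p e y)\<^sup>2 \<partial>?D e) \<le> B" using B(1) by simp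
  have 1: "\<And>p. p \<in> S \<Longrightarrow> E p \<subseteq> {(i, j). i \<le> j \<and> j < n}"
    using E(1) offdiag_subset_noise_index by blast
  have 2: "\<And>p e. p \<in> S \<Longrightarrow> e \<in> E p \<Longrightarrow> \<phi> p e \<in> borel_measurable (?D e)"
    "\<And>p e. p \<in> S \<Longrightarrow> e \<in> E p \<Longrightarrow> integrable (?D e) (\<lambda>y. (\<phi> p e y)\<^sup>2)"
    "\<And>p e. p \<in> S \<Longrightarrow> e \<in> E p \<Longrightarrow> (\<integral>y. \<phi> p e y \<partial>?D e) = 0"
    by (simp_all only: DP meas sq mean)
  note K = card_same_edges_le[OF S E(2)]
  show ?A ?B
    unfolding wigner_noise_def
    using integrable_edge_sum_square[of ?D, OF noise_law_prob_space finite_noise_index fS 1 2 B' B(2) K]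
      integral_edge_sum_square_le[of ?D, OF noise_law_prob_space finite_noise_index fS 1 2 B' B(2) K]
    by blast+
qed

text \<open>\<open>key\<close> assigns each path to one coordinate, so the coordinatewise bounds add
  up to a single sum over all paths.\<close>

lemma path_vector_second_moment:
  fixes \<phi> :: "nat list \<Rightarrow> nat \<times> nat \<Rightarrow> real \<Rightarrow> real" and a :: "nat list \<Rightarrow> real"
  assumes E: "\<And>p. p \<in> saw_paths n m \<Longrightarrow> E p \<subseteq> offdiag_edges n" "\<And>p. p \<in> saw_paths n m \<Longrightarrow> verts (E p) = set p"
    and meas: "\<And>p e. p \<in> saw_paths n m \<Longrightarrow> e \<in> E p \<Longrightarrow> \<phi> p e \<in> borel_measurable P"
    and sq: "\<And>p e. p \<in> saw_paths n m \<Longrightarrow> e \<in> E p \<Longrightarrow> integrable P (\<lambda>y. (\<phi> p e y)\<^sup>2)"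
    and mean: "\<And>p e. p \<in> saw_paths n m \<Longrightarrow> e \<in> E p \<Longrightarrow> (\<integral>y. \<phi> p e y \<partial>P) = 0"
    and B: "\<And>p. p \<in> saw_paths n m \<Longrightarrow> (\<Prod>e\<in>E p. \<integral>y. (\<phi> p e y)\<^sup>2 \<partial>P) \<le> B" "0 \<le> B"
    and key: "\<And>p. p \<in> saw_paths n m \<Longrightarrow> key p < n"
  defines "V \<equiv> \<lambda>i w. \<Sum>p\<in>{p \<in> saw_paths n m. key p = i}. a p * (\<Prod>e\<in>E p. \<phi> p e (w e))"
  shows path_vector_integrable: "integrable noise (\<lambda>w. \<Sum>i<n. (V i w)\<^sup>2)"
    and path_vector_integral_le:
      "(\<integral>w. (\<Sum>i<n. (V i w)\<^sup>2) \<partial>noise) \<le> real (m ^ m) * B * (\<Sum>p\<in>saw_paths n m. (a p)\<^sup>2)"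
proof -
  have sub: "{p \<in> saw_paths n m. key p = i} \<subseteq> saw_paths n m" for i by blast
  have int: "integrable noise (\<lambda>w. (V i w)\<^sup>2)" for i
    unfolding V_def by (rule path_sum_integrable[OF sub _ _ _ _ _ _ B(2)]) (use E meas sq mean B(1) in auto)
  have le: "(\<integral>w. (V i w)\<^sup>2 \<partial>noise) \<le> real (m ^ m) * B * (\<Sum>p\<in>{p \<in> saw_paths n m. key p = i}. (a p)\<^sup>2)" for i
    unfolding V_def by (rule path_sum_integral_le[OF sub _ _ _ _ _ _ B(2)]) (use E meas sq mean B(1) in auto)
  show "integrable noise (\<lambda>w. \<Sum>i<n. (V i w)\<^sup>2)" using int by auto
  have "(\<integral>w. (\<Sum>i<n. (V i w)\<^sup>2) \<partial>noise) = (\<Sum>i<n. \<integral>w. (V i w)\<^sup>2 \<partial>noise)"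
    using int by (intro Bochner_Integration.integral_sum) auto
  also have "\<dots> \<le> (\<Sum>i<n. real (m ^ m) * B * (\<Sum>p\<in>{p \<in> saw_paths n m. key p = i}. (a p)\<^sup>2))"
    by (intro sum_mono le)
  also have "\<dots> = real (m ^ m) * B * (\<Sum>i<n. \<Sum>p\<in>{p \<in> saw_paths n m. key p = i}. (a p)\<^sup>2)"
    by (simp only: sum_distrib_left)
  also have "(\<Sum>i<n. \<Sum>p\<in>{p \<in> saw_paths n m. key p = i}. (a p)\<^sup>2) = (\<Sum>p\<in>saw_paths n m. (a p)\<^sup>2)"
    using key by (intro sum.group) auto
  finally show "(\<integral>w. (\<Sum>i<n. (V i w)\<^sup>2) \<partial>noise) \<le> real (m ^ m) * B * (\<Sum>p\<in>saw_paths n m. (a p)\<^sup>2)" .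
qed

definition loop_term :: "(nat \<Rightarrow> real) \<Rightarrow> nat \<Rightarrow> nat \<Rightarrow> nat \<Rightarrow> (nat \<times> nat \<Rightarrow> real) \<Rightarrow> real" where
  "loop_term x m r i w = (\<Sum>p\<in>{p \<in> saw_paths n m. p ! r = i}. x (last p) *
     (\<Prod>e\<in>insert (edge (p ! r) (hd p)) (path_edges p). g (w e)))"

definition backtrack_term :: "(nat \<Rightarrow> real) \<Rightarrow> nat \<Rightarrow> nat \<Rightarrow> (nat \<times> nat \<Rightarrow> real) \<Rightarrow> real" where
  "backtrack_term x m i w = (\<Sum>p\<in>{p \<in> saw_paths n m. p ! 1 = i}. x (last p) *
     (\<Prod>e\<in>path_edges p. (if e = edge (p ! 0) (p ! 1) then \<lambda>y. (g y)\<^sup>2 - 1 / real n else g) (w e)))"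

lemma saw_path_nth_less: "p \<in> saw_paths n m \<Longrightarrow> r < m \<Longrightarrow> p ! r < n"
  by (auto simp: saw_paths_def dest: nth_mem)

lemma saw_path_hd_less: "p \<in> saw_paths n (Suc m) \<Longrightarrow> hd p < n"
  using saw_path_nth_less[of p "Suc m" 0] by (simp add: hd_conv_nth saw_paths_def length_Suc_conv) force

lemma sum_path_edges_facts:
  assumes "p \<in> saw_paths n (Suc (Suc k))"
  shows "path_edges p \<subseteq> offdiag_edges n" "verts (path_edges p) = set p" "card (path_edges p) = Suc k"
  using assms path_edges_offdiag[of p n] verts_path_edges[of p] card_path_edges[of p]
  by (auto simp: saw_paths_def)

text \<open>Each of the \<open>k\<close> edges contributes variance 1/n, and each of the
  \<open>k\<close> vertices before the last is free to take about n values: the two balance.\<close>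

lemma saw_second_moment:
  shows saw_square_integrable: "integrable noise (\<lambda>w. \<Sum>i<n. (saw n (edge_mat g w) x k i)\<^sup>2)"
    and saw_square_integral_le: "(\<integral>w. (\<Sum>i<n. (saw n (edge_mat g w) x k i)\<^sup>2) \<partial>noise)
      \<le> real ((Suc k) ^ (Suc k)) * (\<Sum>i<n. (x i)\<^sup>2)"
proof -
  interpret N: prob_space noise by (rule noise_prob_space)
  have "integrable noise (\<lambda>w. \<Sum>i<n. (saw n (edge_mat g w) x k i)\<^sup>2) \<and>
    (\<integral>w. (\<Sum>i<n. (saw n (edge_mat g w) x k i)\<^sup>2) \<partial>noise)
      \<le> real ((Suc k) ^ (Suc k)) * (\<Sum>i<n. (x i)\<^sup>2)"
  proof (cases k)
    case 0
    have "saw n Z x 0 i = x i" if "i < n" for Z i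
    proof -
      have "{p \<in> saw_paths n (Suc 0). hd p = i} = {[i]}"
        using that by (auto simp: saw_paths_def length_Suc_conv)
      then show ?thesis by (simp add: saw_def)
    qed
    then have "(\<Sum>i<n. (saw n Z x 0 i)\<^sup>2) = (\<Sum>i<n. (x i)\<^sup>2)" for Z by simp
    then show ?thesis using 0 by (simp add: N.prob_space)
  next
    case (Suc l)
    let ?V = "\<lambda>i w. \<Sum>p\<in>{p \<in> saw_paths n (Suc k). hd p = i}. x (last p) * (\<Prod>e\<in>path_edges p. g (w e))"
    have eq: "saw n (edge_mat g w) x k i = ?V i w" for i w
      unfolding saw_def
      by (intro sum.cong refl) (auto simp: walk_weight_edge_mat saw_paths_def)
    have B: "(\<Prod>e\<in>path_edges p. \<integral>y. (g y)\<^sup>2 \<partial>P) \<le> (1 / real n) ^ k" if "p \<in> saw_paths n (Suc k)" for p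
      using sum_path_edges_facts(3)[of p l] that Suc by (simp add: g_var)
    have int: "integrable noise (\<lambda>w. \<Sum>i<n. (?V i w)\<^sup>2)"
      and le: "(\<integral>w. (\<Sum>i<n. (?V i w)\<^sup>2) \<partial>noise) \<le>
        real (Suc k ^ Suc k) * (1 / real n) ^ k * (\<Sum>p\<in>saw_paths n (Suc k). (x (last p))\<^sup>2)"
      using path_vector_second_moment[where E = path_edges and \<phi> = "\<lambda>p e. g" and key = hd
          and a = "\<lambda>p. x (last p)" and m = "Suc k" and B = "(1 / real n) ^ k"]
        sum_path_edges_facts(1,2)[of _ l] saw_path_hd_less g_meas g2 g_mean B Suc by auto
    have "(\<Sum>p\<in>saw_paths n (Suc k). (x (last p))\<^sup>2) \<le> real n ^ k * (\<Sum>i<n. (x i)\<^sup>2)"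
      using sum_saw_paths_last_le[of "\<lambda>i. (x i)\<^sup>2"] by simp
    then have "real (Suc k ^ Suc k) * (1 / real n) ^ k * (\<Sum>p\<in>saw_paths n (Suc k). (x (last p))\<^sup>2)
        \<le> real (Suc k ^ Suc k) * (1 / real n) ^ k * (real n ^ k * (\<Sum>i<n. (x i)\<^sup>2))"
      by (intro mult_left_mono) auto
    also have "\<dots> = real (Suc k ^ Suc k) * (\<Sum>i<n. (x i)\<^sup>2)"
      using n by (simp add: power_divide)
    finally show ?thesis using int le unfolding eq by linarith
  qed
  then show "integrable noise (\<lambda>w. \<Sum>i<n. (saw n (edge_mat g w) x k i)\<^sup>2)"
    "(\<integral>w. (\<Sum>i<n. (saw n (edge_mat g w) x k i)\<^sup>2) \<partial>noise)
      \<le> real ((Suc k) ^ (Suc k)) * (\<Sum>i<n. (x i)\<^sup>2)" by blast+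
qed

text \<open>Both ends are now weighted by \<open>x\<close>, so there is one free vertex fewer than
  there are edges and a factor 1/n remains.\<close>

lemma saw_overlap_second_moment:
  fixes x k
  defines "m \<equiv> Suc (Suc k)"
  shows saw_overlap_integrable: "integrable noise (\<lambda>w. (ip n (saw n (edge_mat g w) x (Suc k)) x)\<^sup>2)"
    and saw_overlap_integral_le: "(\<integral>w. (ip n (saw n (edge_mat g w) x (Suc k)) x)\<^sup>2 \<partial>noise)
      \<le> real (m ^ m) * (ip n x x)\<^sup>2 / real n"
proof -
  let ?V = "\<lambda>w. \<Sum>p\<in>saw_paths n m. (x (hd p) * x (last p)) * (\<Prod>e\<in>path_edges p. g (w e))"
  have eq: "ip n (saw n (edge_mat g w) x (Suc k)) x = ?V w" for w
  proof -
    have "ip n (saw n (edge_mat g w) x (Suc k)) x = (\<Sum>i<n. \<Sum>p\<in>{p \<in> saw_paths n m. hd p = i}.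
        (x (hd p) * x (last p)) * (\<Prod>e\<in>path_edges p. g (w e)))"
      unfolding ip_def saw_def sum_distrib_right m_def
      by (intro sum.cong refl) (auto simp: walk_weight_edge_mat saw_paths_def)
    also have "\<dots> = ?V w" using saw_path_hd_less unfolding m_def by (intro sum.group) auto
    finally show ?thesis .
  qed
  have B: "(\<Prod>e\<in>path_edges p. \<integral>y. (g y)\<^sup>2 \<partial>P) \<le> (1 / real n) ^ (Suc k)" if "p \<in> saw_paths n m" for p
    using sum_path_edges_facts(3)[of p k] that by (simp add: g_var m_def)
  have int: "integrable noise (\<lambda>w. (?V w)\<^sup>2)"
    and le: "(\<integral>w. (?V w)\<^sup>2 \<partial>noise) \<le>
        real (m ^ m) * (1 / real n) ^ (Suc k) * (\<Sum>p\<in>saw_paths n m. (x (hd p) * x (last p))\<^sup>2)"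
    using path_sum_second_moment[where S = "saw_paths n m" and m = m and E = path_edges and \<phi> = "\<lambda>p e. g"
        and a = "\<lambda>p. x (hd p) * x (last p)" and B = "(1 / real n) ^ (Suc k)"]
      sum_path_edges_facts(1,2)[of _ k] g_meas g2 g_mean B unfolding m_def by auto
  show "integrable noise (\<lambda>w. (ip n (saw n (edge_mat g w) x (Suc k)) x)\<^sup>2)" unfolding eq by (rule int)
  have "(\<Sum>p\<in>saw_paths n m. (x (hd p) * x (last p))\<^sup>2) \<le> real n ^ k * ((\<Sum>i<n. (x i)\<^sup>2) * (\<Sum>i<n. (x i)\<^sup>2))"
    using sum_saw_paths_hd_last_le[of "\<lambda>i. (x i)\<^sup>2" "\<lambda>i. (x i)\<^sup>2" n k] by (simp add: m_def power_mult_distrib)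
  then have "real (m ^ m) * (1 / real n) ^ (Suc k) * (\<Sum>p\<in>saw_paths n m. (x (hd p) * x (last p))\<^sup>2)
     \<le> real (m ^ m) * (1 / real n) ^ (Suc k) * (real n ^ k * ((\<Sum>i<n. (x i)\<^sup>2) * (\<Sum>i<n. (x i)\<^sup>2)))"
    by (intro mult_left_mono) auto
  also have "\<dots> = real (m ^ m) * (ip n x x)\<^sup>2 / real n"
    using n by (simp add: power_divide ip_self_sum_squares power2_eq_square)
  finally show "(\<integral>w. (ip n (saw n (edge_mat g w) x (Suc k)) x)\<^sup>2 \<partial>noise) \<le> real (m ^ m) * (ip n x x)\<^sup>2 / real n"
    using le unfolding eq by linarith
qed

text \<open>Closing the loop adds an edge but no vertex: \<open>k + 2\<close> edges against
  \<open>k + 1\<close> free vertices leave a factor 1/n.\<close>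

lemma loop_term_second_moment:
  fixes x k r
  defines "m \<equiv> Suc (Suc k)"
  assumes r: "2 \<le> r" "r < m"
  shows loop_term_integrable: "integrable noise (\<lambda>w. \<Sum>i<n. (loop_term x m r i w)\<^sup>2)"
    and loop_term_integral_le: "(\<integral>w. (\<Sum>i<n. (loop_term x m r i w)\<^sup>2) \<partial>noise)
      \<le> real (m ^ m) * (ip n x x) / real n"
proof -
  let ?E = "\<lambda>p. insert (edge (p ! r) (hd p)) (path_edges p)"
  have E: "?E p \<subseteq> offdiag_edges n" "verts (?E p) = set p" "card (?E p) = Suc (Suc k)"
    if p: "p \<in> saw_paths n m" for p
  proof -
    have len: "length p = m" and dp: "distinct p" using p by (auto simp: saw_paths_def)
    have hd: "hd p = p ! 0" using len by (cases p) (auto simp: m_def)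
    have "p ! r \<noteq> hd p" using dp r len unfolding hd by (subst nth_eq_iff_index_eq) (auto simp: m_def)
    then show "?E p \<subseteq> offdiag_edges n"
      using sum_path_edges_facts(1)[of p k] p saw_path_nth_less[OF p r(2)] saw_path_hd_less[of p "Suc k"]
      by (auto simp: m_def intro: edge_in_offdiag)
    have "p \<noteq> []" using len by (auto simp: m_def)
    then have "hd p \<in> set p" "p ! r \<in> set p" using len r by auto
    then show "verts (?E p) = set p"
      using sum_path_edges_facts(2)[of p k] p by (auto simp: m_def verts_insert_edge)
    show "card (?E p) = Suc (Suc k)"
      using sum_path_edges_facts(3)[of p k] p closing_edge_not_in_path[OF dp r(1)] r(2) len
      by (simp add: m_def)
  qed
  have B: "(\<Prod>e\<in>?E p. \<integral>y. (g y)\<^sup>2 \<partial>P) \<le> (1 / real n) ^ Suc (Suc k)" if "p \<in> saw_paths n m" for p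
    using E(3)[OF that] by (simp only: g_var prod_constant order_refl)
  have int: "integrable noise (\<lambda>w. \<Sum>i<n. (loop_term x m r i w)\<^sup>2)"
    and le: "(\<integral>w. (\<Sum>i<n. (loop_term x m r i w)\<^sup>2) \<partial>noise) \<le>
        real (m ^ m) * (1 / real n) ^ Suc (Suc k) * (\<Sum>p\<in>saw_paths n m. (x (last p))\<^sup>2)"
    unfolding loop_term_def
    using path_vector_second_moment[where E = ?E and \<phi> = "\<lambda>p e. g" and key = "\<lambda>p. p ! r"
        and a = "\<lambda>p. x (last p)" and m = m and B = "(1 / real n) ^ Suc (Suc k)"]
      E(1,2) saw_path_nth_less[OF _ r(2)] g_meas g2 g_mean B by auto
  show "integrable noise (\<lambda>w. \<Sum>i<n. (loop_term x m r i w)\<^sup>2)" by (rule int)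
  have "(\<Sum>p\<in>saw_paths n m. (x (last p))\<^sup>2) \<le> real n ^ Suc k * (\<Sum>i<n. (x i)\<^sup>2)"
    unfolding m_def using sum_saw_paths_last_le[of "\<lambda>i. (x i)\<^sup>2" n "Suc k"] by simp
  then have "real (m ^ m) * (1 / real n) ^ Suc (Suc k) * (\<Sum>p\<in>saw_paths n m. (x (last p))\<^sup>2)
     \<le> real (m ^ m) * (1 / real n) ^ Suc (Suc k) * (real n ^ Suc k * (\<Sum>i<n. (x i)\<^sup>2))"
    by (intro mult_left_mono) auto
  also have "\<dots> = real (m ^ m) * ip n x x / real n"
    using n by (simp add: power_divide ip_self_sum_squares)
  finally show "(\<integral>w. (\<Sum>i<n. (loop_term x m r i w)\<^sup>2) \<partial>noise) \<le> real (m ^ m) * ip n x x / real n"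
    using le by linarith
qed

text \<open>The centred square has variance of order 1/n^2 where a plain edge has 1/n, so a factor
  1/n is gained here as well.\<close>

lemma backtrack_term_second_moment:
  fixes x k
  defines "m \<equiv> Suc (Suc k)"
  shows backtrack_term_integrable: "integrable noise (\<lambda>w. \<Sum>i<n. (backtrack_term x m i w)\<^sup>2)"
    and backtrack_term_integral_le: "(\<integral>w. (\<Sum>i<n. (backtrack_term x m i w)\<^sup>2) \<partial>noise)
      \<le> real (m ^ m) * \<kappa> * (ip n x x) / real n"
proof -
  let ?b = "\<lambda>y. (g y)\<^sup>2 - 1 / real n"
  let ?\<phi> = "\<lambda>p e. if e = edge (p ! 0) (p ! 1) then ?b else g"
  have B: "(\<Prod>e\<in>path_edges p. \<integral>y. (?\<phi> p e y)\<^sup>2 \<partial>P) \<le> \<kappa> * (1 / real n) ^ Suc (Suc k)"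
    if p: "p \<in> saw_paths n m" for p
  proof -
    obtain u v q where puv: "p = u # v # q" using p by (auto simp: saw_paths_def m_def length_Suc_conv)
    let ?e = "edge (p ! 0) (p ! 1)"
    have e: "?e \<in> path_edges p" by (simp add: puv)
    have "(\<Prod>e\<in>path_edges p. \<integral>y. (?\<phi> p e y)\<^sup>2 \<partial>P) =
        (\<integral>y. (?\<phi> p ?e y)\<^sup>2 \<partial>P) * (\<Prod>e\<in>path_edges p - {?e}. \<integral>y. (?\<phi> p e y)\<^sup>2 \<partial>P)"
      by (rule prod.remove[OF finite_path_edges e])
    also have "(\<Prod>e\<in>path_edges p - {?e}. \<integral>y. (?\<phi> p e y)\<^sup>2 \<partial>P) = (\<Prod>e\<in>path_edges p - {?e}. 1 / real n)"
      by (intro prod.cong refl) (auto simp: g_var)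
    also have "\<dots> = (1 / real n) ^ k"
      using sum_path_edges_facts(3)[of p k] p e by (simp add: m_def card_Diff_singleton)
    also have "(\<integral>y. (?\<phi> p ?e y)\<^sup>2 \<partial>P) * (1 / real n) ^ k \<le> (\<kappa> / (real n)\<^sup>2) * (1 / real n) ^ k"
      using centred_square_var by (intro mult_right_mono) auto
    also have "\<dots> = \<kappa> * (1 / real n) ^ Suc (Suc k)"
      by (simp add: power2_eq_square)
    finally show ?thesis .
  qed
  have int: "integrable noise (\<lambda>w. \<Sum>i<n. (backtrack_term x m i w)\<^sup>2)"
    and le: "(\<integral>w. (\<Sum>i<n. (backtrack_term x m i w)\<^sup>2) \<partial>noise) \<le>
        real (m ^ m) * (\<kappa> * (1 / real n) ^ Suc (Suc k)) * (\<Sum>p\<in>saw_paths n m. (x (last p))\<^sup>2)"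
    unfolding backtrack_term_def
    using path_vector_second_moment[where E = path_edges and \<phi> = ?\<phi> and key = "\<lambda>p. p ! 1"
        and a = "\<lambda>p. x (last p)" and m = m and B = "\<kappa> * (1 / real n) ^ Suc (Suc k)"]
      sum_path_edges_facts(1,2)[of _ k] saw_path_nth_less[of _ m 1] g_meas g2 g_mean B
      centred_square_integrable centred_square_mean kappa_nonneg unfolding m_def by (auto simp: if_distrib)
  show "integrable noise (\<lambda>w. \<Sum>i<n. (backtrack_term x m i w)\<^sup>2)" by (rule int)
  have "(\<Sum>p\<in>saw_paths n m. (x (last p))\<^sup>2) \<le> real n ^ Suc k * (\<Sum>i<n. (x i)\<^sup>2)"
    unfolding m_def using sum_saw_paths_last_le[of "\<lambda>i. (x i)\<^sup>2" n "Suc k"] by simp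
  then have "real (m ^ m) * (\<kappa> * (1 / real n) ^ Suc (Suc k)) * (\<Sum>p\<in>saw_paths n m. (x (last p))\<^sup>2)
     \<le> real (m ^ m) * (\<kappa> * (1 / real n) ^ Suc (Suc k)) * (real n ^ Suc k * (\<Sum>i<n. (x i)\<^sup>2))"
    using kappa_nonneg by (intro mult_left_mono) auto
  also have "\<dots> = real (m ^ m) * \<kappa> * ip n x x / real n"
    using n by (simp add: power_divide ip_self_sum_squares)
  finally show "(\<integral>w. (\<Sum>i<n. (backtrack_term x m i w)\<^sup>2) \<partial>noise) \<le> real (m ^ m) * \<kappa> * ip n x x / real n"
    using le by linarith
qed

end

text \<open>Defect in the three-term recurrence. The conditional removes the predecessor of
  \<open>s_0\<close>, for which \<open>j - 1\<close> would wrongly give 0 again.\<close>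

definition saw_residual :: "nat \<Rightarrow> (nat \<Rightarrow> nat \<Rightarrow> real) \<Rightarrow> (nat \<Rightarrow> real) \<Rightarrow> nat \<Rightarrow> nat \<Rightarrow> real" where
  "saw_residual n Z x j i =
     mv n Z (saw n Z x j) i - saw n Z x (Suc j) i - (if j = 0 then 0 else saw n Z x (j - 1) i)"

lemma saw_0: "i < n \<Longrightarrow> saw n Z x 0 i = x i"
proof -
  assume "i < n"
  then have "{p \<in> saw_paths n (Suc 0). hd p = i} = {[i]}"
    by (auto simp: saw_paths_def length_Suc_conv)
  then show ?thesis by (simp add: saw_def)
qed

lemma mv_saw_split:
  assumes i: "i < n" and Z: "Z i i = 0"
  shows "mv n Z (saw n Z x j) i = saw n Z x (Suc j) i +
    (\<Sum>r\<in>{1..<Suc j}. \<Sum>p\<in>{p \<in> saw_paths n (Suc j). p ! r = i}. Z i (hd p) * (walk_weight Z p * x (last p)))"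
proof -
  let ?F = "\<lambda>p. Z i (hd p) * (walk_weight Z p * x (last p))"
  have "mv n Z (saw n Z x j) i = saw n Z x (Suc j) i +
      (\<Sum>r<Suc j. \<Sum>p\<in>{p \<in> saw_paths n (Suc j). p ! r = i}. ?F p)"
    unfolding mv_saw[OF i] sum_split_by_position[of ?F n "Suc j" i] sum_avoiding_paths[OF i] ..
  also have "(\<Sum>r<Suc j. \<Sum>p\<in>{p \<in> saw_paths n (Suc j). p ! r = i}. ?F p) =
      (\<Sum>p\<in>{p \<in> saw_paths n (Suc j). p ! 0 = i}. ?F p) +
      (\<Sum>r\<in>{1..<Suc j}. \<Sum>p\<in>{p \<in> saw_paths n (Suc j). p ! r = i}. ?F p)"
    unfolding lessThan_atLeast0 by (subst sum.atLeast_Suc_lessThan) auto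
  also have "(\<Sum>p\<in>{p \<in> saw_paths n (Suc j). p ! 0 = i}. ?F p) = 0"
  proof (intro sum.neutral ballI)
    fix p assume "p \<in> {p \<in> saw_paths n (Suc j). p ! 0 = i}"
    then have "hd p = i" by (cases p) (auto simp: saw_paths_def)
    then show "?F p = 0" using Z by simp
  qed
  finally show ?thesis by simp
qed

context centred_noise
begin

lemma saw_residual_0: "i < n \<Longrightarrow> saw_residual n (edge_mat g w) x 0 i = 0"
  by (simp add: saw_residual_def mv_saw_split edge_mat_def)

text \<open>The mean of the backtracked square produces \<open>s_k\<close>, up to the fraction (k +
  1)/n of vertices that the first step must avoid. What remains are centred squares and loops, both
  small in second moment.\<close>

lemma saw_residual_Suc:
  fixes k
  defines "m \<equiv> Suc (Suc k)"
  assumes i: "i < n"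
  shows "saw_residual n (edge_mat g w) x (Suc k) i = backtrack_term x m i w +
    (\<Sum>r\<in>{2..<m}. loop_term x m r i w) - real (Suc k) / real n * saw n (edge_mat g w) x k i"
proof -
  let ?Z = "edge_mat g w"
  let ?F = "\<lambda>p. ?Z i (hd p) * (walk_weight ?Z p * x (last p))"
  let ?S = "\<lambda>r. {p \<in> saw_paths n m. p ! r = i}"
  have m1: "1 < m" by (simp add: m_def)
  have "?Z i i = 0" by (simp add: edge_mat_def)
  then have "mv n ?Z (saw n ?Z x (Suc k)) i - saw n ?Z x (Suc (Suc k)) i = (\<Sum>r\<in>{1..<m}. \<Sum>p\<in>?S r. ?F p)"
    using mv_saw_split[where Z = ?Z and i = i and n = n and x = x and j = "Suc k", OF i]
    unfolding m_def by linarith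
  also have "\<dots> = (\<Sum>p\<in>?S 1. ?F p) + (\<Sum>r\<in>{2..<m}. \<Sum>p\<in>?S r. ?F p)"
    using sum.atLeast_Suc_lessThan[OF m1, of "\<lambda>r. \<Sum>p\<in>?S r. ?F p"] by (simp add: numeral_2_eq_2)
  also have "(\<Sum>r\<in>{2..<m}. \<Sum>p\<in>?S r. ?F p) = (\<Sum>r\<in>{2..<m}. loop_term x m r i w)"
    unfolding loop_term_def
  proof (intro sum.cong refl)
    fix r p assume r: "r \<in> {2..<m}" and p: "p \<in> ?S r"
    then have pp: "distinct p" "length p = m" "p ! r = i" by (auto simp: saw_paths_def)
    have hd: "hd p = p ! 0" using pp(2) by (cases p) (auto simp: m_def)
    have "i \<noteq> hd p" unfolding hd pp(3)[symmetric]
      using pp r by (subst nth_eq_iff_index_eq) (auto simp: m_def)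
    then show "?F p = x (last p) * (\<Prod>e\<in>insert (edge (p ! r) (hd p)) (path_edges p). g (w e))"
      using closing_edge_not_in_path[OF pp(1), of r] r pp
      by (simp add: walk_weight_edge_mat edge_mat_def)
  qed
  also have "(\<Sum>p\<in>?S 1. ?F p) = (\<Sum>p\<in>?S 1. x (last p) *
      (\<Prod>e\<in>path_edges p. (if e = edge (p ! 0) (p ! 1) then \<lambda>y. (g y)\<^sup>2 - 1 / real n else g) (w e)) +
      1 / real n * (walk_weight ?Z (tl p) * x (last (tl p))))"
  proof (intro sum.cong refl)
    fix p assume p: "p \<in> ?S 1"
    then obtain u q where pu: "p = u # i # q" by (auto simp: saw_paths_def m_def length_Suc_conv)
    have d: "distinct p" using p by (simp add: saw_paths_def)
    have ne: "edge u i \<notin> path_edges (i # q)"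
      using d pu edge_in_path_edgesD[of u i "i # q"] by auto
    have "(\<Prod>e\<in>path_edges p. (if e = edge (p ! 0) (p ! 1) then \<lambda>y. (g y)\<^sup>2 - 1 / real n else g) (w e)) =
        ((g (w (edge u i)))\<^sup>2 - 1 / real n) *
        (\<Prod>e\<in>path_edges (i # q). (if e = edge u i then \<lambda>y. (g y)\<^sup>2 - 1 / real n else g) (w e))"
      using ne by (simp add: pu)
    also have "(\<Prod>e\<in>path_edges (i # q). (if e = edge u i then \<lambda>y. (g y)\<^sup>2 - 1 / real n else g) (w e)) =
        (\<Prod>e\<in>path_edges (i # q). g (w e))"
      using ne by (intro prod.cong refl) auto
    also have "\<dots> = walk_weight ?Z (i # q)"
      using d by (simp add: walk_weight_edge_mat pu)
    finally have Pr: "(\<Prod>e\<in>path_edges p. (if e = edge (p ! 0) (p ! 1) then \<lambda>y. (g y)\<^sup>2 - 1 / real n else g) (w e)) =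
        ((g (w (edge u i)))\<^sup>2 - 1 / real n) * walk_weight ?Z (i # q)" .
    have Zs: "?Z i u = g (w (edge u i))" "?Z u i = g (w (edge u i))"
      using d by (auto simp: edge_mat_def edge_commute pu)
    have ps: "hd p = u" "walk_weight ?Z p = ?Z u i * walk_weight ?Z (i # q)" "last p = last (i # q)" "tl p = i # q"
      by (simp_all add: pu)
    show "?F p = x (last p) *
      (\<Prod>e\<in>path_edges p. (if e = edge (p ! 0) (p ! 1) then \<lambda>y. (g y)\<^sup>2 - 1 / real n else g) (w e)) +
      1 / real n * (walk_weight ?Z (tl p) * x (last (tl p)))"
      unfolding Pr unfolding ps Zs by (simp only: power2_eq_square algebra_simps)
  qed
  also have "\<dots> = backtrack_term x m i w +
      1 / real n * (\<Sum>p\<in>?S 1. walk_weight ?Z (tl p) * x (last (tl p)))"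
    by (simp only: sum.distrib backtrack_term_def sum_distrib_left)
  also have "(\<Sum>p\<in>?S 1. walk_weight ?Z (tl p) * x (last (tl p))) = (real n - real (Suc k)) * saw n ?Z x k i"
    unfolding saw_def m_def by (rule sum_backtrack_mean)
  also have "1 / real n * ((real n - real (Suc k)) * saw n ?Z x k i) =
      saw n ?Z x k i - real (Suc k) / real n * saw n ?Z x k i"
    using n by (simp add: field_simps)
  finally show ?thesis by (simp add: saw_residual_def)
qed

text \<open>The majorant \<open>Y\<close> is Cauchy-Schwarz applied to the \<open>m\<close> pieces
  of the residual, so that integrability is inherited from the pieces.\<close>

lemma saw_residual_second_moment:
  fixes x k
  defines "m \<equiv> Suc (Suc k)"
  shows "\<exists>Y. integrable noise Y \<and>
    (\<forall>w. (\<Sum>i<n. (saw_residual n (edge_mat g w) x (Suc k) i)\<^sup>2) \<le> Y w) \<and>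
    (\<integral>w. Y w \<partial>noise) \<le> real m * real (m ^ m) * (\<kappa> + real m + (real m)\<^sup>2) * ip n x x / real n"
proof -
  have m1: "1 < m" by (simp add: m_def)
  define c where "c = real (Suc k) / real n"
  let ?s = "\<lambda>w i. saw n (edge_mat g w) x k i"
  define Y where "Y w = real m * ((\<Sum>i<n. (backtrack_term x m i w)\<^sup>2) +
     (\<Sum>r\<in>{2..<m}. \<Sum>i<n. (loop_term x m r i w)\<^sup>2) + c\<^sup>2 * (\<Sum>i<n. (?s w i)\<^sup>2))" for w
  note ints = backtrack_term_integrable[of x k, folded m_def] loop_term_integrable[of _ k x, folded m_def]
    saw_square_integrable[of x k]
  have intL: "integrable noise (\<lambda>w. \<Sum>r\<in>{2..<m}. \<Sum>i<n. (loop_term x m r i w)\<^sup>2)"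
    by (rule Bochner_Integration.integrable_sum) (use ints(2) in auto)
  have int: "integrable noise Y"
    unfolding Y_def using ints(1,3) intL by (intro integrable_mult_right Bochner_Integration.integrable_add) auto
  have pt: "(\<Sum>i<n. (saw_residual n (edge_mat g w) x (Suc k) i)\<^sup>2) \<le> Y w" for w
  proof -
    have "(saw_residual n (edge_mat g w) x (Suc k) i)\<^sup>2 \<le> real m * ((backtrack_term x m i w)\<^sup>2 +
       (\<Sum>r\<in>{2..<m}. (loop_term x m r i w)\<^sup>2) + c\<^sup>2 * (?s w i)\<^sup>2)" if i: "i < n" for i
    proof -
      \<comment> \<open>The pieces listed by position: index 0 is the counting defect, index 1 the
        centred square, the rest are loops.\<close>
      define f where "f r = (if r = 0 then - (c * ?s w i) else if r = 1 then backtrack_term x m i w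
        else loop_term x m r i w)" for r
      have split: "(\<Sum>r<m. h r) = h 0 + h 1 + (\<Sum>r\<in>{2..<m}. h r)" for h :: "nat \<Rightarrow> real"
        using sum.atLeast_Suc_lessThan[of 0 m h] sum.atLeast_Suc_lessThan[of 1 m h] m1
        by (simp add: numeral_2_eq_2 lessThan_atLeast0)
      have "saw_residual n (edge_mat g w) x (Suc k) i = (\<Sum>r<m. f r)"
        unfolding split saw_residual_Suc[OF i] by (simp add: f_def c_def m_def)
      then have "(saw_residual n (edge_mat g w) x (Suc k) i)\<^sup>2 \<le> (\<Sum>r<m. (f r)\<^sup>2) * real m"
        using sum_squared_le_sum_of_squares[of f "{..<m}"] by simp
      also have "(\<Sum>r<m. (f r)\<^sup>2) = (backtrack_term x m i w)\<^sup>2 +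
          (\<Sum>r\<in>{2..<m}. (loop_term x m r i w)\<^sup>2) + c\<^sup>2 * (?s w i)\<^sup>2"
        unfolding split by (simp add: f_def power_mult_distrib)
      finally show ?thesis by (simp add: mult.commute)
    qed
    then have "(\<Sum>i<n. (saw_residual n (edge_mat g w) x (Suc k) i)\<^sup>2) \<le>
      (\<Sum>i<n. real m * ((backtrack_term x m i w)\<^sup>2 +
       (\<Sum>r\<in>{2..<m}. (loop_term x m r i w)\<^sup>2) + c\<^sup>2 * (?s w i)\<^sup>2))"
      by (intro sum_mono) auto
    also have "\<dots> = real m * ((\<Sum>i<n. (backtrack_term x m i w)\<^sup>2) +
       (\<Sum>i<n. \<Sum>r\<in>{2..<m}. (loop_term x m r i w)\<^sup>2) + c\<^sup>2 * (\<Sum>i<n. (?s w i)\<^sup>2))"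
      by (simp only: sum_distrib_left[symmetric] sum.distrib)
    also have "(\<Sum>i<n. \<Sum>r\<in>{2..<m}. (loop_term x m r i w)\<^sup>2) = (\<Sum>r\<in>{2..<m}. \<Sum>i<n. (loop_term x m r i w)\<^sup>2)"
      by (rule sum.swap)
    finally show ?thesis by (simp only: Y_def)
  qed
  let ?A = "real (m ^ m) * ip n x x / real n"
  have "(\<integral>w. Y w \<partial>noise) = real m * ((\<integral>w. (\<Sum>i<n. (backtrack_term x m i w)\<^sup>2) \<partial>noise) +
     (\<Sum>r\<in>{2..<m}. \<integral>w. (\<Sum>i<n. (loop_term x m r i w)\<^sup>2) \<partial>noise) + c\<^sup>2 * (\<integral>w. (\<Sum>i<n. (?s w i)\<^sup>2) \<partial>noise))"
  proof -
    have "(\<integral>w. (\<Sum>r\<in>{2..<m}. \<Sum>i<n. (loop_term x m r i w)\<^sup>2) \<partial>noise) =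
        (\<Sum>r\<in>{2..<m}. \<integral>w. (\<Sum>i<n. (loop_term x m r i w)\<^sup>2) \<partial>noise)"
      by (rule Bochner_Integration.integral_sum) (use ints(2) in auto)
    then show ?thesis
      unfolding Y_def using ints(1,3) intL
      by (subst integral_mult_right_zero, subst Bochner_Integration.integral_add)
         (auto intro!: Bochner_Integration.integrable_add)
  qed
  also have "\<dots> \<le> real m * (\<kappa> * ?A + (\<Sum>r\<in>{2..<m}. ?A) + (real m)\<^sup>2 * ?A)"
  proof (intro mult_left_mono add_mono sum_mono)
    show "(\<integral>w. (\<Sum>i<n. (backtrack_term x m i w)\<^sup>2) \<partial>noise) \<le> \<kappa> * ?A"
      using backtrack_term_integral_le[of x k, folded m_def] by (simp add: mult_ac)
    show "(\<integral>w. (\<Sum>i<n. (loop_term x m r i w)\<^sup>2) \<partial>noise) \<le> ?A" if "r \<in> {2..<m}" for r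
      using loop_term_integral_le[of r k x, folded m_def] that by simp
    have ipx: "ip n x x = (\<Sum>i<n. (x i)\<^sup>2)" "0 \<le> ip n x x"
      by (simp_all add: ip_self_sum_squares sum_nonneg)
    have c2: "c\<^sup>2 \<le> (real m)\<^sup>2 / real n"
    proof -
      have "c\<^sup>2 = (real (Suc k))\<^sup>2 / (real n)\<^sup>2" by (simp add: c_def power_divide)
      also have "\<dots> \<le> (real m)\<^sup>2 / real n"
        using n by (intro frac_le power_mono) (auto simp: m_def power2_eq_square)
      finally show ?thesis .
    qed
    have "(Suc k) ^ (Suc k) \<le> m ^ m"
    proof -
      have "(Suc k) ^ (Suc k) \<le> m ^ (Suc k)" by (intro power_mono) (auto simp: m_def)
      also have "\<dots> \<le> m ^ m" by (intro power_increasing) (auto simp: m_def)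
      finally show ?thesis .
    qed
    then have "real ((Suc k) ^ (Suc k)) \<le> real (m ^ m)" by (simp only: of_nat_le_iff)
    then have "real ((Suc k) ^ (Suc k)) * ip n x x \<le> real (m ^ m) * ip n x x"
      using ipx(2) by (rule mult_right_mono)
    then have "(\<integral>w. (\<Sum>i<n. (?s w i)\<^sup>2) \<partial>noise) \<le> real (m ^ m) * ip n x x"
      using saw_square_integral_le[of x k] unfolding ipx(1) by (rule order_trans[rotated])
    then have "c\<^sup>2 * (\<integral>w. (\<Sum>i<n. (?s w i)\<^sup>2) \<partial>noise) \<le> (real m)\<^sup>2 / real n * (real (m ^ m) * ip n x x)"
      using c2 by (intro mult_mono) (auto intro!: sum_nonneg Bochner_Integration.integral_nonneg)
    then show "c\<^sup>2 * (\<integral>w. (\<Sum>i<n. (?s w i)\<^sup>2) \<partial>noise) \<le> (real m)\<^sup>2 * ?A" by simp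
  qed simp
  also have "\<dots> \<le> real m * (\<kappa> * ?A + real m * ?A + (real m)\<^sup>2 * ?A)"
  proof -
    have "0 \<le> ?A" using ip_self_nonneg[of n x] by simp
    then have S: "(\<Sum>r\<in>{2..<m}. ?A) \<le> real m * ?A"
      by (simp only: sum_constant card_atLeastLessThan) (intro mult_right_mono, auto)
    show ?thesis
      by (rule mult_left_mono[OF add_mono[OF add_mono[OF order_refl S] order_refl]]) simp
  qed
  also have "\<dots> = real m * real (m ^ m) * (\<kappa> + real m + (real m)\<^sup>2) * ip n x x / real n"
    by (simp add: algebra_simps add_divide_distrib)
  finally show ?thesis using int pt by blast
qed

end

text \<open>Squared norms may grow like n^(1/4), which Markov's inequality grants at once, while
  squared residuals have mean of order 1/n and so tolerate the factor n^(-1/4). The two thresholds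
  multiply to \<open>\<epsilon>\<^sup>2\<close> in Cauchy-Schwarz.\<close>

definition saw_good :: "nat \<Rightarrow> (nat \<Rightarrow> nat \<Rightarrow> real) \<Rightarrow> (nat \<Rightarrow> real) \<Rightarrow> nat \<Rightarrow> real \<Rightarrow> bool" where
  "saw_good n Z x N \<epsilon> \<longleftrightarrow> (\<forall>j\<le>N.
     ip n (saw n Z x j) (saw n Z x j) \<le> sqrt (sqrt (real n)) \<and>
     (1 \<le> j \<longrightarrow> \<bar>ip n (saw n Z x j) x\<bar> \<le> \<epsilon>) \<and>
     ip n (saw_residual n Z x j) (saw_residual n Z x j) \<le> \<epsilon>\<^sup>2 / sqrt (sqrt (real n)))"

lemma Markov_bad_set:
  assumes "integrable M f" "\<And>w. 0 \<le> f w" "0 < t" "(\<integral>w. f w \<partial>M) \<le> b"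
  shows "{w \<in> space M. t \<le> f w} \<in> sets M" "measure M {w \<in> space M. t \<le> f w} \<le> b / t"
proof -
  have [measurable]: "f \<in> borel_measurable M" using assms(1) by auto
  show "{w \<in> space M. t \<le> f w} \<in> sets M" by measurable
  have "measure M {w \<in> space M. t \<le> f w} \<le> (\<integral>w. f w \<partial>M) / t"
    by (rule integral_Markov_inequality_measure[of _ _ "{}"]) (use assms in auto)
  also have "\<dots> \<le> b / t" using assms by (intro divide_right_mono) auto
  finally show "measure M {w \<in> space M. t \<le> f w} \<le> b / t" .
qed

context centred_noise
begin

lemma saw_good_at:
  fixes N :: nat and M :: real
  assumes j: "j \<le> N" and x: "ip n x x \<le> 2" and \<epsilon>: "0 < \<epsilon>"
  defines "M \<equiv> real (Suc N)"
  defines "C \<equiv> M * M ^ Suc N * (1 + \<kappa> + M + M\<^sup>2)"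
  shows "\<exists>B\<in>sets noise. measure noise B \<le>
      C * (2 / sqrt (sqrt (real n)) + 4 / (real n * \<epsilon>\<^sup>2) + 2 * sqrt (sqrt (real n)) / (real n * \<epsilon>\<^sup>2)) \<and>
    (\<forall>w\<in>space noise - B.
       ip n (saw n (edge_mat g w) x j) (saw n (edge_mat g w) x j) \<le> sqrt (sqrt (real n)) \<and>
       (1 \<le> j \<longrightarrow> \<bar>ip n (saw n (edge_mat g w) x j) x\<bar> \<le> \<epsilon>) \<and>
       ip n (saw_residual n (edge_mat g w) x j) (saw_residual n (edge_mat g w) x j) \<le> \<epsilon>\<^sup>2 / sqrt (sqrt (real n)))"
proof -
  interpret N: prob_space noise by (rule noise_prob_space)
  let ?q = "sqrt (sqrt (real n))"
  have q: "0 < ?q" using n by simp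
  have M1: "1 \<le> M" by (simp add: M_def)
  have x0: "0 \<le> ip n x x" by (rule ip_self_nonneg)
  have x2: "(ip n x x)\<^sup>2 \<le> 4" using power_mono[OF x x0, of 2] by simp
  have pw: "real (m ^ m) \<le> M ^ Suc N" if "m \<le> Suc N" for m
  proof -
    have "real (m ^ m) \<le> M ^ m" using that by (simp add: M_def power_mono)
    also have "\<dots> \<le> M ^ Suc N" using that M1 by (intro power_increasing) auto
    finally show ?thesis .
  qed
  have MN: "1 \<le> M ^ Suc N" using M1 by (rule one_le_power)
  have CM: "M ^ Suc N \<le> C"
  proof -
    have "M ^ Suc N * 1 \<le> M ^ Suc N * (M * (1 + \<kappa> + M + M\<^sup>2))"
    proof (intro mult_left_mono)
      have "1 * 1 \<le> M * (1 + \<kappa> + M + M\<^sup>2)"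
        using M1 kappa_nonneg by (intro mult_mono) auto
      then show "1 \<le> M * (1 + \<kappa> + M + M\<^sup>2)" by simp
    qed (use MN in auto)
    then show ?thesis by (simp add: C_def algebra_simps)
  qed
  have C0: "0 \<le> C" using CM MN by linarith
  let ?s = "\<lambda>w j. saw n (edge_mat g w) x j"
  define f1 where "f1 w = (\<Sum>i<n. (?s w j i)\<^sup>2)" for w
  have f1: "integrable noise f1" "\<And>w. 0 \<le> f1 w" "(\<integral>w. f1 w \<partial>noise) \<le> C * 2"
  proof -
    show "integrable noise f1" unfolding f1_def by (rule saw_square_integrable)
    show "0 \<le> f1 w" for w by (simp add: f1_def sum_nonneg)
    have "(\<integral>w. f1 w \<partial>noise) \<le> real (Suc j ^ Suc j) * ip n x x"
      unfolding f1_def ip_self_sum_squares by (rule saw_square_integral_le)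
    also have "\<dots> \<le> C * 2" using pw[of "Suc j"] j CM C0 x x0 by (intro mult_mono) auto
    finally show "(\<integral>w. f1 w \<partial>noise) \<le> C * 2" .
  qed
  note B1 = Markov_bad_set[OF f1(1,2) q f1(3)]
  show ?thesis
  proof (cases j)
    case 0
    have r0: "ip n (saw_residual n (edge_mat g w) x j) (saw_residual n (edge_mat g w) x j) = 0" for w
      using saw_residual_0 0 by (simp add: ip_def)
    have "measure noise {w \<in> space noise. ?q \<le> f1 w} \<le>
        C * (2 / ?q + 4 / (real n * \<epsilon>\<^sup>2) + 2 * ?q / (real n * \<epsilon>\<^sup>2))"
    proof -
      have "C * (2 / ?q) \<le> C * (2 / ?q + 4 / (real n * \<epsilon>\<^sup>2) + 2 * ?q / (real n * \<epsilon>\<^sup>2))"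
        using C0 by (intro mult_left_mono) auto
      then show ?thesis using B1(2) by simp
    qed
    then show ?thesis
      using 0 B1(1) r0 q by (intro bexI[OF _ B1(1)]) (auto simp: f1_def ip_self_sum_squares not_le)
  next
    case (Suc k)
    let ?m = "Suc (Suc k)"
    define f2 where "f2 w = (ip n (?s w j) x)\<^sup>2" for w
    have f2: "integrable noise f2" "\<And>w. 0 \<le> f2 w" "(\<integral>w. f2 w \<partial>noise) \<le> C * 4 / real n"
    proof -
      show "integrable noise f2" unfolding f2_def Suc by (rule saw_overlap_integrable)
      show "0 \<le> f2 w" for w by (simp add: f2_def)
      have "(\<integral>w. f2 w \<partial>noise) \<le> real (?m ^ ?m) * (ip n x x)\<^sup>2 / real n"
        unfolding f2_def Suc by (rule saw_overlap_integral_le)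
      also have "\<dots> \<le> C * 4 / real n"
        using pw[of ?m] j Suc CM C0 x2 by (intro divide_right_mono mult_mono) auto
      finally show "(\<integral>w. f2 w \<partial>noise) \<le> C * 4 / real n" .
    qed
    have e2: "0 < \<epsilon>\<^sup>2" using \<epsilon> by simp
    note B2 = Markov_bad_set[OF f2(1,2) e2 f2(3)]
    obtain Y where Y: "integrable noise Y"
      "\<And>w. (\<Sum>i<n. (saw_residual n (edge_mat g w) x (Suc k) i)\<^sup>2) \<le> Y w"
      "(\<integral>w. Y w \<partial>noise) \<le> real ?m * real (?m ^ ?m) * (\<kappa> + real ?m + (real ?m)\<^sup>2) * ip n x x / real n"
      using saw_residual_second_moment[of x k] by blast
    have Y0: "0 \<le> Y w" for w
      using Y(2)[of w] by (meson order_trans sum_nonneg zero_le_power2)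
    have Y3: "(\<integral>w. Y w \<partial>noise) \<le> C * 2 / real n"
    proof -
      have mM: "real ?m \<le> M" using j Suc by (simp add: M_def)
      have "real ?m * real (?m ^ ?m) * (\<kappa> + real ?m + (real ?m)\<^sup>2) \<le> M * M ^ Suc N * (1 + \<kappa> + M + M\<^sup>2)"
        using mM M1 pw[of ?m] j Suc kappa_nonneg
        by (intro mult_mono add_mono power_mono mult_nonneg_nonneg add_nonneg_nonneg) auto
      then have "real ?m * real (?m ^ ?m) * (\<kappa> + real ?m + (real ?m)\<^sup>2) * ip n x x \<le> C * 2"
        unfolding C_def[symmetric] by (rule mult_mono[OF _ x C0 x0])
      then have "real ?m * real (?m ^ ?m) * (\<kappa> + real ?m + (real ?m)\<^sup>2) * ip n x x / real n \<le> C * 2 / real n"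
        by (intro divide_right_mono) auto
      then show ?thesis using Y(3) by linarith
    qed
    have e3: "0 < \<epsilon>\<^sup>2 / ?q" using e2 q by simp
    note B3 = Markov_bad_set[OF Y(1) Y0 e3 Y3]
    let ?B1 = "{w \<in> space noise. ?q \<le> f1 w}" and ?B2 = "{w \<in> space noise. \<epsilon>\<^sup>2 \<le> f2 w}"
      and ?B3 = "{w \<in> space noise. \<epsilon>\<^sup>2 / ?q \<le> Y w}"
    let ?B = "?B1 \<union> ?B2 \<union> ?B3"
    have "measure noise ?B \<le> measure noise ?B1 + measure noise ?B2 + measure noise ?B3"
      using measure_Un_le[OF sets.Un[OF B1(1) B2(1)] B3(1)] measure_Un_le[OF B1(1) B2(1)] by linarith
    also have "\<dots> \<le> C * 2 / ?q + C * 4 / real n / \<epsilon>\<^sup>2 + C * 2 / real n / (\<epsilon>\<^sup>2 / ?q)"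
      using B1(2) B2(2) B3(2) by linarith
    also have "\<dots> = C * (2 / ?q + 4 / (real n * \<epsilon>\<^sup>2) + 2 * ?q / (real n * \<epsilon>\<^sup>2))"
      by (simp add: algebra_simps)
    finally have meas: "measure noise ?B \<le> C * (2 / ?q + 4 / (real n * \<epsilon>\<^sup>2) + 2 * ?q / (real n * \<epsilon>\<^sup>2))" .
    show ?thesis
    proof (intro bexI[of _ ?B] conjI ballI impI meas)
      show "?B \<in> sets noise" using B1(1) B2(1) B3(1) by auto
      fix w assume w: "w \<in> space noise - ?B"
      then have lt: "f1 w < ?q" "f2 w < \<epsilon>\<^sup>2" "Y w < \<epsilon>\<^sup>2 / ?q" by (auto simp: not_le)
      show "ip n (?s w j) (?s w j) \<le> ?q" using lt(1) by (simp add: f1_def ip_self_sum_squares)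
      show "\<bar>ip n (?s w j) x\<bar> \<le> \<epsilon>"
        using abs_le_square_iff[of "ip n (?s w j) x" \<epsilon>] lt(2) \<epsilon> by (simp add: f2_def)
      show "ip n (saw_residual n (edge_mat g w) x j) (saw_residual n (edge_mat g w) x j) \<le> \<epsilon>\<^sup>2 / ?q"
        using lt(3) Y(2)[of w] by (simp add: ip_self_sum_squares Suc)
    qed
  qed
qed

lemma saw_good_event:
  fixes N :: nat and M :: real
  assumes x: "ip n x x \<le> 2" and \<epsilon>: "0 < \<epsilon>"
  defines "M \<equiv> real (Suc N)"
  defines "C \<equiv> M * M ^ Suc N * (1 + \<kappa> + M + M\<^sup>2)"
  shows "\<exists>B\<in>sets noise. measure noise B \<le>
      M * (C * (2 / sqrt (sqrt (real n)) + 4 / (real n * \<epsilon>\<^sup>2) + 2 * sqrt (sqrt (real n)) / (real n * \<epsilon>\<^sup>2))) \<and>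
    (\<forall>w\<in>space noise - B. saw_good n (edge_mat g w) x N \<epsilon>)"
proof -
  interpret N: prob_space noise by (rule noise_prob_space)
  let ?c = "C * (2 / sqrt (sqrt (real n)) + 4 / (real n * \<epsilon>\<^sup>2) + 2 * sqrt (sqrt (real n)) / (real n * \<epsilon>\<^sup>2))"
  let ?G = "\<lambda>w j. ip n (saw n (edge_mat g w) x j) (saw n (edge_mat g w) x j) \<le> sqrt (sqrt (real n)) \<and>
       (1 \<le> j \<longrightarrow> \<bar>ip n (saw n (edge_mat g w) x j) x\<bar> \<le> \<epsilon>) \<and>
       ip n (saw_residual n (edge_mat g w) x j) (saw_residual n (edge_mat g w) x j) \<le> \<epsilon>\<^sup>2 / sqrt (sqrt (real n))"
  have "\<forall>j\<in>{..N}. \<exists>B. B \<in> sets noise \<and> measure noise B \<le> ?c \<and> (\<forall>w\<in>space noise - B. ?G w j)"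
    using saw_good_at[OF _ x \<epsilon>, of _ N] unfolding M_def C_def by blast
  then have "\<exists>B. \<forall>j\<in>{..N}. B j \<in> sets noise \<and> measure noise (B j) \<le> ?c \<and> (\<forall>w\<in>space noise - B j. ?G w j)"
    by (rule bchoice)
  then obtain B where BB: "\<forall>j\<in>{..N}. B j \<in> sets noise \<and> measure noise (B j) \<le> ?c \<and> (\<forall>w\<in>space noise - B j. ?G w j)" ..
  have BJ: "B j \<in> sets noise \<and> measure noise (B j) \<le> ?c \<and> (\<forall>w\<in>space noise - B j. ?G w j)" if "j \<le> N" for j
    by (rule bspec[OF BB]) (simp add: that)
  have B: "B j \<in> sets noise" "measure noise (B j) \<le> ?c" if "j \<le> N" for j
    using BJ[OF that] by blast+
  have "measure noise (\<Union>j\<in>{..N}. B j) \<le> (\<Sum>j\<in>{..N}. measure noise (B j))"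
    using B(1) by (intro measure_UNION_le) auto
  also have "\<dots> \<le> (\<Sum>j\<in>{..N}. ?c)" using B(2) by (intro sum_mono) auto
  also have "\<dots> = M * ?c" by (simp add: M_def)
  finally have "measure noise (\<Union>j\<in>{..N}. B j) \<le> M * ?c" .
  moreover have "(\<Union>j\<in>{..N}. B j) \<in> sets noise" using B(1) by auto
  moreover have "saw_good n (edge_mat g w) x N \<epsilon>" if w: "w \<in> space noise - (\<Union>j\<in>{..N}. B j)" for w
    unfolding saw_good_def
  proof (intro allI impI)
    fix j assume j: "j \<le> N"
    with w have "w \<in> space noise - B j" by blast
    with BJ[OF j] show "?G w j" by blast
  qed
  ultimately show ?thesis by blast
qed

end

text \<open>The failure probability is bounded in terms of \<open>ip n x x <= 2\<close> alone, so
  one threshold for \<open>n\<close> serves all such spikes. Integration over the prior relies on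
  this order of quantifiers.\<close>

lemma eventually_saw_good:
  assumes P: "prob_space P" and Pd: "prob_space Pd"
    and \<phi>: "\<phi> \<in> borel_measurable P" "integrable P (\<lambda>y. \<phi> y ^ 4)" "(\<integral>y. \<phi> y \<partial>P) = 0" "(\<integral>y. (\<phi> y)\<^sup>2 \<partial>P) = 1"
    and \<epsilon>: "0 < \<epsilon>" and \<eta>: "0 < \<eta>"
  shows "\<forall>\<^sub>F n in sequentially. \<forall>x. ip n x x \<le> 2 \<longrightarrow>
    (\<exists>B\<in>sets (wigner_noise P Pd n). measure (wigner_noise P Pd n) B \<le> \<eta> \<and>
      (\<forall>w\<in>space (wigner_noise P Pd n) - B. saw_good n (edge_mat (\<lambda>y. \<phi> y / sqrt (real n)) w) x N \<epsilon>))"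
proof -
  define \<kappa> where "\<kappa> = (\<integral>y. \<phi> y ^ 4 \<partial>P)"
  define M where "M = real (Suc N)"
  define C where "C = M * M ^ Suc N * (1 + \<kappa> + M + M\<^sup>2)"
  let ?b = "\<lambda>n::nat. M * (C * (2 / sqrt (sqrt (real n)) + 4 / (real n * \<epsilon>\<^sup>2) + 2 * sqrt (sqrt (real n)) / (real n * \<epsilon>\<^sup>2)))"
  have l1: "(\<lambda>n::nat. 2 / sqrt (sqrt (real n))) \<longlonglongrightarrow> 0"
    "(\<lambda>n::nat. 4 / (real n * \<epsilon>\<^sup>2)) \<longlonglongrightarrow> 0"
    "(\<lambda>n::nat. 2 * sqrt (sqrt (real n)) / (real n * \<epsilon>\<^sup>2)) \<longlonglongrightarrow> 0"
    using \<epsilon> by real_asymp+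
  have "?b \<longlonglongrightarrow> M * (C * (0 + 0 + 0))"
    by (intro tendsto_intros l1)
  then have "?b \<longlonglongrightarrow> 0" by simp
  then have "\<forall>\<^sub>F n in sequentially. ?b n < \<eta>" using \<eta> by (rule order_tendstoD)
  moreover have "\<forall>\<^sub>F n in sequentially. 0 < n" by (rule eventually_gt_at_top)
  ultimately show ?thesis
  proof eventually_elim
    case (elim n)
    interpret centred_noise P Pd n "\<lambda>y. \<phi> y / sqrt (real n)" \<kappa>
    proof (rule centred_noise.intro[OF P Pd])
      show "0 < n" by fact
      show "(\<lambda>y. \<phi> y / sqrt (real n)) \<in> borel_measurable P" using \<phi>(1) by measurable
      have 4: "(\<phi> y / sqrt (real n)) ^ 4 = \<phi> y ^ 4 / (real n)\<^sup>2" for y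
      proof -
        have "sqrt (real n) ^ 4 = ((sqrt (real n))\<^sup>2)\<^sup>2" by (simp only: power_mult[symmetric]) simp
        also have "\<dots> = (real n)\<^sup>2" by simp
        finally show ?thesis by (simp only: power_divide)
      qed
      show "integrable P (\<lambda>y. (\<phi> y / sqrt (real n)) ^ 4)" unfolding 4 using \<phi>(2) by simp
      show "(\<integral>y. (\<phi> y / sqrt (real n)) ^ 4 \<partial>P) \<le> \<kappa> / (real n)\<^sup>2" unfolding 4 by (simp add: \<kappa>_def)
      show "(\<integral>y. \<phi> y / sqrt (real n) \<partial>P) = 0" using \<phi>(3) by simp
      show "(\<integral>y. (\<phi> y / sqrt (real n))\<^sup>2 \<partial>P) = 1 / real n" using \<phi>(4) by (simp add: power_divide)
    qed
    show ?case
    proof (intro allI impI)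
      fix x assume "ip n x x \<le> 2"
      from saw_good_event[OF this \<epsilon>, of N, folded M_def, folded C_def] elim(1)
      show "\<exists>B\<in>sets noise. measure noise B \<le> \<eta> \<and>
          (\<forall>w\<in>space noise - B. saw_good n (edge_mat (\<lambda>y. \<phi> y / sqrt (real n)) w) x N \<epsilon>)"
        by (meson less_imp_le order_trans)
    qed
  qed
qed

section \<open>The approximate Chebyshev recursion\<close>

text \<open>Deterministic interface between the moment bounds and the spectral estimates: up to
  \<open>d\<close>, the vectors \<open>s j\<close> are orthonormal and \<open>Z\<close> acts on them
  as the adjacency operator of a half-line, just as multiplication by z acts on the Chebyshev
  polynomials U_j(z/2).\<close>

definition cheb_approx ::
  "nat \<Rightarrow> (nat \<Rightarrow> nat \<Rightarrow> real) \<Rightarrow> (nat \<Rightarrow> real) \<Rightarrow> (nat \<Rightarrow> nat \<Rightarrow> real) \<Rightarrow> (nat \<Rightarrow> nat \<Rightarrow> real) \<Rightarrow> nat \<Rightarrow> real \<Rightarrow> bool" where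
  "cheb_approx n Z x s r K d \<longleftrightarrow>
     (\<forall>i<n. s 0 i = x i) \<and>
     (\<forall>j\<le>K. \<forall>i<n. mv n Z (s j) i = s (Suc j) i + (if j = 0 then 0 else s (j - 1) i) + r j i) \<and>
     (\<forall>j\<le>Suc K. \<forall>l\<le>Suc K. \<bar>ip n (s j) (s l) - of_bool (j = l)\<bar> \<le> d) \<and>
     (\<forall>j\<le>K. \<forall>l\<le>Suc K. \<bar>ip n (r j) (s l)\<bar> \<le> d) \<and>
     (\<forall>j\<le>K. ip n (r j) (r j) \<le> d\<^sup>2)"

text \<open>Among the mixed inner products, only those with \<open>x = s_0\<close> were controlled
  by moments. Moving \<open>Z\<close> across the inner product by symmetry expresses
  \<open><s_j, s_(l+1)>\<close> through inner products with second index at most \<open>l\<close>,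
  so the whole Gram matrix follows by recursion. The range \<open>2 * K + 2\<close> arises because
  the first index can climb to \<open>j + l\<close>.\<close>

lemma saw_good_imp_cheb_approx:
  assumes good: "saw_good n Z x (2 * K + 2) \<epsilon>" and x: "\<bar>ip n x x - 1\<bar> \<le> \<epsilon>"
    and n: "0 < n" and \<epsilon>: "0 < \<epsilon>" and sym: "\<And>i j. i < n \<Longrightarrow> j < n \<Longrightarrow> Z i j = Z j i"
  shows "cheb_approx n Z x (saw n Z x) (saw_residual n Z x) K (5 ^ (2 * K + 2) * \<epsilon>)"
proof -
  let ?s = "saw n Z x" and ?r = "saw_residual n Z x" and ?N = "2 * K + 2"
  let ?q = "sqrt (sqrt (real n))"
  have q: "1 \<le> ?q" using n by simp
  have s0: "?s 0 i = x i" if "i < n" for i using that by (rule saw_0)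
  have step: "mv n Z (?s j) i = ?s (Suc j) i + (if j = 0 then 0 else ?s (j - 1) i) + ?r j i" for i j
    by (simp add: saw_residual_def)
  have ss: "ip n (?s j) (?s j) \<le> ?q" and rr: "ip n (?r j) (?r j) \<le> \<epsilon>\<^sup>2 / ?q" if "j \<le> ?N" for j
    using good that unfolding saw_good_def by blast+
  have rs: "\<bar>ip n (?r j) (?s l)\<bar> \<le> \<epsilon>" if "j \<le> ?N" "l \<le> ?N" for j l
  proof -
    have "(ip n (?r j) (?s l))\<^sup>2 \<le> ip n (?r j) (?r j) * ip n (?s l) (?s l)" by (rule ip_Cauchy_Schwarz)
    also have "\<dots> \<le> \<epsilon>\<^sup>2 / ?q * ?q" using ss that rr q by (intro mult_mono ip_self_nonneg) auto
    also have "\<dots> = \<epsilon>\<^sup>2" using q by simp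
    finally show ?thesis using abs_le_square_iff[of "ip n (?r j) (?s l)" \<epsilon>] \<epsilon> by simp
  qed
  have rec: "\<bar>ip n (?s j) (?s (Suc l)) + (if l = 0 then 0 else ip n (?s j) (?s (l - 1)))
      - ip n (?s (Suc j)) (?s l) - (if j = 0 then 0 else ip n (?s (j - 1)) (?s l))\<bar> \<le> 2 * \<epsilon>"
    if "j \<le> ?N" "l \<le> ?N" for j l
  proof -
    have "ip n (?s j) (mv n Z (?s l)) =
        ip n (?s j) (?s (Suc l)) + (if l = 0 then 0 else ip n (?s j) (?s (l - 1))) + ip n (?s j) (?r l)"
      unfolding step by (cases "l = 0") (simp_all add: ip_linear)
    moreover have "ip n (mv n Z (?s j)) (?s l) =
        ip n (?s (Suc j)) (?s l) + (if j = 0 then 0 else ip n (?s (j - 1)) (?s l)) + ip n (?r j) (?s l)"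
      unfolding step by (cases "j = 0") (simp_all add: ip_linear)
    moreover have "ip n (?s j) (mv n Z (?s l)) = ip n (mv n Z (?s j)) (?s l)"
      using sym by (rule ip_mv_symmetric)
    moreover have "\<bar>ip n (?r j) (?s l)\<bar> \<le> \<epsilon>" "\<bar>ip n (?s j) (?r l)\<bar> \<le> \<epsilon>"
      using rs[OF that] rs[OF that(2,1)] by (simp_all add: ip_commute)
    ultimately show ?thesis by linarith
  qed
  \<comment> \<open>Lowering \<open>l\<close> may raise \<open>j\<close>, hence the induction on
    \<open>l\<close> for all \<open>j\<close> with \<open>j + l\<close> in range. The factor 5
    collects three neighbouring errors and the two residual terms.\<close>
  have g: "\<bar>ip n (?s j) (?s l) - of_bool (j = l)\<bar> \<le> 5 ^ l * \<epsilon>" if "j + l \<le> ?N" for j l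
    using that
  proof (induction l arbitrary: j rule: less_induct)
    case (less l)
    show ?case
    proof (cases l)
      case 0
      have "ip n (?s j) (?s 0) = ip n (?s j) x" by (rule ip_cong) (simp_all add: s0)
      moreover have "\<bar>ip n (?s j) x - of_bool (j = 0)\<bar> \<le> \<epsilon>"
      proof (cases "j = 0")
        case True
        have "ip n (?s 0) x = ip n x x" by (rule ip_cong) (simp_all add: s0)
        then show ?thesis using x True by simp
      next
        case False
        then show ?thesis using good less.prems unfolding saw_good_def by auto
      qed
      ultimately show ?thesis using 0 by simp
    next
      case (Suc k)
      have a: "\<bar>ip n (?s (Suc j)) (?s k) - of_bool (Suc j = k)\<bar> \<le> 5 ^ k * \<epsilon>"
        using less.IH[of k "Suc j"] less.prems Suc by simp
      have b: "\<bar>ip n (?s (j - 1)) (?s k) - of_bool (j - 1 = k)\<bar> \<le> 5 ^ k * \<epsilon>"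
        using less.IH[of k "j - 1"] less.prems Suc by simp
      have c: "\<bar>ip n (?s j) (?s (k - 1)) - of_bool (j = k - 1)\<bar> \<le> 5 ^ (k - 1) * \<epsilon>" if "k \<noteq> 0"
        using less.IH[of "k - 1" j] less.prems Suc that by simp
      have R: "\<bar>ip n (?s j) (?s (Suc k)) + (if k = 0 then 0 else ip n (?s j) (?s (k - 1)))
          - ip n (?s (Suc j)) (?s k) - (if j = 0 then 0 else ip n (?s (j - 1)) (?s k))\<bar> \<le> 2 * \<epsilon>"
        using rec[of j k] less.prems Suc by simp
      define B where "B = (if j = 0 then 0 else ip n (?s (j - 1)) (?s k) - of_bool (j - 1 = k))"
      define C where "C = (if k = 0 then 0 else ip n (?s j) (?s (k - 1)) - of_bool (j = k - 1))"
      \<comment> \<open>The Kronecker delta satisfies the recursion exactly, so only errors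
        propagate.\<close>
      have exact: "of_bool (j = Suc k) = (of_bool (Suc j = k) + (if j = 0 then 0 else of_bool (j - 1 = k))
          - (if k = 0 then 0 else of_bool (j = k - 1)) :: real)"
        by (cases j; cases k) auto
      have Bb: "\<bar>B\<bar> \<le> 5 ^ k * \<epsilon>" using b \<epsilon> by (simp add: B_def)
      have Cb: "2 * \<epsilon> + \<bar>C\<bar> \<le> 3 * (5 ^ k * \<epsilon>)"
      proof (cases "k = 0")
        case False
        have "5 ^ k * \<epsilon> = 5 * (5 ^ (k - 1) * \<epsilon>)"
          using False by (cases k) auto
        moreover have "\<epsilon> \<le> 5 ^ (k - 1) * \<epsilon>" using \<epsilon> one_le_power[of "5::real" "k - 1"] by simp
        moreover have "\<bar>C\<bar> \<le> 5 ^ (k - 1) * \<epsilon>" using c[OF False] False by (simp add: C_def)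
        ultimately show ?thesis using \<epsilon> by linarith
      qed (use \<epsilon> in \<open>simp add: C_def\<close>)
      have "ip n (?s j) (?s (Suc k)) - of_bool (j = Suc k)
          - (ip n (?s (Suc j)) (?s k) - of_bool (Suc j = k)) - B + C =
          ip n (?s j) (?s (Suc k)) + (if k = 0 then 0 else ip n (?s j) (?s (k - 1)))
          - ip n (?s (Suc j)) (?s k) - (if j = 0 then 0 else ip n (?s (j - 1)) (?s k))"
        unfolding exact B_def C_def by (cases "j = 0"; cases "k = 0") simp_all
      then have "\<bar>ip n (?s j) (?s (Suc k)) - of_bool (j = Suc k)
          - (ip n (?s (Suc j)) (?s k) - of_bool (Suc j = k)) - B + C\<bar> \<le> 2 * \<epsilon>"
        using R by simp
      then have "\<bar>ip n (?s j) (?s (Suc k)) - of_bool (j = Suc k)\<bar> \<le> 5 * (5 ^ k * \<epsilon>)"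
        using a Bb Cb by linarith
      then show ?thesis using Suc by simp
    qed
  qed
  have big: "5 ^ l * \<epsilon> \<le> 5 ^ ?N * \<epsilon>" if "l \<le> ?N" for l
    using \<epsilon> that by (intro mult_right_mono power_increasing) auto
  have e1: "\<epsilon> \<le> 5 ^ ?N * \<epsilon>" using big[of 0] by simp
  have rr': "ip n (?r j) (?r j) \<le> (5 ^ ?N * \<epsilon>)\<^sup>2" if "j \<le> K" for j
  proof -
    have "ip n (?r j) (?r j) \<le> \<epsilon>\<^sup>2 / ?q" using rr that by simp
    also have "\<dots> \<le> \<epsilon>\<^sup>2" using divide_left_mono[OF q, of "\<epsilon>\<^sup>2"] n by simp
    also have "\<dots> \<le> (5 ^ ?N * \<epsilon>)\<^sup>2" using e1 \<epsilon> by (intro power_mono) auto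
    finally show ?thesis .
  qed
  have g': "\<bar>ip n (?s j) (?s l) - of_bool (j = l)\<bar> \<le> 5 ^ ?N * \<epsilon>" if "j \<le> Suc K" "l \<le> Suc K" for j l
    using g[of j l] big[of l] that by linarith
  have rs': "\<bar>ip n (?r j) (?s l)\<bar> \<le> 5 ^ ?N * \<epsilon>" if "j \<le> K" "l \<le> Suc K" for j l
    using rs[of j l] e1 that by linarith
  show ?thesis unfolding cheb_approx_def
    using s0 step g' rs' rr' by (intro conjI allI impI)
qed

section \<open>Rayleigh quotients of combinations of the basis vectors\<close>

lemma bilinear_approx:
  fixes a b :: "nat \<Rightarrow> real"
  assumes "\<And>j l. j < K \<Longrightarrow> l < K \<Longrightarrow> \<bar>u j l - v j l\<bar> \<le> d"
  shows "\<bar>(\<Sum>j<K. \<Sum>l<K. a j * b l * u j l) - (\<Sum>j<K. \<Sum>l<K. a j * b l * v j l)\<bar>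
    \<le> (\<Sum>j<K. \<bar>a j\<bar>) * (\<Sum>l<K. \<bar>b l\<bar>) * d"
proof -
  have "(\<Sum>j<K. \<Sum>l<K. a j * b l * u j l) - (\<Sum>j<K. \<Sum>l<K. a j * b l * v j l) =
      (\<Sum>j<K. \<Sum>l<K. a j * b l * (u j l - v j l))"
    by (simp add: sum_subtractf right_diff_distrib)
  also have "\<bar>\<dots>\<bar> \<le> (\<Sum>j<K. \<bar>\<Sum>l<K. a j * b l * (u j l - v j l)\<bar>)" by (rule sum_abs)
  also have "\<dots> \<le> (\<Sum>j<K. \<Sum>l<K. \<bar>a j * b l * (u j l - v j l)\<bar>)" by (intro sum_mono sum_abs)
  also have "\<dots> \<le> (\<Sum>j<K. \<Sum>l<K. \<bar>a j\<bar> * \<bar>b l\<bar> * d)"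
    using assms by (intro sum_mono) (auto simp: abs_mult intro!: mult_left_mono)
  also have "\<dots> = (\<Sum>j<K. \<bar>a j\<bar>) * (\<Sum>l<K. \<bar>b l\<bar>) * d"
    by (simp only: sum_product) (simp only: sum_distrib_right)
  finally show ?thesis .
qed

lemma ip_combination:
  "ip n (\<lambda>i. \<Sum>j<K. a j * u j i) (\<lambda>i. \<Sum>l<K. b l * v l i) = (\<Sum>j<K. \<Sum>l<K. a j * b l * ip n (u j) (v l))"
  by (simp add: ip_linear sum_distrib_left mult_ac)

text \<open>In the nearly orthonormal family the form of \<open>Z\<close> is that of a path graph,
  so norm, form and overlap reduce to sums over the coefficients, with errors governed by their l1
  norm \<open>S\<close>.\<close>

lemma cheb_combination_estimates:
  fixes c :: "nat \<Rightarrow> real"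
  assumes ca: "cheb_approx n Z x s r K d"
  defines "y \<equiv> \<lambda>i. \<Sum>j<K. c j * s j i"
  defines "S \<equiv> \<Sum>j<K. \<bar>c j\<bar>"
  shows "\<bar>ip n y y - (\<Sum>j<K. (c j)\<^sup>2)\<bar> \<le> S\<^sup>2 * d"
    and "\<bar>qf n Z y - 2 * (\<Sum>j<K - 1. c j * c (Suc j))\<bar> \<le> 3 * (S\<^sup>2 * d)"
    and "0 < K \<Longrightarrow> \<bar>ip n y x - c 0\<bar> \<le> S * d"
proof -
  have g: "\<bar>ip n (s j) (s l) - of_bool (j = l)\<bar> \<le> d" if "j \<le> Suc K" "l \<le> Suc K" for j l
    using ca that unfolding cheb_approx_def by blast
  have diag: "(\<Sum>j<K. \<Sum>l<K. c j * c l * of_bool (j = l)) = (\<Sum>j<K. (c j)\<^sup>2)"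
  proof (rule sum.cong)
    fix j assume "j \<in> {..<K}"
    then have "(\<Sum>l<K. c j * c l * of_bool (j = l)) = (\<Sum>l\<in>{j}. c j * c l)"
      by (intro sum.mono_neutral_cong_right) auto
    then show "(\<Sum>l<K. c j * c l * of_bool (j = l)) = (c j)\<^sup>2" by (simp add: power2_eq_square)
  qed simp
  have "\<bar>(\<Sum>j<K. \<Sum>l<K. c j * c l * ip n (s j) (s l)) - (\<Sum>j<K. \<Sum>l<K. c j * c l * of_bool (j = l))\<bar>
      \<le> S * S * d"
    unfolding S_def using g by (intro bilinear_approx) auto
  then show "\<bar>ip n y y - (\<Sum>j<K. (c j)\<^sup>2)\<bar> \<le> S\<^sup>2 * d"
    unfolding y_def ip_combination diag by (simp add: power2_eq_square)
  \<comment> \<open>The adjacency matrix of the path graph; for \<open>l = 0\<close> there is one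
    neighbour only.\<close>
  let ?b = "\<lambda>j l. of_bool (j = Suc l) + (if l = 0 then 0 else of_bool (j = l - 1)) :: real"
  have mvs: "ip n (s j) (mv n Z (s l)) = ip n (s j) (s (Suc l)) + (if l = 0 then 0 else ip n (s j) (s (l - 1)))
      + ip n (s j) (r l)" if lK: "l \<le> K" for j l
  proof -
    have "ip n (s j) (mv n Z (s l)) =
        ip n (s j) (\<lambda>i. s (Suc l) i + (if l = 0 then 0 else s (l - 1) i) + r l i)"
      using ca lK unfolding cheb_approx_def by (intro ip_cong) auto
    also have "\<dots> = ip n (s j) (s (Suc l)) + (if l = 0 then 0 else ip n (s j) (s (l - 1))) + ip n (s j) (r l)"
      by (cases "l = 0") (simp_all add: ip_linear)
    finally show ?thesis .
  qed
  have app: "\<bar>ip n (s j) (mv n Z (s l)) - ?b j l\<bar> \<le> 3 * d" if "j < K" "l < K" for j l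
  proof -
    have 1: "\<bar>ip n (s j) (s (Suc l)) - of_bool (j = Suc l)\<bar> \<le> d" using g that by simp
    have 2: "\<bar>ip n (s j) (s (l - 1)) - of_bool (j = l - 1)\<bar> \<le> d" using g that by simp
    have 3: "\<bar>ip n (s j) (r l)\<bar> \<le> d"
      using ca that unfolding cheb_approx_def by (subst ip_commute) auto
    show ?thesis
    proof (cases "l = 0")
      case True
      then show ?thesis using 1 3 mvs[of l j] that by auto
    next
      case False
      then have "ip n (s j) (mv n Z (s l)) - ?b j l = (ip n (s j) (s (Suc l)) - of_bool (j = Suc l)) +
          (ip n (s j) (s (l - 1)) - of_bool (j = l - 1)) + ip n (s j) (r l)"
        using mvs[of l j] that by simp
      then show ?thesis using 1 2 3 by linarith
    qed
  qed
  have off: "(\<Sum>j<K. \<Sum>l<K. c j * c l * ?b j l) = 2 * (\<Sum>j<K - 1. c j * c (Suc j))"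
  proof -
    have A: "(\<Sum>j<K. \<Sum>l<K. c j * c l * of_bool (j = Suc l)) = (\<Sum>j<K - 1. c j * c (Suc j))"
    proof -
      have "(\<Sum>j<K. \<Sum>l<K. c j * c l * of_bool (j = Suc l)) = (\<Sum>l<K. \<Sum>j<K. c j * c l * of_bool (j = Suc l))"
        by (rule sum.swap)
      also have "\<dots> = (\<Sum>l<K. if l < K - 1 then c l * c (Suc l) else 0)"
      proof (rule sum.cong)
        fix l assume l: "l \<in> {..<K}"
        have "(\<Sum>j<K. c j * c l * of_bool (j = Suc l)) = (\<Sum>j\<in>{j. j = Suc l \<and> j < K}. c j * c l)"
          by (intro sum.mono_neutral_cong_right) auto
        also have "{j. j = Suc l \<and> j < K} = (if l < K - 1 then {Suc l} else {})" by auto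
        finally show "(\<Sum>j<K. c j * c l * of_bool (j = Suc l)) = (if l < K - 1 then c l * c (Suc l) else 0)"
          by (simp add: mult.commute)
      qed simp
      also have "\<dots> = (\<Sum>l<K - 1. c l * c (Suc l))"
        by (intro sum.mono_neutral_cong_right) auto
      finally show ?thesis .
    qed
    have B: "(\<Sum>j<K. \<Sum>l<K. c j * c l * (if l = 0 then 0 else of_bool (j = l - 1))) =
        (\<Sum>j<K. \<Sum>l<K. c j * c l * of_bool (j = Suc l))"
      by (subst sum.swap) (intro sum.cong refl, auto simp: of_bool_def)
    show ?thesis by (simp only: distrib_left sum.distrib B A mult_2)
  qed
  have "qf n Z y = (\<Sum>j<K. \<Sum>l<K. c j * c l * ip n (s j) (mv n Z (s l)))"
    unfolding qf_def y_def mv_sum mv_scale ip_combination ..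
  moreover have "\<bar>(\<Sum>j<K. \<Sum>l<K. c j * c l * ip n (s j) (mv n Z (s l))) - (\<Sum>j<K. \<Sum>l<K. c j * c l * ?b j l)\<bar>
      \<le> S * S * (3 * d)"
    unfolding S_def using app by (intro bilinear_approx) auto
  ultimately show "\<bar>qf n Z y - 2 * (\<Sum>j<K - 1. c j * c (Suc j))\<bar> \<le> 3 * (S\<^sup>2 * d)"
    unfolding off by (simp add: power2_eq_square mult_ac)
  show "\<bar>ip n y x - c 0\<bar> \<le> S * d" if K0: "0 < K"
  proof -
    have "ip n (s j) x = ip n (s j) (s 0)" for j
      using ca unfolding cheb_approx_def by (intro ip_cong) auto
    then have "ip n y x = (\<Sum>j<K. c j * ip n (s j) (s 0))" by (simp add: y_def ip_linear)
    moreover have "(\<Sum>j<K. c j * of_bool (j = 0)) = c 0"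
    proof -
      have "(\<Sum>j<K. c j * of_bool (j = 0)) = (\<Sum>j\<in>{0}. c j)"
        using K0 by (intro sum.mono_neutral_cong_right) auto
      then show ?thesis by simp
    qed
    ultimately have "ip n y x - c 0 = (\<Sum>j<K. c j * (ip n (s j) (s 0) - of_bool (j = 0)))"
      by (simp add: right_diff_distrib sum_subtractf)
    also have "\<bar>\<dots>\<bar> \<le> (\<Sum>j<K. \<bar>c j\<bar> * d)"
    proof (intro order_trans[OF sum_abs] sum_mono)
      fix j assume "j \<in> {..<K}"
      then have "\<bar>ip n (s j) (s 0) - of_bool (j = 0)\<bar> \<le> d" by (intro g) auto
      then show "\<bar>c j * (ip n (s j) (s 0) - of_bool (j = 0))\<bar> \<le> \<bar>c j\<bar> * d"
        unfolding abs_mult by (rule mult_left_mono) simp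
    qed
    also have "\<dots> = S * d" by (simp add: S_def sum_distrib_right)
    finally show ?thesis .
  qed
qed

text \<open>Constant coefficients have Rayleigh quotient 2 (K - 1) / K on the path graph, so
  \<open>K\<close> of order 1/\<eta> suffices; \<open>d0\<close> keeps the accumulated Gram error
  \<open>K\<^sup>2 * d\<close> at 1/5.\<close>

lemma edge_lower:
  assumes \<eta>: "0 < (\<eta>::real)"
  shows "\<exists>K d0. 0 < d0 \<and> (\<forall>n Z x s r d. cheb_approx n Z x s r K d \<longrightarrow> d \<le> d0 \<longrightarrow>
    (\<exists>v. (2 - \<eta>) * ip n v v < qf n Z v))"
proof -
  define K where "K = nat \<lceil>4 / \<eta>\<rceil> + 2"
  have K2: "2 \<le> K" by (simp add: K_def)
  have "4 / \<eta> \<le> real K" unfolding K_def by linarith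
  then have K\<eta>: "4 \<le> \<eta> * real K" using \<eta> by (simp add: field_simps)
  define d0 where "d0 = 1 / (5 * (real K)\<^sup>2)"
  have "0 < d0" using K2 by (simp add: d0_def)
  moreover have "\<exists>v. (2 - \<eta>) * ip n v v < qf n Z v"
    if ca: "cheb_approx n Z x s r K d" and d: "d \<le> d0" for n Z x s r d
  proof -
    define y where "y = (\<lambda>i. \<Sum>j<K. 1 * s j i)"
    have Kd: "(real K)\<^sup>2 * d \<le> 1 / 5"
    proof -
      have "(real K)\<^sup>2 * d \<le> (real K)\<^sup>2 * d0" using d by (intro mult_left_mono) auto
      then show ?thesis using K2 by (simp add: d0_def)
    qed
    have a: "\<bar>ip n y y - real K\<bar> \<le> (real K)\<^sup>2 * d"
      using cheb_combination_estimates(1)[OF ca, of "\<lambda>_. 1"] by (simp add: y_def)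
    have b: "\<bar>qf n Z y - 2 * (real K - 1)\<bar> \<le> 3 * ((real K)\<^sup>2 * d)"
      using cheb_combination_estimates(2)[OF ca, of "\<lambda>_. 1"] K2 by (simp add: y_def of_nat_diff)
    have "real K - 1 / 5 \<le> ip n y y" "ip n y y \<le> real K + 1 / 5" using a Kd by linarith+
    moreover have "2 * real K - 2 - 3 / 5 \<le> qf n Z y"
      using abs_le_D2[OF b] Kd by (simp add: right_diff_distrib)
    moreover have "\<eta> * (real K - 1 / 5) \<le> \<eta> * ip n y y" using calculation(1) \<eta> by (intro mult_left_mono) auto
    moreover have "\<eta> * (real K * (9 / 10)) \<le> \<eta> * (real K - 1 / 5)"
      using \<eta> K2 by (intro mult_left_mono) auto
    ultimately have "(2 - \<eta>) * ip n y y < qf n Z y" using K\<eta> unfolding left_diff_distrib by linarith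
    then show ?thesis by blast
  qed
  ultimately show ?thesis by blast
qed

text \<open>On a half-line with weight \<open>\<theta>\<close> added at its first vertex, the
  geometric sequence \<open>\<theta>^(-j)\<close> is the bound state, with eigenvalue
  \<open>\<theta> + 1 / \<theta>\<close>. Since \<open>\<theta> > 1\<close> it is square summable,
  and cutting it off costs only a power of \<open>m\<^sup>2\<close>.\<close>

lemma spike_lower:
  assumes \<theta>: "1 < (\<theta>::real)" and \<eta>: "0 < (\<eta>::real)"
  shows "\<exists>K d0. 0 < d0 \<and> (\<forall>n Z x s r d. cheb_approx n Z x s r K d \<longrightarrow> 0 \<le> d \<longrightarrow> d \<le> d0 \<longrightarrow>
    (\<exists>v. (\<theta> + 1 / \<theta> - \<eta>) * ip n v v < qf n Z v + \<theta> * (ip n v x)\<^sup>2))"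
proof -
  define m where "m = 1 / \<theta>"
  have m: "0 < m" "m < 1" "\<theta> * m = 1" using \<theta> by (simp_all add: m_def)
  define s0 where "s0 = 1 / (1 - m)"
  have s0: "0 < s0" using m by (simp add: s0_def)
  \<comment> \<open>The coefficient of \<open>d\<close> in all errors together, with
    \<open>s0\<close> bounding the l1 norm of the coefficients.\<close>
  define D where "D = 3 * s0\<^sup>2 + 2 * \<theta> * s0 + (\<theta> + m + \<eta>) * s0\<^sup>2"
  have D: "0 < D" using s0 \<theta> \<eta> m by (simp add: D_def add_pos_pos)
  obtain k where k: "(m\<^sup>2) ^ k < \<eta> / 8"
    using real_arch_pow_inv[of "\<eta> / 8" "m\<^sup>2"] \<eta> m by (auto simp: power_less_one_iff abs_square_less_1)
  define K where "K = Suc k"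
  define d0 where "d0 = \<eta> / (4 * D)"
  have "0 < d0" using D \<eta> by (simp add: d0_def)
  moreover have "\<exists>v. (\<theta> + 1 / \<theta> - \<eta>) * ip n v v < qf n Z v + \<theta> * (ip n v x)\<^sup>2"
    if ca: "cheb_approx n Z x s r K d" and d0: "0 \<le> d" and d: "d \<le> d0" for n Z x s r d
  proof -
    define c where "c j = m ^ j" for j :: nat
    define y where "y = (\<lambda>i. \<Sum>j<K. c j * s j i)"
    define S where "S = (\<Sum>j<K. \<bar>c j\<bar>)"
    define S2 where "S2 = (\<Sum>j<K. (m\<^sup>2) ^ j)"
    have S: "S = (1 - m ^ K) / (1 - m)"
      using m sum_gp_strict[of m K] by (simp add: S_def c_def)
    have S_le: "0 \<le> S" "S \<le> s0"
      using m by (simp_all add: S s0_def divide_right_mono power_le_one)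
    have S2c: "(\<Sum>j<K. (c j)\<^sup>2) = S2" by (simp add: S2_def c_def power_mult[symmetric] mult.commute)
    have S2m: "(1 - m\<^sup>2) * S2 = 1 - (m\<^sup>2) ^ K"
    proof -
      have "m\<^sup>2 \<noteq> 1" using m by (simp add: power2_eq_1_iff)
      then show ?thesis using sum_gp_strict[of "m\<^sup>2" K] by (simp add: S2_def)
    qed
    have S2_1: "1 \<le> S2"
    proof -
      have "(\<Sum>j\<in>{0}. (m\<^sup>2) ^ j) \<le> S2" unfolding S2_def
        using m by (intro sum_mono2) (auto simp: K_def)
      then show ?thesis by simp
    qed
    have a: "\<bar>ip n y y - S2\<bar> \<le> S\<^sup>2 * d"
      using cheb_combination_estimates(1)[OF ca, of c] unfolding S2c y_def S_def .
    have off: "(\<Sum>j<K - 1. c j * c (Suc j)) = m * S2 - m * (m\<^sup>2) ^ k"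
    proof -
      have "(\<Sum>j<K - 1. c j * c (Suc j)) = m * (\<Sum>j<k. (m\<^sup>2) ^ j)"
        unfolding sum_distrib_left
        by (simp add: c_def K_def power2_eq_square power_mult_distrib mult_ac)
      then show ?thesis by (simp add: S2_def K_def algebra_simps)
    qed
    have b: "\<bar>qf n Z y - 2 * (m * S2 - m * (m\<^sup>2) ^ k)\<bar> \<le> 3 * (S\<^sup>2 * d)"
      using cheb_combination_estimates(2)[OF ca, of c] unfolding off y_def S_def .
    have e: "\<bar>ip n y x - 1\<bar> \<le> S * d"
      using cheb_combination_estimates(3)[OF ca, of c] by (simp add: y_def S_def c_def K_def)
    have "(ip n y x)\<^sup>2 \<ge> 1 - 2 * (S * d)"
    proof -
      have "0 \<le> (ip n y x - 1)\<^sup>2" by simp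
      then have "2 * ip n y x - 1 \<le> (ip n y x)\<^sup>2" by (simp add: power2_diff)
      then show ?thesis using e by linarith
    qed
    then have i: "\<theta> * (1 - 2 * (S * d)) \<le> \<theta> * (ip n y x)\<^sup>2" using \<theta> by (intro mult_left_mono) auto
    have j: "(\<theta> + m - \<eta>) * ip n y y \<le> (\<theta> + m - \<eta>) * S2 + (\<theta> + m + \<eta>) * (S\<^sup>2 * d)"
    proof -
      have "(\<theta> + m - \<eta>) * (ip n y y - S2) \<le> \<bar>\<theta> + m - \<eta>\<bar> * \<bar>ip n y y - S2\<bar>"
        by (metis abs_ge_self abs_mult)
      also have "\<dots> \<le> (\<theta> + m + \<eta>) * (S\<^sup>2 * d)" using a \<theta> m \<eta> by (intro mult_mono) auto
      finally show ?thesis by (simp add: algebra_simps)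
    qed
    have l: "(\<theta> + m) * S2 = 2 * (m * S2) + \<theta> * (1 - (m\<^sup>2) ^ K)"
    proof -
      have "\<theta> * ((1 - m\<^sup>2) * S2) = \<theta> * S2 - (\<theta> * m) * (m * S2)"
        by (simp add: algebra_simps power2_eq_square)
      then have "\<theta> * (1 - (m\<^sup>2) ^ K) = \<theta> * S2 - m * S2" unfolding S2m m(3) by simp
      then show ?thesis unfolding distrib_right by linarith
    qed
    have D1: "3 * (S\<^sup>2 * d) + 2 * (\<theta> * (S * d)) + (\<theta> + m + \<eta>) * (S\<^sup>2 * d) \<le> \<eta> / 4"
    proof -
      have "S\<^sup>2 \<le> s0\<^sup>2" using S_le by (intro power_mono) auto
      then have "3 * S\<^sup>2 + 2 * \<theta> * S + (\<theta> + m + \<eta>) * S\<^sup>2 \<le> D"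
        unfolding D_def using S_le \<theta> m \<eta> by (intro add_mono mult_left_mono) auto
      then have "(3 * S\<^sup>2 + 2 * \<theta> * S + (\<theta> + m + \<eta>) * S\<^sup>2) * d \<le> D * d0"
        using d d0 D by (intro mult_mono) auto
      also have "D * d0 = \<eta> / 4" using D by (simp add: d0_def)
      finally show ?thesis by (simp add: algebra_simps)
    qed
    have "m * (m\<^sup>2) ^ k \<le> 1 * (m\<^sup>2) ^ k" using m by (intro mult_right_mono) auto
    then have k': "m * (m\<^sup>2) ^ k \<le> \<eta> / 8" using k by linarith
    have \<theta>K: "0 \<le> \<theta> * (m\<^sup>2) ^ K" using \<theta> by simp
    have \<eta>S: "\<eta> \<le> \<eta> * S2" using mult_left_mono[OF S2_1, of \<eta>] \<eta> by simp
    have "(\<theta> + m - \<eta>) * S2 = 2 * (m * S2) + \<theta> - \<theta> * (m\<^sup>2) ^ K - \<eta> * S2"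
      using l by (simp add: left_diff_distrib right_diff_distrib)
    moreover have "\<theta> - 2 * (\<theta> * (S * d)) \<le> \<theta> * (ip n y x)\<^sup>2"
      using i by (simp add: right_diff_distrib mult_ac)
    moreover have "2 * (m * S2) - 2 * (m * (m\<^sup>2) ^ k) - 3 * (S\<^sup>2 * d) \<le> qf n Z y"
      using abs_le_D2[OF b] by (simp add: right_diff_distrib)
    ultimately have "(\<theta> + m - \<eta>) * ip n y y < qf n Z y + \<theta> * (ip n y x)\<^sup>2"
      using j D1 k' \<theta>K \<eta>S \<eta> by linarith
    then show ?thesis unfolding m_def by blast
  qed
  ultimately show ?thesis by blast
qed

section \<open>Upper bound through the resolvent of \<open>Z\<close>\<close>

lemma square_le_of_nonneg_quadratic:
  fixes a b c :: real
  assumes q: "\<And>t. 0 \<le> a - 2 * t * b + t\<^sup>2 * c" and c: "0 \<le> c"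
  shows "b\<^sup>2 \<le> a * c"
proof (cases "c = 0")
  case True
  have "b = 0"
  proof (rule ccontr)
    assume "b \<noteq> 0"
    \<comment> \<open>At this argument the affine function takes the value -1.\<close>
    then show False using q[of "(a + 1) / (2 * b)"] True by simp
  qed
  then show ?thesis using True by simp
next
  case False
  then have c': "0 < c" using c by simp
  have "0 \<le> a - b\<^sup>2 / c" using q[of "b / c"] c' by (simp add: power2_eq_square field_simps)
  then show ?thesis using c' by (simp add: field_simps)
qed

text \<open>Young's inequality; a small \<open>t\<close> keeps the constant of the main term close
  to 1.\<close>

lemma sum_square_le_weighted:
  fixes p q t :: real
  assumes t: "0 < t"
  shows "(p + q)\<^sup>2 \<le> (1 + t) * p\<^sup>2 + (1 + 1 / t) * q\<^sup>2"
proof -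
  have "0 \<le> (t * p - q)\<^sup>2 / t" using t by simp
  also have "(t * p - q)\<^sup>2 / t = t * p\<^sup>2 - 2 * p * q + 1 / t * q\<^sup>2"
    using t by (simp add: power2_eq_square field_simps)
  finally show ?thesis by (simp add: power2_eq_square algebra_simps)
qed

text \<open>The weights \<open>c_j = m ^ Suc j\<close> solve
  \<open>c_(j-1) + c_(j+1) = (m + 1/m) c_j\<close>, with value 1 at index -1. Hence
  \<open>m + 1/m - Z\<close> applied to their combination telescopes to \<open>s 0\<close> and two
  boundary terms that decay geometrically.\<close>

lemma cheb_telescope:
  fixes s :: "nat \<Rightarrow> real"
  assumes m: "m \<noteq> 0"
  shows "s 0 + (\<Sum>j<Suc k. m ^ Suc j * (s (Suc j) + (if j = 0 then 0 else s (j - 1)))) -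
    (m + 1 / m) * (\<Sum>j<Suc k. m ^ Suc j * s j) = m ^ Suc k * s (Suc k) - m ^ Suc (Suc k) * s k"
proof (induction k)
  case 0
  then show ?case using m by (simp add: field_simps)
next
  case (Suc k)
  have "m ^ Suc (Suc k) * (s (Suc (Suc k)) + s k) - (m + 1 / m) * (m ^ Suc (Suc k) * s (Suc k)) +
      (m ^ Suc k * s (Suc k) - m ^ Suc (Suc k) * s k) =
      m ^ Suc (Suc k) * s (Suc (Suc k)) - m ^ Suc (Suc (Suc k)) * s (Suc k)"
    using m by (simp add: field_simps)
  then show ?case
    using Suc unfolding sum.lessThan_Suc[of _ "Suc k"] by (simp add: distrib_left)
qed

text \<open>\<open>y\<close> plays the role of \<open>B^-1 x\<close>, and \<open><x, y>\<close> is
  close to \<open>m\<close>, the Stieltjes transform of the semicircle law at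
  \<open>m + 1/m\<close>. The condition \<open>\<theta> * m < 1\<close> says that the spike is too
  weak to create an eigenvalue beyond \<open>m + 1/m\<close>.\<close>

lemma spike_upper:
  fixes \<theta> m b :: real
  assumes \<theta>: "0 \<le> \<theta>" and m: "0 < m" "m < 1" and \<theta>m: "\<theta> * m < 1" and b: "b < m + 1 / m"
  shows "\<exists>K d0. 0 < d0 \<and> (\<forall>n Z x s r d. (\<forall>i<n. \<forall>j<n. Z i j = Z j i) \<longrightarrow>
    cheb_approx n Z x s r K d \<longrightarrow> 0 \<le> d \<longrightarrow> d \<le> d0 \<longrightarrow> (\<forall>v. qf n Z v \<le> b * ip n v v) \<longrightarrow>
    (\<forall>w. qf n Z w + \<theta> * (ip n w x)\<^sup>2 \<le> (m + 1 / m) * ip n w w))"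
proof -
  define \<rho> where "\<rho> = m + 1 / m"
  define \<gamma> where "\<gamma> = \<rho> - b"
  have \<gamma>: "0 < \<gamma>" using b by (simp add: \<gamma>_def \<rho>_def)
  \<comment> \<open>Half of the slack in \<open>\<theta> * m < 1\<close>, so that
    \<open>(1 + t) * (\<theta> * m)\<close> is still below 1.\<close>
  define t where "t = (1 - \<theta> * m) / 2"
  have t: "0 < t" using \<theta>m by (simp add: t_def)
  \<comment> \<open>The error budget, obtained by solving \<open>e_final\<close> for
    \<open>e\<close>; the summand 1 keeps the denominator positive when
    \<open>\<theta> = 0\<close>.\<close>
  define e where "e = (1 - (1 + t) * (\<theta> * m)) / (\<theta> * (1 + t) + \<theta> * (1 + 1 / t) / \<gamma> + 1)"
  have den: "0 < \<theta> * (1 + t) + \<theta> * (1 + 1 / t) / \<gamma> + 1"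
    using \<theta> t \<gamma> by (intro add_nonneg_pos add_nonneg_nonneg) auto
  have num: "0 < 1 - (1 + t) * (\<theta> * m)"
  proof -
    have "t * (\<theta> * m) \<le> t" using t \<theta>m by (simp add: mult_left_le)
    then have "(1 + t) * (\<theta> * m) \<le> \<theta> * m + t" by (simp add: distrib_right)
    also have "\<dots> < 1" using \<theta>m by (simp add: t_def field_simps)
    finally show ?thesis by simp
  qed
  have e: "0 < e" using den num by (simp add: e_def)
  have e_final: "\<theta> * ((1 + t) * (m + e) + (1 + 1 / t) * (e / \<gamma>)) \<le> 1"
  proof -
    have "e * (\<theta> * (1 + t) + \<theta> * (1 + 1 / t) / \<gamma>) \<le> e * (\<theta> * (1 + t) + \<theta> * (1 + 1 / t) / \<gamma> + 1)"
      using e by (intro mult_left_mono) auto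
    also have "\<dots> = 1 - (1 + t) * (\<theta> * m)" using den by (simp add: e_def)
    finally have 1: "e * (\<theta> * (1 + t) + \<theta> * (1 + 1 / t) / \<gamma>) \<le> 1 - (1 + t) * (\<theta> * m)" .
    have "\<theta> * ((1 + t) * (m + e) + (1 + 1 / t) * (e / \<gamma>)) =
        (1 + t) * (\<theta> * m) + e * (\<theta> * (1 + t) + \<theta> * (1 + 1 / t) / \<gamma>)"
      by (simp add: algebra_simps add_divide_distrib)
    then show ?thesis using 1 by linarith
  qed
  define s1 where "s1 = 1 / (1 - m)"
  have s1: "0 < s1" using m by (simp add: s1_def)
  \<comment> \<open>Bound for the squared norm of the residual \<open>r'\<close>: the first entry
    serves its pairing with \<open>w\<close>, the second its pairing with \<open>y\<close>.\<close>
  define e1 where "e1 = min e (e\<^sup>2 / (8 * s1\<^sup>2))"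
  have e1: "0 < e1" "e1 \<le> e" "2 * s1\<^sup>2 * e1 \<le> (e / 2)\<^sup>2"
  proof -
    show "0 < e1" "e1 \<le> e" using e s1 by (simp_all add: e1_def)
    have "2 * s1\<^sup>2 * e1 \<le> 2 * s1\<^sup>2 * (e\<^sup>2 / (8 * s1\<^sup>2))" by (intro mult_left_mono) (auto simp: e1_def)
    also have "\<dots> = (e / 2)\<^sup>2" using s1 by (simp add: power_divide)
    finally show "2 * s1\<^sup>2 * e1 \<le> (e / 2)\<^sup>2" .
  qed
  \<comment> \<open>The boundary terms cost \<open>12 * (m\<^sup>2) ^ K\<close>, so the fraction
    1/24 spends half of \<open>e1\<close>; \<open>d0\<close> reserves the other half for the
    recurrence errors.\<close>
  obtain k where k: "(m\<^sup>2) ^ k < e1 / 24"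
    using real_arch_pow_inv[of "e1 / 24" "m\<^sup>2"] e1 m by (auto simp: power_less_one_iff abs_square_less_1)
  define K where "K = Suc k"
  have K: "(m\<^sup>2) ^ K \<le> e1 / 24" "0 < real K"
  proof -
    have "(m\<^sup>2) ^ K \<le> (m\<^sup>2) ^ k" using m unfolding K_def by (intro power_decreasing) (auto simp: power_le_one)
    then show "(m\<^sup>2) ^ K \<le> e1 / 24" using k by linarith
  qed (simp add: K_def)
  define d0 where "d0 = min 1 (min (e / (2 * s1)) (e1 / (6 * (real K)\<^sup>2)))"
  have "0 < d0" using e e1 s1 K by (simp add: d0_def)
  moreover have "qf n Z w + \<theta> * (ip n w x)\<^sup>2 \<le> (m + 1 / m) * ip n w w"
    if sym: "\<forall>i<n. \<forall>j<n. Z i j = Z j i" and ca: "cheb_approx n Z x s r K d"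
      and d0: "0 \<le> d" and d: "d \<le> d0" and Zb: "\<forall>v. qf n Z v \<le> b * ip n v v" for n Z x s r d w
  proof -
    have d1: "d \<le> 1" "s1 * d \<le> e / 2" "3 * (real K)\<^sup>2 * d\<^sup>2 \<le> e1 / 2"
    proof -
      show 1: "d \<le> 1" using d by (simp add: d0_def)
      have "d \<le> e / (2 * s1)" using d by (simp add: d0_def)
      then show "s1 * d \<le> e / 2" using s1 by (simp add: field_simps)
      have "d\<^sup>2 \<le> d" using 1 d0 by (simp add: power2_eq_square mult_left_le)
      also have "d \<le> e1 / (6 * (real K)\<^sup>2)" using d by (simp add: d0_def)
      finally have "3 * (real K)\<^sup>2 * d\<^sup>2 \<le> 3 * (real K)\<^sup>2 * (e1 / (6 * (real K)\<^sup>2))"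
        by (intro mult_left_mono) auto
      then show "3 * (real K)\<^sup>2 * d\<^sup>2 \<le> e1 / 2" using K by simp
    qed
    define c where "c j = m ^ Suc j" for j
    define y where "y = (\<lambda>i. \<Sum>j<K. c j * s j i)"
    define S where "S = (\<Sum>j<K. \<bar>c j\<bar>)"
    have S: "0 \<le> S" "S \<le> s1"
    proof -
      have "S = m * (\<Sum>j<K. m ^ j)" using m by (simp add: S_def c_def sum_distrib_left)
      also have "\<dots> = m * ((1 - m ^ K) / (1 - m))" using m sum_gp_strict[of m K] by simp
      also have "\<dots> \<le> 1 * (1 / (1 - m))"
        using m by (intro mult_mono divide_right_mono) (auto simp: power_le_one)
      finally show "S \<le> s1" by (simp add: s1_def)
    qed (simp add: S_def sum_nonneg)
    have S2: "S\<^sup>2 \<le> s1\<^sup>2" using S by (intro power_mono) auto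
    have yy: "ip n y y \<le> 2 * s1\<^sup>2"
    proof -
      have "(\<Sum>j<K. (c j)\<^sup>2) \<le> S\<^sup>2"
        using L2_set_le_sum_abs[of c "{..<K}"] unfolding L2_set_def S_def by (rule sqrt_le_D)
      moreover have "\<bar>ip n y y - (\<Sum>j<K. (c j)\<^sup>2)\<bar> \<le> S\<^sup>2 * d"
        using cheb_combination_estimates(1)[OF ca, of c] unfolding y_def S_def .
      moreover have "S\<^sup>2 * d \<le> S\<^sup>2 * 1" using d1 by (intro mult_left_mono) auto
      ultimately show ?thesis using S2 by linarith
    qed
    have yx: "ip n y x \<le> m + e / 2"
    proof -
      have "\<bar>ip n y x - c 0\<bar> \<le> S * d"
        using cheb_combination_estimates(3)[OF ca, of c] K unfolding y_def S_def by simp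
      moreover have "S * d \<le> s1 * d" using S d0 by (intro mult_right_mono) auto
      ultimately show ?thesis using d1(2) by (simp add: c_def)
    qed
    define r' where "r' = (\<lambda>i. x i - (\<rho> * y i - mv n Z y i))"
    have r': "r' i = m ^ K * s K i - m ^ Suc K * s k i + (\<Sum>j<K. c j * r j i)" if i: "i < n" for i
    proof -
      have "mv n Z y i = (\<Sum>j<K. c j * mv n Z (s j) i)" unfolding y_def mv_sum mv_scale ..
      also have "\<dots> = (\<Sum>j<K. c j * (s (Suc j) i + (if j = 0 then 0 else s (j - 1) i)) + c j * r j i)"
      proof (rule sum.cong)
        fix j assume "j \<in> {..<K}"
        then have "mv n Z (s j) i = s (Suc j) i + (if j = 0 then 0 else s (j - 1) i) + r j i"
          using ca i unfolding cheb_approx_def by auto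
        then show "c j * mv n Z (s j) i = c j * (s (Suc j) i + (if j = 0 then 0 else s (j - 1) i)) + c j * r j i"
          by (simp only: distrib_left)
      qed simp
      also have "\<dots> = (\<Sum>j<K. c j * (s (Suc j) i + (if j = 0 then 0 else s (j - 1) i))) + (\<Sum>j<K. c j * r j i)"
        by (rule sum.distrib)
      finally have mvy: "mv n Z y i = \<dots>" .
      have "s 0 i = x i" using ca i unfolding cheb_approx_def by blast
      moreover have "s 0 i + (\<Sum>j<K. c j * (s (Suc j) i + (if j = 0 then 0 else s (j - 1) i))) - \<rho> * y i
          = m ^ K * s K i - m ^ Suc K * s k i"
        unfolding y_def c_def \<rho>_def K_def using cheb_telescope[of m "\<lambda>j. s j i" k] m by simp
      ultimately show ?thesis unfolding r'_def mvy by linarith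
    qed
    have rr: "ip n r' r' \<le> e1"
    proof -
      have g: "ip n (s j) (s j) \<le> 2" if "j \<le> K" for j
      proof -
        have "j \<le> Suc K" using that by simp
        then have "\<bar>ip n (s j) (s j) - of_bool (j = j)\<bar> \<le> d"
          using ca unfolding cheb_approx_def by blast
        then show ?thesis using d1(1) by simp
      qed
      define R where "R i = (\<Sum>j<K. c j * r j i)" for i
      have "ip n r' r' = (\<Sum>i<n. (m ^ K * s K i + (- (m ^ Suc K * s k i)) + R i)\<^sup>2)"
        unfolding ip_self_sum_squares using r' by (intro sum.cong refl) (simp add: R_def)
      also have "\<dots> \<le> (\<Sum>i<n. 3 * ((m\<^sup>2) ^ K * (s K i)\<^sup>2 + (m\<^sup>2) ^ K * (s k i)\<^sup>2 + (R i)\<^sup>2))"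
      proof (rule sum_mono)
        fix i
        have three: "(p + q + u)\<^sup>2 \<le> 3 * (p\<^sup>2 + q\<^sup>2 + u\<^sup>2)" for p q u :: real
        proof -
          have "0 \<le> (p - q)\<^sup>2 + (q - u)\<^sup>2 + (p - u)\<^sup>2" by simp
          then show ?thesis by (simp add: power2_eq_square algebra_simps)
        qed
        have "(m ^ Suc K)\<^sup>2 \<le> (m\<^sup>2) ^ K"
        proof -
          have "(m ^ Suc K)\<^sup>2 = (m\<^sup>2) ^ Suc K" by (simp only: power_mult[symmetric] mult.commute)
          also have "\<dots> \<le> (m\<^sup>2) ^ K" using m by (intro power_decreasing) (auto simp: power_le_one)
          finally show ?thesis .
        qed
        then have "(m ^ Suc K * s k i)\<^sup>2 \<le> (m\<^sup>2) ^ K * (s k i)\<^sup>2"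
          unfolding power_mult_distrib[of "m ^ Suc K"] by (rule mult_right_mono) simp
        moreover have "(m ^ K * s K i)\<^sup>2 = (m\<^sup>2) ^ K * (s K i)\<^sup>2"
          unfolding power_mult_distrib by (simp only: power_mult[symmetric] mult.commute)
        ultimately show "(m ^ K * s K i + (- (m ^ Suc K * s k i)) + R i)\<^sup>2 \<le>
            3 * ((m\<^sup>2) ^ K * (s K i)\<^sup>2 + (m\<^sup>2) ^ K * (s k i)\<^sup>2 + (R i)\<^sup>2)"
          using three[of "m ^ K * s K i" "- (m ^ Suc K * s k i)" "R i"] unfolding power2_minus
          by (elim order_trans) (simp only: mult_le_cancel_left_pos zero_less_numeral add_le_cancel_right add_le_cancel_left)
      qed
      also have "\<dots> = 3 * ((m\<^sup>2) ^ K * ip n (s K) (s K) + (m\<^sup>2) ^ K * ip n (s k) (s k) + (\<Sum>i<n. (R i)\<^sup>2))"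
        by (simp only: ip_self_sum_squares sum_distrib_left[symmetric] sum.distrib)
      also have "\<dots> \<le> 3 * ((m\<^sup>2) ^ K * 2 + (m\<^sup>2) ^ K * 2 + (real K)\<^sup>2 * d\<^sup>2)"
      proof (intro mult_left_mono add_mono)
        show "ip n (s K) (s K) \<le> 2" "ip n (s k) (s k) \<le> 2" using g by (auto simp: K_def)
        have c1: "(c j)\<^sup>2 \<le> 1" for j
        proof (rule power_le_one)
          show "0 \<le> c j" unfolding c_def using m by simp
          show "c j \<le> 1" unfolding c_def using m by (intro power_le_one) auto
        qed
        have "(\<Sum>i<n. (R i)\<^sup>2) \<le> (\<Sum>i<n. (\<Sum>j<K. (r j i)\<^sup>2) * real K)"
        proof (rule sum_mono)
          fix i
          have "(R i)\<^sup>2 \<le> (\<Sum>j<K. (c j * r j i)\<^sup>2) * real K"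
            unfolding R_def using sum_squared_le_sum_of_squares[of "\<lambda>j. c j * r j i" "{..<K}"] by simp
          also have "\<dots> \<le> (\<Sum>j<K. (r j i)\<^sup>2) * real K"
            using c1 unfolding power_mult_distrib by (intro mult_right_mono sum_mono mult_left_le_one_le) auto
          finally show "(R i)\<^sup>2 \<le> (\<Sum>j<K. (r j i)\<^sup>2) * real K" .
        qed
        also have "\<dots> = (\<Sum>j<K. ip n (r j) (r j)) * real K"
          unfolding ip_self_sum_squares sum_distrib_right[symmetric] by (subst sum.swap) simp
        also have "\<dots> \<le> (\<Sum>j<K. d\<^sup>2) * real K"
          using ca unfolding cheb_approx_def by (intro mult_right_mono sum_mono) auto
        also have "\<dots> = (real K)\<^sup>2 * d\<^sup>2" by (simp add: power2_eq_square)
        finally show "(\<Sum>i<n. (R i)\<^sup>2) \<le> (real K)\<^sup>2 * d\<^sup>2" .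
      qed (use m in auto)
      also have "\<dots> = 12 * (m\<^sup>2) ^ K + 3 * (real K)\<^sup>2 * d\<^sup>2" by simp
      also have "\<dots> \<le> e1" using K(1) d1(3) by linarith
      finally show ?thesis .
    qed
    define QB where "QB u = \<rho> * ip n u u - qf n Z u" for u
    have QBg: "\<gamma> * ip n u u \<le> QB u" for u
      using Zb[rule_format, of u] by (simp add: QB_def \<gamma>_def left_diff_distrib)
    have QB0: "0 \<le> QB u" for u
      using QBg[of u] mult_nonneg_nonneg[of \<gamma> "ip n u u"] \<gamma> ip_self_nonneg[of n u] by linarith
    \<comment> \<open>The bilinear form of \<open>\<rho> - Z\<close> at \<open>w\<close> and
      \<open>y\<close>. As \<open>(\<rho> - Z) y\<close> is \<open>x\<close> up to
      \<open>r'\<close>, it nearly equals \<open><w, x>\<close>.\<close>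
    define B where "B = \<rho> * ip n w y - ip n w (mv n Z y)"
    have "0 \<le> QB w - 2 * u * B + u\<^sup>2 * QB y" for u
    proof -
      have "ip n y (mv n Z w) = ip n w (mv n Z y)"
        using ip_mv_symmetric[of n Z y w] sym by (simp add: ip_commute)
      then have "QB (\<lambda>i. w i - u * y i) = QB w - 2 * u * B + u\<^sup>2 * QB y"
        by (simp add: QB_def B_def qf_def ip_linear mv_diff mv_scale ip_commute[of n y w])
           (simp add: algebra_simps power2_eq_square)
      then show ?thesis using QB0[of "\<lambda>i. w i - u * y i"] by simp
    qed
    then have Bsq: "B\<^sup>2 \<le> QB w * QB y" using QB0 by (rule square_le_of_nonneg_quadratic)
    have QBy: "QB y \<le> m + e"
    proof -
      have "QB y = ip n y (\<lambda>i. \<rho> * y i - mv n Z y i)" by (simp add: QB_def qf_def ip_linear)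
      also have "\<dots> = ip n y (\<lambda>i. x i - r' i)" by (simp add: r'_def)
      also have "\<dots> = ip n y x - ip n y r'" by (simp add: ip_linear)
      finally have 1: "QB y = ip n y x - ip n y r'" .
      have "(ip n y r')\<^sup>2 \<le> ip n y y * ip n r' r'" by (rule ip_Cauchy_Schwarz)
      also have "\<dots> \<le> 2 * s1\<^sup>2 * e1" using yy rr by (intro mult_mono ip_self_nonneg) auto
      also have "\<dots> \<le> (e / 2)\<^sup>2" by (rule e1(3))
      finally have "\<bar>ip n y r'\<bar> \<le> e / 2" using abs_le_square_iff[of "ip n y r'" "e / 2"] e by simp
      then show ?thesis using 1 yx by linarith
    qed
    have "ip n w x = ip n w (\<lambda>i. (\<rho> * y i - mv n Z y i) + r' i)" by (simp add: r'_def)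
    also have "\<dots> = B + ip n w r'" by (simp add: B_def ip_linear)
    finally have wx: "ip n w x = B + ip n w r'" .
    have q: "(ip n w r')\<^sup>2 \<le> QB w * (e / \<gamma>)"
    proof -
      have "ip n w w \<le> QB w / \<gamma>" using QBg[of w] \<gamma> by (simp add: field_simps)
      then have "ip n w w * ip n r' r' \<le> QB w / \<gamma> * e"
        using rr e1(2) \<gamma> QB0[of w] by (intro mult_mono ip_self_nonneg) auto
      then show ?thesis using ip_Cauchy_Schwarz[of n w r'] by simp
    qed
    have "(ip n w x)\<^sup>2 \<le> (1 + t) * B\<^sup>2 + (1 + 1 / t) * (ip n w r')\<^sup>2"
      unfolding wx by (rule sum_square_le_weighted[OF t])
    also have "\<dots> \<le> (1 + t) * (QB w * (m + e)) + (1 + 1 / t) * (QB w * (e / \<gamma>))"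
      using q t order_trans[OF Bsq mult_left_mono[OF QBy QB0[of w]]]
      by (intro add_mono mult_left_mono) auto
    also have "\<dots> = QB w * ((1 + t) * (m + e) + (1 + 1 / t) * (e / \<gamma>))" by (simp only: distrib_left mult_ac)
    finally have "\<theta> * (ip n w x)\<^sup>2 \<le> \<theta> * (QB w * ((1 + t) * (m + e) + (1 + 1 / t) * (e / \<gamma>)))"
      using \<theta> by (rule mult_left_mono)
    also have "\<dots> = QB w * (\<theta> * ((1 + t) * (m + e) + (1 + 1 / t) * (e / \<gamma>)))" by (simp only: mult_ac)
    also have "\<dots> \<le> QB w * 1" using e_final QB0 by (rule mult_left_mono)
    finally show ?thesis by (simp add: QB_def \<rho>_def)
  qed
  ultimately show ?thesis by blast
qed

section \<open>The trace method\<close>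

primrec mpow :: "nat \<Rightarrow> (nat \<Rightarrow> nat \<Rightarrow> real) \<Rightarrow> nat \<Rightarrow> nat \<Rightarrow> nat \<Rightarrow> real" where
  "mpow n Z 0 i j = of_bool (i = j)"
| "mpow n Z (Suc k) i j = (\<Sum>l<n. Z i l * mpow n Z k l j)"

lemma sum_of_bool_left:
  fixes f :: "nat \<Rightarrow> real"
  shows "i < n \<Longrightarrow> (\<Sum>l<n. of_bool (i = l) * f l) = f i"
proof -
  assume i: "i < n"
  have "(\<Sum>l<n. of_bool (i = l) * f l) = (\<Sum>l\<in>{i}. f l)"
    using i by (intro sum.mono_neutral_cong_right) auto
  then show ?thesis by simp
qed

lemma mpow_add: "i < n \<Longrightarrow> mpow n Z (a + b) i j = (\<Sum>l<n. mpow n Z a i l * mpow n Z b l j)"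
proof (induction a arbitrary: i)
  case 0
  then show ?case by (simp add: sum_of_bool_left)
next
  case (Suc a)
  have "mpow n Z (Suc a + b) i j = (\<Sum>k<n. \<Sum>l<n. Z i k * mpow n Z a k l * mpow n Z b l j)"
    using Suc by (simp add: sum_distrib_left mult_ac)
  also have "\<dots> = (\<Sum>l<n. \<Sum>k<n. Z i k * mpow n Z a k l * mpow n Z b l j)" by (rule sum.swap)
  finally show ?case by (simp add: sum_distrib_right)
qed

lemma mpow_symmetric:
  assumes sym: "\<And>i j. i < n \<Longrightarrow> j < n \<Longrightarrow> Z i j = Z j i"
  shows "i < n \<Longrightarrow> j < n \<Longrightarrow> mpow n Z k i j = mpow n Z k j i"
proof (induction k arbitrary: i j)
  case 0
  then show ?case by auto
next
  case (Suc k)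
  have one: "mpow n Z (Suc 0) l i = Z l i" if "l < n" for l
  proof -
    have "mpow n Z (Suc 0) l i = (\<Sum>k<n. of_bool (i = k) * Z l k)"
      unfolding mpow.simps by (intro sum.cong refl) auto
    then show ?thesis using sum_of_bool_left[OF Suc.prems(1), of "Z l"] by simp
  qed
  have "mpow n Z (Suc k) i j = (\<Sum>l<n. mpow n Z k j l * Z l i)"
    using Suc sym by (auto intro!: sum.cong)
  also have "\<dots> = mpow n Z (k + Suc 0) j i"
    unfolding mpow_add[OF Suc.prems(2)] using one by (intro sum.cong) auto
  finally show ?case by simp
qed

text \<open>For a unit eigenvector \<open>|Z^k v|^2 = c^(2k)\<close>, and Cauchy-Schwarz bounds each
  coordinate of \<open>Z^k v\<close> by a row of \<open>Z^k\<close>. The squared rows sum to the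
  trace of \<open>Z^(2k)\<close>.\<close>

lemma eigenvalue_power_le_trace:
  assumes sym: "\<And>i j. i < n \<Longrightarrow> j < n \<Longrightarrow> Z i j = Z j i"
    and v: "ip n v v = 1" "\<And>i. i < n \<Longrightarrow> mv n Z v i = c * v i"
  shows "c ^ (2 * k) \<le> (\<Sum>i<n. mpow n Z (2 * k) i i)"
proof -
  have pw: "(\<Sum>j<n. mpow n Z k i j * v j) = c ^ k * v i" if "i < n" for i
    using that
  proof (induction k arbitrary: i)
    case 0
    then show ?case by (simp add: sum_of_bool_left)
  next
    case (Suc k)
    have "(\<Sum>j<n. mpow n Z (Suc k) i j * v j) = (\<Sum>j<n. \<Sum>l<n. Z i l * (mpow n Z k l j * v j))"
      by (simp only: mpow.simps sum_distrib_right mult.assoc)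
    also have "\<dots> = (\<Sum>l<n. Z i l * (\<Sum>j<n. mpow n Z k l j * v j))"
      by (subst sum.swap) (simp only: sum_distrib_left)
    also have "\<dots> = c ^ k * mv n Z v i"
      using Suc.IH by (simp add: mv_def sum_distrib_left mult_ac)
    finally show ?case using v(2) Suc.prems by simp
  qed
  have "c ^ (2 * k) = (\<Sum>i<n. (c ^ k * v i)\<^sup>2)"
    using v(1) by (simp add: power_mult_distrib sum_distrib_left[symmetric] ip_self_sum_squares[symmetric]
        power_even_eq)
  also have "\<dots> \<le> (\<Sum>i<n. \<Sum>j<n. (mpow n Z k i j)\<^sup>2)"
  proof (rule sum_mono)
    fix i assume i: "i \<in> {..<n}"
    have "(c ^ k * v i)\<^sup>2 = (ip n (mpow n Z k i) v)\<^sup>2" using pw i by (simp add: ip_def)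
    also have "\<dots> \<le> ip n (mpow n Z k i) (mpow n Z k i) * ip n v v" by (rule ip_Cauchy_Schwarz)
    finally show "(c ^ k * v i)\<^sup>2 \<le> (\<Sum>j<n. (mpow n Z k i j)\<^sup>2)"
      using v(1) by (simp add: ip_self_sum_squares)
  qed
  also have "\<dots> = (\<Sum>i<n. mpow n Z (2 * k) i i)"
  proof (rule sum.cong)
    fix i assume i: "i \<in> {..<n}"
    have "mpow n Z (k + k) i i = (\<Sum>j<n. mpow n Z k i j * mpow n Z k j i)"
      using i by (intro mpow_add) auto
    also have "\<dots> = (\<Sum>j<n. (mpow n Z k i j)\<^sup>2)"
    proof (intro sum.cong refl)
      fix j assume "j \<in> {..<n}"
      then have "mpow n Z k j i = mpow n Z k i j"
        using i mpow_symmetric[where Z = Z and n = n and i = j and j = i and k = k, OF sym] by auto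
      then show "mpow n Z k i j * mpow n Z k j i = (mpow n Z k i j)\<^sup>2" by (simp add: power2_eq_square)
    qed
    finally show "(\<Sum>j<n. (mpow n Z k i j)\<^sup>2) = mpow n Z (2 * k) i i" by (simp add: mult_2)
  qed simp
  finally show ?thesis .
qed

lemma mpow_eq_walk_sum:
  "i < n \<Longrightarrow> mpow n Z k i j = (\<Sum>p\<in>lists_below n (Suc k). of_bool (hd p = i \<and> last p = j) * walk_weight Z p)"
proof (induction k arbitrary: i)
  case 0
  have "lists_below n 0 = {[]}" by (auto simp: lists_below_def)
  then have "(\<Sum>p\<in>lists_below n (Suc 0). of_bool (hd p = i \<and> last p = j) * walk_weight Z p) =
      (\<Sum>a<n. of_bool (i = a) * of_bool (a = j))"
    unfolding sum_lists_below_Suc by (intro sum.cong refl) auto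
  then show ?case using 0 by (simp add: sum_of_bool_left)
next
  case (Suc k)
  let ?L = "lists_below n (Suc k)"
  have "(\<Sum>p\<in>lists_below n (Suc (Suc k)). of_bool (hd p = i \<and> last p = j) * walk_weight Z p) =
      (\<Sum>a<n. \<Sum>p\<in>?L. of_bool (hd (a # p) = i \<and> last (a # p) = j) * walk_weight Z (a # p))"
    by (rule sum_lists_below_Suc)
  also have "\<dots> = (\<Sum>a<n. of_bool (i = a) * (\<Sum>p\<in>?L. of_bool (last p = j) * (Z a (hd p) * walk_weight Z p)))"
  proof (rule sum.cong)
    fix a assume "a \<in> {..<n}"
    have "of_bool (hd (a # p) = i \<and> last (a # p) = j) * walk_weight Z (a # p) =
        of_bool (i = a) * (of_bool (last p = j) * (Z a (hd p) * walk_weight Z p))" if "p \<in> ?L" for p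
      using that by (cases p) (auto simp: lists_below_def)
    then show "(\<Sum>p\<in>?L. of_bool (hd (a # p) = i \<and> last (a # p) = j) * walk_weight Z (a # p)) =
        of_bool (i = a) * (\<Sum>p\<in>?L. of_bool (last p = j) * (Z a (hd p) * walk_weight Z p))"
      unfolding sum_distrib_left by (intro sum.cong) auto
  qed simp
  also have "\<dots> = (\<Sum>p\<in>?L. of_bool (last p = j) * (Z i (hd p) * walk_weight Z p))"
    using Suc.prems by (rule sum_of_bool_left)
  also have "\<dots> = (\<Sum>p\<in>?L. \<Sum>l<n. of_bool (hd p = l) * (Z i l * (of_bool (last p = j) * walk_weight Z p)))"
  proof (rule sum.cong)
    fix p assume "p \<in> ?L"
    then have "hd p < n" by (cases p) (auto simp: lists_below_def)
    then show "of_bool (last p = j) * (Z i (hd p) * walk_weight Z p) =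
        (\<Sum>l<n. of_bool (hd p = l) * (Z i l * (of_bool (last p = j) * walk_weight Z p)))"
      by (subst sum_of_bool_left) (simp_all add: mult_ac)
  qed simp
  also have "\<dots> = (\<Sum>l<n. \<Sum>p\<in>?L. of_bool (hd p = l) * (Z i l * (of_bool (last p = j) * walk_weight Z p)))"
    by (rule sum.swap)
  also have "\<dots> = (\<Sum>l<n. Z i l * (\<Sum>p\<in>?L. of_bool (hd p = l \<and> last p = j) * walk_weight Z p))"
    unfolding sum_distrib_left by (intro sum.cong refl) (auto simp: of_bool_def)
  also have "\<dots> = mpow n Z (Suc k) i j" using Suc.IH by simp
  finally show ?case by simp
qed

lemma trace_mpow_eq_walk_sum:
  "(\<Sum>i<n. mpow n Z k i i) = (\<Sum>p\<in>{p \<in> lists_below n (Suc k). hd p = last p}. walk_weight Z p)"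
proof -
  let ?L = "lists_below n (Suc k)"
  have "(\<Sum>i<n. mpow n Z k i i) = (\<Sum>i<n. \<Sum>p\<in>?L. of_bool (hd p = i \<and> last p = i) * walk_weight Z p)"
    using mpow_eq_walk_sum by (intro sum.cong) auto
  also have "\<dots> = (\<Sum>p\<in>?L. \<Sum>i<n. of_bool (hd p = i) * (of_bool (last p = i) * walk_weight Z p))"
    by (subst sum.swap) (auto intro!: sum.cong)
  also have "\<dots> = (\<Sum>p\<in>?L. of_bool (last p = hd p) * walk_weight Z p)"
  proof (rule sum.cong)
    fix p assume "p \<in> ?L"
    then have "hd p < n" by (cases p) (auto simp: lists_below_def)
    then show "(\<Sum>i<n. of_bool (hd p = i) * (of_bool (last p = i) * walk_weight Z p)) =
        of_bool (last p = hd p) * walk_weight Z p"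
      by (rule sum_of_bool_left)
  qed simp
  also have "\<dots> = (\<Sum>p\<in>{p \<in> ?L. hd p = last p}. walk_weight Z p)"
    by (intro sum.mono_neutral_cong_right) auto
  finally show ?thesis .
qed

section \<open>Walk weights and their combinatorial cost\<close>

fun multiplicity_in :: "nat list \<Rightarrow> nat \<times> nat \<Rightarrow> nat" where
  "multiplicity_in (a # b # p) e = (if e = edge a b then 1 else 0) + multiplicity_in (b # p) e"
| "multiplicity_in _ e = 0"

fun loop_free :: "nat list \<Rightarrow> bool" where
  "loop_free (a # b # p) \<longleftrightarrow> a \<noteq> b \<and> loop_free (b # p)"
| "loop_free _ \<longleftrightarrow> True"

lemma multiplicity_in_pos: "0 < multiplicity_in p e \<longleftrightarrow> e \<in> path_edges p"
  by (induction p rule: path_edges.induct) auto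

lemma multiplicity_in_eq_0: "e \<notin> path_edges p \<Longrightarrow> multiplicity_in p e = 0"
  using multiplicity_in_pos[of p e] by simp

lemma path_edges_offdiag': "loop_free p \<Longrightarrow> set p \<subseteq> {..<n} \<Longrightarrow> path_edges p \<subseteq> offdiag_edges n"
  by (induction p rule: path_edges.induct) (auto intro: edge_in_offdiag)

lemma walk_weight_not_loop_free: "\<not> loop_free p \<Longrightarrow> walk_weight (edge_mat g w) p = 0"
  by (induction p rule: path_edges.induct) (auto simp: edge_mat_def)

lemma walk_weight_multiplicity:
  "loop_free p \<Longrightarrow> walk_weight (edge_mat g w) p = (\<Prod>e\<in>path_edges p. g (w e) ^ multiplicity_in p e)"
proof (induction p rule: path_edges.induct)
  case (1 a b p)
  let ?e = "edge a b" and ?E = "path_edges (b # p)"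
  have same: "(\<Prod>e\<in>?E - {?e}. g (w e) ^ multiplicity_in (a # b # p) e) =
      (\<Prod>e\<in>?E - {?e}. g (w e) ^ multiplicity_in (b # p) e)"
    by (intro prod.cong) auto
  have "(\<Prod>e\<in>?E. g (w e) ^ multiplicity_in (b # p) e) =
      g (w ?e) ^ multiplicity_in (b # p) ?e * (\<Prod>e\<in>?E - {?e}. g (w e) ^ multiplicity_in (b # p) e)"
  proof (cases "?e \<in> ?E")
    case True
    then show ?thesis by (intro prod.remove) auto
  next
    case False
    then show ?thesis by (simp add: multiplicity_in_eq_0)
  qed
  moreover have "(\<Prod>e\<in>path_edges (a # b # p). g (w e) ^ multiplicity_in (a # b # p) e) =
      g (w ?e) ^ multiplicity_in (a # b # p) ?e * (\<Prod>e\<in>?E - {?e}. g (w e) ^ multiplicity_in (a # b # p) e)"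
    by (simp only: path_edges.simps prod.insert_remove finite_path_edges)
  moreover have "edge_mat g w a b = g (w ?e)" using 1 by (simp add: edge_mat_def)
  ultimately show ?case using 1 by (simp only: walk_weight.simps loop_free.simps same) simp
qed auto

text \<open>
  Walks are read from the end of the list. An edge is open if it was created by a step to a new vertex
  and has been traversed exactly once so far.
\<close>

fun open_edges :: "nat list \<Rightarrow> (nat \<times> nat) set" where
  "open_edges (y # c # p) =
     (if y \<notin> set (c # p) then insert (edge y c) (open_edges (c # p)) else open_edges (c # p) - {edge y c})"
| "open_edges _ = {}"

text \<open>A step to a new vertex pays the second moment 1/n in advance, which its at most
  \<open>n\<close> targets compensate. The first return along that edge is then free, and every
  other step pays the sup bound \<open>\<delta>\<close>.\<close>

definition step_cost :: "nat \<Rightarrow> real \<Rightarrow> nat \<Rightarrow> nat list \<Rightarrow> real" where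
  "step_cost n \<delta> y p = (if y \<notin> set p then 1 / real n else if edge y (hd p) \<in> open_edges p then 1 else \<delta>)"

fun walk_cost :: "nat \<Rightarrow> real \<Rightarrow> nat list \<Rightarrow> real" where
  "walk_cost n \<delta> (y # c # p) = step_cost n \<delta> y (c # p) * walk_cost n \<delta> (c # p)"
| "walk_cost n \<delta> _ = 1"

text \<open>The same bookkeeping per edge: a second moment 1/n times sup bounds for further
  traversals. An edge traversed once has mean 0 and is still charged a positive amount, because a
  longer walk may traverse it again.\<close>

definition edge_cost :: "nat \<Rightarrow> real \<Rightarrow> nat list \<Rightarrow> nat \<times> nat \<Rightarrow> real" where
  "edge_cost n \<delta> p e = (if e \<in> open_edges p then 1 / real n else
     if multiplicity_in p e = 1 then \<delta> else 1 / real n * \<delta> ^ (multiplicity_in p e - 2))"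

lemma open_edges_subset: "open_edges p \<subseteq> path_edges p"
  by (induction p rule: open_edges.induct) auto

lemma open_edge_multiplicity: "e \<in> open_edges p \<Longrightarrow> multiplicity_in p e = 1"
proof (induction p rule: path_edges.induct)
  case (1 y c p)
  show ?case
  proof (cases "y \<in> set (c # p)")
    case True
    then show ?thesis using 1 by auto
  next
    case new: False
    have ne: "edge y c \<notin> path_edges (c # p)" using new edge_in_path_edgesD[of y c "c # p"] by blast
    show ?thesis
    proof (cases "e = edge y c")
      case True
      then show ?thesis using multiplicity_in_eq_0[OF ne] by simp
    next
      case False
      then have "e \<in> open_edges (c # p)" using 1(2) new by simp
      then show ?thesis using 1(1) False by simp
    qed
  qed
qed auto

text \<open>A step changes the charge of its own edge only. The hypothesis
  \<open>1 / real n \<le> \<delta>\<^sup>2\<close> serves the second traversal of an edge that never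
  was open: there two sup bounds must dominate a second moment.\<close>

lemma prod_edge_cost_le_walk_cost:
  assumes \<delta>: "0 < \<delta>" "1 / real n \<le> \<delta>\<^sup>2"
  shows "(\<Prod>e\<in>path_edges p. edge_cost n \<delta> p e) \<le> walk_cost n \<delta> p"
proof (induction p rule: path_edges.induct)
  case (1 y c p)
  let ?p = "c # p" and ?q = "y # c # p" and ?e = "edge y c"
  let ?C = "edge_cost n \<delta>"
  let ?R = "\<Prod>e\<in>path_edges ?p - {?e}. ?C ?p e"
  have C0: "0 \<le> ?C r e" for r e using \<delta> by (simp add: edge_cost_def)
  have R0: "0 \<le> ?R" by (intro prod_nonneg C0)
  have s0: "0 \<le> step_cost n \<delta> y ?p" using \<delta> by (simp add: step_cost_def)
  have other: "?C ?q e = ?C ?p e" if "e \<noteq> ?e" for e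
    using that by (simp add: edge_cost_def)
  have "(\<Prod>e\<in>path_edges ?q. ?C ?q e) = ?C ?q ?e * (\<Prod>e\<in>path_edges ?p - {?e}. ?C ?q e)"
    by (simp only: path_edges.simps prod.insert_remove finite_path_edges)
  also have "(\<Prod>e\<in>path_edges ?p - {?e}. ?C ?q e) = ?R"
    using other by (intro prod.cong) auto
  finally have q: "(\<Prod>e\<in>path_edges ?q. ?C ?q e) = ?C ?q ?e * ?R" .
  have "?C ?q ?e * ?R \<le> step_cost n \<delta> y ?p * (\<Prod>e\<in>path_edges ?p. ?C ?p e)"
  proof (cases "?e \<in> path_edges ?p")
    case True
    then have y: "y \<in> set ?p" using edge_in_path_edgesD by blast
    have old: "(\<Prod>e\<in>path_edges ?p. ?C ?p e) = ?C ?p ?e * ?R"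
      using True by (intro prod.remove) auto
    have pos: "0 < multiplicity_in ?p ?e" using True by (simp only: multiplicity_in_pos)
    have "?C ?q ?e \<le> step_cost n \<delta> y ?p * ?C ?p ?e"
    proof (cases "?e \<in> open_edges ?p")
      case True
      then have "multiplicity_in ?p ?e = 1" by (rule open_edge_multiplicity)
      then show ?thesis using True y by (auto simp: edge_cost_def step_cost_def)
    next
      case False
      then have sc: "step_cost n \<delta> y ?p = \<delta>" using y by (simp add: step_cost_def)
      have nq: "?e \<notin> open_edges ?q" using y by auto
      obtain l where l: "multiplicity_in ?p ?e = Suc l" using pos gr0_implies_Suc by blast
      have mq: "multiplicity_in ?q ?e = Suc (Suc l)" using l by simp
      have Cq: "?C ?q ?e = 1 / real n * \<delta> ^ l" unfolding edge_cost_def mq using nq by simp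
      show ?thesis
      proof (cases l)
        case 0
        then have "?C ?p ?e = \<delta>" unfolding edge_cost_def l using False by simp
        then show ?thesis unfolding sc Cq using 0 \<delta>(2) by (simp add: power2_eq_square)
      next
        case (Suc l')
        then have "?C ?p ?e = 1 / real n * \<delta> ^ l'" unfolding edge_cost_def l using False by simp
        then show ?thesis unfolding sc Cq Suc by simp
      qed
    qed
    then have "?C ?q ?e * ?R \<le> (step_cost n \<delta> y ?p * ?C ?p ?e) * ?R"
      using R0 by (rule mult_right_mono)
    then show ?thesis unfolding old by (simp only: mult.assoc)
  next
    case False
    then have R: "?R = (\<Prod>e\<in>path_edges ?p. ?C ?p e)" by simp
    have no: "?e \<notin> open_edges ?p" using False open_edges_subset by blast
    have mq: "multiplicity_in ?q ?e = 1" using multiplicity_in_eq_0[OF False] by simp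
    have "?C ?q ?e \<le> step_cost n \<delta> y ?p"
    proof (cases "y \<in> set ?p")
      case True
      then have "?e \<notin> open_edges ?q" by auto
      then show ?thesis unfolding edge_cost_def mq step_cost_def using True no by simp
    next
      case False
      then have "?e \<in> open_edges ?q" by auto
      then show ?thesis unfolding edge_cost_def step_cost_def using False by simp
    qed
    then show ?thesis using R0 unfolding R by (rule mult_right_mono)
  qed
  also have "\<dots> \<le> step_cost n \<delta> y ?p * walk_cost n \<delta> ?p"
    using 1 s0 by (rule mult_left_mono)
  finally show ?case unfolding q by simp
qed auto

lemma walk_cost_nonneg: "0 \<le> \<delta> \<Longrightarrow> 0 \<le> walk_cost n \<delta> p"
  by (induction p rule: path_edges.induct) (auto simp: step_cost_def)

text \<open>
  The excess counts the open edges that could be closed next ambiguously. It is what makes returns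
  along open edges essentially deterministic: an ambiguous return lowers the excess.
\<close>

definition open_nbrs :: "nat list \<Rightarrow> nat \<Rightarrow> nat set" where
  "open_nbrs p v = {u. edge u v \<in> open_edges p}"

definition excess :: "nat list \<Rightarrow> nat" where
  "excess p = (\<Sum>v\<in>set p - {hd p}. card (open_nbrs p v) - 2) + (card (open_nbrs p (hd p)) - 1)"

lemma open_nbrs_subset: "open_nbrs p v \<subseteq> set p"
  using open_edges_subset edge_in_path_edgesD unfolding open_nbrs_def by blast

lemma finite_open_nbrs [simp]: "finite (open_nbrs p v)"
  using open_nbrs_subset by (rule finite_subset) simp

lemma card_open_nbrs_le: "card (open_nbrs p v) \<le> length p"
  using card_mono[OF _ open_nbrs_subset[of p v]] card_length[of p] by simp

lemma open_nbrs_irrefl: "v \<notin> open_nbrs p v"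
proof -
  have "edge v v \<notin> open_edges p"
    by (induction p rule: path_edges.induct) (auto simp: edge_eq_iff)
  then show ?thesis by (simp add: open_nbrs_def)
qed

lemma open_nbrs_commute: "u \<in> open_nbrs p v \<longleftrightarrow> v \<in> open_nbrs p u"
  by (simp add: open_nbrs_def edge_commute)

text \<open>The new head has one open edge, within its allowance of 1. The old head gains an open
  edge, but its allowance rises from 1 to 2 when it stops being the head.\<close>

lemma excess_new_vertex:
  assumes "y \<notin> set (c # p)"
  shows "excess (y # c # p) = excess (c # p)"
proof -
  let ?p = "c # p" and ?q = "y # c # p"
  have ny: "open_nbrs ?q y = {c}"
    using assms open_nbrs_subset[of ?p] open_nbrs_commute[of _ ?p y]
    by (auto simp: open_nbrs_def edge_eq_iff)
  have nc: "open_nbrs ?q c = insert y (open_nbrs ?p c)"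
    using assms by (auto simp: open_nbrs_def edge_eq_iff)
  have y_notin: "y \<notin> open_nbrs ?p c" using assms open_nbrs_subset[of ?p c] by auto
  have nv: "open_nbrs ?q v = open_nbrs ?p v" if "v \<noteq> y" "v \<noteq> c" for v
    using assms that by (auto simp: open_nbrs_def edge_eq_iff)
  have "set ?q - {y} = insert c (set p - {c})" using assms by auto
  then have set_eq: "set ?q - {y} = insert c (set p - {c})" .
  have "excess ?q = (card (open_nbrs ?q c) - 2) + (\<Sum>v\<in>set p - {c}. card (open_nbrs ?q v) - 2)"
    unfolding excess_def list.sel ny set_eq by (subst sum.insert) auto
  also have "(\<Sum>v\<in>set p - {c}. card (open_nbrs ?q v) - 2) = (\<Sum>v\<in>set p - {c}. card (open_nbrs ?p v) - 2)"
    using assms by (intro sum.cong refl) (subst nv, auto)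
  also have "card (open_nbrs ?q c) - 2 = card (open_nbrs ?p c) - 1"
    unfolding nc using y_notin by simp
  finally show ?thesis by (simp add: excess_def)
qed

lemma excess_old_split:
  assumes "y \<in> set (c # p)" "y \<noteq> c"
  shows "excess (c # p) = (\<Sum>v\<in>set (c # p) - {y, c}. card (open_nbrs (c # p) v) - 2)
      + (card (open_nbrs (c # p) y) - 2) + (card (open_nbrs (c # p) c) - 1)"
    and "excess (y # c # p) = (\<Sum>v\<in>set (c # p) - {y, c}. card (open_nbrs (y # c # p) v) - 2)
      + (card (open_nbrs (y # c # p) c) - 2) + (card (open_nbrs (y # c # p) y) - 1)"
proof -
  have 1: "set (c # p) - {c} = insert y (set (c # p) - {y, c})" using assms by auto
  show "excess (c # p) = (\<Sum>v\<in>set (c # p) - {y, c}. card (open_nbrs (c # p) v) - 2)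
      + (card (open_nbrs (c # p) y) - 2) + (card (open_nbrs (c # p) c) - 1)"
    unfolding excess_def list.sel 1 by (subst sum.insert) auto
  have 2: "set (y # c # p) - {y} = insert c (set (c # p) - {y, c})" using assms by auto
  show "excess (y # c # p) = (\<Sum>v\<in>set (c # p) - {y, c}. card (open_nbrs (y # c # p) v) - 2)
      + (card (open_nbrs (y # c # p) c) - 2) + (card (open_nbrs (y # c # p) y) - 1)"
    unfolding excess_def list.sel 2 by (subst sum.insert) auto
qed

text \<open>With \<open>d\<close> open edges at the head, the return keeps the excess for
  \<open>d = 1\<close>, lowers it by 1 for \<open>d = 2\<close> and by 2 for larger
  \<open>d\<close>. Truncated subtraction states all three cases at once.\<close>

lemma excess_return:
  assumes y: "y \<in> open_nbrs (c # p) c"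
  defines "d \<equiv> card (open_nbrs (c # p) c)"
  shows "excess (y # c # p) + (d - 1) = excess (c # p) + (d - 3)"
proof -
  let ?p = "c # p" and ?q = "y # c # p"
  have yp: "y \<in> set ?p" "y \<noteq> c" using y open_nbrs_subset[of ?p c] open_nbrs_irrefl[of c ?p] by auto
  have oq: "open_edges ?q = open_edges ?p - {edge y c}" using yp by auto
  have nc: "open_nbrs ?q c = open_nbrs ?p c - {y}" and ny: "open_nbrs ?q y = open_nbrs ?p y - {c}"
    and nv: "\<And>v. v \<noteq> y \<Longrightarrow> v \<noteq> c \<Longrightarrow> open_nbrs ?q v = open_nbrs ?p v"
    using yp(2) unfolding open_nbrs_def oq by (auto simp: edge_eq_iff)
  have cy: "c \<in> open_nbrs ?p y" using y by (simp only: open_nbrs_commute)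
  have "(\<Sum>v\<in>set ?p - {y, c}. card (open_nbrs ?q v) - 2) = (\<Sum>v\<in>set ?p - {y, c}. card (open_nbrs ?p v) - 2)"
    by (intro sum.cong refl) (subst nv, auto)
  moreover have "card (open_nbrs ?q c) = d - 1" unfolding nc d_def using y by (simp add: card_Diff_singleton)
  moreover have "card (open_nbrs ?q y) = card (open_nbrs ?p y) - 1"
    unfolding ny using cy by (simp add: card_Diff_singleton)
  ultimately show ?thesis
    unfolding excess_old_split(1)[OF yp] excess_old_split(2)[OF yp] d_def[symmetric] by simp
qed

text \<open>No edge is opened or closed. Only the head moves, and its allowance of 1 in place of 2
  can raise the excess by 1.\<close>

lemma excess_other:
  assumes y: "y \<in> set (c # p)" "y \<notin> open_nbrs (c # p) c"
  shows "excess (y # c # p) \<le> excess (c # p) + 1"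
proof -
  let ?p = "c # p" and ?q = "y # c # p"
  have "edge y c \<notin> open_edges ?p" using y(2) by (simp add: open_nbrs_def)
  then have nq: "open_nbrs ?q = open_nbrs ?p" using y(1) by (auto simp: open_nbrs_def fun_eq_iff)
  show ?thesis
  proof (cases "y = c")
    case True
    then show ?thesis using nq unfolding excess_def by (simp add: insert_absorb)
  next
    case False
    show ?thesis
      unfolding excess_old_split(1)[OF y(1) False] excess_old_split(2)[OF y(1) False] nq by linarith
  qed
qed

text \<open>The potential \<open>\<gamma> ^ excess\<close> makes the total weight of the next step
  nearly 2. New vertices give at most 1. Returns give at most 1: a single one keeps the excess, and
  if there are several, at most \<open>\<gamma>\<close> of them, each lowers it. The remaining
  steps, at most \<open>\<gamma>\<close> many and raising the excess by at most 1, give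
  \<open>\<gamma>\<^sup>2 * \<delta>\<close>.\<close>

lemma sum_step_cost_le:
  fixes \<gamma> :: real
  assumes \<delta>: "0 \<le> \<delta>" and n: "0 < n" and len: "real (length (c # p)) \<le> \<gamma>" and p: "set (c # p) \<subseteq> {..<n}"
  shows "(\<Sum>y<n. step_cost n \<delta> y (c # p) * \<gamma> ^ excess (y # c # p)) \<le> (2 + \<gamma>\<^sup>2 * \<delta>) * \<gamma> ^ excess (c # p)"
proof -
  let ?p = "c # p"
  let ?f = "\<lambda>y. step_cost n \<delta> y ?p * \<gamma> ^ excess (y # ?p)"
  let ?N = "open_nbrs ?p c"
  define X where "X = excess ?p"
  have \<gamma>1: "1 \<le> \<gamma>" using len by simp
  have split: "{..<n} = ({..<n} - set ?p) \<union> (?N \<union> (set ?p - ?N))" using p open_nbrs_subset[of ?p c] by blast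
  have "(\<Sum>y<n. ?f y) = (\<Sum>y\<in>{..<n} - set ?p. ?f y) + ((\<Sum>y\<in>?N. ?f y) + (\<Sum>y\<in>set ?p - ?N. ?f y))"
  proof -
    have "(\<Sum>y<n. ?f y) = (\<Sum>y\<in>({..<n} - set ?p) \<union> (?N \<union> (set ?p - ?N)). ?f y)"
      by (rule sum.cong[OF split refl])
    also have "\<dots> = (\<Sum>y\<in>{..<n} - set ?p. ?f y) + (\<Sum>y\<in>?N \<union> (set ?p - ?N). ?f y)"
      using open_nbrs_subset[of ?p c] by (intro sum.union_disjoint) auto
    also have "(\<Sum>y\<in>?N \<union> (set ?p - ?N). ?f y) = (\<Sum>y\<in>?N. ?f y) + (\<Sum>y\<in>set ?p - ?N. ?f y)"
      by (intro sum.union_disjoint) auto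
    finally show ?thesis .
  qed
  also have "(\<Sum>y\<in>{..<n} - set ?p. ?f y) \<le> \<gamma> ^ X"
  proof -
    have "(\<Sum>y\<in>{..<n} - set ?p. ?f y) = (\<Sum>y\<in>{..<n} - set ?p. 1 / real n * \<gamma> ^ X)"
    proof (rule sum.cong)
      fix y assume "y \<in> {..<n} - set ?p"
      then have "y \<notin> set ?p" by blast
      then show "?f y = 1 / real n * \<gamma> ^ X"
        using excess_new_vertex[of y c p] by (simp add: step_cost_def X_def)
    qed simp
    also have "\<dots> = real (card ({..<n} - set ?p)) / real n * \<gamma> ^ X" by simp
    also have "\<dots> \<le> 1 * \<gamma> ^ X"
    proof (rule mult_right_mono)
      have "card ({..<n} - set ?p) \<le> n" using card_mono[of "{..<n}" "{..<n} - set ?p"] by auto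
      then show "real (card ({..<n} - set ?p)) / real n \<le> 1" using n by simp
    qed (use \<gamma>1 in auto)
    finally show ?thesis by simp
  qed
  also have "(\<Sum>y\<in>?N. ?f y) \<le> \<gamma> ^ X"
  proof (cases "card ?N = 0")
    case True
    then have "?N = {}" by simp
    then have "(\<Sum>y\<in>?N. ?f y) = 0" by (simp only: sum.empty)
    then show ?thesis using \<gamma>1 by simp
  next
    case False
    have f: "?f y = \<gamma> ^ excess (y # ?p)" if y: "y \<in> ?N" for y
    proof -
      have "y \<in> set ?p" using y open_nbrs_subset by blast
      then show ?thesis using y by (simp add: step_cost_def open_nbrs_def)
    qed
    show ?thesis
    proof (cases "card ?N = 1")
      case True
      then obtain y where N: "?N = {y}" by (rule card_1_singletonE)
      have "excess (y # ?p) = X" using excess_return[of y c p] N by (simp add: X_def)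
      then have "?f y = \<gamma> ^ X" using f[of y] N by simp
      then show ?thesis unfolding N by simp
    next
      case many: False
      have le: "?f y \<le> \<gamma> ^ (X - 1)" and X1: "1 \<le> X" if y: "y \<in> ?N" for y
      proof -
        have "excess (y # ?p) + 1 \<le> X"
          using excess_return[OF y] False many unfolding X_def by linarith
        then show "1 \<le> X" "?f y \<le> \<gamma> ^ (X - 1)"
          unfolding f[OF y] using \<gamma>1 by (auto intro!: power_increasing)
      qed
      obtain y0 where y0: "y0 \<in> ?N" using False by fastforce
      have "(\<Sum>y\<in>?N. ?f y) \<le> real (card ?N) * \<gamma> ^ (X - 1)"
        using sum_bounded_above[of ?N ?f "\<gamma> ^ (X - 1)"] le by simp
      also have "\<dots> \<le> \<gamma> * \<gamma> ^ (X - 1)"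
      proof (rule mult_right_mono)
        have "real (card ?N) \<le> real (length ?p)" using card_open_nbrs_le[of ?p c] by (simp only: of_nat_le_iff)
        then show "real (card ?N) \<le> \<gamma>" using len by linarith
      qed (use \<gamma>1 in auto)
      also have "\<dots> = \<gamma> ^ X" using X1[OF y0] by (cases X) auto
      finally show ?thesis .
    qed
  qed
  also have "(\<Sum>y\<in>set ?p - ?N. ?f y) \<le> \<gamma>\<^sup>2 * \<delta> * \<gamma> ^ X"
  proof -
    have "?f y \<le> \<delta> * \<gamma> ^ (X + 1)" if y: "y \<in> set ?p - ?N" for y
    proof -
      have "step_cost n \<delta> y ?p = \<delta>" using y by (simp add: step_cost_def open_nbrs_def)
      moreover have "excess (y # ?p) \<le> X + 1" using excess_other[of y c p] y by (simp add: X_def)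
      then have "\<gamma> ^ excess (y # ?p) \<le> \<gamma> ^ (X + 1)" using \<gamma>1 by (rule power_increasing)
      ultimately show ?thesis using \<delta> by (simp add: mult_left_mono)
    qed
    then have "(\<Sum>y\<in>set ?p - ?N. ?f y) \<le> real (card (set ?p - ?N)) * (\<delta> * \<gamma> ^ (X + 1))"
      by (rule sum_bounded_above)
    also have "\<dots> \<le> \<gamma> * (\<delta> * \<gamma> ^ (X + 1))"
    proof (rule mult_right_mono)
      have "card (set ?p - ?N) \<le> length ?p"
        using card_mono[of "set ?p" "set ?p - ?N"] card_length[of ?p] by auto
      then have "real (card (set ?p - ?N)) \<le> real (length ?p)" by (simp only: of_nat_le_iff)
      then show "real (card (set ?p - ?N)) \<le> \<gamma>" using len by linarith
    qed (use \<gamma>1 \<delta> in auto)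
    also have "\<dots> = \<gamma>\<^sup>2 * \<delta> * \<gamma> ^ X" by (simp add: power2_eq_square)
    finally show ?thesis .
  qed
  finally show ?thesis by (simp add: X_def algebra_simps)
qed

lemma sum_walk_cost_le:
  fixes \<gamma> :: real
  assumes \<delta>: "0 \<le> \<delta>" and n: "0 < n"
  shows "real (Suc L) \<le> \<gamma> \<Longrightarrow>
    (\<Sum>p\<in>lists_below n (Suc L). walk_cost n \<delta> p * \<gamma> ^ excess p) \<le> real n * (2 + \<gamma>\<^sup>2 * \<delta>) ^ L"
proof (induction L)
  case 0
  have "lists_below n 0 = {[]}" by (auto simp: lists_below_def)
  moreover have "excess [a] = 0" for a by (simp add: excess_def open_nbrs_def)
  ultimately show ?case by (simp add: sum_lists_below_Suc)
next
  case (Suc L)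
  let ?L = "lists_below n (Suc L)"
  have "(\<Sum>p\<in>lists_below n (Suc (Suc L)). walk_cost n \<delta> p * \<gamma> ^ excess p) =
      (\<Sum>p\<in>?L. \<Sum>y<n. walk_cost n \<delta> (y # p) * \<gamma> ^ excess (y # p))"
    unfolding sum_lists_below_Suc[where m = "Suc L"] by (rule sum.swap)
  also have "\<dots> \<le> (\<Sum>p\<in>?L. walk_cost n \<delta> p * ((2 + \<gamma>\<^sup>2 * \<delta>) * \<gamma> ^ excess p))"
  proof (rule sum_mono)
    fix p assume p: "p \<in> ?L"
    then obtain c q where cq: "p = c # q" by (cases p) (auto simp: lists_below_def)
    have "(\<Sum>y<n. walk_cost n \<delta> (y # p) * \<gamma> ^ excess (y # p)) =
        walk_cost n \<delta> p * (\<Sum>y<n. step_cost n \<delta> y p * \<gamma> ^ excess (y # p))"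
      unfolding sum_distrib_left by (intro sum.cong refl) (simp add: cq mult_ac)
    also have "\<dots> \<le> walk_cost n \<delta> p * ((2 + \<gamma>\<^sup>2 * \<delta>) * \<gamma> ^ excess p)"
    proof (rule mult_left_mono)
      have "set p \<subseteq> {..<n}" "length p = Suc L" using p by (simp_all add: lists_below_def)
      then show "(\<Sum>y<n. step_cost n \<delta> y p * \<gamma> ^ excess (y # p)) \<le> (2 + \<gamma>\<^sup>2 * \<delta>) * \<gamma> ^ excess p"
        unfolding cq using Suc.prems by (intro sum_step_cost_le \<delta> n) auto
    qed (rule walk_cost_nonneg[OF \<delta>])
    finally show "(\<Sum>y<n. walk_cost n \<delta> (y # p) * \<gamma> ^ excess (y # p)) \<le>
      walk_cost n \<delta> p * ((2 + \<gamma>\<^sup>2 * \<delta>) * \<gamma> ^ excess p)" .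
  qed
  also have "\<dots> = (2 + \<gamma>\<^sup>2 * \<delta>) * (\<Sum>p\<in>?L. walk_cost n \<delta> p * \<gamma> ^ excess p)"
    by (simp only: sum_distrib_left mult_ac)
  also have "\<dots> \<le> (2 + \<gamma>\<^sup>2 * \<delta>) * (real n * (2 + \<gamma>\<^sup>2 * \<delta>) ^ L)"
    using Suc \<delta> by (intro mult_left_mono) auto
  finally show ?case by (simp add: mult_ac)
qed

section \<open>Trace and norm bounds for bounded entries\<close>

lemma bounded_power_integral:
  fixes g :: "real \<Rightarrow> real"
  assumes P: "prob_space P" and g: "g \<in> borel_measurable P" and bd: "\<And>y. \<bar>g y\<bar> \<le> \<delta>"
    and var: "(\<integral>y. (g y)\<^sup>2 \<partial>P) \<le> v"
  shows "integrable P (\<lambda>y. g y ^ r)" and "\<bar>\<integral>y. g y ^ (Suc (Suc r)) \<partial>P\<bar> \<le> v * \<delta> ^ r"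
proof -
  interpret prob_space P by (rule P)
  have \<delta>: "0 \<le> \<delta>" using bd[of 0] by linarith
  show int: "integrable P (\<lambda>y. g y ^ r)" for r
  proof (rule integrable_const_bound[of _ "\<delta> ^ r"])
    show "AE y in P. norm (g y ^ r) \<le> \<delta> ^ r"
      using bd by (intro AE_I2) (simp add: power_abs power_mono)
  qed (use g in measurable)
  have "\<bar>\<integral>y. g y ^ (Suc (Suc r)) \<partial>P\<bar> \<le> (\<integral>y. \<bar>g y ^ (Suc (Suc r))\<bar> \<partial>P)"
    by (rule integral_abs_bound)
  also have "\<dots> \<le> (\<integral>y. (g y)\<^sup>2 * \<delta> ^ r \<partial>P)"
  proof (rule integral_mono)
    show "integrable P (\<lambda>y. \<bar>g y ^ (Suc (Suc r))\<bar>)" using int by (intro integrable_abs)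
    show "integrable P (\<lambda>y. (g y)\<^sup>2 * \<delta> ^ r)" using int[of 2] by simp
    fix y
    have "\<bar>g y ^ (Suc (Suc r))\<bar> = \<bar>g y\<bar>\<^sup>2 * \<bar>g y\<bar> ^ r"
      unfolding power_abs by (simp add: power2_eq_square)
    also have "\<bar>g y\<bar>\<^sup>2 = (g y)\<^sup>2" by simp
    finally have "\<bar>g y ^ (Suc (Suc r))\<bar> = (g y)\<^sup>2 * \<bar>g y\<bar> ^ r" .
    also have "\<dots> \<le> (g y)\<^sup>2 * \<delta> ^ r" using bd by (intro mult_left_mono power_mono) auto
    finally show "\<bar>g y ^ (Suc (Suc r))\<bar> \<le> (g y)\<^sup>2 * \<delta> ^ r" .
  qed
  also have "\<dots> = (\<integral>y. (g y)\<^sup>2 \<partial>P) * \<delta> ^ r" by simp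
  also have "\<dots> \<le> v * \<delta> ^ r" using var \<delta> by (intro mult_right_mono) auto
  finally show "\<bar>\<integral>y. g y ^ (Suc (Suc r)) \<partial>P\<bar> \<le> v * \<delta> ^ r" .
qed

locale bounded_noise =
  fixes P Pd :: "real measure" and n :: nat and g :: "real \<Rightarrow> real" and \<delta> :: real
  assumes P: "prob_space P" and Pd: "prob_space Pd" and n: "0 < n"
    and g_meas: "g \<in> borel_measurable P" and bd: "\<And>y. \<bar>g y\<bar> \<le> \<delta>"
    and mean: "(\<integral>y. g y \<partial>P) = 0" and var: "(\<integral>y. (g y)\<^sup>2 \<partial>P) \<le> 1 / real n"
    and \<delta>: "0 < \<delta>" "1 / real n \<le> \<delta>\<^sup>2"
begin

lemma walk_weight_expectation:
  assumes p: "set p \<subseteq> {..<n}"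
  shows walk_weight_integrable: "integrable (wigner_noise P Pd n) (\<lambda>w. walk_weight (edge_mat g w) p)"
    and walk_weight_integral_le:
      "\<bar>\<integral>w. walk_weight (edge_mat g w) p \<partial>wigner_noise P Pd n\<bar> \<le> walk_cost n \<delta> p"
proof -
  let ?D = "\<lambda>(i, j). if i = j then Pd else P"
  have cost0: "0 \<le> walk_cost n \<delta> p" using \<delta> by (intro walk_cost_nonneg) simp
  have "integrable (wigner_noise P Pd n) (\<lambda>w. walk_weight (edge_mat g w) p) \<and>
    \<bar>\<integral>w. walk_weight (edge_mat g w) p \<partial>wigner_noise P Pd n\<bar> \<le> walk_cost n \<delta> p"
  proof (cases "loop_free p")
    case False
    then show ?thesis using cost0 by (simp add: walk_weight_not_loop_free)
  next
    case True
    have Dprob: "prob_space (?D e)" for e using P Pd by (cases e) auto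
    have off: "path_edges p \<subseteq> offdiag_edges n" using path_edges_offdiag'[OF True p] .
    then have DP: "?D e = P" if "e \<in> path_edges p" for e
      using that by (auto simp: offdiag_edges_def)
    have fin: "finite {(i, j). i \<le> j \<and> j < n}"
      by (rule finite_subset[of _ "{..<n} \<times> {..<n}"]) auto
    have sub: "path_edges p \<subseteq> {(i, j). i \<le> j \<and> j < n}"
      using off by (auto simp: offdiag_edges_def)
    have int: "integrable (?D e) (\<lambda>y. g y ^ multiplicity_in p e)" if "e \<in> path_edges p" for e
      unfolding DP[OF that] by (rule bounded_power_integral(1)[OF P g_meas bd var])
    note ex = product_expectation[of ?D, OF Dprob fin sub int]
    have "\<bar>\<integral>w. walk_weight (edge_mat g w) p \<partial>wigner_noise P Pd n\<bar> =
        \<bar>\<Prod>e\<in>path_edges p. \<integral>y. g y ^ multiplicity_in p e \<partial>?D e\<bar>"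
      unfolding wigner_noise_def walk_weight_multiplicity[OF True] by (subst ex(2)) auto
    also have "\<dots> = (\<Prod>e\<in>path_edges p. \<bar>\<integral>y. g y ^ multiplicity_in p e \<partial>?D e\<bar>)"
      by (rule abs_prod)
    also have "\<dots> \<le> (\<Prod>e\<in>path_edges p. edge_cost n \<delta> p e)"
    proof (intro prod_mono conjI abs_ge_zero)
      fix e assume e: "e \<in> path_edges p"
      then have pos: "0 < multiplicity_in p e" by (simp only: multiplicity_in_pos)
      show "\<bar>\<integral>y. g y ^ multiplicity_in p e \<partial>?D e\<bar> \<le> edge_cost n \<delta> p e"
      proof (cases "multiplicity_in p e = 1")
        case True
        then have "(\<integral>y. g y ^ multiplicity_in p e \<partial>?D e) = 0" unfolding DP[OF e] using mean by simp
        then show ?thesis using \<delta> by (simp add: edge_cost_def)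
      next
        case False
        then obtain r where r: "multiplicity_in p e = Suc (Suc r)"
          using pos by (metis One_nat_def gr0_implies_Suc nat.exhaust)
        then have "e \<notin> open_edges p" using open_edge_multiplicity[of e p] by auto
        then show ?thesis
          unfolding DP[OF e] edge_cost_def r using bounded_power_integral(2)[OF P g_meas bd var, of r] by simp
      qed
    qed
    also have "\<dots> \<le> walk_cost n \<delta> p" by (rule prod_edge_cost_le_walk_cost[OF \<delta>])
    finally show ?thesis
      unfolding wigner_noise_def walk_weight_multiplicity[OF True] using ex(1) by blast
  qed
  then show "integrable (wigner_noise P Pd n) (\<lambda>w. walk_weight (edge_mat g w) p)"
    "\<bar>\<integral>w. walk_weight (edge_mat g w) p \<partial>wigner_noise P Pd n\<bar> \<le> walk_cost n \<delta> p" by blast+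
qed

lemma trace_expectation:
  shows trace_integrable: "integrable (wigner_noise P Pd n) (\<lambda>w. \<Sum>i<n. mpow n (edge_mat g w) k i i)"
    and trace_integral_le: "(\<integral>w. (\<Sum>i<n. mpow n (edge_mat g w) k i i) \<partial>wigner_noise P Pd n)
      \<le> real n * (2 + (real (Suc k))\<^sup>2 * \<delta>) ^ k"
proof -
  let ?S = "{p \<in> lists_below n (Suc k). hd p = last p}"
  have fin: "finite ?S" by simp
  have int: "integrable (wigner_noise P Pd n) (\<lambda>w. walk_weight (edge_mat g w) p)" if "p \<in> ?S" for p
    using that by (intro walk_weight_integrable) (auto simp: lists_below_def)
  show "integrable (wigner_noise P Pd n) (\<lambda>w. \<Sum>i<n. mpow n (edge_mat g w) k i i)"
    unfolding trace_mpow_eq_walk_sum using int by (rule Bochner_Integration.integrable_sum)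
  have "(\<integral>w. (\<Sum>i<n. mpow n (edge_mat g w) k i i) \<partial>wigner_noise P Pd n) =
      (\<Sum>p\<in>?S. \<integral>w. walk_weight (edge_mat g w) p \<partial>wigner_noise P Pd n)"
    unfolding trace_mpow_eq_walk_sum using int by (rule Bochner_Integration.integral_sum)
  also have "\<dots> \<le> (\<Sum>p\<in>?S. walk_cost n \<delta> p)"
  proof (rule sum_mono)
    fix p assume "p \<in> ?S"
    then have "set p \<subseteq> {..<n}" by (auto simp: lists_below_def)
    then show "(\<integral>w. walk_weight (edge_mat g w) p \<partial>wigner_noise P Pd n) \<le> walk_cost n \<delta> p"
      using walk_weight_integral_le[of p] by linarith
  qed
  \<comment> \<open>Passing from closed walks to all walks keeps the right exponential rate, since
    the potential bound gives a factor of nearly 2 per step.\<close>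
  also have "\<dots> \<le> (\<Sum>p\<in>lists_below n (Suc k). walk_cost n \<delta> p)"
    using \<delta> by (intro sum_mono2) (auto intro: walk_cost_nonneg)
  also have "\<dots> \<le> (\<Sum>p\<in>lists_below n (Suc k). walk_cost n \<delta> p * real (Suc k) ^ excess p)"
  proof (rule sum_mono)
    fix p
    have "walk_cost n \<delta> p * 1 \<le> walk_cost n \<delta> p * real (Suc k) ^ excess p"
      using \<delta> by (intro mult_left_mono one_le_power walk_cost_nonneg) auto
    then show "walk_cost n \<delta> p \<le> walk_cost n \<delta> p * real (Suc k) ^ excess p" by simp
  qed
  also have "\<dots> \<le> real n * (2 + (real (Suc k))\<^sup>2 * \<delta>) ^ k"
    using \<delta> n by (intro sum_walk_cost_le) auto
  finally show "(\<integral>w. (\<Sum>i<n. mpow n (edge_mat g w) k i i) \<partial>wigner_noise P Pd n)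
      \<le> real n * (2 + (real (Suc k))\<^sup>2 * \<delta>) ^ k" .
qed

text \<open>A trace of the even power below \<open>b ^ (2 * k)\<close> forces the top eigenvalue
  below \<open>b\<close>; Markov's inequality bounds the probability of the complementary
  event.\<close>

lemma edge_bound:
  assumes b: "0 < b" and k: "0 < k"
  shows "\<exists>B\<in>sets (wigner_noise P Pd n).
    measure (wigner_noise P Pd n) B \<le> real n * ((2 + (real (Suc (2 * k)))\<^sup>2 * \<delta>) / b) ^ (2 * k) \<and>
    (\<forall>w\<in>space (wigner_noise P Pd n) - B. \<forall>v. qf n (edge_mat g w) v \<le> b * ip n v v)"
proof -
  let ?M = "wigner_noise P Pd n"
  let ?T = "\<lambda>w. \<Sum>i<n. mpow n (edge_mat g w) (2 * k) i i"
  have eig: "\<exists>c. c ^ (2 * k) \<le> ?T w \<and> (\<forall>u. qf n (edge_mat g w) u \<le> c * ip n u u)" for w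
  proof -
    obtain v c where v: "ip n v v = 1" "\<forall>i<n. mv n (edge_mat g w) v i = c * v i"
      and c: "\<forall>u. qf n (edge_mat g w) u \<le> c * ip n u u"
      using rayleigh_maximizer[where A = "edge_mat g w", OF n edge_mat_commute] by blast
    have "c ^ (2 * k) \<le> ?T w"
      using eigenvalue_power_le_trace[where Z = "edge_mat g w", OF edge_mat_commute v(1)] v(2) by blast
    then show ?thesis using c by blast
  qed
  have T0: "0 \<le> ?T w" for w
  proof -
    obtain c where "c ^ (2 * k) \<le> ?T w" using eig by blast
    moreover have "0 \<le> c ^ (2 * k)" by (simp add: power_mult)
    ultimately show ?thesis by linarith
  qed
  have bk: "0 < b ^ (2 * k)" using b by simp
  note MB = Markov_bad_set[OF trace_integrable T0 bk trace_integral_le]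
  let ?B = "{w \<in> space ?M. b ^ (2 * k) \<le> ?T w}"
  have "measure ?M ?B \<le> real n * ((2 + (real (Suc (2 * k)))\<^sup>2 * \<delta>) / b) ^ (2 * k)"
    using MB(2) by (simp only: power_divide times_divide_eq_right)
  moreover have "qf n (edge_mat g w) v \<le> b * ip n v v" if w: "w \<in> space ?M - ?B" for w v
  proof -
    obtain c where c: "c ^ (2 * k) \<le> ?T w" "\<forall>u. qf n (edge_mat g w) u \<le> c * ip n u u"
      using eig by blast
    have "c ^ (2 * k) < b ^ (2 * k)" using w c(1) by auto
    then have "c < b" using b power_mono[of b c "2 * k"] by (meson less_imp_le not_le)
    then have "c * ip n v v \<le> b * ip n v v" by (intro mult_right_mono ip_self_nonneg) simp
    then show ?thesis using c(2) order_trans by blast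
  qed
  ultimately show ?thesis using MB(1) by blast
qed

end

text \<open>Entries are truncated at \<open>T\<close> and recentred. Larger entries are excluded by
  a union bound over at most n^2 edges with the fifth moment. As the original mean is 0, the shift
  of the mean is at most \<open>M / T ^ 4\<close>, and it perturbs the form by at most
  \<open>sqrt n\<close> times that.\<close>

lemma truncated_edge_bound:
  fixes \<phi> :: "real \<Rightarrow> real" and T \<delta> b M :: real
  assumes P: "prob_space P" and Pd: "prob_space Pd" and n: "0 < n"
    and \<phi>: "\<phi> \<in> borel_measurable P" and five: "integrable P (\<lambda>y. \<bar>\<phi> y\<bar> ^ 5)"
    and mean: "(\<integral>y. \<phi> y \<partial>P) = 0" and var: "(\<integral>y. (\<phi> y)\<^sup>2 \<partial>P) = 1"
    and T: "1 \<le> T" and \<delta>: "\<delta> = 2 * T / sqrt (real n)"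
    and b: "0 < b" and k: "0 < k"
    and M: "M = (\<integral>y. \<bar>\<phi> y\<bar> ^ 5 \<partial>P)"
  shows "\<exists>B\<in>sets (wigner_noise P Pd n).
    measure (wigner_noise P Pd n) B \<le> (real n)\<^sup>2 * (M / T ^ 5) +
      real n * ((2 + (real (Suc (2 * k)))\<^sup>2 * \<delta>) / b) ^ (2 * k) \<and>
    (\<forall>w\<in>space (wigner_noise P Pd n) - B. \<forall>v.
      qf n (edge_mat (\<lambda>y. \<phi> y / sqrt (real n)) w) v \<le> (b + M / T ^ 4 * sqrt (real n)) * ip n v v)"
proof -
  interpret P: prob_space P by (rule P)
  let ?N = "wigner_noise P Pd n" and ?D = "\<lambda>(i, j). if i = j then Pd else P"
  define \<tau> where "\<tau> y = (if \<bar>\<phi> y\<bar> \<le> T then \<phi> y else 0)" for y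
  have \<tau>_meas: "\<tau> \<in> borel_measurable P" unfolding \<tau>_def using \<phi> by measurable
  have \<tau>_bd: "\<bar>\<tau> y\<bar> \<le> T" for y using T by (auto simp: \<tau>_def)
  have int_\<tau>: "integrable P \<tau>"
    by (rule P.integrable_const_bound[of _ T]) (use \<tau>_bd \<tau>_meas in auto)
  have int_\<tau>2: "integrable P (\<lambda>y. (\<tau> y)\<^sup>2)"
  proof (rule P.integrable_const_bound[of _ "T\<^sup>2"])
    have "(\<tau> y)\<^sup>2 \<le> T\<^sup>2" for y using \<tau>_bd[of y] T abs_le_square_iff[of "\<tau> y" T] by simp
    then show "AE y in P. norm ((\<tau> y)\<^sup>2) \<le> T\<^sup>2" by simp
    show "(\<lambda>y. (\<tau> y)\<^sup>2) \<in> borel_measurable P" using \<tau>_meas by measurable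
  qed
  have int_\<phi>2: "integrable P (\<lambda>y. (\<phi> y)\<^sup>2)"
    using var not_integrable_integral_eq by fastforce
  have int_\<phi>: "integrable P \<phi>" by (rule P.square_integrable_imp_integrable[OF \<phi> int_\<phi>2])
  define \<mu> where "\<mu> = (\<integral>y. \<tau> y \<partial>P)"
  have \<mu>T: "\<bar>\<mu>\<bar> \<le> T"
  proof -
    have "\<bar>\<mu>\<bar> \<le> (\<integral>y. \<bar>\<tau> y\<bar> \<partial>P)" unfolding \<mu>_def by (rule integral_abs_bound)
    also have "\<dots> \<le> (\<integral>y. T \<partial>P)" using int_\<tau> \<tau>_bd by (intro integral_mono) auto
    finally show ?thesis by (simp add: P.prob_space)
  qed
  have \<mu>M: "\<bar>\<mu>\<bar> \<le> M / T ^ 4"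
  proof -
    have "\<mu> = - (\<integral>y. \<phi> y - \<tau> y \<partial>P)" unfolding \<mu>_def using int_\<tau> int_\<phi> mean by simp
    then have "\<bar>\<mu>\<bar> \<le> (\<integral>y. \<bar>\<phi> y - \<tau> y\<bar> \<partial>P)"
      using integral_abs_bound[of P "\<lambda>y. \<phi> y - \<tau> y"] by simp
    also have "\<dots> \<le> (\<integral>y. \<bar>\<phi> y\<bar> ^ 5 / T ^ 4 \<partial>P)"
    proof (rule integral_mono)
      fix y
      show "\<bar>\<phi> y - \<tau> y\<bar> \<le> \<bar>\<phi> y\<bar> ^ 5 / T ^ 4"
      proof (cases "\<bar>\<phi> y\<bar> \<le> T")
        case False
        then have "\<bar>\<phi> y\<bar> * T ^ 4 \<le> \<bar>\<phi> y\<bar> * \<bar>\<phi> y\<bar> ^ 4"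
          using T by (intro mult_left_mono power_mono) auto
        also have "\<dots> = \<bar>\<phi> y\<bar> ^ 5" by (simp add: eval_nat_numeral)
        finally show ?thesis using False T by (simp add: \<tau>_def field_simps)
      qed (use T in \<open>simp add: \<tau>_def\<close>)
    qed (use int_\<tau> int_\<phi> five in auto)
    also have "\<dots> = M / T ^ 4" using M by simp
    finally show ?thesis .
  qed
  define g where "g y = (\<tau> y - \<mu>) / sqrt (real n)" for y
  have g_var: "(\<integral>y. (g y)\<^sup>2 \<partial>P) \<le> 1 / real n"
  proof -
    have "(g y)\<^sup>2 = ((\<tau> y)\<^sup>2 - 2 * \<mu> * \<tau> y + \<mu>\<^sup>2) / real n" for y
      using n by (simp add: g_def power_divide power2_diff)
    then have "(\<integral>y. (g y)\<^sup>2 \<partial>P) = ((\<integral>y. (\<tau> y)\<^sup>2 \<partial>P) - 2 * \<mu> * \<mu> + \<mu>\<^sup>2) / real n"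
      using int_\<tau> int_\<tau>2 by (simp add: P.prob_space \<mu>_def[symmetric])
    also have "\<dots> \<le> 1 / real n"
    proof (rule divide_right_mono)
      have "(\<integral>y. (\<tau> y)\<^sup>2 \<partial>P) \<le> (\<integral>y. (\<phi> y)\<^sup>2 \<partial>P)"
        using int_\<tau>2 int_\<phi>2 by (intro integral_mono) (auto simp: \<tau>_def)
      then show "(\<integral>y. (\<tau> y)\<^sup>2 \<partial>P) - 2 * \<mu> * \<mu> + \<mu>\<^sup>2 \<le> 1"
        unfolding var mult.assoc power2_eq_square[symmetric, of \<mu>] using zero_le_power2[of \<mu>] by linarith
    qed simp
    finally show ?thesis .
  qed
  interpret bounded_noise P Pd n g \<delta>
  proof (rule bounded_noise.intro[OF P Pd n])
    show "g \<in> borel_measurable P" unfolding g_def using \<tau>_meas by measurable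
    show "\<bar>g y\<bar> \<le> \<delta>" for y
    proof -
      have "\<bar>\<tau> y - \<mu>\<bar> \<le> 2 * T" using \<tau>_bd[of y] \<mu>T by linarith
      then show ?thesis using n by (simp add: g_def \<delta> divide_right_mono)
    qed
    show "(\<integral>y. g y \<partial>P) = 0" unfolding g_def using int_\<tau> by (simp add: P.prob_space \<mu>_def)
    show "(\<integral>y. (g y)\<^sup>2 \<partial>P) \<le> 1 / real n" by (rule g_var)
    show "0 < \<delta>" using T n by (simp add: \<delta>)
    have "1 / real n \<le> (2 * T)\<^sup>2 / real n"
      using T n by (intro divide_right_mono one_le_power) auto
    then show "1 / real n \<le> \<delta>\<^sup>2" using n by (simp add: \<delta> power_divide)
  qed
  obtain B2 where B2s: "B2 \<in> sets ?N" and
    B2': "measure ?N B2 \<le> real n * ((2 + (real (Suc (2 * k)))\<^sup>2 * \<delta>) / b) ^ (2 * k) \<and>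
      (\<forall>w\<in>space ?N - B2. \<forall>v. qf n (edge_mat g w) v \<le> b * ip n v v)"
    using edge_bound[OF b k] ..
  note B2 = B2s B2'[THEN conjunct1] bspec[OF B2'[THEN conjunct2], THEN spec]
  let ?E = "\<lambda>e. {w \<in> space ?N. T ^ 5 \<le> \<bar>\<phi> (w e)\<bar> ^ 5}"
  have E: "?E e \<in> sets ?N" "measure ?N (?E e) \<le> M / T ^ 5" if e: "e \<in> offdiag_edges n" for e
  proof -
    have Dprob: "prob_space (?D e)" for e using P Pd by (cases e) auto
    have DP: "?D e = P" using e by (auto simp: offdiag_edges_def)
    have fin: "finite {(i, j). i \<le> j \<and> j < n}"
      by (rule finite_subset[of _ "{..<n} \<times> {..<n}"]) auto
    have sub: "{e} \<subseteq> {(i, j). i \<le> j \<and> j < n}" using e by (auto simp: offdiag_edges_def)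
    have int: "integrable (?D e') (\<lambda>y. \<bar>\<phi> y\<bar> ^ 5)" if "e' \<in> {e}" for e'
      using that five DP by simp
    note ex = product_expectation[of ?D, OF Dprob fin sub int]
    have 1: "integrable ?N (\<lambda>w. \<bar>\<phi> (w e)\<bar> ^ 5)" using ex(1) by (simp add: wigner_noise_def)
    have 2: "(\<integral>w. \<bar>\<phi> (w e)\<bar> ^ 5 \<partial>?N) \<le> M"
      using ex(2) DP M by (simp add: wigner_noise_def)
    have T5: "0 < T ^ 5" using T by simp
    show "?E e \<in> sets ?N" "measure ?N (?E e) \<le> M / T ^ 5"
      using Markov_bad_set[OF 1 _ T5 2] by auto
  qed
  define B1 where "B1 = (\<Union>e\<in>offdiag_edges n. ?E e)"
  have B1: "B1 \<in> sets ?N" unfolding B1_def using E(1) by (intro sets.finite_UN) auto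
  have "measure ?N B1 \<le> (\<Sum>e\<in>offdiag_edges n. measure ?N (?E e))"
    unfolding B1_def using E(1) by (intro measure_UNION_le) auto
  also have "\<dots> \<le> real (card (offdiag_edges n)) * (M / T ^ 5)"
    using E(2) by (intro sum_bounded_above) auto
  also have "\<dots> \<le> (real n)\<^sup>2 * (M / T ^ 5)"
  proof (rule mult_right_mono)
    have "card (offdiag_edges n) \<le> card ({..<n} \<times> {..<n})"
      by (intro card_mono) (auto simp: offdiag_edges_def)
    then have "real (card (offdiag_edges n)) \<le> real (n * n)" by (simp only: card_cartesian_product card_lessThan of_nat_le_iff)
    then show "real (card (offdiag_edges n)) \<le> (real n)\<^sup>2" by (simp add: power2_eq_square)
    show "0 \<le> M / T ^ 5" using T by (simp add: M)
  qed
  finally have B1m: "measure ?N B1 \<le> (real n)\<^sup>2 * (M / T ^ 5)" .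
  have "qf n (edge_mat (\<lambda>y. \<phi> y / sqrt (real n)) w) v \<le> (b + M / T ^ 4 * sqrt (real n)) * ip n v v"
    if w: "w \<in> space ?N - (B1 \<union> B2)" for w v
  proof -
    have \<phi>\<tau>: "\<tau> (w e) = \<phi> (w e)" if "e \<in> offdiag_edges n" for e
    proof -
      have "\<bar>\<phi> (w e)\<bar> ^ 5 < T ^ 5" using w that by (auto simp: B1_def not_le)
      then have "\<bar>\<phi> (w e)\<bar> \<le> T" using T by (meson power_less_imp_less_base less_imp_le order_trans zero_le_one)
      then show ?thesis by (simp add: \<tau>_def)
    qed
    \<comment> \<open>Off the exceptional set truncation changes nothing, and recentring adds a
      multiple of the all-ones matrix without its diagonal.\<close>
    have ent: "edge_mat (\<lambda>y. \<phi> y / sqrt (real n)) w i j =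
        edge_mat g w i j + (if i = j then 0 else \<mu> / sqrt (real n))" if "i < n" "j < n" for i j
      using \<phi>\<tau>[OF edge_in_offdiag[of i j n]] that by (simp add: edge_mat_def g_def diff_divide_distrib)
    have "qf n (edge_mat (\<lambda>y. \<phi> y / sqrt (real n)) w) v =
        (\<Sum>i<n. \<Sum>j<n. edge_mat g w i j * v i * v j + (if i = j then 0 else \<mu> / sqrt (real n)) * v i * v j)"
      unfolding qf_eq_double_sum by (intro sum.cong refl) (simp add: ent distrib_right)
    also have "\<dots> = qf n (edge_mat g w) v + (\<Sum>i<n. \<Sum>j<n. (if i = j then 0 else \<mu> / sqrt (real n)) * v i * v j)"
      unfolding qf_eq_double_sum by (simp only: sum.distrib)
    also have "(\<Sum>i<n. \<Sum>j<n. (if i = j then 0 else \<mu> / sqrt (real n)) * v i * v j) \<le>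
        (\<Sum>i<n. \<Sum>j<n. \<bar>\<mu>\<bar> / sqrt (real n) * (\<bar>v i\<bar> * \<bar>v j\<bar>))"
    proof (intro sum_mono)
      fix i j
      have "\<mu> / sqrt (real n) * v i * v j \<le> \<bar>\<mu> / sqrt (real n) * v i * v j\<bar>"
        by (rule abs_ge_self)
      also have "\<dots> = \<bar>\<mu>\<bar> / sqrt (real n) * (\<bar>v i\<bar> * \<bar>v j\<bar>)" by (simp add: abs_mult)
      finally show "(if i = j then 0 else \<mu> / sqrt (real n)) * v i * v j \<le>
          \<bar>\<mu>\<bar> / sqrt (real n) * (\<bar>v i\<bar> * \<bar>v j\<bar>)" by auto
    qed
    also have "\<dots> = \<bar>\<mu>\<bar> / sqrt (real n) * (\<Sum>i<n. \<bar>v i\<bar>)\<^sup>2"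
      unfolding power2_eq_square sum_product by (simp only: sum_distrib_left)
    also have "\<dots> \<le> \<bar>\<mu>\<bar> / sqrt (real n) * (ip n v v * real n)"
      using sum_squared_le_sum_of_squares[of "\<lambda>i. \<bar>v i\<bar>" "{..<n}"]
      by (intro mult_left_mono) (simp_all add: ip_self_sum_squares)
    also have "\<dots> = \<bar>\<mu>\<bar> * sqrt (real n) * ip n v v"
    proof -
      have "real n / sqrt (real n) = sqrt (real n)" by (rule real_div_sqrt) simp
      moreover have "\<bar>\<mu>\<bar> / sqrt (real n) * (ip n v v * real n) = \<bar>\<mu>\<bar> * (real n / sqrt (real n)) * ip n v v"
        by simp
      ultimately show ?thesis by (simp only:)
    qed
    also have "\<dots> \<le> M / T ^ 4 * sqrt (real n) * ip n v v"
      using \<mu>M by (intro mult_right_mono ip_self_nonneg) auto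
    also have "qf n (edge_mat g w) v \<le> b * ip n v v" using B2(3) w by blast
    finally show ?thesis by (simp add: distrib_right)
  qed
  moreover have "measure ?N (B1 \<union> B2) \<le> (real n)\<^sup>2 * (M / T ^ 5) +
      real n * ((2 + (real (Suc (2 * k)))\<^sup>2 * \<delta>) / b) ^ (2 * k)"
    using measure_Un_le[OF B1 B2(1)] B1m B2(2) by linarith
  ultimately show ?thesis using B1 B2(1) by (meson sets.Un)
qed

lemma eventually_edge_upper:
  fixes \<phi> :: "real \<Rightarrow> real"
  assumes P: "prob_space P" and Pd: "prob_space Pd"
    and \<phi>: "\<phi> \<in> borel_measurable P" and five: "integrable P (\<lambda>y. \<bar>\<phi> y\<bar> ^ 5)"
    and mean: "(\<integral>y. \<phi> y \<partial>P) = 0" and var: "(\<integral>y. (\<phi> y)\<^sup>2 \<partial>P) = 1"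
    and \<epsilon>: "0 < \<epsilon>" and \<eta>: "0 < \<eta>"
  shows "\<forall>\<^sub>F n in sequentially. \<exists>B\<in>sets (wigner_noise P Pd n). measure (wigner_noise P Pd n) B \<le> \<eta> \<and>
    (\<forall>w\<in>space (wigner_noise P Pd n) - B. \<forall>v.
      qf n (edge_mat (\<lambda>y. \<phi> y / sqrt (real n)) w) v \<le> (2 + \<epsilon>) * ip n v v)"
proof -
  define M where "M = (\<integral>y. \<bar>\<phi> y\<bar> ^ 5 \<partial>P)"
  have M0: "0 \<le> M" by (simp add: M_def)
  \<comment> \<open>With this exponent \<open>n^2 / T^5 = n^(-1/4)\<close> closes the union bound,
    and \<open>\<delta> = 2 n^(-1/20)\<close>. Hence \<open>k^2 \<delta>\<close> vanishes for
    \<open>k\<close> near \<open>n^(1/100)\<close>, which still outgrows every multiple of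
    \<open>ln n\<close>.\<close>
  define T where "T n = real n powr (9 / 20)" for n
  define \<delta> where "\<delta> n = 2 * T n / sqrt (real n)" for n
  define k where "k n = nat \<lceil>real n powr (1 / 100)\<rceil>" for n
  \<comment> \<open>Bounds the ratio of trace growth to threshold once the correction to 2 is below
    \<open>\<epsilon> / 4\<close>. As \<open>r < 1\<close>, the prefactor \<open>n\<close> of the
    trace is absorbed by \<open>r ^ (2 * k)\<close>.\<close>
  define r where "r = (2 + \<epsilon> / 4) / (2 + \<epsilon> / 2)"
  have r: "0 < r" "r < 1" using \<epsilon> by (simp_all add: r_def)
  define c where "c = - ln r"
  have c: "0 < c" using r by (simp add: c_def)
  have lims: "(\<lambda>n. (real n)\<^sup>2 * (M / T n ^ 5)) \<longlonglongrightarrow> 0"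
    "(\<lambda>n. M / T n ^ 4 * sqrt (real n)) \<longlonglongrightarrow> 0"
    "(\<lambda>n. (2 * (real n powr (1 / 100) + 1) + 1)\<^sup>2 * \<delta> n) \<longlonglongrightarrow> 0"
    "(\<lambda>n. real n * exp (- (2 * c * real n powr (1 / 100)))) \<longlonglongrightarrow> 0"
    unfolding T_def \<delta>_def using c by real_asymp+
  have e1: "\<forall>\<^sub>F n in sequentially. (real n)\<^sup>2 * (M / T n ^ 5) < \<eta> / 2"
    by (rule order_tendstoD(2)[OF lims(1)]) (use \<eta> in simp)
  have e2: "\<forall>\<^sub>F n in sequentially. M / T n ^ 4 * sqrt (real n) < \<epsilon> / 2"
    by (rule order_tendstoD(2)[OF lims(2)]) (use \<epsilon> in simp)
  have e3: "\<forall>\<^sub>F n in sequentially. (2 * (real n powr (1 / 100) + 1) + 1)\<^sup>2 * \<delta> n < \<epsilon> / 4"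
    by (rule order_tendstoD(2)[OF lims(3)]) (use \<epsilon> in simp)
  have e4: "\<forall>\<^sub>F n in sequentially. real n * exp (- (2 * c * real n powr (1 / 100))) < \<eta> / 2"
    by (rule order_tendstoD(2)[OF lims(4)]) (use \<eta> in simp)
  show ?thesis
    using e1 e2 e3 e4 eventually_gt_at_top[of 0]
  proof eventually_elim
    case (elim n)
    note n = elim(5)
    have T1: "1 \<le> T n" using n by (simp add: T_def ge_one_powr_ge_zero)
    have x1: "1 \<le> real n powr (1 / 100)" using n by (simp add: ge_one_powr_ge_zero)
    have kl: "real n powr (1 / 100) \<le> real (k n)" unfolding k_def by linarith
    have ku: "real (k n) \<le> real n powr (1 / 100) + 1" unfolding k_def using x1 by linarith
    have k0: "0 < k n" using kl x1 by linarith
    have b: "0 < 2 + \<epsilon> / 2" using \<epsilon> by simp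
    have \<delta>0: "0 \<le> \<delta> n" using T1 by (simp add: \<delta>_def)
    obtain B where Bs: "B \<in> sets (wigner_noise P Pd n)" and
      B': "measure (wigner_noise P Pd n) B \<le> (real n)\<^sup>2 * (M / T n ^ 5) +
        real n * ((2 + (real (Suc (2 * k n)))\<^sup>2 * \<delta> n) / (2 + \<epsilon> / 2)) ^ (2 * k n) \<and>
      (\<forall>w\<in>space (wigner_noise P Pd n) - B. \<forall>v. qf n (edge_mat (\<lambda>y. \<phi> y / sqrt (real n)) w) v
        \<le> (2 + \<epsilon> / 2 + M / T n ^ 4 * sqrt (real n)) * ip n v v)"
      using truncated_edge_bound[OF P Pd n \<phi> five mean var T1 \<delta>_def b k0 M_def] ..
    note B = Bs B'[THEN conjunct1] bspec[OF B'[THEN conjunct2], THEN spec]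
    have "(real (Suc (2 * k n)))\<^sup>2 * \<delta> n \<le> (2 * (real n powr (1 / 100) + 1) + 1)\<^sup>2 * \<delta> n"
      using ku \<delta>0 by (intro mult_right_mono power_mono) auto
    then have "(2 + (real (Suc (2 * k n)))\<^sup>2 * \<delta> n) / (2 + \<epsilon> / 2) \<le> r"
      unfolding r_def using elim(3) b by (intro divide_right_mono) auto
    then have "((2 + (real (Suc (2 * k n)))\<^sup>2 * \<delta> n) / (2 + \<epsilon> / 2)) ^ (2 * k n) \<le> r ^ (2 * k n)"
      using \<delta>0 b by (intro power_mono) auto
    also have "r ^ (2 * k n) = exp (- (2 * c * real (k n)))"
    proof -
      have "r ^ (2 * k n) = exp (ln r) ^ (2 * k n)" using r by simp
      also have "\<dots> = exp (real (2 * k n) * ln r)" by (rule exp_of_nat_mult[symmetric])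
      finally show ?thesis by (simp add: c_def mult_ac)
    qed
    also have "\<dots> \<le> exp (- (2 * c * real n powr (1 / 100)))" using kl c by simp
    finally have "real n * ((2 + (real (Suc (2 * k n)))\<^sup>2 * \<delta> n) / (2 + \<epsilon> / 2)) ^ (2 * k n) \<le>
        real n * exp (- (2 * c * real n powr (1 / 100)))"
      by (intro mult_left_mono) auto
    then have "measure (wigner_noise P Pd n) B \<le> \<eta>" using B(2) elim(1,4) by linarith
    moreover have "qf n (edge_mat (\<lambda>y. \<phi> y / sqrt (real n)) w) v \<le> (2 + \<epsilon>) * ip n v v"
      if "w \<in> space (wigner_noise P Pd n) - B" for w v
    proof -
      have "(2 + \<epsilon> / 2 + M / T n ^ 4 * sqrt (real n)) * ip n v v \<le> (2 + \<epsilon>) * ip n v v"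
        by (rule mult_right_mono[OF _ ip_self_nonneg]) (use elim(2) in linarith)
      then show ?thesis using B(3)[OF that, of v] by linarith
    qed
    ultimately show ?case using B(1) by blast
  qed
qed

section \<open>The score function\<close>

text \<open>On \<open>{-R..R}\<close> the integral of \<open>g\<close> is
  \<open>G R - G (- R)\<close>. Were the total nonzero, \<open>|G R| + |G (- R)|\<close> would stay
  above a positive constant for all large \<open>R\<close>, against the integrability of
  \<open>G\<close>.\<close>

lemma integral_derivative_eq_0:
  fixes G g :: "real \<Rightarrow> real"
  assumes deriv: "\<And>x. (G has_real_derivative g x) (at x)" and cont: "\<And>x. isCont g x"
    and G: "integrable lborel G" and g: "integrable lborel g"
  shows "(\<integral>x. g x \<partial>lborel) = 0"
proof (rule ccontr)
  let ?I = "\<integral>x. g x \<partial>lborel"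
  assume I: "?I \<noteq> 0"
  have ftc: "(\<integral>x. g x * indicator {- R..R} x \<partial>lborel) = G R - G (- R)" if "0 \<le> R" for R
    using that deriv cont by (intro integral_FTC_Icc_real) auto
  have lim: "((\<lambda>R. \<integral>x. g x * indicator {- R..R} x \<partial>lborel) \<longlongrightarrow> ?I) at_top"
  proof (rule integral_dominated_convergence_at_top[where w = "\<lambda>x. norm (g x)"])
    show "AE x in lborel. ((\<lambda>R. g x * indicator {- R..R} x) \<longlongrightarrow> g x) at_top"
    proof (intro AE_I2)
      fix x
      have "\<forall>\<^sub>F R in at_top. g x * indicator {- R..R} x = g x"
        using eventually_ge_at_top[of "\<bar>x\<bar>"] by eventually_elim (auto simp: indicator_def)
      then show "((\<lambda>R. g x * indicator {- R..R} x) \<longlongrightarrow> g x) at_top"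
        by (rule tendsto_eventually)
    qed
    show "\<forall>\<^sub>F R in at_top. AE x in lborel. norm (g x * indicator {- R..R} x) \<le> norm (g x)"
      by (intro always_eventually allI AE_I2) (auto simp: indicator_def)
  qed (use g in auto)
  have "\<forall>\<^sub>F R in at_top. dist (\<integral>x. g x * indicator {- R..R} x \<partial>lborel) ?I < \<bar>?I\<bar> / 2"
    using tendstoD[OF lim, of "\<bar>?I\<bar> / 2"] I by simp
  then obtain R0 where R0: "\<And>R. R0 \<le> R \<Longrightarrow> dist (\<integral>x. g x * indicator {- R..R} x \<partial>lborel) ?I < \<bar>?I\<bar> / 2"
    unfolding eventually_at_top_linorder by blast
  define h where "h x = \<bar>G x\<bar> + \<bar>G (- x)\<bar>" for x
  have h_int: "integrable lborel h"
  proof -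
    have "integrable lborel (\<lambda>x. G (0 + (- 1) * x))" using G by (intro lborel_integrable_real_affine) auto
    then show ?thesis unfolding h_def using G by simp
  qed
  have big: "\<bar>?I\<bar> / 2 \<le> h R" if "max R0 0 \<le> R" for R
  proof -
    have "dist (G R - G (- R)) ?I < \<bar>?I\<bar> / 2" using R0[of R] ftc[of R] that by simp
    then show ?thesis unfolding h_def dist_real_def by linarith
  qed
  let ?A = "{x \<in> space lborel. \<bar>?I\<bar> / 2 \<le> h x}"
  have "emeasure lborel ?A \<le> ennreal (1 / (\<bar>?I\<bar> / 2) * (\<integral>x. h x \<partial>lborel))"
    by (rule integral_Markov_inequality[OF h_int]) (use I in \<open>auto simp: h_def\<close>)
  also have "\<dots> < \<infinity>" by (simp add: less_top[symmetric])
  finally have "emeasure lborel ?A < \<infinity>" .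
  moreover have "emeasure lborel {max R0 0..} \<le> emeasure lborel ?A"
    using big h_int by (intro emeasure_mono) auto
  moreover have "emeasure lborel {max R0 0..} = \<infinity>"
  proof -
    have "of_nat n \<le> emeasure lborel {max R0 0..}" for n :: nat
    proof -
      have "emeasure lborel {max R0 0..max R0 0 + real n} = of_nat n"
        by (simp add: ennreal_of_nat_eq_real_of_nat)
      then show ?thesis using emeasure_mono[of "{max R0 0..max R0 0 + real n}" "{max R0 0..}" lborel] by auto
    qed
    then show ?thesis using ennreal_Ex_less_of_nat[of "emeasure lborel {max R0 0..}"]
      by (metis infinity_ennreal_def less_le_not_le less_top)
  qed
  ultimately show False by simp
qed

section \<open>Regularity, moments and integration by parts for the score\<close>

locale score_setting =
  fixes P :: "real measure" and p :: "real \<Rightarrow> real" and C :: real and m :: nat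
  assumes P: "real_distribution P"
    and dens: "P = density lborel (\<lambda>w. ennreal (p w))" and pos: "\<And>w. 0 < p w" and C3: "Ck 3 p"
    and C: "0 < C" and even: "even m" and m2: "2 \<le> m"
    and bound: "\<And>l w. l \<le> 2 \<Longrightarrow> \<bar>(deriv ^^ l) (score p) w\<bar> \<le> C + w ^ m"
    and mom: "\<And>k. 1 \<le> k \<Longrightarrow> k \<le> 5 * m \<Longrightarrow> integrable P (\<lambda>w. \<bar>w\<bar> ^ k)"
begin

abbreviation "f \<equiv> score p"
abbreviation "f1 \<equiv> deriv (score p)"
abbreviation "f2 \<equiv> deriv (deriv (score p))"

lemma prob: "prob_space P" using P by (simp add: real_distribution_def)

lemma sets_P [simp, measurable_cong]: "sets P = sets borel"
  using P by (simp add: real_distribution_def real_distribution_axioms_def)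

lemma p_deriv:
  shows "(p has_real_derivative deriv p w) (at w)"
    and "(deriv p has_real_derivative deriv (deriv p) w) (at w)"
    and "(deriv (deriv p) has_real_derivative deriv (deriv (deriv p)) w) (at w)"
proof -
  have d: "(deriv ^^ j) p field_differentiable (at w)" if "j < 3" for j
    using C3 that unfolding Ck_def by blast
  show "(p has_real_derivative deriv p w) (at w)"
    using d[of 0] by (simp add: DERIV_deriv_iff_field_differentiable)
  show "(deriv p has_real_derivative deriv (deriv p) w) (at w)"
    using d[of 1] by (simp add: DERIV_deriv_iff_field_differentiable)
  show "(deriv (deriv p) has_real_derivative deriv (deriv (deriv p)) w) (at w)"
    using d[of 2] by (simp add: DERIV_deriv_iff_field_differentiable numeral_2_eq_2)
qed

lemma f_deriv_formula: "(f has_real_derivative (deriv p w * deriv p w - deriv (deriv p) w * p w) / (p w)\<^sup>2) (at w)"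
proof -
  have "((\<lambda>w. - deriv p w / p w) has_real_derivative
      (- deriv (deriv p) w * p w - (- deriv p w) * deriv p w) / (p w * p w)) (at w)"
    using pos[of w] by (intro DERIV_divide DERIV_minus p_deriv) simp
  moreover have "f = (\<lambda>w. - deriv p w / p w)" by (auto simp: score_def)
  ultimately show ?thesis by (simp add: power2_eq_square algebra_simps)
qed

lemma f1_eq: "f1 = (\<lambda>w. (deriv p w * deriv p w - deriv (deriv p) w * p w) / (p w)\<^sup>2)"
  using f_deriv_formula by (intro ext DERIV_imp_deriv)

lemma f_deriv: "(f has_real_derivative f1 w) (at w)"
  unfolding f1_eq by (rule f_deriv_formula)

lemma f1_deriv: "(f1 has_real_derivative f2 w) (at w)"
proof -
  have "\<exists>D. (f1 has_real_derivative D) (at w)"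
    unfolding f1_eq using pos[of w]
    by (intro exI) (rule derivative_eq_intros p_deriv refl | simp)+
  then show ?thesis using DERIV_imp_deriv by metis
qed

lemma f_cont: "isCont f w" and f1_cont: "isCont f1 w"
  using f_deriv f1_deriv DERIV_isCont by blast+

lemma p_cont: "isCont p w" and p1_cont: "isCont (deriv p) w" and p2_cont: "isCont (deriv (deriv p)) w"
  using p_deriv DERIV_isCont by blast+

lemma meas [measurable]: "f \<in> borel_measurable borel" "f1 \<in> borel_measurable borel" "p \<in> borel_measurable borel"
  using f_cont f1_cont p_cont
  by (auto intro!: borel_measurable_continuous_onI simp: continuous_on_eq_continuous_at)

lemma integrable_P_iff:
  assumes [measurable]: "h \<in> borel_measurable borel"
  shows "integrable P h \<longleftrightarrow> integrable lborel (\<lambda>w. p w * h w)"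
  unfolding dens using pos by (subst integrable_real_density) (auto intro: less_imp_le)

lemma integral_P_eq:
  assumes [measurable]: "h \<in> borel_measurable borel"
  shows "(\<integral>w. h w \<partial>P) = (\<integral>w. p w * h w \<partial>lborel)"
  unfolding dens using pos by (subst integral_real_density) (auto intro: less_imp_le)

lemma power_sum_le:
  fixes a b :: real
  assumes "0 \<le> a" "0 \<le> b"
  shows "(a + b) ^ r \<le> 2 ^ r * (a ^ r + b ^ r)"
proof -
  have "(a + b) ^ r \<le> (2 * max a b) ^ r" using assms by (intro power_mono) auto
  also have "\<dots> = 2 ^ r * max a b ^ r" by (rule power_mult_distrib)
  also have "\<dots> \<le> 2 ^ r * (a ^ r + b ^ r)" using assms by (intro mult_left_mono) (auto simp: max_def)
  finally show ?thesis .
qed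

text \<open>Growth of order \<open>m\<close> together with moments up to \<open>5 * m\<close> yields
  five moments, the number that the truncation consumes.\<close>

lemma integrable_power_growth:
  assumes [measurable]: "h \<in> borel_measurable borel" and h: "\<And>w. \<bar>h w\<bar> \<le> A + B * \<bar>w\<bar> ^ m"
    and A: "0 \<le> A" "0 \<le> B" and r: "r \<le> 5"
  shows "integrable P (\<lambda>w. \<bar>h w\<bar> ^ r)"
proof -
  interpret prob_space P by (rule prob)
  have k: "integrable P (\<lambda>w. \<bar>w\<bar> ^ (m * r))"
  \<comment> \<open>Moments are assumed from order 1 on, so order 0 is a separate, constant
    case.\<close>
  proof (cases "m * r = 0")
    case True
    show ?thesis unfolding True by simp
  next
    case False
    then have "1 \<le> m * r" by simp
    moreover have "m * r \<le> 5 * m" using mult_le_mono2[OF r, of m] by (simp add: mult.commute)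
    ultimately show ?thesis by (rule mom)
  qed
  show ?thesis
  proof (rule Bochner_Integration.integrable_bound)
    show "integrable P (\<lambda>w. 2 ^ r * (A ^ r + B ^ r * \<bar>w\<bar> ^ (m * r)))"
      using k by (intro integrable_mult_right Bochner_Integration.integrable_add) auto
    show "AE w in P. norm (\<bar>h w\<bar> ^ r) \<le> norm (2 ^ r * (A ^ r + B ^ r * \<bar>w\<bar> ^ (m * r)))"
    proof (intro AE_I2)
      fix w
      have "\<bar>h w\<bar> ^ r \<le> (A + B * \<bar>w\<bar> ^ m) ^ r" using h by (intro power_mono) auto
      also have "\<dots> \<le> 2 ^ r * (A ^ r + (B * \<bar>w\<bar> ^ m) ^ r)" using A by (intro power_sum_le) auto
      also have "\<dots> = 2 ^ r * (A ^ r + B ^ r * \<bar>w\<bar> ^ (m * r))" by (simp add: power_mult_distrib power_mult)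
      finally show "norm (\<bar>h w\<bar> ^ r) \<le> norm (2 ^ r * (A ^ r + B ^ r * \<bar>w\<bar> ^ (m * r)))"
        using A by simp
    qed
  qed simp
qed

lemma f_bound: "\<bar>f w\<bar> \<le> C + 1 * \<bar>w\<bar> ^ m" and f1_bound: "\<bar>f1 w\<bar> \<le> C + 1 * \<bar>w\<bar> ^ m"
  and f2_bound: "\<bar>f2 w\<bar> \<le> C + \<bar>w\<bar> ^ m"
  using bound[of 0 w] bound[of 1 w] bound[of 2 w] even
  by (simp_all add: power_even_abs numeral_2_eq_2)

lemma f_moment: "r \<le> 5 \<Longrightarrow> integrable P (\<lambda>w. \<bar>f w\<bar> ^ r)"
  using f_bound C by (intro integrable_power_growth[where A = C and B = 1]) auto

lemma f1_moment: "r \<le> 5 \<Longrightarrow> integrable P (\<lambda>w. \<bar>f1 w\<bar> ^ r)"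
  using f1_bound C by (intro integrable_power_growth[where A = C and B = 1]) auto

lemma f_int: "integrable P f" and f_sq_int: "integrable P (\<lambda>w. (f w)\<^sup>2)" and f1_int: "integrable P f1"
proof -
  show "integrable P f" using f_moment[of 1] by (subst integrable_abs_iff[symmetric]) auto
  show "integrable P f1" using f1_moment[of 1] by (subst integrable_abs_iff[symmetric]) auto
  show "integrable P (\<lambda>w. (f w)\<^sup>2)" using f_moment[of 2] by simp
qed

lemma p_int: "integrable lborel p"
proof -
  interpret prob_space P by (rule prob)
  show ?thesis using integrable_P_iff[of "\<lambda>_. 1"] by simp
qed

lemma pf: "p w * f w = - deriv p w"
  using pos[of w] by (simp add: score_def)

lemma f_mean: "(\<integral>w. f w \<partial>P) = 0"
proof -
  have "integrable lborel (\<lambda>w. - deriv p w)"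
    using f_int integrable_P_iff[of f] by (simp add: pf)
  then have "integrable lborel (deriv p)" by simp
  then have "(\<integral>w. deriv p w \<partial>lborel) = 0"
    using p_deriv(1) p1_cont p_int by (intro integral_derivative_eq_0)
  then show ?thesis by (simp add: integral_P_eq pf)
qed

text \<open>\<open>p (f' - f^2) = - p''\<close> is the derivative of the integrable function
  \<open>- p'\<close>, so its integral vanishes.\<close>

lemma f1_mean: "(\<integral>w. f1 w \<partial>P) = (\<integral>w. (f w)\<^sup>2 \<partial>P)"
proof -
  have eq: "p w * (f1 w - (f w)\<^sup>2) = - deriv (deriv p) w" for w
    using pos[of w] by (simp add: f1_eq score_def power_divide field_simps power2_eq_square)
  have "integrable P (\<lambda>w. f1 w - (f w)\<^sup>2)" using f1_int f_sq_int by simp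
  then have 1: "integrable lborel (\<lambda>w. - deriv (deriv p) w)"
    by (subst (asm) integrable_P_iff) (simp_all add: eq)
  have 2: "integrable lborel (\<lambda>w. - deriv p w)"
    using f_int integrable_P_iff[of f] by (simp add: pf)
  have "(\<integral>w. - deriv (deriv p) w \<partial>lborel) = 0"
    using p_deriv(2) p2_cont by (intro integral_derivative_eq_0[OF _ _ 2 1]) (auto intro: DERIV_minus)
  then have "(\<integral>w. f1 w - (f w)\<^sup>2 \<partial>P) = 0" by (subst integral_P_eq) (simp_all add: eq)
  then show ?thesis using f1_int f_sq_int by simp
qed

lemma fisher_eq: "fisher_info P p = (\<integral>w. (f w)\<^sup>2 \<partial>P)"
  by (simp add: fisher_info_def score_def power_divide)

text \<open>Integrating the derivative of \<open>w p(w)\<close> gives \<open>E [w f(w)] = 1\<close>, so the score is not almost surely zero.\<close>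

lemma fisher_pos: "0 < fisher_info P p"
proof (rule ccontr)
  assume "\<not> 0 < fisher_info P p"
  then have "(\<integral>w. (f w)\<^sup>2 \<partial>P) = 0"
    unfolding fisher_eq by (intro antisym) auto
  then have ae: "AE w in P. f w = 0"
    using integral_nonneg_eq_0_iff_AE[OF f_sq_int] by simp
  have 1: "integrable lborel (\<lambda>w. p w * w)"
  proof -
    have "integrable P (\<lambda>w. \<bar>w\<bar>)" using mom[of 1] m2 by simp
    then have "integrable P (\<lambda>w. w)" by (subst (asm) integrable_abs_iff) auto
    then show ?thesis using integrable_P_iff[of "\<lambda>w. w"] by simp
  qed
  \<comment> \<open>Under the contrary assumption \<open>w * f w\<close> vanishes almost surely,
    which supplies its integrability.\<close>
  have wf: "integrable P (\<lambda>w. 1 - w * f w)"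
  proof -
    interpret prob_space P by (rule prob)
    have "AE w in P. w * f w = 0" using ae by (rule eventually_mono) simp
    then have "integrable P (\<lambda>w. w * f w) \<longleftrightarrow> integrable P (\<lambda>_. 0::real)"
      by (intro integrable_cong_AE) simp_all
    then show ?thesis by simp
  qed
  have eq: "p w * (1 - w * f w) = deriv p w * w + p w" for w
  proof -
    have "p w * (1 - w * f w) = p w - w * (p w * f w)" by (simp add: right_diff_distrib)
    also have "\<dots> = deriv p w * w + p w" unfolding pf by simp
    finally show ?thesis .
  qed
  then have 2: "integrable lborel (\<lambda>w. deriv p w * w + p w)"
    using wf by (subst (asm) integrable_P_iff) simp_all
  have "(\<integral>w. deriv p w * w + p w \<partial>lborel) = 0"
    using p_cont p1_cont by (intro integral_derivative_eq_0[OF _ _ 1 2])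
      (auto intro!: derivative_eq_intros p_deriv continuous_intros)
  then have "(\<integral>w. 1 - w * f w \<partial>P) = 0" by (subst integral_P_eq) (simp_all add: eq)
  moreover have "AE w in P. 1 - w * f w = 1" using ae by (rule eventually_mono) simp
  then have "(\<integral>w. 1 - w * f w \<partial>P) = (\<integral>w. 1 \<partial>P)"
    by (intro integral_cong_AE) simp_all
  ultimately show False using prob_space.prob_space[OF prob] by simp
qed

end

section \<open>Linearization of the entrywise transform\<close>

text \<open>For symmetric \<open>B\<close> this is the trace of \<open>B^4\<close>.\<close>

definition frob_sq :: "nat \<Rightarrow> (nat \<Rightarrow> nat \<Rightarrow> real) \<Rightarrow> real" where
  "frob_sq n B = (\<Sum>i<n. \<Sum>k<n. (\<Sum>j<n. B i j * B j k)\<^sup>2)"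

lemma mv_frobenius_le:
  "ip n (mv n A u) (mv n A u) \<le> (\<Sum>i<n. \<Sum>k<n. (A i k)\<^sup>2) * ip n u u"
proof -
  have "(mv n A u i)\<^sup>2 \<le> (\<Sum>k<n. (A i k)\<^sup>2) * ip n u u" for i
    using ip_Cauchy_Schwarz[of n "A i" u] by (simp add: ip_def mv_def power2_eq_square)
  then have "(\<Sum>i<n. (mv n A u i)\<^sup>2) \<le> (\<Sum>i<n. (\<Sum>k<n. (A i k)\<^sup>2) * ip n u u)"
    by (intro sum_mono)
  then show ?thesis by (simp add: ip_self_sum_squares sum_distrib_right)
qed

text \<open>The fourth power of the operator norm is at most the squared Frobenius norm of the square.\<close>

lemma qf_le_frob_sq:
  assumes sym: "\<And>i j. i < n \<Longrightarrow> j < n \<Longrightarrow> B i j = B j i"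
    and fb: "frob_sq n B \<le> \<tau> ^ 4" and \<tau>: "0 \<le> \<tau>"
  shows "\<bar>qf n B u\<bar> \<le> \<tau> * ip n u u"
proof -
  let ?A = "\<lambda>i k. \<Sum>j<n. B i j * B j k"
  define U where "U = ip n u u"
  have U: "0 \<le> U" by (simp add: U_def ip_self_nonneg)
  have BB: "mv n B (mv n B u) i = mv n ?A u i" for i
  proof -
    have "mv n B (mv n B u) i = (\<Sum>j<n. \<Sum>k<n. B i j * (B j k * u k))"
      by (simp only: mv_def sum_distrib_left)
    also have "\<dots> = (\<Sum>k<n. \<Sum>j<n. B i j * (B j k * u k))" by (rule sum.swap)
    also have "\<dots> = mv n ?A u i" by (simp only: mv_def sum_distrib_right mult.assoc)
    finally show ?thesis .
  qed
  have 1: "(qf n B u)\<^sup>2 \<le> U * ip n (mv n B u) (mv n B u)"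
    unfolding qf_def U_def by (rule ip_Cauchy_Schwarz)
  have "ip n (mv n B u) (mv n B u) = ip n u (mv n B (mv n B u))"
    using ip_mv_symmetric[of n B u "mv n B u", OF sym] by simp
  also have "\<dots> = ip n u (mv n ?A u)" using BB by (simp add: ip_def)
  finally have e: "ip n (mv n B u) (mv n B u) = ip n u (mv n ?A u)" .
  have 2: "(ip n (mv n B u) (mv n B u))\<^sup>2 \<le> U * ip n (mv n ?A u) (mv n ?A u)"
    unfolding U_def e by (rule ip_Cauchy_Schwarz)
  have 3: "ip n (mv n ?A u) (mv n ?A u) \<le> \<tau> ^ 4 * U"
    unfolding U_def
    by (rule order_trans[OF mv_frobenius_le mult_right_mono[OF fb[unfolded frob_sq_def]]]) (rule ip_self_nonneg)
  have "U * (\<tau> ^ 4 * U) = (\<tau>\<^sup>2 * U)\<^sup>2" by (simp add: power2_eq_square power4_eq_xxxx)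
  then have "(ip n (mv n B u) (mv n B u))\<^sup>2 \<le> (\<tau>\<^sup>2 * U)\<^sup>2"
    using order_trans[OF 2 mult_left_mono[OF 3 U]] by (simp only:)
  then have "ip n (mv n B u) (mv n B u) \<le> \<tau>\<^sup>2 * U"
    by (rule power2_le_imp_le) (simp add: U)
  then have "(qf n B u)\<^sup>2 \<le> U * (\<tau>\<^sup>2 * U)"
    by (rule order_trans[OF 1 mult_left_mono[OF _ U]])
  also have "\<dots> = (\<tau> * U)\<^sup>2" by (simp add: power2_eq_square)
  finally show ?thesis
    using abs_le_square_iff[of "qf n B u" "\<tau> * U"] \<tau> U by (simp add: U_def)
qed

lemma qf_le_entry_squares:
  "\<bar>qf n A v\<bar> \<le> sqrt (\<Sum>i<n. \<Sum>k<n. (A i k)\<^sup>2) * ip n v v"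
proof -
  let ?S = "\<Sum>i<n. \<Sum>k<n. (A i k)\<^sup>2"
  have S: "0 \<le> ?S" by (intro sum_nonneg) auto
  have "(qf n A v)\<^sup>2 \<le> ip n v v * ip n (mv n A v) (mv n A v)" unfolding qf_def by (rule ip_Cauchy_Schwarz)
  also have "\<dots> \<le> ip n v v * (?S * ip n v v)"
    by (intro mult_left_mono mv_frobenius_le ip_self_nonneg)
  also have "\<dots> = (sqrt ?S * ip n v v)\<^sup>2" using S by (simp add: power_mult_distrib power2_eq_square)
  finally show ?thesis
    using abs_le_square_iff[of "qf n A v" "sqrt ?S * ip n v v"] S ip_self_nonneg[of n v] by (simp add: abs_mult)
qed

section \<open>Moments of matrices of edge functions\<close>

lemma edge_mat_expectation:
  assumes P: "prob_space P" and Pd: "prob_space Pd" and g: "integrable P g"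
    and ij: "i \<noteq> j" "i < n" "j < n"
  shows edge_mat_integrable: "integrable (wigner_noise P Pd n) (\<lambda>w. edge_mat g w i j)"
    and edge_mat_integral: "(\<integral>w. edge_mat g w i j \<partial>wigner_noise P Pd n) = (\<integral>y. g y \<partial>P)"
proof -
  let ?D = "\<lambda>(i, j). if i = j then Pd else P" and ?e = "edge i j"
  have Dprob: "prob_space (?D e)" for e using P Pd by (cases e) auto
  have fin: "finite {(i, j). i \<le> j \<and> j < n}"
    by (rule finite_subset[of _ "{..<n} \<times> {..<n}"]) auto
  have DP: "?D ?e = P" using ij by (auto simp: edge_def)
  have sub: "{?e} \<subseteq> {(i, j). i \<le> j \<and> j < n}" using ij by (auto simp: edge_def)
  have int: "integrable (?D e') g" if "e' \<in> {?e}" for e'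
    unfolding singletonD[OF that] DP by (rule g)
  have "integrable (PiM {(i, j). i \<le> j \<and> j < n} ?D) (\<lambda>w. \<Prod>e\<in>{?e}. g (w e))"
    by (rule integrable_product[where g = "\<lambda>_. g", OF Dprob fin sub int])
  then show "integrable (wigner_noise P Pd n) (\<lambda>w. edge_mat g w i j)"
    using ij by (simp add: edge_mat_def wigner_noise_def)
  have "(\<integral>w. (\<Prod>e\<in>{?e}. g (w e)) \<partial>PiM {(i, j). i \<le> j \<and> j < n} ?D) = (\<Prod>e\<in>{?e}. \<integral>y. g y \<partial>?D e)"
    by (rule integral_product[where g = "\<lambda>_. g", OF Dprob fin sub int])
  also have "\<dots> = (\<integral>y. g y \<partial>?D ?e)" by simp
  also have "\<dots> = (\<integral>y. g y \<partial>P)" unfolding DP ..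
  finally show "(\<integral>w. edge_mat g w i j \<partial>wigner_noise P Pd n) = (\<integral>y. g y \<partial>P)"
    using ij by (simp add: edge_mat_def wigner_noise_def)
qed

text \<open>An off-diagonal entry of the squared matrix sums about n orthogonal products and has
  second moment of order n; the n diagonal entries have second moments of order n^2. Both groups
  total n^3, which bounds the operator norm by order n^(3/4).\<close>

lemma frob_sq_expectation:
  fixes b :: "real \<Rightarrow> real"
  assumes P: "prob_space P" and Pd: "prob_space Pd"
    and b: "b \<in> borel_measurable P" and b4: "integrable P (\<lambda>y. b y ^ 4)" and mean: "(\<integral>y. b y \<partial>P) = 0"
  defines "\<beta> \<equiv> \<integral>y. b y ^ 4 \<partial>P"
  shows frob_sq_integrable: "integrable (wigner_noise P Pd n) (\<lambda>w. frob_sq n (edge_mat b w))"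
    and frob_sq_integral_le: "(\<integral>w. frob_sq n (edge_mat b w) \<partial>wigner_noise P Pd n) \<le> 2 * real n ^ 3 * \<beta>"
proof -
  interpret P: prob_space P by (rule P)
  let ?N = "wigner_noise P Pd n" and ?D = "\<lambda>(i, j). if i = j then Pd else P"
  have Dprob: "prob_space (?D e)" for e using P Pd by (cases e) auto
  have DP: "?D e = P" if "e \<in> offdiag_edges n" for e using that by (auto simp: offdiag_edges_def)
  have fin: "finite {(i, j). i \<le> j \<and> j < n}"
    by (rule finite_subset[of _ "{..<n} \<times> {..<n}"]) auto
  have off_sub: "offdiag_edges n \<subseteq> {(i, j). i \<le> j \<and> j < n}" by (auto simp: offdiag_edges_def)
  have b2: "integrable P (\<lambda>y. (b y)\<^sup>2)"
  proof -
    have "integrable P (\<lambda>y. ((b y)\<^sup>2)\<^sup>2)" using b4 by (simp flip: power_mult)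
    then show ?thesis by (rule P.square_integrable_imp_integrable[rotated]) (use b in simp)
  qed
  define v where "v = (\<integral>y. (b y)\<^sup>2 \<partial>P)"
  have v2: "v\<^sup>2 \<le> \<beta>"
  proof -
    have "0 \<le> (\<integral>y. ((b y)\<^sup>2 - v)\<^sup>2 \<partial>P)" by simp
    also have "(\<integral>y. ((b y)\<^sup>2 - v)\<^sup>2 \<partial>P) = (\<integral>y. b y ^ 4 - 2 * v * (b y)\<^sup>2 + v\<^sup>2 \<partial>P)"
      by (intro Bochner_Integration.integral_cong refl) (simp add: power2_eq_square power4_eq_xxxx algebra_simps)
    also have "\<dots> = \<beta> - 2 * v * v + v\<^sup>2"
      using b2 b4 by (simp add: P.prob_space \<beta>_def v_def)
    finally show ?thesis by (simp add: power2_eq_square)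
  qed
  have \<beta>0: "0 \<le> \<beta>" by (simp add: \<beta>_def)
  have entry: "integrable ?N (\<lambda>w. (\<Sum>j<n. edge_mat b w i j * edge_mat b w j k)\<^sup>2) \<and>
    (\<integral>w. (\<Sum>j<n. edge_mat b w i j * edge_mat b w j k)\<^sup>2 \<partial>?N)
      \<le> (if i = k then (real n)\<^sup>2 * \<beta> else real n * \<beta>)" if ik: "i < n" "k < n" for i k
  proof (cases "i = k")
    case False
    let ?S = "{..<n} - {i, k}" and ?E = "\<lambda>j. {edge i j, edge j k}"
    have E: "?E j \<subseteq> offdiag_edges n" if "j \<in> ?S" for j
      using that ik edge_in_offdiag[of i j n] edge_in_offdiag[of j k n] by auto
    have ne: "edge i j \<noteq> edge j k" if "j \<in> ?S" for j using that False by (auto simp: edge_eq_iff)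
    have eq: "(\<Sum>j<n. edge_mat b w i j * edge_mat b w j k) = (\<Sum>j\<in>?S. 1 * (\<Prod>e\<in>?E j. b (w e)))" for w
      using ne by (intro sum.mono_neutral_cong_right) (auto simp: edge_mat_def)
    \<comment> \<open>For \<open>i \<noteq> k\<close> the two edges determine the middle vertex, so
      different \<open>j\<close> are orthogonal and the multiplicity is 1.\<close>
    have uniq: "card {q' \<in> ?S. ?E q' = ?E q} \<le> 1" if "q \<in> ?S" for q
    proof -
      have "{q' \<in> ?S. ?E q' = ?E q} \<subseteq> {q}"
        using that False by (auto simp: doubleton_eq_iff edge_eq_iff)
      then show ?thesis using card_mono[of "{q}" "{q' \<in> ?S. ?E q' = ?E q}"] by simp
    qed
    have DPE: "?D e = P" if "q \<in> ?S" "e \<in> ?E q" for q e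
      using E[OF that(1)] that(2) by (intro DP) blast
    have Bq: "(\<Prod>e\<in>?E q. \<integral>y. (b y)\<^sup>2 \<partial>?D e) \<le> \<beta>" if "q \<in> ?S" for q
    proof -
      have "(\<Prod>e\<in>?E q. \<integral>y. (b y)\<^sup>2 \<partial>?D e) = (\<Prod>e\<in>?E q. v)"
        by (rule prod.cong) (simp_all only: DPE[OF that] v_def)
      also have "\<dots> = v\<^sup>2" using ne[OF that] by (simp add: power2_eq_square)
      finally show ?thesis using v2 by simp
    qed
    have sub: "?E q \<subseteq> {(i, j). i \<le> j \<and> j < n}" if "q \<in> ?S" for q using E[OF that] off_sub by blast
    have m1: "b \<in> borel_measurable (?D e)" if "q \<in> ?S" "e \<in> ?E q" for q e
      using b by (simp only: DPE[OF that])
    have m2: "integrable (?D e) (\<lambda>y. (b y)\<^sup>2)" if "q \<in> ?S" "e \<in> ?E q" for q e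
      using b2 by (simp only: DPE[OF that])
    have m3: "(\<integral>y. b y \<partial>?D e) = 0" if "q \<in> ?S" "e \<in> ?E q" for q e
      using mean by (simp only: DPE[OF that])
    have finS: "finite ?S" by simp
    have int: "integrable (PiM {(i, j). i \<le> j \<and> j < n} ?D) (\<lambda>w. (\<Sum>j\<in>?S. 1 * (\<Prod>e\<in>?E j. b (w e)))\<^sup>2)"
      by (rule integrable_edge_sum_square[where \<phi> = "\<lambda>q e. b" and E = ?E, OF Dprob fin finS sub m1 m2 m3 Bq \<beta>0 uniq])
    have "(\<integral>w. (\<Sum>j\<in>?S. 1 * (\<Prod>e\<in>?E j. b (w e)))\<^sup>2 \<partial>PiM {(i, j). i \<le> j \<and> j < n} ?D)
        \<le> real 1 * \<beta> * (\<Sum>q\<in>?S. 1\<^sup>2)"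
      by (rule integral_edge_sum_square_le[where \<phi> = "\<lambda>q e. b" and E = ?E, OF Dprob fin finS sub m1 m2 m3 Bq \<beta>0 uniq])
    also have "\<dots> \<le> real n * \<beta>"
    proof -
      have "real (card ?S) \<le> real n" using card_mono[of "{..<n}" ?S] by auto
      from mult_left_mono[OF this \<beta>0] show ?thesis by (simp add: mult.commute)
    qed
    finally show ?thesis using int False unfolding eq wigner_noise_def by simp
  next
    case True
    have one: "integrable ?N (\<lambda>w. edge_mat b w i j ^ 4) \<and> (\<integral>w. edge_mat b w i j ^ 4 \<partial>?N) \<le> \<beta>"
      if j: "j < n" for j
    proof (cases "i = j")
      case True
      then show ?thesis using \<beta>0 by (simp add: edge_mat_def)
    next
      case False
      then show ?thesis
        using edge_mat_integrable[OF P Pd b4 False ik(1) j] edge_mat_integral[OF P Pd b4 False ik(1) j]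
        by (simp add: edge_mat_def \<beta>_def)
    qed
    have sq: "(\<Sum>j<n. edge_mat b w i j * edge_mat b w j k)\<^sup>2 \<le> real n * (\<Sum>j<n. edge_mat b w i j ^ 4)" for w
    proof -
      have "edge_mat b w i j * edge_mat b w j k = (edge_mat b w i j)\<^sup>2" for j
        using edge_mat_commute[of b w i j] True by (simp add: power2_eq_square)
      then have "(\<Sum>j<n. edge_mat b w i j * edge_mat b w j k)\<^sup>2 = (\<Sum>j<n. (edge_mat b w i j)\<^sup>2)\<^sup>2" by simp
      also have "\<dots> \<le> (\<Sum>j<n. ((edge_mat b w i j)\<^sup>2)\<^sup>2) * real (card {..<n})"
        by (rule sum_squared_le_sum_of_squares)
      finally show ?thesis by (simp add: mult.commute)
    qed
    have int4: "integrable ?N (\<lambda>w. real n * (\<Sum>j<n. edge_mat b w i j ^ 4))"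
      using one by (intro integrable_mult_right Bochner_Integration.integrable_sum) auto
    have me: "(\<lambda>w. edge_mat b w i' j') \<in> borel_measurable ?N" if "i' < n" "j' < n" for i' j'
    proof (cases "i' = j'")
      case False
      then have e: "edge i' j' \<in> offdiag_edges n" using that by (intro edge_in_offdiag)
      have "(\<lambda>w. w (edge i' j')) \<in> measurable ?N (?D (edge i' j'))"
        unfolding wigner_noise_def by (rule measurable_component_singleton) (rule subsetD[OF off_sub e])
      then have "(\<lambda>w. w (edge i' j')) \<in> measurable ?N P" by (simp only: DP[OF e])
      then show ?thesis using b False by (simp add: edge_mat_def measurable_compose)
    qed (simp add: edge_mat_def)
    have meas: "(\<lambda>w. (\<Sum>j<n. edge_mat b w i j * edge_mat b w j k)\<^sup>2) \<in> borel_measurable ?N"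
      using me ik by (intro borel_measurable_power borel_measurable_sum borel_measurable_times) auto
    have int: "integrable ?N (\<lambda>w. (\<Sum>j<n. edge_mat b w i j * edge_mat b w j k)\<^sup>2)"
    proof (rule Bochner_Integration.integrable_bound[OF int4 meas])
      show "AE w in ?N. norm ((\<Sum>j<n. edge_mat b w i j * edge_mat b w j k)\<^sup>2) \<le>
          norm (real n * (\<Sum>j<n. edge_mat b w i j ^ 4))"
      proof (intro AE_I2)
        fix w
        have "0 \<le> real n * (\<Sum>j<n. edge_mat b w i j ^ 4)" by (intro mult_nonneg_nonneg sum_nonneg) auto
        then show "norm ((\<Sum>j<n. edge_mat b w i j * edge_mat b w j k)\<^sup>2) \<le>
          norm (real n * (\<Sum>j<n. edge_mat b w i j ^ 4))" using sq[of w] by simp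
      qed
    qed
    have "(\<integral>w. (\<Sum>j<n. edge_mat b w i j * edge_mat b w j k)\<^sup>2 \<partial>?N) \<le>
        (\<integral>w. real n * (\<Sum>j<n. edge_mat b w i j ^ 4) \<partial>?N)"
      using int int4 sq by (rule integral_mono)
    also have "\<dots> = real n * (\<Sum>j<n. \<integral>w. edge_mat b w i j ^ 4 \<partial>?N)"
      using one by (subst integral_mult_right_zero, subst Bochner_Integration.integral_sum) auto
    also have "\<dots> \<le> real n * (\<Sum>j<n. \<beta>)" using one by (intro mult_left_mono sum_mono) auto
    also have "\<dots> = (real n)\<^sup>2 * \<beta>" by (simp add: power2_eq_square)
    finally show ?thesis using int True by simp
  qed
  show "integrable ?N (\<lambda>w. frob_sq n (edge_mat b w))"
    unfolding frob_sq_def using entry by (intro Bochner_Integration.integrable_sum) auto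
  have "(\<integral>w. frob_sq n (edge_mat b w) \<partial>?N) =
      (\<Sum>i<n. \<Sum>k<n. \<integral>w. (\<Sum>j<n. edge_mat b w i j * edge_mat b w j k)\<^sup>2 \<partial>?N)"
    unfolding frob_sq_def using entry
    by (subst Bochner_Integration.integral_sum)
       (auto intro!: sum.cong Bochner_Integration.integrable_sum Bochner_Integration.integral_sum)
  also have "\<dots> \<le> (\<Sum>i<n. \<Sum>k<n. of_bool (i = k) * ((real n)\<^sup>2 * \<beta>) + real n * \<beta>)"
  proof (intro sum_mono)
    fix i k assume "i \<in> {..<n}" "k \<in> {..<n}"
    then have "(\<integral>w. (\<Sum>j<n. edge_mat b w i j * edge_mat b w j k)\<^sup>2 \<partial>?N)
      \<le> (if i = k then (real n)\<^sup>2 * \<beta> else real n * \<beta>)" using entry[of i k] by blast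
    also have "\<dots> \<le> of_bool (i = k) * ((real n)\<^sup>2 * \<beta>) + real n * \<beta>" using \<beta>0 by simp
    finally show "(\<integral>w. (\<Sum>j<n. edge_mat b w i j * edge_mat b w j k)\<^sup>2 \<partial>?N)
      \<le> of_bool (i = k) * ((real n)\<^sup>2 * \<beta>) + real n * \<beta>" .
  qed
  also have "\<dots> = (\<Sum>i<n. (real n)\<^sup>2 * \<beta> + real n * (real n * \<beta>))"
    by (intro sum.cong refl) (simp add: sum.distrib sum_of_bool_left)
  also have "\<dots> = 2 * real n ^ 3 * \<beta>" by (simp add: power2_eq_square power3_eq_cube)
  finally show "(\<integral>w. frob_sq n (edge_mat b w) \<partial>?N) \<le> 2 * real n ^ 3 * \<beta>" .
qed

text \<open>The entries of \<open>transformed_matrix\<close> as a plain function: rescaling by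
  \<open>sqrt n\<close> restores the noise entry and leaves the factor \<open>lam * sqrt n\<close>
  on \<open>x i * x j\<close>.\<close>

definition signal_mat :: "(real \<Rightarrow> real) \<Rightarrow> real \<Rightarrow> nat \<Rightarrow> (nat \<Rightarrow> real) \<Rightarrow> (nat \<times> nat \<Rightarrow> real) \<Rightarrow> nat \<Rightarrow> nat \<Rightarrow> real" where
  "signal_mat g lam n x w i j =
     (if i = j then 0 else g (w (edge i j) + lam * sqrt (real n) * (x i * x j)))"

lemma qf_add: "qf n (\<lambda>i j. A i j + B i j) v = qf n A v + qf n B v"
  by (simp add: qf_eq_double_sum sum.distrib ring_distribs)

lemma qf_scale: "qf n (\<lambda>i j. c * A i j) v = c * qf n A v"
  by (simp add: qf_eq_double_sum sum_distrib_left mult.assoc)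

text \<open>Entrywise multiplication by a rank-one matrix is conjugation by the diagonal matrix of
  \<open>x\<close>, so a bound on the form of \<open>B\<close> carries over with the factor max
  \<open>x_i^2\<close>.\<close>

lemma qf_hadamard_rank_one: "qf n (\<lambda>i j. x i * x j * B i j) v = qf n B (\<lambda>i. x i * v i)"
  by (simp add: qf_eq_double_sum mult_ac)

lemma qf_rank_one_offdiag:
  "qf n (\<lambda>i j. if i = j then 0 else x i * x j) v = (ip n v x)\<^sup>2 - (\<Sum>i<n. (x i)\<^sup>2 * (v i)\<^sup>2)"
proof -
  have "qf n (\<lambda>i j. if i = j then 0 else x i * x j) v =
      (\<Sum>i<n. \<Sum>j<n. (v i * x i) * (v j * x j) - of_bool (i = j) * ((x j)\<^sup>2 * (v j)\<^sup>2))"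
    unfolding qf_eq_double_sum by (intro sum.cong refl) (simp add: power2_eq_square mult_ac)
  also have "\<dots> = (\<Sum>i<n. \<Sum>j<n. (v i * x i) * (v j * x j)) - (\<Sum>i<n. (x i)\<^sup>2 * (v i)\<^sup>2)"
    by (simp add: sum_subtractf sum_of_bool_left)
  also have "(\<Sum>i<n. \<Sum>j<n. (v i * x i) * (v j * x j)) = (ip n v x)\<^sup>2"
    by (simp only: ip_def power2_eq_square sum_product)
  finally show ?thesis .
qed

lemma ip_weighted_le:
  assumes "\<And>i. i < n \<Longrightarrow> (x i)\<^sup>2 \<le> \<rho>"
  shows "ip n (\<lambda>i. x i * v i) (\<lambda>i. x i * v i) \<le> \<rho> * ip n v v"
  unfolding ip_self_sum_squares sum_distrib_left power_mult_distrib
  using assms by (intro sum_mono mult_right_mono) auto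

context score_setting
begin

abbreviation "F \<equiv> fisher_info P p"

text \<open>Dominates the second derivative of the score within distance 1 of
  \<open>w\<close>.\<close>

definition "taylor_bound w = C + (\<bar>w\<bar> + 1) ^ m"

lemma taylor_remainder_le:
  assumes t: "\<bar>t\<bar> \<le> 1"
  shows "\<bar>f (w + t) - f w - t * f1 w\<bar> \<le> t\<^sup>2 * taylor_bound w"
\<comment> \<open>Taylor's theorem with Lagrange remainder asks for two distinct points.\<close>
proof (cases "t = 0")
  case False
  define D where "D k = (if k = 0 then f else if k = 1 then f1 else f2)" for k :: nat
  have "\<exists>\<xi>. (if w + t < w then w + t < \<xi> \<and> \<xi> < w else w < \<xi> \<and> \<xi> < w + t) \<and>
      f (w + t) = (\<Sum>k<2. D k w / fact k * (w + t - w) ^ k) + D 2 \<xi> / fact 2 * (w + t - w) ^ 2"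
  proof (rule Taylor[where a = "w - 1" and b = "w + 1"])
    show "\<forall>k s. k < 2 \<and> w - 1 \<le> s \<and> s \<le> w + 1 \<longrightarrow> DERIV (D k) s :> D (Suc k) s"
      by (auto simp: D_def less_2_cases_iff f_deriv f1_deriv)
  qed (use t False in \<open>auto simp: D_def\<close>)
  then obtain \<xi> where "if w + t < w then w + t < \<xi> \<and> \<xi> < w else w < \<xi> \<and> \<xi> < w + t"
    and eq: "f (w + t) = (\<Sum>k<2. D k w / fact k * (w + t - w) ^ k) + D 2 \<xi> / fact 2 * (w + t - w) ^ 2" by blast
  then have \<xi>: "\<bar>\<xi>\<bar> \<le> \<bar>w\<bar> + 1" using t by (auto split: if_splits)
  have "f (w + t) - f w - t * f1 w = t\<^sup>2 * (f2 \<xi> / 2)"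
    unfolding eq by (simp add: D_def numeral_2_eq_2)
  moreover have "\<bar>f2 \<xi> / 2\<bar> \<le> taylor_bound w"
  proof -
    have "\<bar>f2 \<xi>\<bar> \<le> C + (\<bar>w\<bar> + 1) ^ m"
      using f2_bound[of \<xi>] power_mono[OF \<xi>, of m] by simp
    then show ?thesis unfolding taylor_bound_def using C by linarith
  qed
  then have "t\<^sup>2 * \<bar>f2 \<xi> / 2\<bar> \<le> t\<^sup>2 * taylor_bound w" by (rule mult_left_mono) simp
  ultimately show ?thesis by (simp only: abs_mult abs_power2)
qed (use C in \<open>simp add: taylor_bound_def\<close>)

lemma taylor_bound_sq_int: "integrable P (\<lambda>w. (taylor_bound w)\<^sup>2)"
proof -
  have "\<bar>taylor_bound w\<bar> \<le> (C + 2 ^ m) + 2 ^ m * \<bar>w\<bar> ^ m" for w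
    using power_sum_le[of "\<bar>w\<bar>" 1 m] C by (simp add: taylor_bound_def distrib_left)
  then have "integrable P (\<lambda>w. \<bar>taylor_bound w\<bar> ^ 2)"
    using C by (intro integrable_power_growth[where A = "C + 2 ^ m" and B = "2 ^ m"]) (auto simp: taylor_bound_def)
  then show ?thesis by simp
qed

text \<open>The three errors are, in order, the missing diagonal of the spike, the fluctuation of
  \<open>f'\<close> about its mean \<open>F\<close>, and the Taylor remainder measured in Frobenius
  norm.\<close>

lemma signal_mat_linearization:
  assumes n: "0 < n" and lam: "0 \<le> lam" and \<rho>: "0 \<le> \<rho>" and x: "\<And>i. i < n \<Longrightarrow> (x i)\<^sup>2 \<le> \<rho>"
    and small: "lam * sqrt (real n) * \<rho> \<le> 1" and \<tau>: "0 \<le> \<tau>"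
    and frob: "frob_sq n (edge_mat (\<lambda>y. f1 y - F) w) \<le> \<tau> ^ 4"
    and rest: "(\<Sum>i<n. \<Sum>k<n. edge_mat (\<lambda>y. (taylor_bound y)\<^sup>2) w i k) \<le> S"
  defines "s \<equiv> sqrt (real n) * sqrt F"
  shows "\<bar>qf n (signal_mat f lam n x w) v / s - qf n (edge_mat (\<lambda>y. f y / sqrt F / sqrt (real n)) w) v
      - lam * sqrt F * (ip n v x)\<^sup>2\<bar>
    \<le> (lam * sqrt F * \<rho> + lam / sqrt F * (\<rho> * \<tau>) + (lam * sqrt (real n) * \<rho>)\<^sup>2 * sqrt S / s) * ip n v v"
proof -
  have Fpos: "0 < F" by (rule fisher_pos)
  have s: "0 < s" using n Fpos by (simp add: s_def)
  define c where "c = lam * sqrt (real n)"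
  have c0: "0 \<le> c" using lam by (simp add: c_def)
  define R where "R i j = (if i = j then 0 else
    f (w (edge i j) + c * (x i * x j)) - f (w (edge i j)) - c * (x i * x j) * f1 (w (edge i j)))" for i j
  have xx: "\<bar>x i * x j\<bar> \<le> \<rho>" if "i < n" "j < n" for i j
  proof -
    have "\<bar>x i\<bar> \<le> sqrt \<rho>" if "i < n" for i using x[OF that] by (rule real_le_rsqrt[of "\<bar>x i\<bar>", unfolded power2_abs])
    then have "\<bar>x i\<bar> * \<bar>x j\<bar> \<le> sqrt \<rho> * sqrt \<rho>" using that \<rho> by (intro mult_mono) auto
    then show ?thesis using \<rho> by (simp add: abs_mult)
  qed
  have R: "(R i j)\<^sup>2 \<le> (c * \<rho>) ^ 4 * edge_mat (\<lambda>y. (taylor_bound y)\<^sup>2) w i j" if ij: "i < n" "j < n" for i j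
  proof (cases "i = j")
    case True
    then show ?thesis by (simp add: R_def edge_mat_def)
  next
    case False
    let ?t = "c * (x i * x j)"
    have t: "\<bar>?t\<bar> \<le> c * \<rho>" using xx[OF ij] c0 by (simp add: abs_mult mult_left_mono)
    then have "\<bar>?t\<bar> \<le> 1" using small by (simp add: c_def)
    then have "\<bar>R i j\<bar> \<le> ?t\<^sup>2 * taylor_bound (w (edge i j))"
      unfolding R_def using taylor_remainder_le[of ?t "w (edge i j)"] False by simp
    also have "\<dots> \<le> (c * \<rho>)\<^sup>2 * taylor_bound (w (edge i j))"
      using t C by (intro mult_right_mono) (auto simp: taylor_bound_def intro: abs_le_square_iff[THEN iffD1])
    finally have "\<bar>R i j\<bar>\<^sup>2 \<le> ((c * \<rho>)\<^sup>2 * taylor_bound (w (edge i j)))\<^sup>2"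
      by (rule power_mono) simp
    then have "(R i j)\<^sup>2 \<le> ((c * \<rho>)\<^sup>2 * taylor_bound (w (edge i j)))\<^sup>2" by simp
    also have "\<dots> = (c * \<rho>) ^ 4 * (taylor_bound (w (edge i j)))\<^sup>2"
      by (simp add: power_mult_distrib power2_eq_square power4_eq_xxxx)
    finally show ?thesis using False by (simp add: edge_mat_def)
  qed
  \<comment> \<open>Replacing \<open>f'\<close> by its mean \<open>F\<close> produces the spike; the
    centred rest multiplies the rank-one matrix entrywise.\<close>
  have split: "signal_mat f lam n x w i j = edge_mat f w i j +
      (c * F * (if i = j then 0 else x i * x j) +
       (c * (x i * x j * edge_mat (\<lambda>y. f1 y - F) w i j) + R i j))" for i j
    by (simp add: signal_mat_def edge_mat_def R_def c_def algebra_simps)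
  have "qf n (signal_mat f lam n x w) v =
      qf n (\<lambda>i j. edge_mat f w i j + (c * F * (if i = j then 0 else x i * x j) +
       (c * (x i * x j * edge_mat (\<lambda>y. f1 y - F) w i j) + R i j))) v"
    by (simp only: split[symmetric])
  also have "\<dots> = qf n (edge_mat f w) v + (c * F * ((ip n v x)\<^sup>2 - (\<Sum>i<n. (x i)\<^sup>2 * (v i)\<^sup>2)) +
      (c * qf n (edge_mat (\<lambda>y. f1 y - F) w) (\<lambda>i. x i * v i) + qf n R v))"
    by (simp only: qf_add qf_scale qf_hadamard_rank_one qf_rank_one_offdiag)
  finally have Q: "qf n (signal_mat f lam n x w) v / s = qf n (edge_mat f w) v / s
      + c * F / s * (ip n v x)\<^sup>2 - c * F / s * (\<Sum>i<n. (x i)\<^sup>2 * (v i)\<^sup>2)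
      + c / s * qf n (edge_mat (\<lambda>y. f1 y - F) w) (\<lambda>i. x i * v i) + qf n R v / s"
    by (simp add: add_divide_distrib right_diff_distrib diff_divide_distrib)
  have Z: "qf n (edge_mat f w) v / s = qf n (edge_mat (\<lambda>y. f y / sqrt F / sqrt (real n)) w) v"
  proof -
    have "edge_mat (\<lambda>y. f y / sqrt F / sqrt (real n)) w = (\<lambda>i j. (1 / s) * edge_mat f w i j)"
      by (intro ext) (simp add: edge_mat_def s_def mult.commute)
    then show ?thesis by (simp only: qf_scale) simp
  qed
  have cs: "c / s = lam / sqrt F" "c * F / s = lam * sqrt F"
    using n Fpos by (simp_all add: c_def s_def field_simps)
  define V where "V = ip n v v"
  have V: "0 \<le> V" by (simp add: V_def ip_self_nonneg)
  have D: "\<bar>\<Sum>i<n. (x i)\<^sup>2 * (v i)\<^sup>2\<bar> \<le> \<rho> * V"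
    using ip_weighted_le[of n x \<rho> v, OF x] unfolding V_def
    by (simp add: ip_self_sum_squares power_mult_distrib sum_nonneg)
  have E: "\<bar>qf n (edge_mat (\<lambda>y. f1 y - F) w) (\<lambda>i. x i * v i)\<bar> \<le> \<tau> * (\<rho> * V)"
    unfolding V_def
    by (rule order_trans[OF qf_le_frob_sq[OF edge_mat_commute frob \<tau>] mult_left_mono[OF ip_weighted_le[OF x] \<tau>]])
  have G: "\<bar>qf n R v\<bar> \<le> (c * \<rho>)\<^sup>2 * sqrt S * V"
  proof -
    have "(\<Sum>i<n. \<Sum>k<n. (R i k)\<^sup>2) \<le> (\<Sum>i<n. \<Sum>k<n. (c * \<rho>) ^ 4 * edge_mat (\<lambda>y. (taylor_bound y)\<^sup>2) w i k)"
      using R by (intro sum_mono) simp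
    also have "\<dots> \<le> (c * \<rho>) ^ 4 * S"
      using mult_left_mono[OF rest, of "(c * \<rho>) ^ 4"] by (simp add: sum_distrib_left)
    finally have "sqrt (\<Sum>i<n. \<Sum>k<n. (R i k)\<^sup>2) \<le> sqrt ((c * \<rho>) ^ 4 * S)" by simp
    also have "\<dots> = (c * \<rho>)\<^sup>2 * sqrt S"
    proof -
      have "(c * \<rho>) ^ 4 = ((c * \<rho>)\<^sup>2)\<^sup>2" by (simp flip: power_mult)
      then show ?thesis by (simp only: real_sqrt_mult real_sqrt_abs abs_power2)
    qed
    finally show ?thesis unfolding V_def
      by (intro order_trans[OF qf_le_entry_squares] mult_right_mono ip_self_nonneg)
  qed
  have "\<bar>lam * sqrt F * (\<Sum>i<n. (x i)\<^sup>2 * (v i)\<^sup>2)\<bar> \<le> lam * sqrt F * (\<rho> * V)"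
    using D lam Fpos by (simp add: abs_mult mult_left_mono)
  moreover have "\<bar>lam / sqrt F * qf n (edge_mat (\<lambda>y. f1 y - F) w) (\<lambda>i. x i * v i)\<bar> \<le> lam / sqrt F * (\<tau> * (\<rho> * V))"
    unfolding abs_mult using E lam Fpos by (intro mult_mono) auto
  moreover have "\<bar>qf n R v / s\<bar> \<le> (c * \<rho>)\<^sup>2 * sqrt S * V / s"
    using G s by (simp add: divide_right_mono)
  moreover have "(lam * sqrt F * \<rho> + lam / sqrt F * (\<rho> * \<tau>) + (lam * sqrt (real n) * \<rho>)\<^sup>2 * sqrt S / s) * V
    = lam * sqrt F * (\<rho> * V) + lam / sqrt F * (\<tau> * (\<rho> * V)) + (c * \<rho>)\<^sup>2 * sqrt S * V / s"
    unfolding c_def by (simp add: ring_distribs mult_ac)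
  ultimately show ?thesis unfolding Q Z cs V_def[symmetric] by linarith
qed

end

lemma edge_mat_sum_expectation:
  assumes P: "prob_space P" and Pd: "prob_space Pd" and g: "integrable P g" and nonneg: "\<And>y. 0 \<le> g y"
  shows edge_mat_sum_integrable: "integrable (wigner_noise P Pd n) (\<lambda>w. \<Sum>i<n. \<Sum>j<n. edge_mat g w i j)"
    and edge_mat_sum_integral_le:
      "(\<integral>w. (\<Sum>i<n. \<Sum>j<n. edge_mat g w i j) \<partial>wigner_noise P Pd n) \<le> (real n)\<^sup>2 * (\<integral>y. g y \<partial>P)"
proof -
  let ?N = "wigner_noise P Pd n"
  have one: "integrable ?N (\<lambda>w. edge_mat g w i j)"
    "(\<integral>w. edge_mat g w i j \<partial>?N) \<le> (\<integral>y. g y \<partial>P)" if "i < n" "j < n" for i j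
  proof -
    show "integrable ?N (\<lambda>w. edge_mat g w i j)"
      using edge_mat_integrable[OF P Pd g _ that] by (cases "i = j") (auto simp: edge_mat_def)
    show "(\<integral>w. edge_mat g w i j \<partial>?N) \<le> (\<integral>y. g y \<partial>P)"
    proof (cases "i = j")
      case True
      have "0 \<le> (\<integral>y. g y \<partial>P)" using nonneg by (intro integral_nonneg_AE AE_I2)
      then show ?thesis using True by (simp add: edge_mat_def)
    qed (simp add: edge_mat_integral[OF P Pd g _ that])
  qed
  show "integrable ?N (\<lambda>w. \<Sum>i<n. \<Sum>j<n. edge_mat g w i j)"
    using one by (intro Bochner_Integration.integrable_sum) auto
  have "(\<integral>w. (\<Sum>i<n. \<Sum>j<n. edge_mat g w i j) \<partial>?N) = (\<Sum>i<n. \<Sum>j<n. \<integral>w. edge_mat g w i j \<partial>?N)"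
    using one by (subst Bochner_Integration.integral_sum)
       (auto intro!: sum.cong Bochner_Integration.integrable_sum Bochner_Integration.integral_sum)
  also have "\<dots> \<le> (\<Sum>i<n. \<Sum>j<n. \<integral>y. g y \<partial>P)" using one(2) by (intro sum_mono) auto
  also have "\<dots> = (real n)\<^sup>2 * (\<integral>y. g y \<partial>P)" by (simp add: power2_eq_square mult.assoc)
  finally show "(\<integral>w. (\<Sum>i<n. \<Sum>j<n. edge_mat g w i j) \<partial>?N) \<le> (real n)\<^sup>2 * (\<integral>y. g y \<partial>P)" .
qed

context score_setting
begin

lemma eventually_linearization:
  assumes Pd: "prob_space Pd" and lam: "0 \<le> lam" and \<alpha>: "\<alpha> < 1 / 8" and \<epsilon>: "0 < \<epsilon>" and \<eta>: "0 < \<eta>"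
  shows "\<forall>\<^sub>F n in sequentially. \<forall>x. (\<forall>i<n. \<bar>x i\<bar> \<le> real n powr (- 1 / 2 + \<alpha>)) \<longrightarrow>
    (\<exists>B\<in>sets (wigner_noise P Pd n). measure (wigner_noise P Pd n) B \<le> \<eta> \<and>
      (\<forall>w\<in>space (wigner_noise P Pd n) - B. \<forall>v.
        \<bar>qf n (signal_mat f lam n x w) v / (sqrt (real n) * sqrt F)
          - qf n (edge_mat (\<lambda>y. f y / sqrt F / sqrt (real n)) w) v - lam * sqrt F * (ip n v x)\<^sup>2\<bar>
        \<le> \<epsilon> * ip n v v))"
proof -
  interpret P: prob_space P by (rule prob)
  define b where "b y = f1 y - F" for y
  define \<beta> where "\<beta> = (\<integral>y. b y ^ 4 \<partial>P)"
  define Q where "Q = (\<integral>y. (taylor_bound y)\<^sup>2 \<partial>P)"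
  have \<beta>0: "0 \<le> \<beta>" and Q0: "0 \<le> Q" by (simp_all add: \<beta>_def Q_def)
  have Fpos: "0 < F" by (rule fisher_pos)
  \<comment> \<open>With these constants Markov's inequality leaves each of the two bad events
    probability at most \<open>\<eta> / 2\<close>; adding 1 keeps the constants positive when a
    moment vanishes.\<close>
  define K1 where "K1 = (4 * (\<beta> + 1) / \<eta>) powr (1 / 4)"
  define K2 where "K2 = 2 * (Q + 1) / \<eta>"
  have K10: "0 < K1" and K20: "0 < K2" using \<beta>0 Q0 \<eta> by (simp_all add: K1_def K2_def)
  have K14: "K1 ^ 4 = 4 * (\<beta> + 1) / \<eta>"
    using \<beta>0 \<eta> K10 unfolding K1_def by (subst powr_realpow[symmetric]) (auto simp: powr_powr)
  \<comment> \<open>\<open>\<rho>\<close> bounds the squared entries of \<open>x\<close>,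
    \<open>\<tau>\<close> the norm of the matrix of the centred \<open>f'\<close>, and
    \<open>S\<close> the sum of the squared Taylor bounds over all entries.\<close>
  define \<rho> \<tau> S where "\<rho> n = real n powr (- 1 + 2 * \<alpha>)" and "\<tau> n = K1 * real n powr (3 / 4)"
    and "S n = K2 * (real n)\<^sup>2" for n
  define e where "e n = lam * sqrt F * \<rho> n + lam / sqrt F * (\<rho> n * \<tau> n)
    + (lam * sqrt (real n) * \<rho> n)\<^sup>2 * sqrt (S n) / (sqrt (real n) * sqrt F)" for n
  have pow0: "(\<lambda>n. real n powr a) \<longlonglongrightarrow> 0" if "a < 0" for a
    using that by (rule tendsto_neg_powr[OF _ filterlim_real_sequentially])
  have \<rho>\<tau>: "\<rho> n * \<tau> n = K1 * real n powr (- 1 / 4 + 2 * \<alpha>)" for n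
    unfolding \<rho>_def \<tau>_def by (simp add: mult.left_commute powr_add[symmetric])
  have sq: "sqrt (real n) * \<rho> n = real n powr (- 1 / 2 + 2 * \<alpha>)" for n
    unfolding \<rho>_def powr_half_sqrt[symmetric, OF of_nat_0_le_iff] by (simp add: powr_add[symmetric])
  have rem: "(lam * sqrt (real n) * \<rho> n)\<^sup>2 * sqrt (S n) / (sqrt (real n) * sqrt F)
      = lam\<^sup>2 * sqrt K2 / sqrt F * real n powr (- 1 / 2 + 4 * \<alpha>)" if "0 < n" for n
  proof -
    have "(real n powr (- 1 / 2 + 2 * \<alpha>))\<^sup>2 = real n powr (- 1 + 4 * \<alpha>)"
      by (simp add: power2_eq_square powr_add[symmetric])
    moreover have "real n / sqrt (real n) = real n powr (1 / 2)"
      using that by (simp add: powr_half_sqrt real_div_sqrt)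
    moreover have "real n powr (- 1 + 4 * \<alpha>) * real n powr (1 / 2) = real n powr (- 1 / 2 + 4 * \<alpha>)"
      by (simp add: powr_add[symmetric])
    moreover have "(lam * sqrt (real n) * \<rho> n)\<^sup>2 * sqrt (S n) / (sqrt (real n) * sqrt F)
        = lam\<^sup>2 * sqrt K2 / sqrt F * ((sqrt (real n) * \<rho> n)\<^sup>2 * (real n / sqrt (real n)))"
      using K20 by (simp add: S_def real_sqrt_mult power_mult_distrib mult_ac)
    ultimately show ?thesis by (simp only: sq)
  qed
  have "(\<lambda>n. lam * sqrt F * real n powr (- 1 + 2 * \<alpha>) + lam / sqrt F * (K1 * real n powr (- 1 / 4 + 2 * \<alpha>))
      + lam\<^sup>2 * sqrt K2 / sqrt F * real n powr (- 1 / 2 + 4 * \<alpha>)) \<longlonglongrightarrow>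
      lam * sqrt F * 0 + lam / sqrt F * (K1 * 0) + lam\<^sup>2 * sqrt K2 / sqrt F * 0"
    using \<alpha> by (intro tendsto_intros pow0) auto
  then have "(\<lambda>n. lam * sqrt F * real n powr (- 1 + 2 * \<alpha>) + lam / sqrt F * (K1 * real n powr (- 1 / 4 + 2 * \<alpha>))
      + lam\<^sup>2 * sqrt K2 / sqrt F * real n powr (- 1 / 2 + 4 * \<alpha>)) \<longlonglongrightarrow> 0" by simp
  then have "\<forall>\<^sub>F n in sequentially. lam * sqrt F * real n powr (- 1 + 2 * \<alpha>)
      + lam / sqrt F * (K1 * real n powr (- 1 / 4 + 2 * \<alpha>))
      + lam\<^sup>2 * sqrt K2 / sqrt F * real n powr (- 1 / 2 + 4 * \<alpha>) < \<epsilon>"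
    using \<epsilon> by (rule order_tendstoD)
  moreover have "(\<lambda>n. lam * real n powr (- 1 / 2 + 2 * \<alpha>)) \<longlonglongrightarrow> lam * 0"
    using \<alpha> by (intro tendsto_intros pow0) auto
  then have "\<forall>\<^sub>F n in sequentially. lam * real n powr (- 1 / 2 + 2 * \<alpha>) < 1"
    by (rule order_tendstoD) simp
  ultimately show ?thesis using eventually_gt_at_top[of 0]
  proof eventually_elim
    case (elim n)
    have n: "0 < real n" using elim by simp
    let ?N = "wigner_noise P Pd n"
    have en: "e n < \<epsilon>"
      using elim(1) unfolding e_def rem[OF elim(3)] unfolding \<rho>\<tau> unfolding \<rho>_def .
    have small: "lam * sqrt (real n) * \<rho> n \<le> 1"
      using elim(2) unfolding sq[symmetric] by (simp add: mult.assoc)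
    have \<tau>0: "0 < \<tau> n" and S0: "0 < S n" and \<rho>0: "0 \<le> \<rho> n"
      using K10 K20 n by (simp_all add: \<tau>_def S_def \<rho>_def)
    have b_meas: "b \<in> borel_measurable P" unfolding b_def by measurable
    have b4: "integrable P (\<lambda>y. b y ^ 4)"
    proof -
      have "\<bar>b w\<bar> \<le> (C + F) + 1 * \<bar>w\<bar> ^ m" for w using f1_bound[of w] Fpos unfolding b_def by linarith
      then have "integrable P (\<lambda>y. \<bar>b y\<bar> ^ 4)"
        using C Fpos by (intro integrable_power_growth[where A = "C + F" and B = 1]) (auto simp: b_def)
      then show ?thesis by (simp add: power_even_abs)
    qed
    have b_mean: "(\<integral>y. b y \<partial>P) = 0"
      unfolding b_def using f1_int by (simp add: f1_mean fisher_eq P.prob_space)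
    have frob0: "0 \<le> frob_sq n (edge_mat b w)" for w unfolding frob_sq_def by (intro sum_nonneg) auto
    note B1 = Markov_bad_set[where f = "\<lambda>w. frob_sq n (edge_mat b w)",
        OF frob_sq_integrable[OF prob Pd b_meas b4 b_mean] frob0 zero_less_power[OF \<tau>0, of 4]
        frob_sq_integral_le[OF prob Pd b_meas b4 b_mean]]
    have rest0: "0 \<le> (\<Sum>i<n. \<Sum>k<n. edge_mat (\<lambda>y. (taylor_bound y)\<^sup>2) w i k)" for w
      by (intro sum_nonneg) (simp add: edge_mat_def)
    let ?g = "\<lambda>y. (taylor_bound y)\<^sup>2"
    have g0: "0 \<le> ?g y" for y by simp
    have int2: "integrable ?N (\<lambda>w. \<Sum>i<n. \<Sum>k<n. edge_mat ?g w i k)"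
      by (rule edge_mat_sum_integrable[OF prob Pd taylor_bound_sq_int g0])
    have exp2: "(\<integral>w. (\<Sum>i<n. \<Sum>k<n. edge_mat ?g w i k) \<partial>?N) \<le> (real n)\<^sup>2 * Q"
      unfolding Q_def by (rule edge_mat_sum_integral_le[OF prob Pd taylor_bound_sq_int g0])
    note B2 = Markov_bad_set[OF int2 rest0 S0 exp2]
    let ?B1 = "{w \<in> space ?N. \<tau> n ^ 4 \<le> frob_sq n (edge_mat b w)}"
    let ?B2 = "{w \<in> space ?N. S n \<le> (\<Sum>i<n. \<Sum>k<n. edge_mat ?g w i k)}"
    have ratio: "b * a / (c * (b + 1) / \<eta> * a) \<le> \<eta> / c" if "0 < a" "0 \<le> b" "0 < c" for a b c :: real
    proof -
      have "b * a / (c * (b + 1) / \<eta> * a) = \<eta> / c * (b / (b + 1))"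
        using that by (simp add: mult_ac)
      also have "\<dots> \<le> \<eta> / c * 1" using that \<eta> by (intro mult_left_mono) auto
      finally show ?thesis by simp
    qed
    have "measure ?N ?B1 \<le> \<eta> / 2"
    proof -
      have "(real n powr (3 / 4)) ^ 4 = real n ^ 3"
        using n by (simp add: powr_power)
      then have "\<tau> n ^ 4 = 4 * (\<beta> + 1) / \<eta> * real n ^ 3"
        unfolding \<tau>_def power_mult_distrib K14 by simp
      then have "2 * real n ^ 3 * \<beta> / \<tau> n ^ 4 \<le> \<eta> / 2"
        using ratio[of "real n ^ 3" \<beta> 4] n \<beta>0 by (simp add: mult_ac)
      then show ?thesis using B1(2) unfolding \<beta>_def by linarith
    qed
    moreover have "measure ?N ?B2 \<le> \<eta> / 2"
    proof -
      have "(real n)\<^sup>2 * Q / S n \<le> \<eta> / 2"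
        using ratio[of "(real n)\<^sup>2" Q 2] n Q0 by (simp add: S_def K2_def mult_ac)
      then show ?thesis using B2(2) by linarith
    qed
    ultimately have meas: "measure ?N (?B1 \<union> ?B2) \<le> \<eta>"
      using measure_Un_le[OF B1(1) B2(1)] by linarith
    have sets: "?B1 \<union> ?B2 \<in> sets ?N" using B1(1) B2(1) by (rule sets.Un)
    show ?case
    proof (intro allI impI bexI[OF _ sets] conjI meas ballI)
      fix x w v
      assume x: "\<forall>i<n. \<bar>x i\<bar> \<le> real n powr (- 1 / 2 + \<alpha>)" and w: "w \<in> space ?N - (?B1 \<union> ?B2)"
      have x2: "(x i)\<^sup>2 \<le> \<rho> n" if "i < n" for i
      proof -
        have "\<bar>x i\<bar>\<^sup>2 \<le> (real n powr (- 1 / 2 + \<alpha>))\<^sup>2" using x that by (intro power_mono) auto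
        also have "\<dots> = \<rho> n" by (simp add: \<rho>_def power2_eq_square powr_add[symmetric])
        finally show ?thesis by simp
      qed
      have "frob_sq n (edge_mat (\<lambda>y. f1 y - F) w) \<le> \<tau> n ^ 4"
        "(\<Sum>i<n. \<Sum>k<n. edge_mat (\<lambda>y. (taylor_bound y)\<^sup>2) w i k) \<le> S n"
        using w unfolding b_def by (simp_all add: not_le less_imp_le)
      from signal_mat_linearization[OF elim(3) lam \<rho>0 x2 small less_imp_le[OF \<tau>0] this]
      have "\<bar>qf n (signal_mat f lam n x w) v / (sqrt (real n) * sqrt F)
          - qf n (edge_mat (\<lambda>y. f y / sqrt F / sqrt (real n)) w) v - lam * sqrt F * (ip n v x)\<^sup>2\<bar>
        \<le> e n * ip n v v" unfolding e_def by simp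
      also have "\<dots> \<le> \<epsilon> * ip n v v" using en by (intro mult_right_mono ip_self_nonneg) simp
      finally show "\<bar>qf n (signal_mat f lam n x w) v / (sqrt (real n) * sqrt F)
          - qf n (edge_mat (\<lambda>y. f y / sqrt F / sqrt (real n)) w) v - lam * sqrt F * (ip n v x)\<^sup>2\<bar>
        \<le> \<epsilon> * ip n v v" .
    qed
  qed
qed

end

section \<open>The spectral transition\<close>

lemma saw_good_antimono: "saw_good n Z x N \<epsilon> \<Longrightarrow> M \<le> N \<Longrightarrow> saw_good n Z x M \<epsilon>"
  unfolding saw_good_def by auto

text \<open>Limit of the top eigenvalue of \<open>Z + \<theta> x x\<^sup>T\<close> in the transition
  of Baik, Ben Arous and Peche: it is 2 up to \<open>\<theta> = 1\<close> and
  \<open>\<theta> + 1 / \<theta>\<close> beyond.\<close>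

definition bbp_edge :: "real \<Rightarrow> real" where
  "bbp_edge \<theta> = max 1 \<theta> + 1 / max 1 \<theta>"

text \<open>Taking \<open>m\<close> slightly below \<open>1 / max 1 \<theta>\<close> makes the
  inequalities strict, while \<open>m + 1 / m\<close> exceeds the limit by at most
  \<open>\<epsilon>\<close>.\<close>

lemma exists_subcritical_decay:
  assumes \<epsilon>: "0 < \<epsilon>" and \<theta>: "0 \<le> \<theta>"
  obtains m where "0 < m" "m < 1" "\<theta> * m < 1" "2 < m + 1 / m" "m + 1 / m \<le> bbp_edge \<theta> + \<epsilon>"
proof -
  define u where "u = max 1 \<theta>"
  have u: "1 \<le> u" "\<theta> \<le> u" by (simp_all add: u_def)
  define m where "m = 1 / (u + \<epsilon>)"
  have m: "0 < m" "m < 1" using u \<epsilon> by (simp_all add: m_def)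
  have "\<theta> * m < 1" using u \<epsilon> by (simp add: m_def)
  moreover have "2 < m + 1 / m"
  proof -
    have "0 < (1 - m)\<^sup>2 / m" using m by simp
    also have "(1 - m)\<^sup>2 / m = m + 1 / m - 2" using m by (simp add: power2_eq_square field_simps)
    finally show ?thesis by simp
  qed
  moreover have "m + 1 / m \<le> bbp_edge \<theta> + \<epsilon>"
  proof -
    have "1 / (u + \<epsilon>) \<le> 1 / u" using u \<epsilon> by (intro divide_left_mono) auto
    then show ?thesis by (simp add: m_def bbp_edge_def u_def)
  qed
  ultimately show ?thesis using m that by blast
qed

text \<open>For \<open>\<theta> > 1\<close> the supremum of \<open>Z + \<theta> x x\<^sup>T\<close> is approached on the span of the self-avoiding vectors, for
  \<open>\<theta> \<le> 1\<close> already by \<open>Z\<close> alone.\<close>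

lemma perturbed_spectral_window:
  fixes \<theta> \<epsilon> :: real
  assumes \<theta>: "0 \<le> \<theta>" and \<epsilon>: "0 < \<epsilon>"
  shows "\<exists>N e \<delta>. 0 < e \<and> 0 < \<delta> \<and> (\<forall>n Z x A. 0 < n \<longrightarrow> (\<forall>i<n. \<forall>j<n. Z i j = Z j i) \<longrightarrow>
    saw_good n Z x N e \<longrightarrow> \<bar>ip n x x - 1\<bar> \<le> e \<longrightarrow>
    (\<forall>v. qf n Z v \<le> (2 + \<delta>) * ip n v v) \<longrightarrow>
    (\<forall>v. \<bar>qf n A v - qf n Z v - \<theta> * (ip n v x)\<^sup>2\<bar> \<le> \<delta> * ip n v v) \<longrightarrow>
    (\<forall>v. qf n A v \<le> (bbp_edge \<theta> + \<epsilon>) * ip n v v) \<and>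
    (\<exists>v. (bbp_edge \<theta> - \<epsilon>) * ip n v v < qf n A v) \<and>
    (\<forall>v. qf n A v \<le> (2 + \<epsilon>) * ip n v v + \<theta> * (ip n v x)\<^sup>2))"
proof -
  obtain m where m: "0 < m" "m < 1" "\<theta> * m < 1" "2 < m + 1 / m" "m + 1 / m \<le> bbp_edge \<theta> + \<epsilon> / 2"
    using exists_subcritical_decay[of "\<epsilon> / 2" \<theta>] \<epsilon> \<theta> by auto
  \<comment> \<open>Small enough for the tolerance and for \<open>2 + \<delta>\<close> to stay below
    \<open>m + 1 / m\<close>, as \<open>spike_upper\<close> demands.\<close>
  define \<delta> where "\<delta> = min (\<epsilon> / 2) ((m + 1 / m - 2) / 2)"
  have \<delta>: "0 < \<delta>" "\<delta> \<le> \<epsilon> / 2" using \<epsilon> m by (simp_all add: \<delta>_def)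
  have "\<delta> \<le> (m + 1 / m - 2) / 2" unfolding \<delta>_def by (rule min.cobounded2)
  moreover have "2 + c < X" if "c \<le> (X - 2) / 2" "2 < X" for c X :: real using that by simp
  ultimately have b: "2 + \<delta> < m + 1 / m" using m(4) by blast
  obtain K1 d1 where d1: "0 < d1" and upper: "\<forall>n Z x s r d. (\<forall>i<n. \<forall>j<n. Z i j = Z j i) \<longrightarrow>
    cheb_approx n Z x s r K1 d \<longrightarrow> 0 \<le> d \<longrightarrow> d \<le> d1 \<longrightarrow> (\<forall>v. qf n Z v \<le> (2 + \<delta>) * ip n v v) \<longrightarrow>
    (\<forall>w. qf n Z w + \<theta> * (ip n w x)\<^sup>2 \<le> (m + 1 / m) * ip n w w)"
    using spike_upper[OF \<theta> m(1,2,3) b] by auto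
  have "\<exists>K2 d2. 0 < d2 \<and> (\<forall>n Z x s r d. cheb_approx n Z x s r K2 d \<longrightarrow> 0 \<le> d \<longrightarrow> d \<le> d2 \<longrightarrow>
    (\<exists>v. (bbp_edge \<theta> - \<epsilon> / 2) * ip n v v < qf n Z v + \<theta> * (ip n v x)\<^sup>2))"
  proof (cases "1 < \<theta>")
    case True
    then have "bbp_edge \<theta> = \<theta> + 1 / \<theta>" by (simp add: bbp_edge_def)
    then show ?thesis using spike_lower[OF True, of "\<epsilon> / 2"] \<epsilon> by simp
  next
    case False
    then have 2: "bbp_edge \<theta> = 2" by (simp add: bbp_edge_def max_def)
    obtain K d where d: "0 < d" and low: "\<forall>n Z x s r d'. cheb_approx n Z x s r K d' \<longrightarrow> d' \<le> d \<longrightarrow>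
      (\<exists>v. (2 - \<epsilon> / 2) * ip n v v < qf n Z v)"
      using edge_lower[of "\<epsilon> / 2"] \<epsilon> by auto
    have "\<exists>v. (2 - \<epsilon> / 2) * ip n v v < qf n Z v + \<theta> * (ip n v x)\<^sup>2"
      if ca: "cheb_approx n Z x s r K d'" and d': "d' \<le> d" for n Z x s r d'
    proof -
      obtain v where "(2 - \<epsilon> / 2) * ip n v v < qf n Z v"
        using low[rule_format, OF ca d'] by (elim exE)
      also have "\<dots> \<le> qf n Z v + \<theta> * (ip n v x)\<^sup>2" using \<theta> by simp
      finally show ?thesis by (rule exI[of _ v])
    qed
    then show ?thesis unfolding 2 using d by (intro exI[of _ K] exI[of _ d]) simp
  qed
  then obtain K2 d2 where d2: "0 < d2" and lower: "\<forall>n Z x s r d. cheb_approx n Z x s r K2 d \<longrightarrow> 0 \<le> d \<longrightarrow> d \<le> d2 \<longrightarrow>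
    (\<exists>v. (bbp_edge \<theta> - \<epsilon> / 2) * ip n v v < qf n Z v + \<theta> * (ip n v x)\<^sup>2)"
    by (elim exE conjE)
  \<comment> \<open>Undoes the loss \<open>5 ^ (2 * K + 2)\<close> of
    \<open>saw_good_imp_cheb_approx\<close> for both values of \<open>K\<close>.\<close>
  define e where "e = min (d1 / 5 ^ (2 * K1 + 2)) (d2 / 5 ^ (2 * K2 + 2))"
  define N where "N = max (2 * K1 + 2) (2 * K2 + 2)"
  have e0: "0 < e" using d1 d2 by (simp add: e_def)
  have "e \<le> d1 / 5 ^ (2 * K1 + 2)" "e \<le> d2 / 5 ^ (2 * K2 + 2)" by (simp_all add: e_def)
  then have e1: "5 ^ (2 * K1 + 2) * e \<le> d1" and e2: "5 ^ (2 * K2 + 2) * e \<le> d2"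
    by (simp_all add: field_simps)
  have "(\<forall>v. qf n A v \<le> (bbp_edge \<theta> + \<epsilon>) * ip n v v) \<and>
    (\<exists>v. (bbp_edge \<theta> - \<epsilon>) * ip n v v < qf n A v) \<and>
    (\<forall>v. qf n A v \<le> (2 + \<epsilon>) * ip n v v + \<theta> * (ip n v x)\<^sup>2)"
    if n: "0 < n" and sym: "\<forall>i<n. \<forall>j<n. Z i j = Z j i" and good: "saw_good n Z x N e"
      and x: "\<bar>ip n x x - 1\<bar> \<le> e" and edge: "\<forall>v. qf n Z v \<le> (2 + \<delta>) * ip n v v"
      and lin: "\<forall>v. \<bar>qf n A v - qf n Z v - \<theta> * (ip n v x)\<^sup>2\<bar> \<le> \<delta> * ip n v v"
    for n Z x A
  proof -
    have sym': "\<And>i j. i < n \<Longrightarrow> j < n \<Longrightarrow> Z i j = Z j i" using sym by blast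
    have ca: "cheb_approx n Z x (saw n Z x) (saw_residual n Z x) K (5 ^ (2 * K + 2) * e)" if "2 * K + 2 \<le> N" for K
      by (rule saw_good_imp_cheb_approx[OF saw_good_antimono[OF good that] x n e0 sym'])
    have ca1: "cheb_approx n Z x (saw n Z x) (saw_residual n Z x) K1 (5 ^ (2 * K1 + 2) * e)"
      and ca2: "cheb_approx n Z x (saw n Z x) (saw_residual n Z x) K2 (5 ^ (2 * K2 + 2) * e)"
      by (rule ca, simp add: N_def)+
    have dle: "\<delta> * ip n v v \<le> \<epsilon> / 2 * ip n v v" for v using \<delta> ip_self_nonneg by (intro mult_right_mono) auto
    have lin1: "qf n A v \<le> qf n Z v + \<theta> * (ip n v x)\<^sup>2 + \<epsilon> / 2 * ip n v v"
      and lin2: "qf n Z v + \<theta> * (ip n v x)\<^sup>2 \<le> qf n A v + \<epsilon> / 2 * ip n v v" for v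
      using lin[rule_format, of v] dle[of v] by linarith+
    have up: "qf n Z v + \<theta> * (ip n v x)\<^sup>2 \<le> (m + 1 / m) * ip n v v" for v
      using upper[rule_format, OF _ ca1 _ e1] sym edge e0 by simp
    have 1: "qf n A v \<le> (bbp_edge \<theta> + \<epsilon>) * ip n v v" for v
    proof -
      have "(m + 1 / m) * ip n v v \<le> (bbp_edge \<theta> + \<epsilon> / 2) * ip n v v"
        using m(5) ip_self_nonneg by (rule mult_right_mono)
      also have "\<dots> = (bbp_edge \<theta> + \<epsilon>) * ip n v v - \<epsilon> / 2 * ip n v v" by (simp add: algebra_simps)
      finally show ?thesis using lin1[of v] up[of v] by linarith
    qed
    have 2: "qf n A v \<le> (2 + \<epsilon>) * ip n v v + \<theta> * (ip n v x)\<^sup>2" for v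
    proof -
      have "(2 + \<delta>) * ip n v v \<le> (2 + \<epsilon> / 2) * ip n v v"
        using \<delta> ip_self_nonneg by (intro mult_right_mono) auto
      also have "\<dots> = (2 + \<epsilon>) * ip n v v - \<epsilon> / 2 * ip n v v" by (simp add: algebra_simps)
      finally show ?thesis using lin1[of v] edge[rule_format, of v] by linarith
    qed
    have "\<exists>v. (bbp_edge \<theta> - \<epsilon> / 2) * ip n v v < qf n Z v + \<theta> * (ip n v x)\<^sup>2"
      using lower[rule_format, OF ca2 _ e2] e0 by simp
    then obtain v where "(bbp_edge \<theta> - \<epsilon> / 2) * ip n v v < qf n Z v + \<theta> * (ip n v x)\<^sup>2" ..
    moreover have "(bbp_edge \<theta> - \<epsilon> / 2) * ip n v v = (bbp_edge \<theta> - \<epsilon>) * ip n v v + \<epsilon> / 2 * ip n v v"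
      by (simp add: algebra_simps)
    ultimately have "(bbp_edge \<theta> - \<epsilon>) * ip n v v < qf n A v" using lin2[of v] by linarith
    then show ?thesis using 1 2 by blast
  qed
  then show ?thesis using e0 \<delta>(1) by (intro exI[of _ N] exI[of _ e] exI[of _ \<delta>]) simp
qed

section \<open>The transformed matrix for a fixed spike\<close>

lemma signal_mat_commute: "signal_mat g lam n x w i j = signal_mat g lam n x w j i"
  by (simp add: signal_mat_def edge_commute mult.commute)

lemma transformed_matrix_eq:
  assumes "0 < n"
  shows "transformed_matrix g lam n (x, w) = mat n n (\<lambda>(i, j). signal_mat g lam n x w i j)"
  using assms
  by (intro eq_matI) (auto simp: transformed_matrix_def entrywise_offdiag_def spiked_matrix_def
      noise_matrix_def signal_mat_def edge_def distrib_left mult_ac add.commute)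

context score_setting
begin

lemma normalized_score:
  shows "(\<lambda>y. f y / sqrt F) \<in> borel_measurable P" "integrable P (\<lambda>y. (f y / sqrt F) ^ 4)"
    "integrable P (\<lambda>y. \<bar>f y / sqrt F\<bar> ^ 5)"
    "(\<integral>y. f y / sqrt F \<partial>P) = 0" "(\<integral>y. (f y / sqrt F)\<^sup>2 \<partial>P) = 1"
proof -
  have Fpos: "0 < F" by (rule fisher_pos)
  show "(\<lambda>y. f y / sqrt F) \<in> borel_measurable P" by measurable
  show "integrable P (\<lambda>y. (f y / sqrt F) ^ 4)"
    using f_moment[of 4] by (simp add: power_divide power_even_abs)
  show "integrable P (\<lambda>y. \<bar>f y / sqrt F\<bar> ^ 5)"
    using f_moment[of 5] by (simp add: power_divide abs_divide)
  show "(\<integral>y. f y / sqrt F \<partial>P) = 0" by (simp add: f_mean)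
  have "(\<integral>y. (f y / sqrt F)\<^sup>2 \<partial>P) = (\<integral>y. (f y)\<^sup>2 / F \<partial>P)"
    using Fpos by (simp add: power_divide)
  then show "(\<integral>y. (f y / sqrt F)\<^sup>2 \<partial>P) = 1" using Fpos by (simp add: fisher_eq[symmetric])
qed

text \<open>The exceptional noise set may depend on \<open>x\<close>, but \<open>e\<close> and the
  threshold for \<open>n\<close> do not. This uniformity lets Fubini pass to the joint law of spike
  and noise.\<close>

lemma eventually_transformed_window:
  assumes Pd: "prob_space Pd" and lam: "0 \<le> lam" and \<alpha>: "\<alpha> < 1 / 8" and \<epsilon>: "0 < \<epsilon>" and \<eta>: "0 < \<eta>"
  defines "\<theta> \<equiv> lam * sqrt F"
  shows "\<exists>e>0. \<forall>\<^sub>F n in sequentially. \<forall>x. \<bar>ip n x x - 1\<bar> \<le> e \<longrightarrow>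
    (\<forall>i<n. \<bar>x i\<bar> \<le> real n powr (- 1 / 2 + \<alpha>)) \<longrightarrow>
    (\<exists>B\<in>sets (wigner_noise P Pd n). measure (wigner_noise P Pd n) B \<le> \<eta> \<and>
      (\<forall>w\<in>space (wigner_noise P Pd n) - B.
        \<bar>lambda_max (transformed_matrix f lam n (x, w)) / (sqrt (real n) * sqrt F) - bbp_edge \<theta>\<bar> \<le> \<epsilon> \<and>
        (\<forall>v. top_unit_eigenvector (transformed_matrix f lam n (x, w)) v \<longrightarrow>
          bbp_edge \<theta> - 2 - 2 * \<epsilon> \<le> \<theta> * (scalar_prod v (Matrix.vec n x))\<^sup>2)))"
proof -
  have Fpos: "0 < F" by (rule fisher_pos)
  have \<theta>: "0 \<le> \<theta>" using lam Fpos by (simp add: \<theta>_def)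
  obtain N e \<delta> where e: "0 < e" and \<delta>: "0 < \<delta>" and window:
    "\<forall>n Z x A. 0 < n \<longrightarrow> (\<forall>i<n. \<forall>j<n. Z i j = Z j i) \<longrightarrow>
    saw_good n Z x N e \<longrightarrow> \<bar>ip n x x - 1\<bar> \<le> e \<longrightarrow>
    (\<forall>v. qf n Z v \<le> (2 + \<delta>) * ip n v v) \<longrightarrow>
    (\<forall>v. \<bar>qf n A v - qf n Z v - \<theta> * (ip n v x)\<^sup>2\<bar> \<le> \<delta> * ip n v v) \<longrightarrow>
    (\<forall>v. qf n A v \<le> (bbp_edge \<theta> + \<epsilon>) * ip n v v) \<and>
    (\<exists>v. (bbp_edge \<theta> - \<epsilon>) * ip n v v < qf n A v) \<and>
    (\<forall>v. qf n A v \<le> (2 + \<epsilon>) * ip n v v + \<theta> * (ip n v x)\<^sup>2)"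
    using perturbed_spectral_window[OF \<theta> \<epsilon>] by (elim exE conjE)
  have \<eta>3: "0 < \<eta> / 3" using \<eta> by simp
  \<comment> \<open>The cap at 1 gives \<open>ip n x x <= 2\<close>, as the self-avoiding estimates
    require.\<close>
  have min_e: "0 < min e 1" using e by simp
  show ?thesis
  proof (rule exI[of _ "min e 1"], intro conjI min_e)
    show "\<forall>\<^sub>F n in sequentially. \<forall>x. \<bar>ip n x x - 1\<bar> \<le> min e 1 \<longrightarrow>
      (\<forall>i<n. \<bar>x i\<bar> \<le> real n powr (- 1 / 2 + \<alpha>)) \<longrightarrow>
      (\<exists>B\<in>sets (wigner_noise P Pd n). measure (wigner_noise P Pd n) B \<le> \<eta> \<and>
        (\<forall>w\<in>space (wigner_noise P Pd n) - B.
          \<bar>lambda_max (transformed_matrix f lam n (x, w)) / (sqrt (real n) * sqrt F) - bbp_edge \<theta>\<bar> \<le> \<epsilon> \<and>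
          (\<forall>v. top_unit_eigenvector (transformed_matrix f lam n (x, w)) v \<longrightarrow>
            bbp_edge \<theta> - 2 - 2 * \<epsilon> \<le> \<theta> * (scalar_prod v (Matrix.vec n x))\<^sup>2)))"
      using eventually_saw_good[OF prob Pd normalized_score(1,2,4,5) e \<eta>3, of N]
        eventually_edge_upper[OF prob Pd normalized_score(1,3,4,5) \<delta> \<eta>3]
        eventually_linearization[OF Pd lam \<alpha> \<delta> \<eta>3] eventually_gt_at_top[of 0]
    proof (eventually_elim, intro allI impI)
      fix n x
      let ?N = "wigner_noise P Pd n"
      let ?Z = "edge_mat (\<lambda>y. f y / sqrt F / sqrt (real n))"
      let ?H = "signal_mat f lam n x"
      define s where "s = sqrt (real n) * sqrt F"
      assume saw: "\<forall>x. ip n x x \<le> 2 \<longrightarrow> (\<exists>B\<in>sets ?N. measure ?N B \<le> \<eta> / 3 \<and>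
          (\<forall>w\<in>space ?N - B. saw_good n (?Z w) x N e))"
        and edge: "\<exists>B\<in>sets ?N. measure ?N B \<le> \<eta> / 3 \<and>
          (\<forall>w\<in>space ?N - B. \<forall>v. qf n (?Z w) v \<le> (2 + \<delta>) * ip n v v)"
        and lin: "\<forall>x. (\<forall>i<n. \<bar>x i\<bar> \<le> real n powr (- 1 / 2 + \<alpha>)) \<longrightarrow> (\<exists>B\<in>sets ?N. measure ?N B \<le> \<eta> / 3 \<and>
          (\<forall>w\<in>space ?N - B. \<forall>v. \<bar>qf n (signal_mat f lam n x w) v / (sqrt (real n) * sqrt F) - qf n (?Z w) v
            - lam * sqrt F * (ip n v x)\<^sup>2\<bar> \<le> \<delta> * ip n v v))"
        and n: "0 < n" and x1: "\<bar>ip n x x - 1\<bar> \<le> min e 1"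
        and x2: "\<forall>i<n. \<bar>x i\<bar> \<le> real n powr (- 1 / 2 + \<alpha>)"
      have s: "0 < s" using n Fpos by (simp add: s_def)
      have ip2: "ip n x x \<le> 2" using x1 by linarith
      obtain B1 where B1: "B1 \<in> sets ?N" "measure ?N B1 \<le> \<eta> / 3"
          "\<forall>w\<in>space ?N - B1. saw_good n (?Z w) x N e"
        using saw[rule_format, OF ip2] by (elim bexE conjE) (rule that)
      obtain B2 where B2: "B2 \<in> sets ?N" "measure ?N B2 \<le> \<eta> / 3"
          "\<forall>w\<in>space ?N - B2. \<forall>v. qf n (?Z w) v \<le> (2 + \<delta>) * ip n v v"
        using edge by (elim bexE conjE) (rule that)
      obtain B3 where B3: "B3 \<in> sets ?N" "measure ?N B3 \<le> \<eta> / 3"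
          "\<forall>w\<in>space ?N - B3. \<forall>v. \<bar>qf n (?H w) v / s - qf n (?Z w) v - \<theta> * (ip n v x)\<^sup>2\<bar> \<le> \<delta> * ip n v v"
        using lin[THEN spec, THEN mp, OF x2, folded s_def \<theta>_def] by (elim bexE conjE) (rule that)
      have B12: "B1 \<union> B2 \<in> sets ?N" using B1(1) B2(1) by (rule sets.Un)
      have sets: "B1 \<union> B2 \<union> B3 \<in> sets ?N" using B12 B3(1) by (rule sets.Un)
      have meas: "measure ?N (B1 \<union> B2 \<union> B3) \<le> \<eta>"
        using measure_Un_le[OF B12 B3(1)] measure_Un_le[OF B1(1) B2(1)] B1(2) B2(2) B3(2) by linarith
      show "\<exists>B\<in>sets ?N. measure ?N B \<le> \<eta> \<and> (\<forall>w\<in>space ?N - B.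
          \<bar>lambda_max (transformed_matrix f lam n (x, w)) / (sqrt (real n) * sqrt F) - bbp_edge \<theta>\<bar> \<le> \<epsilon> \<and>
          (\<forall>v. top_unit_eigenvector (transformed_matrix f lam n (x, w)) v \<longrightarrow>
            bbp_edge \<theta> - 2 - 2 * \<epsilon> \<le> \<theta> * (scalar_prod v (Matrix.vec n x))\<^sup>2))"
      proof (intro bexI[OF _ sets] conjI meas ballI)
        fix w
        assume w: "w \<in> space ?N - (B1 \<union> B2 \<union> B3)"
        define L where "L = lambda_max (mat n n (\<lambda>(i, j). ?H w i j))"
        have sym: "\<And>i j. i < n \<Longrightarrow> j < n \<Longrightarrow> ?H w i j = ?H w j i" by (rule signal_mat_commute)
        have wg: "saw_good n (?Z w) x N e" "\<forall>v. qf n (?Z w) v \<le> (2 + \<delta>) * ip n v v"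
          "\<forall>v. \<bar>qf n (?H w) v / s - qf n (?Z w) v - \<theta> * (ip n v x)\<^sup>2\<bar> \<le> \<delta> * ip n v v"
          using B1(3) B2(3) B3(3) w by auto
        have scale: "qf n (\<lambda>i j. 1 / s * ?H w i j) v = qf n (?H w) v / s" for v
          by (simp only: qf_scale) simp
        have Zsym: "\<forall>i<n. \<forall>j<n. ?Z w i j = ?Z w j i" using edge_mat_commute by blast
        have xe: "\<bar>ip n x x - 1\<bar> \<le> e" using x1 by simp
        have res: "(\<forall>v. qf n (?H w) v / s \<le> (bbp_edge \<theta> + \<epsilon>) * ip n v v) \<and>
          (\<exists>v. (bbp_edge \<theta> - \<epsilon>) * ip n v v < qf n (?H w) v / s) \<and>
          (\<forall>v. qf n (?H w) v / s \<le> (2 + \<epsilon>) * ip n v v + \<theta> * (ip n v x)\<^sup>2)"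
          using window[THEN spec, THEN spec, THEN spec, THEN spec,
              of n "?Z w" x "\<lambda>i j. 1 / s * ?H w i j", unfolded scale] n Zsym wg(1) xe wg(2,3)
          by (simp only: simp_thms)
        have upper: "L / s \<le> bbp_edge \<theta> + \<epsilon>"
        proof -
          have "qf n (?H w) v \<le> (bbp_edge \<theta> + \<epsilon>) * s * ip n v v" for v
            using res s by (simp add: pos_divide_le_eq mult_ac)
          then have "L \<le> (bbp_edge \<theta> + \<epsilon>) * s"
            unfolding L_def using lambda_max_le_iff[where A = "?H w", OF n sym] by blast
          then show ?thesis using s by (simp add: pos_divide_le_eq)
        qed
        have lower: "bbp_edge \<theta> - \<epsilon> \<le> L / s"
        proof -
          obtain v where v: "(bbp_edge \<theta> - \<epsilon>) * ip n v v < qf n (?H w) v / s" using res by blast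
          have "qf n (?H w) v \<le> L * ip n v v"
            unfolding L_def by (rule qf_le_lambda_max[where A = "?H w", OF n sym])
          then have "qf n (?H w) v / s \<le> L / s * ip n v v" using s by (simp add: divide_right_mono)
          then have *: "(bbp_edge \<theta> - \<epsilon>) * ip n v v < L / s * ip n v v" using v by linarith
          \<comment> \<open>The strict inequality excludes the zero vector, so the norm can be
            cancelled.\<close>
          then have "0 < ip n v v" using ip_self_nonneg[of n v] by (cases "ip n v v = 0") auto
          then show ?thesis by (rule mult_right_le_imp_le[OF less_imp_le[OF *]])
        qed
        show "\<bar>lambda_max (transformed_matrix f lam n (x, w)) / (sqrt (real n) * sqrt F) - bbp_edge \<theta>\<bar> \<le> \<epsilon>"
          using upper lower unfolding transformed_matrix_eq[OF n] L_def s_def by linarith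
        show "\<forall>v. top_unit_eigenvector (transformed_matrix f lam n (x, w)) v \<longrightarrow>
            bbp_edge \<theta> - 2 - 2 * \<epsilon> \<le> \<theta> * (scalar_prod v (Matrix.vec n x))\<^sup>2"
        proof (intro allI impI)
          fix v assume "top_unit_eigenvector (transformed_matrix f lam n (x, w)) v"
          then have v: "v \<in> carrier_vec n" "ip n (vec_index v) (vec_index v) = 1"
            "\<forall>i<n. mv n (?H w) (vec_index v) i = L * vec_index v i"
            unfolding transformed_matrix_eq[OF n] top_unit_eigenvector_mat_iff[OF n] L_def by auto
          have "qf n (?H w) (vec_index v) = ip n (vec_index v) (\<lambda>i. L * vec_index v i)"
            unfolding qf_def using v(3) by (intro ip_cong) auto
          also have "\<dots> = L * ip n (vec_index v) (vec_index v)"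
            by (simp add: ip_def sum_distrib_left mult_ac)
          finally have "L / s = qf n (?H w) (vec_index v) / s" using v(2) by simp
          also have "\<dots>
              \<le> (2 + \<epsilon>) * ip n (vec_index v) (vec_index v) + \<theta> * (ip n (vec_index v) x)\<^sup>2"
            using res by blast
          also have "ip n (vec_index v) x = scalar_prod v (Matrix.vec n x)"
            by (simp add: ip_def scalar_prod_def lessThan_atLeast0)
          finally have "bbp_edge \<theta> - \<epsilon> \<le> (2 + \<epsilon>) * 1 + \<theta> * (scalar_prod v (Matrix.vec n x))\<^sup>2"
            unfolding v(2) using lower by (rule order_trans[rotated])
          then show "bbp_edge \<theta> - 2 - 2 * \<epsilon> \<le> \<theta> * (scalar_prod v (Matrix.vec n x))\<^sup>2" by simp
        qed
      qed
    qed
  qed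
qed

end

text \<open>Each \<open>B\<close> bounds the measure of one slice of \<open>E\<close>, and only
  measures of slices are integrated over \<open>x\<close>, so \<open>B\<close> may depend on
  \<open>x\<close> in an arbitrary way.\<close>

lemma product_bad_event:
  assumes X: "prob_space X" and N: "prob_space N" and E: "E \<in> sets (X \<Otimes>\<^sub>M N)" and G: "G \<in> sets X"
    and \<eta>: "0 \<le> \<eta>"
    and slice: "\<And>x. x \<in> G \<Longrightarrow> \<exists>B\<in>sets N. measure N B \<le> \<eta> \<and> (\<forall>w\<in>space N - B. (x, w) \<notin> E)"
  shows "measure (X \<Otimes>\<^sub>M N) E \<le> measure X (space X - G) + \<eta>"
proof -
  interpret X: prob_space X by (rule X)
  interpret N: prob_space N by (rule N)
  interpret XN: pair_prob_space X N ..
  have "emeasure N (Pair x -` E) \<le> indicator (space X - G) x + ennreal \<eta>" if x: "x \<in> space X" for x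
  proof (cases "x \<in> G")
    case True
    from slice[OF this] obtain B where B: "B \<in> sets N" "measure N B \<le> \<eta>" "\<forall>w\<in>space N - B. (x, w) \<notin> E"
      by (elim bexE conjE)
    have "Pair x -` E \<subseteq> B"
      using B(3) sets.sets_into_space[OF E] by (auto simp: space_pair_measure)
    then have "emeasure N (Pair x -` E) \<le> emeasure N B" using B(1) by (intro emeasure_mono)
    also have "\<dots> \<le> ennreal \<eta>" using B(2) by (simp add: N.emeasure_eq_measure ennreal_leI)
    finally show ?thesis by (simp add: add_increasing)
  next
    case False
    have "emeasure N (Pair x -` E) \<le> 1" by (rule N.emeasure_le_1)
    then show ?thesis using False x by (simp add: add_increasing2)
  qed
  then have "emeasure (X \<Otimes>\<^sub>M N) E \<le> (\<integral>\<^sup>+x. indicator (space X - G) x + ennreal \<eta> \<partial>X)"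
    unfolding N.emeasure_pair_measure_alt[OF E] by (intro nn_integral_mono)
  also have "\<dots> = emeasure X (space X - G) + ennreal \<eta>"
    using G by (subst nn_integral_add) (auto simp: X.emeasure_space_1)
  also have "\<dots> = ennreal (measure X (space X - G) + \<eta>)"
    using \<eta> by (simp add: X.emeasure_eq_measure)
  finally have "ennreal (measure (X \<Otimes>\<^sub>M N) E) \<le> ennreal (measure X (space X - G) + \<eta>)"
    unfolding XN.emeasure_eq_measure .
  then show ?thesis by (subst (asm) ennreal_le_iff) (use \<eta> in simp)
qed

text \<open>A diagonal choice: \<open>\<epsilon> n\<close> is \<open>1 / (k + 1)\<close> for the
  largest \<open>k <= n\<close> whose convergence threshold \<open>n\<close> has passed, so the
  tolerance shrinks only as fast as the individual limits permit.\<close>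

lemma exists_vanishing_rate:
  fixes q :: "real \<Rightarrow> nat \<Rightarrow> real"
  assumes q: "\<And>\<epsilon>. 0 < \<epsilon> \<Longrightarrow> q \<epsilon> \<longlonglongrightarrow> 1"
  shows "\<exists>\<epsilon>. \<epsilon> \<longlonglongrightarrow> 0 \<and> (\<lambda>n. q (\<epsilon> n) n) \<longlonglongrightarrow> 1"
proof -
  let ?r = "\<lambda>k::nat. 1 / real (Suc k)"
  have "\<exists>N. \<forall>n\<ge>N. \<bar>q (?r k) n - 1\<bar> < ?r k" for k
    using LIMSEQ_D[OF q[of "?r k"], of "?r k"] by simp
  then obtain N where N: "\<And>k n. N k \<le> n \<Longrightarrow> \<bar>q (?r k) n - 1\<bar> < ?r k" by metis
  \<comment> \<open>The condition \<open>k \<le> n\<close> keeps the set finite, and the inserted 0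
    keeps it nonempty.\<close>
  define K where "K n = Max (insert 0 {k. k \<le> n \<and> N k \<le> n})" for n
  have fin: "finite (insert 0 {k. k \<le> n \<and> N k \<le> n})" for n by simp
  have K_ge: "k \<le> K n" if "k \<le> n" "N k \<le> n" for k n
    unfolding K_def using that by (intro Max_ge fin) simp
  have K_mem: "N (K n) \<le> n" if "N 0 \<le> n" for n
    using Max_in[OF fin, of n] that unfolding K_def by auto
  have "filterlim K at_top sequentially"
    unfolding filterlim_at_top eventually_sequentially
  proof
    fix k show "\<exists>M. \<forall>n\<ge>M. k \<le> K n" by (intro exI[of _ "max k (N k)"]) (auto intro: K_ge)
  qed
  then have r: "(\<lambda>n. ?r (K n)) \<longlonglongrightarrow> 0"
    by (rule filterlim_compose[OF LIMSEQ_Suc[OF lim_1_over_n]])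
  have "(\<lambda>n. q (?r (K n)) n - 1) \<longlonglongrightarrow> 0"
  proof (rule Lim_null_comparison[OF _ r])
    show "\<forall>\<^sub>F n in sequentially. norm (q (?r (K n)) n - 1) \<le> ?r (K n)"
      using eventually_ge_at_top[of "N 0"]
    proof eventually_elim
      case (elim n)
      show ?case using N[OF K_mem[OF elim]] by simp
    qed
  qed
  then have "(\<lambda>n. q (?r (K n)) n) \<longlonglongrightarrow> 1" by (rule LIM_zero_cancel)
  then show ?thesis using r by (intro exI[of _ "\<lambda>n. ?r (K n)"]) simp
qed

section \<open>Measurability and transfer to the joint law of spike and noise\<close>

lemma wigner_noise_prob_space:
  assumes "prob_space P" "prob_space Pd" shows "prob_space (wigner_noise P Pd n)"
  unfolding wigner_noise_def using assms by (intro prob_space_PiM) auto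

lemma spike_component_measurable:
  assumes X: "sets X = sets (PiM {..<n} (\<lambda>_. borel :: real measure))" and i: "i < n"
  shows "(\<lambda>x. x i) \<in> borel_measurable X"
  unfolding measurable_cong_sets[OF X refl] using i by (intro measurable_component_singleton) simp

lemma wig_space_spike_measurable:
  assumes X: "sets (X n) = sets (PiM {..<n} (\<lambda>_. borel :: real measure))" and i: "i < n"
  shows "(\<lambda>\<omega>. fst \<omega> i) \<in> borel_measurable (wig_space P Pd X n)"
  unfolding wig_space_def
  by (rule measurable_compose[OF measurable_fst spike_component_measurable[OF X i]])

lemma wig_space_signal_measurable:
  assumes P: "sets P = sets borel" and X: "sets (X n) = sets (PiM {..<n} (\<lambda>_. borel :: real measure))"
    and g: "g \<in> borel_measurable borel" and ij: "i < n" "j < n"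
  shows "(\<lambda>\<omega>. signal_mat g lam n (fst \<omega>) (snd \<omega>) i j) \<in> borel_measurable (wig_space P Pd X n)"
proof (cases "i = j")
  case False
  let ?D = "\<lambda>(i, j). if i = j then Pd else P"
  have e: "edge i j \<in> {(i, j). i \<le> j \<and> j < n}" and D: "?D (edge i j) = P"
    using False ij by (auto simp: edge_def)
  have "(\<lambda>w. w (edge i j)) \<in> measurable (wigner_noise P Pd n) (?D (edge i j))"
    unfolding wigner_noise_def using e by (rule measurable_component_singleton)
  then have "(\<lambda>w. w (edge i j)) \<in> borel_measurable (wigner_noise P Pd n)"
    unfolding D measurable_cong_sets[OF refl P] .
  then have w: "(\<lambda>\<omega>. snd \<omega> (edge i j)) \<in> borel_measurable (wig_space P Pd X n)"
    unfolding wig_space_def by (rule measurable_compose[OF measurable_snd])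
  have "(\<lambda>\<omega>. snd \<omega> (edge i j) + lam * sqrt (real n) * (fst \<omega> i * fst \<omega> j))
      \<in> borel_measurable (wig_space P Pd X n)"
    using w wig_space_spike_measurable[where X = X, OF X ij(1)] wig_space_spike_measurable[where X = X, OF X ij(2)]
      by measurable
  then have "(\<lambda>\<omega>. g (snd \<omega> (edge i j) + lam * sqrt (real n) * (fst \<omega> i * fst \<omega> j)))
      \<in> borel_measurable (wig_space P Pd X n)"
    by (rule measurable_compose) (rule g)
  then show ?thesis using False by (simp add: signal_mat_def)
qed (simp add: signal_mat_def)

text \<open>Spikes that are delocalised and nearly of norm 1 have probability tending to 1, and for
  each of them the noise slice of \<open>E n\<close> has small measure, uniformly in the
  spike.\<close>

lemma wig_space_rare_event:
  fixes X :: "nat \<Rightarrow> (nat \<Rightarrow> real) measure" and b :: "nat \<Rightarrow> real"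
  assumes P: "prob_space P" and Pd: "prob_space Pd" and spike: "spike_prior X"
    and deloc: "(\<lambda>n. measure (X n) {x \<in> space (X n). \<forall>i<n. \<bar>x i\<bar> \<le> b n}) \<longlonglongrightarrow> 1"
    and E: "\<And>n. 0 < n \<Longrightarrow> E n \<in> sets (wig_space P Pd X n)"
    and good: "\<And>n x w. Q n x w \<Longrightarrow> (x, w) \<notin> E n"
    and rare: "\<And>\<eta>. 0 < \<eta> \<Longrightarrow> \<exists>e>0. \<forall>\<^sub>F n in sequentially. \<forall>x. \<bar>ip n x x - 1\<bar> \<le> e \<longrightarrow>
      (\<forall>i<n. \<bar>x i\<bar> \<le> b n) \<longrightarrow> (\<exists>B\<in>sets (wigner_noise P Pd n). measure (wigner_noise P Pd n) B \<le> \<eta> \<and>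
        (\<forall>w\<in>space (wigner_noise P Pd n) - B. Q n x w))"
  shows "(\<lambda>n. measure (wig_space P Pd X n) (E n)) \<longlonglongrightarrow> 0"
proof (rule order_tendstoI)
  fix r :: real assume r: "0 < r"
  then have r4: "0 < r / 4" by simp
  from rare[OF r4] obtain e where e: "0 < e" and ev: "\<forall>\<^sub>F n in sequentially. \<forall>x. \<bar>ip n x x - 1\<bar> \<le> e \<longrightarrow>
      (\<forall>i<n. \<bar>x i\<bar> \<le> b n) \<longrightarrow> (\<exists>B\<in>sets (wigner_noise P Pd n). measure (wigner_noise P Pd n) B \<le> r / 4 \<and>
        (\<forall>w\<in>space (wigner_noise P Pd n) - B. Q n x w))" by (elim exE conjE)
  \<comment> \<open>The prior controls the norm \<open>l\<close>, the estimates ask for its square: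
    \<open>|l - 1| <= \<kappa> <= 1\<close> gives
    \<open>|l^2 - 1| <= 3 \<kappa> <= e\<close>.\<close>
  define \<kappa> where "\<kappa> = min 1 (e / 3)"
  have \<kappa>: "0 < \<kappa>" "\<kappa> \<le> 1" "3 * \<kappa> \<le> e" using e by (auto simp: \<kappa>_def)
  have norm: "(\<lambda>n. measure (X n) {x \<in> space (X n). \<kappa> < \<bar>L2_set x {..<n} - 1\<bar>}) \<longlonglongrightarrow> 0"
    and norm_meas: "\<And>n. (\<lambda>x. L2_set x {..<n}) \<in> borel_measurable (X n)"
    and prob: "\<And>n. prob_space (X n)" and sets_X: "\<And>n. sets (X n) = sets (PiM {..<n} (\<lambda>_. borel))"
    using spike \<kappa>(1) unfolding spike_prior_def tendsto_in_prob_def by blast+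
  have "\<forall>\<^sub>F n in sequentially. measure (X n) {x \<in> space (X n). \<kappa> < \<bar>L2_set x {..<n} - 1\<bar>} < r / 4"
    using norm r4 by (rule order_tendstoD)
  moreover have "\<forall>\<^sub>F n in sequentially. 1 - r / 4 < measure (X n) {x \<in> space (X n). \<forall>i<n. \<bar>x i\<bar> \<le> b n}"
    using deloc by (rule order_tendstoD) (use r4 in simp)
  ultimately show "\<forall>\<^sub>F n in sequentially. measure (wig_space P Pd X n) (E n) < r"
    using ev eventually_gt_at_top[of 0]
  proof eventually_elim
    case (elim n)
    interpret X: prob_space "X n" by (rule prob)
    define A where "A = {x \<in> space (X n). \<kappa> < \<bar>L2_set x {..<n} - 1\<bar>}"
    define D where "D = {x \<in> space (X n). \<forall>i<n. \<bar>x i\<bar> \<le> b n}"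
    have A: "A \<in> sets (X n)" unfolding A_def using norm_meas[of n] by measurable
    have D: "D \<in> sets (X n)"
    proof -
      have "(\<lambda>x. x i) \<in> borel_measurable (X n)" if "i < n" for i
        by (rule spike_component_measurable[OF sets_X that])
      then have "{x \<in> space (X n). \<bar>x i\<bar> \<le> b n} \<in> sets (X n)" if "i < n" for i
        using that by measurable
      then have "{x \<in> space (X n). \<forall>i\<in>{..<n}. \<bar>x i\<bar> \<le> b n} \<in> sets (X n)"
        by (intro sets.sets_Collect_finite_All finite_lessThan) simp
      then show ?thesis unfolding D_def by (simp only: Ball_def lessThan_iff)
    qed
    have sets: "D - A \<in> sets (X n)" using D A by (rule sets.Diff)
    have m1: "measure (X n \<Otimes>\<^sub>M wigner_noise P Pd n) (E n) \<le> measure (X n) (space (X n) - (D - A)) + r / 4"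
    proof (rule product_bad_event[OF prob _ _ sets])
      show "E n \<in> sets (X n \<Otimes>\<^sub>M wigner_noise P Pd n)" using E[OF elim(4)] unfolding wig_space_def .
      show "prob_space (wigner_noise P Pd n)" using P Pd by (rule wigner_noise_prob_space)
      fix x assume x: "x \<in> D - A"
      have x1: "\<bar>ip n x x - 1\<bar> \<le> e"
      proof -
        let ?l = "L2_set x {..<n}"
        have l: "\<bar>?l - 1\<bar> \<le> \<kappa>" using x by (auto simp: A_def D_def)
        have "ip n x x = ?l\<^sup>2" by (simp add: L2_set_def ip_self_sum_squares sum_nonneg)
        then have "ip n x x - 1 = (?l - 1) * (?l + 1)" by (simp add: power2_eq_square algebra_simps)
        then have "\<bar>ip n x x - 1\<bar> = \<bar>?l - 1\<bar> * \<bar>?l + 1\<bar>" by (simp only: abs_mult)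
        also have "\<dots> \<le> \<kappa> * 3" using l \<kappa> by (intro mult_mono) linarith+
        finally show ?thesis using \<kappa> by simp
      qed
      have x2: "\<forall>i<n. \<bar>x i\<bar> \<le> b n" using x by (simp add: D_def)
      show "\<exists>B\<in>sets (wigner_noise P Pd n). measure (wigner_noise P Pd n) B \<le> r / 4 \<and>
        (\<forall>w\<in>space (wigner_noise P Pd n) - B. (x, w) \<notin> E n)"
        using elim(3)[THEN spec, THEN mp, THEN mp, OF x1 x2] by (elim bexE conjE) (intro bexI conjI ballI good, auto)
    qed (rule less_imp_le[OF r4])
    have "measure (X n) (space (X n) - (D - A)) \<le> measure (X n) ((space (X n) - D) \<union> A)"
      using D A by (intro X.finite_measure_mono) auto
    also have "\<dots> \<le> measure (X n) (space (X n) - D) + measure (X n) A"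
      using D A by (intro measure_Un_le) auto
    also have "measure (X n) (space (X n) - D) = 1 - measure (X n) D" using D by (rule X.prob_compl)
    finally show ?case using m1 r elim(1,2) unfolding wig_space_def A_def[symmetric] D_def[symmetric] by linarith
  qed
next
  fix r :: real assume "r < 0"
  then show "\<forall>\<^sub>F n in sequentially. r < measure (wig_space P Pd X n) (E n)"
    by (intro always_eventually allI) (rule less_le_trans, auto)
qed

lemma transformed_matrix_eq_fst_snd:
  assumes "0 < n"
  shows "transformed_matrix g lam n \<omega> = mat n n (\<lambda>(i, j). signal_mat g lam n (fst \<omega>) (snd \<omega>) i j)"
  using transformed_matrix_eq[OF assms, of g lam "fst \<omega>" "snd \<omega>"] by simp

context score_setting
begin

lemma score_measurable: "f \<in> borel_measurable borel" by measurable

lemma lambda_max_transformed_measurable: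
  assumes X: "sets (X n) = sets (PiM {..<n} (\<lambda>_. borel :: real measure))"
  shows "(\<lambda>\<omega>. 1 / sqrt (real n) * lambda_max (transformed_matrix f lam n \<omega>)) \<in> borel_measurable (wig_space P Pd X n)"
proof (cases "n = 0")
  case False
  then have n: "0 < n" by simp
  have "(\<lambda>\<omega>. lambda_max (mat n n (\<lambda>(i, j). signal_mat f lam n (fst \<omega>) (snd \<omega>) i j)))
      \<in> borel_measurable (wig_space P Pd X n)"
    by (rule borel_measurable_lambda_max[where A = "\<lambda>\<omega>. signal_mat f lam n (fst \<omega>) (snd \<omega>)",
          OF signal_mat_commute wig_space_signal_measurable[where X = X, OF sets_P X score_measurable]])
  then show ?thesis unfolding transformed_matrix_eq_fst_snd[OF n] by (rule borel_measurable_times[rotated]) simp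
qed simp

lemma tendsto_lambda_max_transformed:
  assumes Pd: "prob_space Pd" and lam: "0 \<le> lam" and \<alpha>: "\<alpha> < 1 / 8" and spike: "spike_prior X"
    and deloc: "(\<lambda>n. measure (X n) {x \<in> space (X n). \<forall>i<n. \<bar>x i\<bar> \<le> real n powr (- 1 / 2 + \<alpha>)}) \<longlonglongrightarrow> 1"
  shows "tendsto_in_prob (wig_space P Pd X)
    (\<lambda>n \<omega>. 1 / sqrt (real n) * lambda_max (transformed_matrix f lam n \<omega>)) (sqrt F * bbp_edge (lam * sqrt F))"
proof -
  have Fpos: "0 < F" by (rule fisher_pos)
  let ?Z = "\<lambda>n \<omega>. 1 / sqrt (real n) * lambda_max (transformed_matrix f lam n \<omega>)"
  let ?c = "sqrt F * bbp_edge (lam * sqrt F)"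
  have sets_X: "sets (X n) = sets (PiM {..<n} (\<lambda>_. borel))" for n
    using spike unfolding spike_prior_def by blast
  have meas: "?Z n \<in> borel_measurable (wig_space P Pd X n)" for n
    by (rule lambda_max_transformed_measurable[where X = X, OF sets_X])
  have "(\<lambda>n. measure (wig_space P Pd X n) {\<omega> \<in> space (wig_space P Pd X n). \<epsilon> < \<bar>?Z n \<omega> - ?c\<bar>}) \<longlonglongrightarrow> 0"
    if \<epsilon>: "0 < \<epsilon>" for \<epsilon>
  proof (rule wig_space_rare_event[where X = X, OF prob Pd spike deloc _ _ eventually_transformed_window[OF Pd lam \<alpha>]])
    show "{\<omega> \<in> space (wig_space P Pd X n). \<epsilon> < \<bar>?Z n \<omega> - ?c\<bar>} \<in> sets (wig_space P Pd X n)" for n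
      using meas[of n] by measurable
    show "0 < \<epsilon> / sqrt F" using \<epsilon> Fpos by simp
    fix n x w
    let ?L = "lambda_max (transformed_matrix f lam n (x, w))"
    assume "\<bar>?L / (sqrt (real n) * sqrt F) - bbp_edge (lam * sqrt F)\<bar> \<le> \<epsilon> / sqrt F \<and>
      (\<forall>v. top_unit_eigenvector (transformed_matrix f lam n (x, w)) v \<longrightarrow>
        bbp_edge (lam * sqrt F) - 2 - 2 * (\<epsilon> / sqrt F) \<le> lam * sqrt F * (scalar_prod v (Matrix.vec n x))\<^sup>2)"
    then have Q: "\<bar>?L / (sqrt (real n) * sqrt F) - bbp_edge (lam * sqrt F)\<bar> \<le> \<epsilon> / sqrt F" ..
    have "?Z n (x, w) - ?c = sqrt F * (?L / (sqrt (real n) * sqrt F) - bbp_edge (lam * sqrt F))"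
      using Fpos by (simp add: right_diff_distrib)
    then have "\<bar>?Z n (x, w) - ?c\<bar> = sqrt F * \<bar>?L / (sqrt (real n) * sqrt F) - bbp_edge (lam * sqrt F)\<bar>"
      using Fpos by (simp add: abs_mult)
    also have "\<dots> \<le> sqrt F * (\<epsilon> / sqrt F)" using Q Fpos by (intro mult_left_mono) auto
    also have "\<dots> = \<epsilon>" using Fpos by simp
    finally show "(x, w) \<notin> {\<omega> \<in> space (wig_space P Pd X n). \<epsilon> < \<bar>?Z n \<omega> - ?c\<bar>}"
      by (simp only: mem_Collect_eq not_less de_Morgan_conj simp_thms)
  qed
  then show ?thesis unfolding tendsto_in_prob_def using meas by blast
qed

text \<open>With \<open>\<theta> = lam * sqrt F\<close>, the window gives \<open>\<theta> + 1 /
  \<theta> - 2 - \<epsilon> <= \<theta> <v, x>^2\<close>, and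
  \<open>\<theta> + 1 / \<theta> - 2 = \<theta> (1 - 1 / \<theta>)^2\<close>. Dividing by
  \<open>\<theta> > 1\<close> yields the bound, as
  \<open>1 - 1 / \<theta> = (lam - 1 / sqrt F) / lam\<close>.\<close>

lemma tendsto_top_eigenvector_overlap:
  assumes Pd: "prob_space Pd" and lam: "1 / sqrt F < lam" and \<alpha>: "\<alpha> < 1 / 8" and spike: "spike_prior X"
    and deloc: "(\<lambda>n. measure (X n) {x \<in> space (X n). \<forall>i<n. \<bar>x i\<bar> \<le> real n powr (- 1 / 2 + \<alpha>)}) \<longlonglongrightarrow> 1"
    and \<epsilon>: "0 < \<epsilon>"
  shows "(\<lambda>n. measure (wig_space P Pd X n) {\<omega> \<in> space (wig_space P Pd X n).
      \<forall>v. top_unit_eigenvector (transformed_matrix f lam n \<omega>) v \<longrightarrow>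
        (lam - 1 / sqrt F)\<^sup>2 / lam\<^sup>2 - \<epsilon> \<le> (scalar_prod v (Matrix.vec n (fst \<omega>)))\<^sup>2}) \<longlonglongrightarrow> 1"
proof -
  have Fpos: "0 < F" by (rule fisher_pos)
  have lam0: "0 < lam" using lam Fpos by (intro less_trans[OF _ lam]) simp
  define \<theta> where "\<theta> = lam * sqrt F"
  have \<theta>: "1 < \<theta>" using lam Fpos by (simp add: \<theta>_def field_simps)
  define c where "c = (lam - 1 / sqrt F)\<^sup>2 / lam\<^sup>2 - \<epsilon>"
  have lower: "c \<le> t" if "bbp_edge \<theta> - 2 - 2 * (\<epsilon> / 2) \<le> \<theta> * t" for t
  proof -
    have "(lam - 1 / sqrt F)\<^sup>2 / lam\<^sup>2 = ((lam - 1 / sqrt F) / lam)\<^sup>2" by (simp add: power_divide)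
    also have "(lam - 1 / sqrt F) / lam = 1 - 1 / \<theta>" using lam0 Fpos by (simp add: \<theta>_def field_simps)
    finally have c: "c = (1 - 1 / \<theta>)\<^sup>2 - \<epsilon>" by (simp add: c_def)
    have "bbp_edge \<theta> = \<theta> + 1 / \<theta>" using \<theta> by (simp add: bbp_edge_def)
    moreover have "\<theta> * (1 - 1 / \<theta>)\<^sup>2 = \<theta> + 1 / \<theta> - 2" using \<theta> by (simp add: power2_eq_square field_simps)
    ultimately have "\<theta> * (1 - 1 / \<theta>)\<^sup>2 - \<epsilon> \<le> \<theta> * t" using that by simp
    moreover have "\<epsilon> \<le> \<theta> * \<epsilon>" using \<theta> \<epsilon> by simp
    ultimately have "\<theta> * c \<le> \<theta> * t" unfolding c right_diff_distrib by linarith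
    then show ?thesis using \<theta> by simp
  qed
  define G where "G n = {\<omega> \<in> space (wig_space P Pd X n).
      \<forall>v. top_unit_eigenvector (transformed_matrix f lam n \<omega>) v \<longrightarrow>
        c \<le> (scalar_prod v (Matrix.vec n (fst \<omega>)))\<^sup>2}" for n
  have sets_X: "sets (X n) = sets (PiM {..<n} (\<lambda>_. borel))" and prob_X: "prob_space (X n)" for n
    using spike unfolding spike_prior_def by blast+
  have prob_W: "prob_space (wig_space P Pd X n)" for n
  proof -
    interpret pair_prob_space "X n" "wigner_noise P Pd n"
      using prob_X[of n] wigner_noise_prob_space[OF prob Pd, of n]
      by (simp add: pair_prob_space_def pair_sigma_finite_def prob_space_imp_sigma_finite)
    show ?thesis unfolding wig_space_def by (rule prob_space_axioms)
  qed
  have G: "G n \<in> sets (wig_space P Pd X n)" if "0 < n" for n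
    unfolding G_def transformed_matrix_eq_fst_snd[OF that]
    by (rule measurable_top_eigenvector_event[where A = "\<lambda>\<omega>. signal_mat f lam n (fst \<omega>) (snd \<omega>)" and x = fst,
          OF signal_mat_commute wig_space_signal_measurable[where X = X, OF sets_P sets_X score_measurable]
          wig_space_spike_measurable[where X = X, OF sets_X] that])
  have "(\<lambda>n. measure (wig_space P Pd X n) (space (wig_space P Pd X n) - G n)) \<longlonglongrightarrow> 0"
  proof (rule wig_space_rare_event[where X = X, OF prob Pd spike deloc _ _
        eventually_transformed_window[OF Pd less_imp_le[OF lam0] \<alpha>, folded \<theta>_def]])
    show "space (wig_space P Pd X n) - G n \<in> sets (wig_space P Pd X n)" if "0 < n" for n
      using G[OF that] by (rule sets.compl_sets)
    show "0 < \<epsilon> / 2" using \<epsilon> by simp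
    fix n x w
    assume "\<bar>lambda_max (transformed_matrix f lam n (x, w)) / (sqrt (real n) * sqrt F) - bbp_edge \<theta>\<bar> \<le> \<epsilon> / 2 \<and>
      (\<forall>v. top_unit_eigenvector (transformed_matrix f lam n (x, w)) v \<longrightarrow>
        bbp_edge \<theta> - 2 - 2 * (\<epsilon> / 2) \<le> \<theta> * (scalar_prod v (Matrix.vec n x))\<^sup>2)"
    then show "(x, w) \<notin> space (wig_space P Pd X n) - G n" using lower by (auto simp: G_def)
  qed
  then have "(\<lambda>n. 1 - measure (wig_space P Pd X n) (space (wig_space P Pd X n) - G n)) \<longlonglongrightarrow> 1 - 0"
    by (intro tendsto_intros)
  moreover have "\<forall>\<^sub>F n in sequentially.
      1 - measure (wig_space P Pd X n) (space (wig_space P Pd X n) - G n) = measure (wig_space P Pd X n) (G n)"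
    using eventually_gt_at_top[of 0]
  proof eventually_elim
    case (elim n)
    show ?case using prob_space.prob_compl[OF prob_W G[OF elim]] by simp
  qed
  ultimately have "(\<lambda>n. measure (wig_space P Pd X n) (G n)) \<longlonglongrightarrow> 1"
    using tendsto_cong[of _ _ sequentially "1 :: real"] by fastforce
  then show ?thesis unfolding G_def c_def .
qed

end

theorem theorem4p8:
  fixes lam \<alpha> C :: real
    and m :: nat
    and X :: "nat \<Rightarrow> (nat \<Rightarrow> real) measure"
    and P Pd :: "real measure"
    and p :: "real \<Rightarrow> real"
  assumes "0 \<le> lam"
    and "spike_prior X"
    and "\<alpha> < 1 / 8"
    and "(\<lambda>n. measure (X n) {x \<in> space (X n). \<forall>i<n. \<bar>x i\<bar> \<le> real n powr (- 1 / 2 + \<alpha>)}) \<longlonglongrightarrow> 1"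
    and "real_distribution P"
    and "integrable P (\<lambda>w. w)" and "prob_space.expectation P (\<lambda>w. w) = 0"
    and "prob_space.variance P (\<lambda>w. w) = 1"
    and "real_distribution Pd"
    and "P = density lborel (\<lambda>w. ennreal (p w))" and "\<And>w. 0 < p w" and "Ck 3 p"
    and "0 < C" and "even m" and "2 \<le> m"
    and "\<And>l w. l \<le> 2 \<Longrightarrow> \<bar>(deriv ^^ l) (score p) w\<bar> \<le> C + w ^ m"
    and "\<And>k. 1 \<le> k \<Longrightarrow> k \<le> 5 * m \<Longrightarrow> integrable P (\<lambda>w. \<bar>w\<bar> ^ k)"
  shows "(lam \<le> 1 / sqrt (fisher_info P p) \<longrightarrow>
      tendsto_in_prob (wig_space P Pd X)
        (\<lambda>n \<omega>. 1 / sqrt (real n) * lambda_max (transformed_matrix (score p) lam n \<omega>))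
        (2 * sqrt (fisher_info P p))) \<and>
    (1 / sqrt (fisher_info P p) < lam \<longrightarrow>
      tendsto_in_prob (wig_space P Pd X)
        (\<lambda>n \<omega>. 1 / sqrt (real n) * lambda_max (transformed_matrix (score p) lam n \<omega>))
        (lam * fisher_info P p + 1 / lam) \<and>
      2 * sqrt (fisher_info P p) < lam * fisher_info P p + 1 / lam \<and>
      (\<exists>\<epsilon>. \<epsilon> \<longlonglongrightarrow> (0::real) \<and>
        (\<lambda>n. measure (wig_space P Pd X n)
          {\<omega> \<in> space (wig_space P Pd X n).
            \<forall>v. top_unit_eigenvector (transformed_matrix (score p) lam n \<omega>) v \<longrightarrow>
              (lam - 1 / sqrt (fisher_info P p))\<^sup>2 / lam\<^sup>2 - \<epsilon> n
                \<le> (scalar_prod v (Matrix.vec n (fst \<omega>)))\<^sup>2})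
          \<longlonglongrightarrow> 1))"
proof -
  interpret score_setting P p C m
    by (rule score_setting.intro[OF assms(5,10,11,12,13,14,15,16,17)])
  have Pd: "prob_space Pd" using assms(9) by (simp add: real_distribution_def)
  have Fpos: "0 < F" by (rule fisher_pos)
  note limit = tendsto_lambda_max_transformed[OF Pd assms(1,3,2,4)]
  show ?thesis
  proof (intro conjI impI)
    assume "lam \<le> 1 / sqrt F"
    then have "lam * sqrt F \<le> 1" using Fpos by (simp add: pos_le_divide_eq)
    then have c: "sqrt F * bbp_edge (lam * sqrt F) = 2 * sqrt F" by (simp add: bbp_edge_def max_def)
    show "tendsto_in_prob (wig_space P Pd X)
        (\<lambda>n \<omega>. 1 / sqrt (real n) * lambda_max (transformed_matrix f lam n \<omega>)) (2 * sqrt F)"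
      using limit unfolding c .
  next
    assume lam: "1 / sqrt F < lam"
    then have \<theta>: "1 < lam * sqrt F" using Fpos by (simp add: pos_divide_less_eq)
    have lam0: "0 < lam" using lam Fpos by (intro less_trans[OF _ lam]) simp
    have "sqrt F * bbp_edge (lam * sqrt F) = lam * (sqrt F * sqrt F) + 1 / lam"
      using \<theta> lam0 Fpos by (simp add: bbp_edge_def distrib_left mult_ac)
    then have c: "sqrt F * bbp_edge (lam * sqrt F) = lam * F + 1 / lam" using Fpos by simp
    show "tendsto_in_prob (wig_space P Pd X)
        (\<lambda>n \<omega>. 1 / sqrt (real n) * lambda_max (transformed_matrix f lam n \<omega>)) (lam * F + 1 / lam)"
      using limit unfolding c .
    \<comment> \<open>The gap to \<open>2 * sqrt F\<close> is a square over \<open>lam\<close>,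
      nonzero above the threshold.\<close>
    have "0 < (lam * sqrt F - 1)\<^sup>2 / lam" using \<theta> lam0 by simp
    also have "\<dots> = lam * (sqrt F * sqrt F) + 1 / lam - 2 * sqrt F"
      using lam0 by (simp add: power2_eq_square field_simps)
    finally show "2 * sqrt F < lam * F + 1 / lam" using Fpos by simp
    \<comment> \<open>The statement for every fixed tolerance is upgraded to one tolerance sequence
      tending to 0.\<close>
    show "\<exists>\<epsilon>. \<epsilon> \<longlonglongrightarrow> (0::real) \<and>
        (\<lambda>n. measure (wig_space P Pd X n)
          {\<omega> \<in> space (wig_space P Pd X n).
            \<forall>v. top_unit_eigenvector (transformed_matrix f lam n \<omega>) v \<longrightarrow>
              (lam - 1 / sqrt F)\<^sup>2 / lam\<^sup>2 - \<epsilon> n \<le> (scalar_prod v (Matrix.vec n (fst \<omega>)))\<^sup>2}) \<longlonglongrightarrow> 1"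
      by (rule exists_vanishing_rate) (rule tendsto_top_eigenvector_overlap[OF Pd lam assms(3,2,4)])
  qed
qed

end
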